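(* For every integer $k\ge 2$ there exists $\rho_k>0$ such that, if $M$ is a simple real-representable matroid on $n$ elements, $(X_2,\dots,X_k)$ is an optimal $k$-stratification of $M$, and $n-|X_k|>b_k(k-2)$, then the number of rank-$k$ flats in $M$ is at least $\rho_k\, n\prod_{i=2}^{k}(n-|X_i|)$.
   Context: All matroids are finite. A line, hyperplane of a matroid $M$ is a flat of rank $2$, rank $r(M)-1$ respectively. Two sets $X,Y$ are skew in $M$ if $r_M(X\cup Y)=r_M(X)+r_M(Y)$. Degeneracy: for $k\ge 2$, a matroid $M$ is $k$-degenerate if it has rank at most one, or there is a collection $(F_1,\dots,F_t)$ of flats of $M$, each of rank at least two, with $E(M)\subseteq F_1\cup\dots\cup F_t$ and $\sum_{i=1}^t (r_M(F_i)-1)\le k-1$. A matroid is $1$-degenerate if and only if it is empty. A subset $X\subseteq E(M)$ is $k$-degenerate in $M$ if $M|X$ is $k$-degenerate. Stratification: for $k\ge 2$, a $k$-stratification of $M$ is a sequence $(X_2,\dots,X_k)$ of subsets of $E(M)$ such that, for each $i\in\{2,\dots,k\}$, $X_i$ is $i$-degenerate and $X_{i-1}\subseteq X_i$, where $X_1=\emptyset$ and $X_{k+1}=E(M)$. It is optimal if, for each $i\in\{2,\dots,k\}$, $X_i$ is a largest $i$-degenerate subset of $X_{i+1}$. A 2-colouring of a simple matroid $M$ is a partition $(R,B)$ of $E(M)$ into red elements $R$ and blue elements $B$. For an integer $k\ge 1$ and an integer $t\ge 0$, $b_k(t)$ is the largest number $n$ for which there exists a simple rank-$(k+1)$ real-representable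 matroid $M$ with a 2-colouring $(R,B)$ with $|R|=t$, $|B|=n$ such that: (C1) $r_M(B)\ge 2$; (C2) $H\cap R\ne\emptyset$ for every hyperplane $H$ of $M$; (C3) for every line $L$ of $M|B$ there is a rank-$(k-1)$ flat $F$ of $M$ skew to $L$ with $F\cap R=\emptyset$. If no such $n$ exists, $b_k(t)=0$; in particular $b_k(0)=0$. (The maximum is finite.) *)

theory Defs
  imports "HOL-Analysis.Analysis" "HOL-Analysis.Finite_Function_Topology"
begin

record 'a matroid =
  ground :: "'a set"
  indep :: "'a set \<Rightarrow> bool"

locale matroid =
  fixes M :: "'a matroid" (structure)
  assumes finite_ground: "finite (ground M)"
    and indep_subset_ground: "indep M I \<Longrightarrow> I \<subseteq> ground M"
    and indep_empty: "indep M {}"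
    and indep_mono: "indep M J \<Longrightarrow> I \<subseteq> J \<Longrightarrow> indep M I"
    and indep_augment: "indep M I \<Longrightarrow> indep M J \<Longrightarrow> card I < card J \<Longrightarrow>
          \<exists>x\<in>J - I. indep M (insert x I)"

definition matroid_rank :: "'a matroid \<Rightarrow> 'a set \<Rightarrow> nat" where
  "matroid_rank M X = Max {card I | I. I \<subseteq> X \<and> indep M I}"

definition restrict :: "'a matroid \<Rightarrow> 'a set \<Rightarrow> 'a matroid" where
  "restrict M X = \<lparr>ground = ground M \<inter> X, indep = (\<lambda>I. indep M I \<and> I \<subseteq> X)\<rparr>"

definition flat :: "'a matroid \<Rightarrow> 'a set \<Rightarrow> bool" where
  "flat M F \<longleftrightarrow> F \<subseteq> ground M \<and> (\<forall>x\<in>ground M - F. matroid_rank M F < matroid_rank M (insert x F))"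

definition line :: "'a matroid \<Rightarrow> 'a set \<Rightarrow> bool" where
  "line M L \<longleftrightarrow> flat M L \<and> matroid_rank M L = 2"

text \<open>The equation is additive because a matroid of rank 0 has no hyperplane.\<close>

definition hyperplane :: "'a matroid \<Rightarrow> 'a set \<Rightarrow> bool" where
  "hyperplane M H \<longleftrightarrow> flat M H \<and> matroid_rank M H + 1 = matroid_rank M (ground M)"

definition skew :: "'a matroid \<Rightarrow> 'a set \<Rightarrow> 'a set \<Rightarrow> bool" where
  "skew M X Y \<longleftrightarrow> matroid_rank M (X \<union> Y) = matroid_rank M X + matroid_rank M Y"

text \<open>No loops and no parallel pairs.\<close>

definition simple_matroid :: "'a matroid \<Rightarrow> bool" where
  "simple_matroid M \<longleftrightarrow> (\<forall>x\<in>ground M. \<forall>y\<in>ground M. indep M {x, y})"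

text \<open>
  The real vector space of finitely supported sequences contains a copy of every
  finite-dimensional real space, so no dimension has to be fixed. Injectivity on \<open>I\<close> turns
  linear independence of the set \<open>\<phi> ` I\<close> into that of the family indexed by \<open>I\<close>.
\<close>

definition real_representable :: "'a matroid \<Rightarrow> bool" where
  "real_representable M \<longleftrightarrow>
     (\<exists>\<phi> :: 'a \<Rightarrow> (nat \<Rightarrow>\<^sub>0 real). \<forall>I \<subseteq> ground M.
        indep M I \<longleftrightarrow> inj_on \<phi> I \<and> independent (\<phi> ` I))"

text \<open>The case \<open>k \<le> 1\<close> is the convention that exactly the empty matroid is 1-degenerate.\<close>

definition degenerate :: "nat \<Rightarrow> 'a matroid \<Rightarrow> bool" where
  "degenerate k M \<longleftrightarrow>
     (if k \<le> 1 then ground M = {}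
      else matroid_rank M (ground M) \<le> 1 \<or>
        (\<exists>Fs. (\<forall>F\<in>set Fs. flat M F \<and> matroid_rank M F \<ge> 2) \<and> ground M \<subseteq> \<Union>(set Fs) \<and>
              (\<Sum>F\<leftarrow>Fs. matroid_rank M F - 1) \<le> k - 1))"

definition degenerate_in :: "nat \<Rightarrow> 'a matroid \<Rightarrow> 'a set \<Rightarrow> bool" where
  "degenerate_in k M X \<longleftrightarrow> X \<subseteq> ground M \<and> degenerate k (restrict M X)"

text \<open>
  A sequence \<open>(X 2, \<dots>, X k)\<close> is a function of which only the values at \<open>2, \<dots>, k\<close> matter;
  the following supplies the conventions for the indices 1 and \<open>k + 1\<close>.
\<close>

definition strat_ext :: "nat \<Rightarrow> 'a matroid \<Rightarrow> (nat \<Rightarrow> 'a set) \<Rightarrow> nat \<Rightarrow> 'a set" where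
  "strat_ext k M X i = (if i \<le> 1 then {} else if i \<le> k then X i else ground M)"

definition stratification :: "nat \<Rightarrow> 'a matroid \<Rightarrow> (nat \<Rightarrow> 'a set) \<Rightarrow> bool" where
  "stratification k M X \<longleftrightarrow>
     (\<forall>i\<in>{2..k}. X i \<subseteq> ground M \<and> degenerate_in i M (X i) \<and> strat_ext k M X (i - 1) \<subseteq> X i)"

definition optimal_stratification :: "nat \<Rightarrow> 'a matroid \<Rightarrow> (nat \<Rightarrow> 'a set) \<Rightarrow> bool" where
  "optimal_stratification k M X \<longleftrightarrow>
     stratification k M X \<and>
     (\<forall>i\<in>{2..k}. X i \<subseteq> strat_ext k M X (i + 1) \<and> degenerate_in i M (X i) \<and>
        (\<forall>Y. Y \<subseteq> strat_ext k M X (i + 1) \<and> degenerate_in i M Y \<longrightarrow> card Y \<le> card (X i)))"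

definition two_colouring :: "'a matroid \<Rightarrow> 'a set \<Rightarrow> 'a set \<Rightarrow> bool" where
  "two_colouring M R B \<longleftrightarrow> R \<union> B = ground M \<and> R \<inter> B = {}"

text \<open>Every finite matroid is isomorphic to one on a set of natural numbers.\<close>

definition blue_counts :: "nat \<Rightarrow> nat \<Rightarrow> nat set" where
  "blue_counts k t =
     {n. \<exists>(M :: nat matroid) R B.
        matroid M \<and> simple_matroid M \<and> real_representable M \<and>
        matroid_rank M (ground M) = k + 1 \<and> two_colouring M R B \<and> card R = t \<and> card B = n \<and>
        matroid_rank M B \<ge> 2 \<and>
        (\<forall>H. hyperplane M H \<longrightarrow> H \<inter> R \<noteq> {}) \<and>
        (\<forall>L. line (restrict M B) L \<longrightarrow>
           (\<exists>F. flat M F \<and> matroid_rank M F = k - 1 \<and> skew M F L \<and> F \<inter> R = {}))}"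

definition max_blue :: "nat \<Rightarrow> nat \<Rightarrow> nat" where
  "max_blue k t = (if blue_counts k t = {} then 0 else Max (blue_counts k t))"

end

theory Submission
  imports Defs
begin

text \<open>
  Represent the matroid by vectors, projected generically so that the rank is at most \<open>k + 1\<close>, and choose
  greedily large sets \<open>A 0, A 1, \<dots>\<close> (slots) such that any \<open>m\<close> of them span rank at least \<open>m + 1\<close> and no
  subspace contains a large part of a slot without containing all of it. Optimality of the stratification
  makes the slot \<open>A i\<close> at least proportional to \<open>n - |X (i + 1)|\<close>. The choice stops with \<open>j \<le> k\<close> slots when all but
  boundedly many elements lie in tight unions of slots, that is, unions of \<open>m\<close> slots of rank \<open>m + 1\<close>.

  For most tuples of one element per slot, the contraction of the tuple makes every slot a single parallel
  class, which is coloured red; the remaining elements are blue. If every flat of rank \<open>k - j\<close> spanned by blue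
  points met a red one, then, by a recursion in which failure of (C3) allows one to contract a generic point
  of a blue line, all but \<open>b k (k - 2)\<close> blue points would be covered by few flats, and \<open>X k\<close> would be too large.
  So the tuple spans, together with some blue points, a flat of rank \<open>k\<close> that contains no slot. A weighted Beck
  theorem, obtained by ham-sandwich cell decompositions and iterated along the tuple, shows that most of
  these flats contain boundedly many elements of each slot, so that each arises from boundedly many tuples.
\<close>

subsection \<open>Dimension of finite sets of vectors\<close>

text \<open>One count survives all contractions. A typical tuple of \<open>j\<close> elements uses
  up \<open>j\<close> ranks and leaves at most \<open>j\<close> red points; every generic point
  contracted later uses one more rank and adds one more red point. So if \<open>m + 1\<close> bounds
  the remaining rank, \<open>card R + m \<le> k\<close> always holds, and a configuration with such
  parameters can be padded by coloops to one with parameters \<open>k\<close> and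
  \<open>k - 2\<close> without losing blue points. This is why the single number
  \<open>b k (k - 2)\<close> serves every stage.

  The rank condition on slots is independence in the Dilworth truncation: it is what makes one
  typical element from each slot independent and keeps every slot out of the span of the tuple.

  Beck's theorem has to be weighted because contraction merges points into parallel classes of
  unequal size.

  The constants are chosen against the order of the slots. Typicality is a union bound over all
  subsets of the leftover elements, whose number is known only to be below a threshold
  \<open>\<Lambda> j\<close>. The spread \<open>\<eta> i\<close> of slot \<open>i\<close> must
  therefore be chosen after \<open>\<Lambda> (i + 1)\<close>, and \<open>\<Lambda> i\<close> after
  \<open>\<eta> i\<close>.\<close>

lemma dim_empty [simp]: "dim ({}::'v::real_vector set) = 0"
  using dim_eq_card_independent[of "{}::'v set"] independent_empty by (metis card.empty)

lemma span_eq_of_subsets: "B \<subseteq> W \<Longrightarrow> W \<subseteq> span B \<Longrightarrow> span B = span (W::'v::real_vector set)"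
  by (rule subset_antisym) (simp_all add: span_minimal span_mono)

lemma span_Un_absorb: "W \<subseteq> span T \<Longrightarrow> span (T \<union> W) = span (T::'v::real_vector set)"
  by (rule subset_antisym) (simp_all add: span_minimal span_superset span_mono)

lemma span_Un_cong: "span S = span S' \<Longrightarrow> span (T \<union> S) = span (T \<union> (S'::'v::real_vector set))"
  by (simp add: span_Un)

text \<open>In a general real vector space a set of infinite rank has \<open>dim\<close> 0, so rank
  arguments need finite sets; this is the source of the finiteness hypotheses below.\<close>

lemma dim_insert_finite:
  fixes T :: "'v::real_vector set"
  assumes "finite T"
  shows "dim (insert v T) = (if v \<in> span T then dim T else Suc (dim T))"
proof (cases "v \<in> span T")
  case True
  then show ?thesis using span_redundant span_eq_dim by metis
next
  case False
  obtain B where B: "B \<subseteq> T" "independent B" "T \<subseteq> span B" "card B = dim T"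
    using basis_exists by metis
  have fB: "finite B" using B(1) assms finite_subset by blast
  have sB: "span B = span T" using B span_mono span_minimal[of T "span B"] by (metis subset_antisym subspace_span)
  have "independent (insert v B)" using False B(2) sB independent_insertI by metis
  moreover have "span (insert v B) = span (insert v T)"
    using sB by (simp add: span_insert)
  ultimately have "dim (insert v T) = card (insert v B)"
    by (metis dim_eq_card_independent span_eq_dim)
  also have "\<dots> = Suc (dim T)" using fB B False sB
    by (metis card_insert_disjoint span_superset subsetD)
  finally show ?thesis using False by simp
qed

lemma dim_mono_finite:
  fixes T :: "'v::real_vector set"
  assumes "finite T" "S \<subseteq> span T"
  shows "dim S \<le> dim T"
proof -
  obtain B where B: "B \<subseteq> T" "independent B" "T \<subseteq> span B" "card B = dim T"
    using basis_exists by metis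
  have "finite B" using B(1) assms finite_subset by blast
  moreover have "S \<subseteq> span B" using assms(2) B(3) span_minimal[of T "span B"] by (metis subset_trans subspace_span)
  ultimately show ?thesis using dim_le_card B by metis
qed

lemma independent_card_le_dim_finite:
  fixes T :: "'v::real_vector set"
  assumes "finite T" "S \<subseteq> span T" "independent S"
  shows "finite S" "card S \<le> dim T"
proof -
  obtain B where B: "B \<subseteq> T" "independent B" "T \<subseteq> span B" "card B = dim T"
    using basis_exists by metis
  have "finite B" using B(1) assms finite_subset by blast
  moreover have "S \<subseteq> span B" using assms(2) B(3) span_minimal[of T "span B"] by (metis subset_trans subspace_span)
  ultimately show "finite S" "card S \<le> dim T" using independent_span_bound[of B S] assms(3) B(4) by auto
qed

lemma span_eq_of_dim_ge:
  fixes T :: "'v::real_vector set"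
  assumes "finite T" "finite S" "S \<subseteq> span T" "dim T \<le> dim S"
  shows "span S = span T"
proof (rule ccontr)
  assume *: "span S \<noteq> span T"
  have "span S \<subseteq> span T" using assms(3) by (simp add: span_minimal)
  then obtain v where v: "v \<in> T" "v \<notin> span S" using * by (metis span_minimal subsetI subset_antisym subspace_span)
  then have "dim (insert v S) = Suc (dim S)" using dim_insert_finite assms(2) by metis
  moreover have "dim (insert v S) \<le> dim T" using assms(1,3) v(1) by (intro dim_mono_finite) (auto intro: span_base)
  ultimately show False using assms(4) by simp
qed

lemma dim_card_le: "finite T \<Longrightarrow> dim (T::'v::real_vector set) \<le> card T"
  by (rule dim_le_card) (auto simp: span_superset)

text \<open>Submodularity as decreasing marginal gain: when the vectors of \<open>T\<close> are
  adjoined one by one to a basis of \<open>W\<close>, a vector that raises the rank in the presence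
  of \<open>S\<close> also raises it without \<open>S\<close>.\<close>

lemma dim_Un_Diff_le:
  fixes S :: "'v::real_vector set"
  assumes "finite S" "finite T" "W \<subseteq> span T"
  shows "dim (S \<union> T) + dim W \<le> dim (S \<union> W) + dim T"
proof -
  obtain B where B: "B \<subseteq> W" "independent B" "W \<subseteq> span B" "card B = dim W"
    using basis_exists by metis
  have fB: "finite B" "card B \<le> dim T" using independent_card_le_dim_finite[of T B] assms B by auto
  have "dim (S \<union> T') + dim B \<le> dim (S \<union> B) + dim T'"
    if "finite T'" "T' = X \<union> B" for T' X
  proof -
    have "finite X" using that by auto
    then have "dim (S \<union> (X \<union> B)) + dim B \<le> dim (S \<union> B) + dim (X \<union> B)"
    proof (induction X rule: finite_induct)
      case empty then show ?case by simp
    next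
      case (insert x X)
      have f: "finite (S \<union> (X \<union> B))" "finite (X \<union> B)" using insert fB assms by auto
      have "x \<in> span (X \<union> B) \<Longrightarrow> x \<in> span (S \<union> (X \<union> B))"
        by (meson le_sup_iff span_mono subsetD sup_ge2)
      then have "dim (insert x (S \<union> (X \<union> B))) + dim B \<le> dim (S \<union> B) + dim (insert x (X \<union> B))"
        using insert.IH f by (auto simp: dim_insert_finite)
      then show ?case by (simp add: insert_commute)
    qed
    then show ?thesis using that by simp
  qed
  from this[of "T \<union> B" T] have "dim (S \<union> (T \<union> B)) + dim B \<le> dim (S \<union> B) + dim (T \<union> B)"
    using assms fB by simp
  moreover have "dim (T \<union> B) = dim T"
    using span_Un_absorb[of B T] B(1) assms(3) span_eq_dim by (metis subset_trans)
  moreover have "dim B = dim W" using B by (metis dim_eq_card_independent)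
  moreover have "dim (S \<union> B) \<le> dim (S \<union> W)"
  proof -
    have "span (S \<union> B) = span (S \<union> W)" using B(1,3) span_eq_of_subsets span_Un_cong by metis
    then show ?thesis using span_eq_dim by (metis order_refl)
  qed
  moreover have "dim (S \<union> T) \<le> dim (S \<union> (T \<union> B))" using assms fB
    by (intro dim_mono_finite) (auto intro: span_base)
  ultimately show ?thesis by linarith
qed

lemma dim_submodular:
  fixes S :: "'v::real_vector set"
  assumes "finite S" "finite T" "W \<subseteq> span S" "W \<subseteq> span T"
  shows "dim (S \<union> T) + dim W \<le> dim S + dim T"
proof -
  have "span (S \<union> W) = span S" using assms(3)
    by (rule span_Un_absorb)
  then have "dim (S \<union> W) = dim S" by (rule span_eq_dim)
  then show ?thesis using dim_Un_Diff_le[OF assms(1,2,4)] by simp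
qed

lemma dim_Un_le: "finite S \<Longrightarrow> finite T \<Longrightarrow> dim (S \<union> T) \<le> dim S + dim (T::'v::real_vector set)"
  using dim_submodular[of S T "{}"] by simp

subsection \<open>Projection along a subspace\<close>

text \<open>Contraction of \<open>span S\<close> as an endomorphism, so that repeated contractions
  keep the type of the vectors. A basis of \<open>span S\<close> is sent to 0 and the rest of a
  basis of the whole space is fixed; then \<open>p x - x\<close> always lies in
  \<open>span S\<close>.\<close>

lemma exists_projection:
  fixes S :: "'v::real_vector set"
  shows "\<exists>p :: 'v \<Rightarrow> 'v. linear p \<and> (\<forall>x. p x = 0 \<longleftrightarrow> x \<in> span S)"
proof -
  obtain B where B: "B \<subseteq> S" "independent B" "S \<subseteq> span B" using maximal_independent_subset by metis
  obtain C where C: "B \<subseteq> C" "independent C" "UNIV \<subseteq> span C"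
    using maximal_independent_subset_extend[of B UNIV] B by auto
  obtain p where p: "linear p" "\<forall>x\<in>C. p x = (if x \<in> B then 0 else x)"
    using linear_independent_extend[OF C(2), of "\<lambda>x. if x \<in> B then 0 else x"] by blast
  have sB: "span B = span S" using B by (metis span_eq subset_trans span_superset)
  have lin: "linear p" by (fact p(1))
  have *: "p x - x \<in> span B" if "x \<in> span C" for x
    using that
  proof (induction rule: span_induct_alt)
    case base then show ?case using linear_0[OF lin] by (simp add: span_zero)
  next
    case (step c x y)
    have "p x - x \<in> span B" using step p by (auto intro: span_base span_neg simp: span_zero)
    then have "c *\<^sub>R (p x - x) + (p y - y) \<in> span B" using step by (intro span_add span_scale)
    moreover have "p (c *\<^sub>R x + y) - (c *\<^sub>R x + y) = c *\<^sub>R (p x - x) + (p y - y)"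
      using lin by (simp add: linear_add linear_scale algebra_simps)
    ultimately show ?case by metis
  qed
  have "p x = 0 \<longleftrightarrow> x \<in> span S" for x
  proof
    assume "p x = 0"
    then have "- x \<in> span B" using *[of x] C by auto
    then show "x \<in> span S" using sB span_neg[of "- x" B] by simp
  next
    assume "x \<in> span S"
    then have "x \<in> span B" using sB by simp
    then show "p x = 0"
    proof (induction rule: span_induct_alt)
      case base then show ?case using linear_0[OF lin] by simp
    next
      case (step c x y) then show ?case using p C by (auto simp: linear_add linear_scale)
    qed
  qed
  then show ?thesis using lin by blast
qed

lemma projection_in_span_iff:
  fixes p :: "'v::real_vector \<Rightarrow> 'v"
  assumes "linear p" "\<And>x. p x = 0 \<longleftrightarrow> x \<in> span S"
  shows "p y \<in> span (p ` T) \<longleftrightarrow> y \<in> span (T \<union> S)"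
proof
  assume "p y \<in> span (p ` T)"
  then have "p y \<in> p ` span T" using linear_span_image[OF assms(1)] by simp
  then obtain z where z: "z \<in> span T" "p y = p z" by auto
  then have "p (y - z) = 0" using assms(1) by (simp add: linear_diff)
  then have "y - z \<in> span (T \<union> S)" using assms(2) by (meson span_mono subsetD sup_ge2)
  moreover have "z \<in> span (T \<union> S)" using z(1) by (meson span_mono subsetD sup_ge1)
  ultimately show "y \<in> span (T \<union> S)" by (metis diff_add_cancel span_add)
next
  assume "y \<in> span (T \<union> S)"
  then have "p y \<in> span (p ` (T \<union> S))" using linear_span_image[OF assms(1)] by blast
  also have "p ` (T \<union> S) \<subseteq> span (p ` T)"
  proof
    fix z assume "z \<in> p ` (T \<union> S)"
    then obtain x where x: "z = p x" "x \<in> T \<or> x \<in> S" by blast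
    show "z \<in> span (p ` T)"
    proof (cases "x \<in> T")
      case True then show ?thesis using x by (auto intro: span_base)
    next
      case False
      then have "p x = 0" using assms(2) x(2) span_base by metis
      then show ?thesis using x(1) by (simp add: span_zero)
    qed
  qed
  then have "span (p ` (T \<union> S)) \<subseteq> span (p ` T)" by (simp add: span_minimal)
  finally show "p y \<in> span (p ` T)" .
qed

lemma projection_dim:
  fixes p :: "'v::real_vector \<Rightarrow> 'v"
  assumes "linear p" "\<And>x. p x = 0 \<longleftrightarrow> x \<in> span S" "finite S" "finite T"
  shows "dim (p ` T) + dim S = dim (T \<union> S)"
  using assms(4)
proof (induction T rule: finite_induct)
  case empty then show ?case by simp
next
  case (insert x T)
  then show ?case using projection_in_span_iff[OF assms(1,2), of x T] assms(3)
    by (simp add: dim_insert_finite)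
qed

subsection \<open>Avoiding finitely many subspaces\<close>

text \<open>The usual argument over an infinite field: a line \<open>p + t q\<close> with
  \<open>p\<close> outside the old subspaces and \<open>q\<close> outside the new one meets each
  subspace at most once, because two common points would put both \<open>p\<close> and
  \<open>q\<close> into it.\<close>

lemma exists_avoiding_subspaces:
  fixes S :: "'v::real_vector set"
  assumes "finite \<Q>" "subspace S" "\<And>Q. Q \<in> \<Q> \<Longrightarrow> subspace Q" "\<And>Q. Q \<in> \<Q> \<Longrightarrow> \<not> S \<subseteq> Q"
  shows "\<exists>p\<in>S. \<forall>Q\<in>\<Q>. p \<notin> Q"
  using assms(1,3,4)
proof (induction \<Q> rule: finite_induct)
  case empty then show ?case using assms(2) subspace_0 by auto
next
  case (insert Q \<Q>)
  then obtain p where p: "p \<in> S" "\<forall>Q\<in>\<Q>. p \<notin> Q" by auto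
  obtain q where q: "q \<in> S" "q \<notin> Q" using insert.prems(2)[of Q] by auto
  have "finite {t::real. p + t *\<^sub>R q \<in> P}" if "P \<in> insert Q \<Q>" for P
  proof (rule ccontr)
    assume inf: "infinite {t::real. p + t *\<^sub>R q \<in> P}"
    have sP: "subspace P" using insert.prems(1) that by auto
    obtain t where t: "p + t *\<^sub>R q \<in> P" using inf not_finite_existsD by auto
    have "\<not> {t::real. p + t *\<^sub>R q \<in> P} \<subseteq> {t}" using inf finite_subset by blast
    then obtain u where u: "p + u *\<^sub>R q \<in> P" "u \<noteq> t" by auto
    have "(p + u *\<^sub>R q) - (p + t *\<^sub>R q) \<in> P" using sP t u subspace_diff by blast
    then have "(u - t) *\<^sub>R q \<in> P" by (simp add: algebra_simps)
    then have "inverse (u - t) *\<^sub>R (u - t) *\<^sub>R q \<in> P" using sP subspace_scale by blast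
    then have qP: "q \<in> P" using u(2) by simp
    then have "(p + t *\<^sub>R q) - t *\<^sub>R q \<in> P" using sP t by (meson subspace_diff subspace_scale)
    then have "p \<in> P" by simp
    then show False using p(2) q(2) qP that by auto
  qed
  then have "finite (\<Union>P\<in>insert Q \<Q>. {t::real. p + t *\<^sub>R q \<in> P})" using insert.hyps by auto
  then obtain t :: real where t: "t \<notin> (\<Union>P\<in>insert Q \<Q>. {t::real. p + t *\<^sub>R q \<in> P})"
    using ex_new_if_finite infinite_UNIV_char_0 by blast
  have "p + t *\<^sub>R q \<in> S" using p q assms(2) by (simp add: subspace_add subspace_scale)
  then show ?case using t by blast
qed

text \<open>Correcting \<open>f\<close> by a multiple \<open>t\<close> of a functional that is 1 on
  the new vector spoils only finitely many values of \<open>t\<close>. The generic coordinates of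
  the plane embedding come from here.\<close>

lemma exists_nonzero_functional:
  fixes N :: "'v::real_vector set"
  assumes "finite N" "0 \<notin> N"
  shows "\<exists>f :: 'v \<Rightarrow> real. linear f \<and> (\<forall>v\<in>N. f v \<noteq> 0)"
  using assms
proof (induction N rule: finite_induct)
  case empty
  have "linear (\<lambda>x::'v. 0::real)" by (simp add: linear_iff)
  then show ?case by blast
next
  case (insert v N)
  then obtain f :: "'v \<Rightarrow> real" where f: "linear f" "\<forall>v\<in>N. f v \<noteq> 0" by auto
  obtain g :: "'v \<Rightarrow> real" where g: "linear g" "g v = 1"
    using linear_independent_extend[of "{v}" "\<lambda>_. 1::real"] insert.prems by auto
  have "finite ((\<lambda>u. - f u / g u) ` insert v N)" using insert by auto
  then obtain t where t: "t \<notin> (\<lambda>u. - f u / g u) ` insert v N"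
    using ex_new_if_finite infinite_UNIV_char_0 by blast
  have "linear (\<lambda>x. f x + t * g x)" using f g by (simp add: linear_iff algebra_simps)
  moreover have "f u + t * g u \<noteq> 0" if "u \<in> insert v N" for u
  proof
    assume a: "f u + t * g u = 0"
    show False
    proof (cases "g u = 0")
      case True then show False using a f g that by auto
    next
      case False
      then have "t = - f u / g u" using a by (simp add: field_simps)
      then show False using t that by auto
    qed
  qed
  ultimately show ?case by blast
qed

text \<open>Projection from a generic point \<open>p\<close> of the whole span: \<open>p\<close>
  lies in the span of a subset only if that subset spans everything, so exactly the full rank drops
  by one and all smaller ranks survive. Repeat until the rank is \<open>m\<close>. With
  \<open>m = k + 1\<close> the flats of rank \<open>k\<close> become hyperplanes of a space of
  bounded rank.\<close>

lemma truncate_configuration: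
  fixes \<phi> :: "'a \<Rightarrow> 'v::real_vector"
  assumes "finite E"
  shows "\<exists>\<phi>' :: 'a \<Rightarrow> 'v. \<forall>X\<subseteq>E. dim (\<phi>' ` X) = min (dim (\<phi> ` X)) m"
proof (induction "dim (\<phi> ` E)" arbitrary: \<phi>)
  case 0
  have "\<forall>X\<subseteq>E. dim (\<phi> ` X) = min (dim (\<phi> ` X)) m"
  proof (intro allI impI)
    fix X assume "X \<subseteq> E"
    then have "dim (\<phi> ` X) \<le> dim (\<phi> ` E)" using assms by (intro dim_mono_finite) (auto intro: span_base)
    then show "dim (\<phi> ` X) = min (dim (\<phi> ` X)) m" using 0 by simp
  qed
  then show ?case by blast
next
  case (Suc n)
  have mono: "dim (\<phi> ` X) \<le> dim (\<phi> ` E)" if "X \<subseteq> E" for X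
    using assms that by (intro dim_mono_finite) (auto intro: span_base)
  show ?case
  proof (cases "dim (\<phi> ` E) \<le> m")
    case True
    then have "\<forall>X\<subseteq>E. dim (\<phi> ` X) = min (dim (\<phi> ` X)) m" by (metis mono True le_trans min_absorb1)
    then show ?thesis by blast
  next
    case False
    let ?Q = "(\<lambda>X. span (\<phi> ` X)) ` {X. X \<subseteq> E \<and> \<not> span (\<phi> ` E) \<subseteq> span (\<phi> ` X)}"
    have "\<exists>p\<in>span (\<phi> ` E). \<forall>Q\<in>?Q. p \<notin> Q"
      by (rule exists_avoiding_subspaces) (use assms in auto)
    then obtain p where p1: "p \<in> span (\<phi> ` E)" and p2: "\<forall>Q\<in>?Q. p \<notin> Q" by (elim bexE)
    have p: "p \<in> span (\<phi> ` E)"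
      "\<And>X. X \<subseteq> E \<Longrightarrow> p \<in> span (\<phi> ` X) \<Longrightarrow> span (\<phi> ` E) \<subseteq> span (\<phi> ` X)"
      using p1 p2 by auto
    obtain \<pi> :: "'v \<Rightarrow> 'v" where pi: "linear \<pi>" "\<And>x. \<pi> x = 0 \<longleftrightarrow> x \<in> span {p}"
      using exists_projection[of "{p}"] by blast
    have p0: "p \<noteq> 0"
    proof
      assume "p = 0"
      then have "span (\<phi> ` E) \<subseteq> span (\<phi> ` {})" using p(2)[of "{}"] by (simp add: span_zero)
      then have "dim (\<phi> ` E) \<le> dim (\<phi> ` {})" by (intro dim_mono_finite) (meson finite.emptyI finite_imageI assms finite_subset span_superset subset_trans)+
      then show False using False by simp
    qed
    have d: "dim (\<pi> ` \<phi> ` X) = min (dim (\<phi> ` X)) n" if "X \<subseteq> E" for X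
    proof -
      have fX: "finite (\<phi> ` X)" using that assms finite_subset by blast
      have "dim (\<pi> ` \<phi> ` X) + dim {p} = dim (\<phi> ` X \<union> {p})"
        using projection_dim[OF pi, of "\<phi> ` X"] fX by auto
      moreover have "dim {p} = 1" using p0 dim_insert_finite[of "{}" p] by simp
      ultimately have *: "Suc (dim (\<pi> ` \<phi> ` X)) = (if p \<in> span (\<phi> ` X) then dim (\<phi> ` X) else Suc (dim (\<phi> ` X)))"
        using fX by (simp add: dim_insert_finite)
      show ?thesis
      proof (cases "p \<in> span (\<phi> ` X)")
        case True
        then have "span (\<phi> ` E) \<subseteq> span (\<phi> ` X)" using p(2) that by blast
        then have "dim (\<phi> ` E) \<le> dim (\<phi> ` X)" using fX by (intro dim_mono_finite) (meson finite.emptyI finite_imageI assms finite_subset span_superset subset_trans)+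
        then show ?thesis using * True mono[OF that] Suc(2) by simp
      next
        case False
        have "\<not> dim (\<phi> ` E) \<le> dim (\<phi> ` X)"
        proof
          assume "dim (\<phi> ` E) \<le> dim (\<phi> ` X)"
          then have "span (\<phi> ` X) = span (\<phi> ` E)"
            using fX that assms by (intro span_eq_of_dim_ge) (auto intro: span_base)
          then show False using p(1) False by simp
        qed
        then show ?thesis using * False Suc(2) by simp
      qed
    qed
    have "n = dim ((\<pi> \<circ> \<phi>) ` E)" using d[of E] Suc(2) by (simp add: image_comp)
    from Suc(1)[OF this] obtain \<phi>' :: "'a \<Rightarrow> 'v" where
      \<phi>': "\<forall>X\<subseteq>E. dim (\<phi>' ` X) = min (dim ((\<pi> \<circ> \<phi>) ` X)) m" by blast
    have "\<forall>X\<subseteq>E. dim (\<phi>' ` X) = min (dim (\<phi> ` X)) m"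
    proof (intro allI impI)
      fix X assume X: "X \<subseteq> E"
      have "dim (\<phi>' ` X) = min (dim (\<pi> ` \<phi> ` X)) m" using \<phi>' X by (simp add: image_comp)
      then show "dim (\<phi>' ` X) = min (dim (\<phi> ` X)) m" using d[OF X] False Suc(2) by simp
    qed
    then show ?thesis by blast
  qed
qed

subsection \<open>Weighted Beck theorem in the plane\<close>

definition on_line :: "real \<times> real \<Rightarrow> real \<times> real \<Rightarrow> bool" where
  "on_line l p \<longleftrightarrow> snd p = fst l * fst p + snd l"

text \<open>A weighted median, written as a minimum of maxima over the subsets that carry half of
  the weight. In this form it is visibly continuous in any parameter on which \<open>f\<close>
  depends continuously.\<close>

definition wmed :: "('p \<Rightarrow> real) \<Rightarrow> 'p set \<Rightarrow> ('p \<Rightarrow> real) \<Rightarrow> real" where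
  "wmed w A f = Min ((\<lambda>T. Max (f ` T)) ` {T. T \<subseteq> A \<and> T \<noteq> {} \<and> sum w A \<le> 2 * sum w T})"

lemma wmed_halves:
  assumes "finite A" "A \<noteq> {}" "\<And>p. p \<in> A \<Longrightarrow> 0 \<le> w p"
  shows "2 * sum w {p \<in> A. f p < wmed w A f} \<le> sum w A"
    and "2 * sum w {p \<in> A. wmed w A f < f p} \<le> sum w A"
proof -
  let ?F = "{T. T \<subseteq> A \<and> T \<noteq> {} \<and> sum w A \<le> 2 * sum w T}"
  have fin: "finite ?F" using assms(1) by simp
  have "sum w A \<ge> 0" using assms(3) by (simp add: sum_nonneg)
  then have ne: "?F \<noteq> {}" using assms(2) by force
  show "2 * sum w {p \<in> A. f p < wmed w A f} \<le> sum w A"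
  proof (rule ccontr)
    let ?T = "{p \<in> A. f p < wmed w A f}"
    assume a: "\<not> 2 * sum w ?T \<le> sum w A"
    have "?T \<noteq> {}" using a \<open>sum w A \<ge> 0\<close> by (auto simp del: Collect_empty_eq)
    then have T: "?T \<in> ?F" using a by auto
    then have "wmed w A f \<le> Max (f ` ?T)" unfolding wmed_def using fin by (intro Min_le) auto
    moreover have "Max (f ` ?T) < wmed w A f" using \<open>?T \<noteq> {}\<close> assms(1) by (subst Max_less_iff) auto
    ultimately show False by simp
  qed
  have "wmed w A f \<in> (\<lambda>T. Max (f ` T)) ` ?F" unfolding wmed_def using fin ne by (intro Min_in) auto
  then obtain T where T: "T \<subseteq> A" "T \<noteq> {}" "sum w A \<le> 2 * sum w T" "wmed w A f = Max (f ` T)" by auto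
  have fT: "finite T" using T(1) assms(1) finite_subset by blast
  have "{p \<in> A. wmed w A f < f p} \<subseteq> A - T" using T(4) fT by (auto simp: leD)
  then have "sum w {p \<in> A. wmed w A f < f p} \<le> sum w (A - T)"
    using assms by (intro sum_mono2) auto
  also have "\<dots> = sum w A - sum w T" using assms(1) T(1) fT by (simp add: sum_diff)
  finally show "2 * sum w {p \<in> A. wmed w A f < f p} \<le> sum w A" using T(3) by simp
qed

lemma continuous_on_Max_image:
  fixes g :: "'i \<Rightarrow> 'x::topological_space \<Rightarrow> real"
  assumes "finite I" "I \<noteq> {}" "\<And>i. i \<in> I \<Longrightarrow> continuous_on U (g i)"
  shows "continuous_on U (\<lambda>m. Max ((\<lambda>i. g i m) ` I))"
  using assms
proof (induction I rule: finite_ne_induct)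
  case (singleton x) then show ?case by simp
next
  case (insert x F)
  then have "continuous_on U (\<lambda>m. max (g x m) (Max ((\<lambda>i. g i m) ` F)))"
    by (intro continuous_on_max) auto
  then show ?case using insert by simp
qed

lemma continuous_on_Min_image:
  fixes g :: "'i \<Rightarrow> 'x::topological_space \<Rightarrow> real"
  assumes "finite I" "I \<noteq> {}" "\<And>i. i \<in> I \<Longrightarrow> continuous_on U (g i)"
  shows "continuous_on U (\<lambda>m. Min ((\<lambda>i. g i m) ` I))"
  using assms
proof (induction I rule: finite_ne_induct)
  case (singleton x) then show ?case by simp
next
  case (insert x F)
  then have "continuous_on U (\<lambda>m. min (g x m) (Min ((\<lambda>i. g i m) ` F)))"
    by (intro continuous_on_min) auto
  then show ?case using insert by simp
qed

lemma wmed_continuous: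
  assumes "finite A" "A \<noteq> {}" "\<And>p. p \<in> A \<Longrightarrow> 0 \<le> w p"
  shows "continuous_on UNIV (\<lambda>m. wmed w A (\<lambda>p. snd p - m * fst p :: real))"
proof -
  have "sum w A \<ge> 0" using assms(3) by (simp add: sum_nonneg)
  then have "{T. T \<subseteq> A \<and> T \<noteq> {} \<and> sum w A \<le> 2 * sum w T} \<noteq> {}" using assms(2) by force
  then show ?thesis unfolding wmed_def
    by (intro continuous_on_Min_image continuous_on_Max_image continuous_intros)
      (use assms(1) finite_subset in auto)
qed

lemma wmed_less:
  assumes "finite A" "A \<noteq> {}" "\<And>p. p \<in> A \<Longrightarrow> 0 \<le> w p"
    and "finite B" "B \<noteq> {}" "\<And>p. p \<in> B \<Longrightarrow> 0 \<le> w p"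
    and "\<And>p q. p \<in> A \<Longrightarrow> q \<in> B \<Longrightarrow> f p < f q"
  shows "wmed w A f < wmed w B f"
proof -
  have *: "\<exists>p\<in>A. wmed w A f = f p" if A: "finite A" "A \<noteq> {}" "\<And>p. p \<in> A \<Longrightarrow> 0 \<le> w p" for A
  proof -
    let ?F = "{T. T \<subseteq> A \<and> T \<noteq> {} \<and> sum w A \<le> 2 * sum w T}"
    have "sum w A \<ge> 0" using A(3) by (simp add: sum_nonneg)
    then have "?F \<noteq> {}" using A(2) by force
    then have "wmed w A f \<in> (\<lambda>T. Max (f ` T)) ` ?F" unfolding wmed_def using A(1) by (intro Min_in) auto
    then obtain T where T: "T \<subseteq> A" "T \<noteq> {}" "wmed w A f = Max (f ` T)" by auto
    then have "Max (f ` T) \<in> f ` T" using A(1) finite_subset by (intro Max_in) auto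
    then show ?thesis using T by auto
  qed
  show ?thesis using *[OF assms(1-3)] *[OF assms(4-6)] assms(7) by auto
qed

text \<open>The vertical line is a median of the abscissae. For the second line the slope is moved
  until the median heights of the left and of the right part agree, by the intermediate value
  theorem. Letting \<open>X\<close> and \<open>Y\<close> range over the two order relations treats
  the four open quadrants at once; points on the two lines are not counted.\<close>

lemma ham_sandwich:
  fixes S :: "(real \<times> real) set" and w :: "real \<times> real \<Rightarrow> real"
  assumes "finite S" "\<And>p. p \<in> S \<Longrightarrow> 0 \<le> w p"
  shows "\<exists>c l. \<forall>X Y. X \<in> {(<), (>)} \<longrightarrow> Y \<in> {(<), (>)} \<longrightarrow>
     4 * sum w {p \<in> S. X (fst p) c \<and> Y (snd p - fst l * fst p) (snd l)} \<le> sum w S"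
proof (cases "S = {}")
  case True then show ?thesis by auto
next
  case False
  define c where "c = wmed w S fst"
  define A where "A = {p \<in> S. fst p < c}"
  define B where "B = {p \<in> S. c < fst p}"
  have fA: "finite A" "\<And>p. p \<in> A \<Longrightarrow> 0 \<le> w p" and fB: "finite B" "\<And>p. p \<in> B \<Longrightarrow> 0 \<le> w p"
    using assms by (auto simp: A_def B_def)
  have AB: "2 * sum w A \<le> sum w S" "2 * sum w B \<le> sum w S"
    using wmed_halves[of S w fst] False assms by (auto simp: A_def B_def c_def)
  define h where "h = (\<lambda>m p. snd p - m * fst p :: real)"
  have "\<exists>m b. (A \<noteq> {} \<longrightarrow> wmed w A (h m) = b) \<and> (B \<noteq> {} \<longrightarrow> wmed w B (h m) = b)"
  proof (cases "A = {} \<or> B = {}")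
    case True then show ?thesis by auto
  next
    case ne: False
    let ?g = "\<lambda>(p, q). \<bar>snd q - snd p\<bar> / (fst q - fst p)"
    \<comment> \<open>\<open>M\<close> exceeds the absolute slope of every segment from the left to
      the right part. At slope \<open>-M\<close> the whole left part is therefore lower than the
      right part, and at slope \<open>M\<close> it is higher, which gives the change of
      sign.\<close>
    define M where "M = Max (insert 0 (?g ` (A \<times> B))) + 1"
    have M: "?g (p, q) < M" if "p \<in> A" "q \<in> B" for p q
    proof -
      have "?g (p, q) \<le> Max (insert 0 (?g ` (A \<times> B)))" using that fA fB by (intro Max_ge) auto
      then show ?thesis by (simp add: M_def)
    qed
    have M': "\<bar>snd q - snd p\<bar> < M * (fst q - fst p)" if "p \<in> A" "q \<in> B" for p q
    proof -
      have "fst q - fst p > 0" using that by (auto simp: A_def B_def)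
      then show ?thesis using M[OF that] by (simp add: field_simps)
    qed
    have 1: "wmed w A (h (-M)) < wmed w B (h (-M))"
      using ne fA fB M' by (intro wmed_less) (auto simp: h_def algebra_simps dest!: M')
    have 2: "wmed w B (h M) < wmed w A (h M)"
      using ne fA fB by (intro wmed_less) (auto simp: h_def algebra_simps dest!: M')
    have "M > 0" unfolding M_def using fA fB
      by (metis (no_types, lifting) Max_ge add_nonneg_pos finite.insertI finite_SigmaI finite_imageI insertI1 zero_less_one)
    have "\<exists>m\<ge>-M. m \<le> M \<and> wmed w A (h m) - wmed w B (h m) = 0"
    proof (rule IVT')
      show "continuous_on {- M..M} (\<lambda>m. wmed w A (h m) - wmed w B (h m))"
      proof (rule continuous_on_diff)
        show "continuous_on {- M..M} (\<lambda>m. wmed w A (h m))" unfolding h_def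
          by (rule continuous_on_subset[OF wmed_continuous[OF fA(1) _ fA(2)]]) (use ne in blast)+
        show "continuous_on {- M..M} (\<lambda>m. wmed w B (h m))" unfolding h_def
          by (rule continuous_on_subset[OF wmed_continuous[OF fB(1) _ fB(2)]]) (use ne in blast)+
      qed
    qed (use 1 2 \<open>M > 0\<close> in auto)
    then show ?thesis by auto
  qed
  then obtain m b where mb: "A \<noteq> {} \<Longrightarrow> wmed w A (h m) = b" "B \<noteq> {} \<Longrightarrow> wmed w B (h m) = b" by blast
  have A2: "4 * sum w {p \<in> A. h m p < b} \<le> sum w S" "4 * sum w {p \<in> A. b < h m p} \<le> sum w S"
  proof -
    have "2 * sum w {p \<in> A. h m p < b} \<le> sum w A" "2 * sum w {p \<in> A. b < h m p} \<le> sum w A"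
      if "A \<noteq> {}"
      using wmed_halves[of A w "h m"] fA mb(1)[OF that] that by auto
    moreover have "sum w S \<ge> 0" using assms by (simp add: sum_nonneg)
    ultimately show "4 * sum w {p \<in> A. h m p < b} \<le> sum w S" "4 * sum w {p \<in> A. b < h m p} \<le> sum w S"
      using AB(1) by (cases "A = {}"; force)+
  qed
  have B2: "4 * sum w {p \<in> B. h m p < b} \<le> sum w S" "4 * sum w {p \<in> B. b < h m p} \<le> sum w S"
  proof -
    have "2 * sum w {p \<in> B. h m p < b} \<le> sum w B" "2 * sum w {p \<in> B. b < h m p} \<le> sum w B"
      if "B \<noteq> {}"
      using wmed_halves[of B w "h m"] fB mb(2)[OF that] that by auto
    moreover have "sum w S \<ge> 0" using assms by (simp add: sum_nonneg)
    ultimately show "4 * sum w {p \<in> B. h m p < b} \<le> sum w S" "4 * sum w {p \<in> B. b < h m p} \<le> sum w S"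
      using AB(2) by (cases "B = {}"; force)+
  qed
  show ?thesis
    using A2 B2 by (intro exI[of _ c] exI[of _ "(m, b)"]) (auto simp: A_def B_def h_def conj_assoc)
qed

text \<open>The height of one line over the other is an affine function of the abscissa, hence
  monotone; it cannot take both signs on the left and both signs on the right of
  \<open>c\<close>.\<close>

lemma line_misses_quadrant:
  assumes "on_line k p1" "on_line k p2" "on_line k p3" "on_line k p4"
    and "fst p1 < c" "snd p1 - fst l * fst p1 < snd l"
    and "fst p2 < c" "snd p2 - fst l * fst p2 > snd l"
    and "fst p3 > c" "snd p3 - fst l * fst p3 < snd l"
    and "fst p4 > c" "snd p4 - fst l * fst p4 > snd l"
  shows False
proof -
  define \<alpha> where "\<alpha> = fst k - fst l"
  define \<beta> where "\<beta> = snd k - snd l"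
  have e: "snd p - fst l * fst p - snd l = \<alpha> * fst p + \<beta>" if "on_line k p" for p
    using that by (simp add: on_line_def \<alpha>_def \<beta>_def algebra_simps)
  have *: "\<alpha> * fst p1 + \<beta> < 0" "\<alpha> * fst p2 + \<beta> > 0" "\<alpha> * fst p3 + \<beta> < 0" "\<alpha> * fst p4 + \<beta> > 0"
    using e assms by (smt (verit))+
  show False
  proof (cases "\<alpha> \<ge> 0")
    case True
    then have "\<alpha> * fst p2 \<le> \<alpha> * fst p3" using assms by (intro mult_left_mono) auto
    then show False using * by linarith
  next
    case False
    then have "\<alpha> * fst p4 \<le> \<alpha> * fst p1" using assms by (intro mult_left_mono_neg) auto
    then show False using * by linarith
  qed
qed

text \<open>Ham-sandwich cuts iterated \<open>d\<close> times. A line misses one of the four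
  quadrants at each level, so it meets \<open>3 ^ d\<close> of the \<open>4 ^ d\<close> cells: the
  exponent gap on which everything rests. Each cut uses one vertical and one other line, in total
  \<open>(4 ^ d - 1) / 3\<close> of each kind; points on cuts belong to no cell.\<close>

lemma partition_tree:
  fixes S :: "(real \<times> real) set" and w :: "real \<times> real \<Rightarrow> real"
  assumes "finite S" "\<And>p. p \<in> S \<Longrightarrow> 0 \<le> w p"
  shows "\<exists>cs K V. length cs = 4 ^ d \<and> finite K \<and> 3 * card K + 1 \<le> 4 ^ d \<and> finite V \<and> 3 * card V + 1 \<le> 4 ^ d \<and>
     (\<forall>c\<in>set cs. c \<subseteq> S \<and> 4 ^ d * sum w c \<le> sum w S) \<and>
     (\<forall>p\<in>S. p \<in> \<Union>(set cs) \<or> fst p \<in> V \<or> (\<exists>l\<in>K. on_line l p)) \<and>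
     (\<forall>l. length (filter (\<lambda>c. \<exists>p\<in>c. on_line l p) cs) \<le> 3 ^ d)"
  using assms
proof (induction d arbitrary: S)
  case 0
  show ?case by (intro exI[of _ "[S]"] exI[of _ "{}"]) auto
next
  case (Suc d)
  obtain c l where cl: "\<And>X Y. X \<in> {(<), (>)} \<Longrightarrow> Y \<in> {(<), (>)} \<Longrightarrow>
     4 * sum w {p \<in> S. X (fst p) c \<and> Y (snd p - fst l * fst p) (snd l)} \<le> sum w S"
    using ham_sandwich[of S w] Suc.prems by blast
  define Q where "Q = (\<lambda>X Y. {p \<in> S. X (fst p) c \<and> Y (snd p - fst l * fst p) (snd l)})"
  define R where "R = (\<lambda>S cs K V. length cs = 4 ^ d \<and> finite K \<and> 3 * card K + 1 \<le> 4 ^ d \<and> finite V \<and> 3 * card V + 1 \<le> 4 ^ d \<and>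
     (\<forall>c\<in>set cs. c \<subseteq> S \<and> 4 ^ d * sum w c \<le> sum w S) \<and>
     (\<forall>p\<in>S. p \<in> \<Union>(set cs) \<or> fst p \<in> V \<or> (\<exists>l\<in>K. on_line l p)) \<and>
     (\<forall>l. length (filter (\<lambda>c. \<exists>p\<in>c. on_line l p) cs) \<le> 3 ^ d))"
  have "\<exists>cs K V. R (Q X Y) cs K V" for X Y
    unfolding R_def by (rule Suc.IH) (use Suc.prems in \<open>auto simp: Q_def\<close>)
  then obtain cs K V where R: "\<And>X Y. R (Q X Y) (cs X Y) (K X Y) (V X Y)" by metis
  define cs' where "cs' = cs (<) (<) @ cs (<) (>) @ cs (>) (<) @ cs (>) (>)"
  define K' where "K' = insert l (K (<) (<) \<union> K (<) (>) \<union> K (>) (<) \<union> K (>) (>))"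
  define V' where "V' = insert c (V (<) (<) \<union> V (<) (>) \<union> V (>) (<) \<union> V (>) (>))"
  have "length cs' = 4 ^ Suc d" using R by (simp add: cs'_def R_def)
  moreover have "finite K'" "finite V'" using R by (auto simp: K'_def V'_def R_def)
  moreover have "3 * card K' + 1 \<le> 4 ^ Suc d"
  proof -
    have "card K' \<le> Suc (card (K (<) (<)) + card (K (<) (>)) + card (K (>) (<)) + card (K (>) (>)))"
      unfolding K'_def by (rule order.trans[OF card_insert_le_m1[where x=l, of "Suc (card (K (<) (<)) + card (K (<) (>)) + card (K (>) (<)) + card (K (>) (>)))"]])
        (auto intro!: order.trans[OF card_Un_le] add_mono)
    moreover have "3 * card (K X Y) + 1 \<le> 4 ^ d" for X Y using R by (simp add: R_def)
    from this[of "(<)" "(<)"] this[of "(<)" "(>)"] this[of "(>)" "(<)"] this[of "(>)" "(>)"]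
    have "3 * (card (K (<) (<)) + card (K (<) (>)) + card (K (>) (<)) + card (K (>) (>))) + 4 \<le> 4 ^ Suc d" by simp
    ultimately show ?thesis by simp
  qed
  moreover have "3 * card V' + 1 \<le> 4 ^ Suc d"
  proof -
    have "card V' \<le> Suc (card (V (<) (<)) + card (V (<) (>)) + card (V (>) (<)) + card (V (>) (>)))"
      unfolding V'_def by (rule order.trans[OF card_insert_le_m1[where x=c, of "Suc (card (V (<) (<)) + card (V (<) (>)) + card (V (>) (<)) + card (V (>) (>)))"]])
        (auto intro!: order.trans[OF card_Un_le] add_mono)
    moreover have "3 * card (V X Y) + 1 \<le> 4 ^ d" for X Y using R by (simp add: R_def)
    from this[of "(<)" "(<)"] this[of "(<)" "(>)"] this[of "(>)" "(<)"] this[of "(>)" "(>)"]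
    have "3 * (card (V (<) (<)) + card (V (<) (>)) + card (V (>) (<)) + card (V (>) (>))) + 4 \<le> 4 ^ Suc d" by simp
    ultimately show ?thesis by simp
  qed
  moreover have "c' \<subseteq> S \<and> 4 ^ Suc d * sum w c' \<le> sum w S" if "c' \<in> set cs'" for c'
  proof -
    from that obtain X Y where XY: "c' \<in> set (cs X Y)" "X \<in> {(<), (>)}" "Y \<in> {(<), (>)}" by (auto simp: cs'_def)
    then have "c' \<subseteq> Q X Y" "4 ^ d * sum w c' \<le> sum w (Q X Y)" using R by (auto simp: R_def)
    moreover have "4 * sum w (Q X Y) \<le> sum w S" using cl XY by (simp add: Q_def)
    ultimately show ?thesis by (auto simp: Q_def)
  qed
  moreover have "p \<in> \<Union>(set cs') \<or> fst p \<in> V' \<or> (\<exists>l\<in>K'. on_line l p)" if "p \<in> S" for p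
  proof (cases "fst p = c \<or> snd p - fst l * fst p = snd l")
    case True
    then show ?thesis by (auto simp: V'_def K'_def on_line_def algebra_simps)
  next
    case False
    then have "\<exists>X\<in>{(<), (>)}. \<exists>Y\<in>{(<), (>)}. p \<in> Q X Y" using that unfolding Q_def by auto
    then obtain X Y where XY: "p \<in> Q X Y" "X \<in> {(<), (>)}" "Y \<in> {(<), (>)}" by blast
    then have "p \<in> \<Union>(set (cs X Y)) \<or> fst p \<in> V X Y \<or> (\<exists>l\<in>K X Y. on_line l p)"
      using R[of X Y] unfolding R_def by blast
    then show ?thesis using XY(2,3) by (auto simp: cs'_def K'_def V'_def)
  qed
  moreover have "length (filter (\<lambda>c. \<exists>p\<in>c. on_line k p) cs') \<le> 3 ^ Suc d" for k
  proof -
    define N where "N = (\<lambda>X Y. length (filter (\<lambda>c. \<exists>p\<in>c. on_line k p) (cs X Y)))"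
    have le: "N X Y \<le> 3 ^ d" for X Y using R[of X Y] unfolding R_def N_def by blast
    have zero: "N X Y = 0" if "\<not> (\<exists>p\<in>Q X Y. on_line k p)" for X Y
    proof -
      have "\<And>c. c \<in> set (cs X Y) \<Longrightarrow> c \<subseteq> Q X Y" using R by (simp add: R_def)
      then show ?thesis using that unfolding N_def by (auto simp: filter_empty_conv)
    qed
    have "\<exists>X\<in>{(<), (>)}. \<exists>Y\<in>{(<), (>)}. N X Y = 0"
    proof (rule ccontr)
      assume a: "\<not> ?thesis"
      then have "\<exists>p\<in>Q X Y. on_line k p" if "X \<in> {(<), (>)}" "Y \<in> {(<), (>)}" for X Y using zero that by blast
      from this[of "(<)" "(<)"] this[of "(<)" "(>)"] this[of "(>)" "(<)"] this[of "(>)" "(>)"]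
      show False unfolding Q_def using line_misses_quadrant[of k _ _ _ _ c l] by auto
    qed
    then have "N (<) (<) + N (<) (>) + N (>) (<) + N (>) (>) \<le> 3 * 3 ^ d"
      using le[of "(<)" "(<)"] le[of "(<)" "(>)"] le[of "(>)" "(<)"] le[of "(>)" "(>)"] by auto
    then show ?thesis by (simp add: cs'_def N_def)
  qed
  ultimately show ?case by (intro exI[of _ cs'] exI[of _ K'] exI[of _ V']) blast
qed

lemma lines_intersect_once:
  assumes "on_line k p" "on_line k q" "on_line l p" "on_line l q" "p \<noteq> q"
  shows "k = l"
proof -
  have "fst p \<noteq> fst q" using assms by (auto simp: on_line_def prod_eq_iff)
  moreover have "(fst k - fst l) * (fst p - fst q) = 0"
    using assms by (simp add: on_line_def algebra_simps)
  ultimately have "fst k = fst l" by simp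
  then show ?thesis using assms(1,3) by (simp add: on_line_def prod_eq_iff)
qed

lemma sum_UN_le:
  fixes w :: "'p \<Rightarrow> real"
  assumes "finite I" "\<And>i. i \<in> I \<Longrightarrow> finite (B i)" "\<And>i p. i \<in> I \<Longrightarrow> p \<in> B i \<Longrightarrow> 0 \<le> w p"
  shows "sum w (\<Union>i\<in>I. B i) \<le> (\<Sum>i\<in>I. sum w (B i))"
  using assms
proof (induction I rule: finite_induct)
  case empty then show ?case by simp
next
  case (insert i I)
  have "sum w (B i \<union> (\<Union>i\<in>I. B i)) \<le> sum w (B i) + sum w (\<Union>i\<in>I. B i)"
    using insert.prems insert.hyps by (subst sum.union_inter[symmetric]) (auto intro!: sum_nonneg)
  moreover have "sum w (\<Union>i\<in>I. B i) \<le> (\<Sum>i\<in>I. sum w (B i))"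
    by (intro insert.IH) (use insert.prems in auto)
  ultimately show ?case using insert.hyps by simp
qed

lemma sum_Un_le_add:
  fixes w :: "'p \<Rightarrow> real"
  assumes "finite X" "finite Y" "\<And>p. p \<in> X \<inter> Y \<Longrightarrow> 0 \<le> w p"
  shows "sum w (X \<union> Y) \<le> sum w X + sum w Y"
proof -
  have "sum w (X \<inter> Y) \<ge> 0" using assms(3) by (rule sum_nonneg)
  then show ?thesis using sum.union_inter[OF assms(1,2), of w] by simp
qed

lemma sum_le_single:
  fixes w :: "'p \<Rightarrow> real"
  assumes "\<And>p q. p \<in> X \<Longrightarrow> q \<in> X \<Longrightarrow> p = q" "\<And>p. p \<in> X \<Longrightarrow> w p \<le> t" "0 \<le> t"
  shows "sum w X \<le> t"
proof (cases "X = {}")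
  case False
  then obtain p where "X = {p}" using assms(1) by blast
  then show ?thesis using assms by simp
qed (use assms in simp)

text \<open>Double counting of pairs of distinct points in a common cell. A rich line loses little
  weight to the cuts, meets only \<open>3 ^ d\<close> cells, and so has pair weight at least of
  order \<open>\<theta>\<close> squared over \<open>3 ^ d\<close>. Two points determine a line, so
  all lines together have pair weight at most \<open>4 ^ d\<close> times the square of a cell
  weight, that is \<open>1 / 4 ^ d\<close>. The last term of the bound pays for the lines that are
  themselves cuts.\<close>

lemma rich_lines_bound:
  fixes S :: "(real \<times> real) set" and w :: "real \<times> real \<Rightarrow> real"
  assumes S: "finite S" "\<And>p. p \<in> S \<Longrightarrow> 0 \<le> w p" "\<And>p. p \<in> S \<Longrightarrow> w p \<le> \<tau>" "sum w S \<le> 1" "0 < \<tau>"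
    and L: "finite L" "\<And>l. l \<in> L \<Longrightarrow> \<theta> \<le> sum w {p \<in> S. on_line l p}"
    and \<theta>: "16 * 4 ^ d * \<tau> \<le> \<theta>"
  shows "real (card L) * \<theta>\<^sup>2 \<le> 8 * (3/4) ^ d + 4 ^ d * \<theta>\<^sup>2"
proof -
  have "\<exists>cs K V. length cs = 4 ^ d \<and> finite K \<and> 3 * card K + 1 \<le> 4 ^ d \<and> finite V \<and> 3 * card V + 1 \<le> 4 ^ d \<and>
     (\<forall>c\<in>set cs. c \<subseteq> S \<and> 4 ^ d * sum w c \<le> sum w S) \<and>
     (\<forall>p\<in>S. p \<in> \<Union>(set cs) \<or> fst p \<in> V \<or> (\<exists>l\<in>K. on_line l p)) \<and>
     (\<forall>l. length (filter (\<lambda>c. \<exists>p\<in>c. on_line l p) cs) \<le> 3 ^ d)"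
    by (rule partition_tree) (use S in auto)
  then obtain cs K V where P: "length cs = 4 ^ d \<and> finite K \<and> 3 * card K + 1 \<le> 4 ^ d \<and> finite V \<and> 3 * card V + 1 \<le> 4 ^ d \<and>
     (\<forall>c\<in>set cs. c \<subseteq> S \<and> 4 ^ d * sum w c \<le> sum w S) \<and>
     (\<forall>p\<in>S. p \<in> \<Union>(set cs) \<or> fst p \<in> V \<or> (\<exists>l\<in>K. on_line l p)) \<and>
     (\<forall>l. length (filter (\<lambda>c. \<exists>p\<in>c. on_line l p) cs) \<le> 3 ^ d)"
    by (elim exE) (rule that)
  have cs: "length cs = 4 ^ d" and K: "finite K" "3 * card K + 1 \<le> 4 ^ d"
    and V: "finite V" "3 * card V + 1 \<le> 4 ^ d" using P by blast+
  have c: "c \<subseteq> S" "4 ^ d * sum w c \<le> sum w S" if "c \<in> set cs" for c using P that by blast+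
  have cov: "p \<in> \<Union>(set cs) \<or> fst p \<in> V \<or> (\<exists>l\<in>K. on_line l p)" if "p \<in> S" for p
    using P that by blast
  have meet: "length (filter (\<lambda>c. \<exists>p\<in>c. on_line l p) cs) \<le> 3 ^ d" for l using P by blast
  have \<theta>0: "\<theta> > 0" using \<theta> S(5) by (smt (verit) mult_pos_pos zero_less_power)
  let ?I = "{..<(4::nat) ^ d}"
  define C where "C = (\<lambda>i. cs ! i)"
  have C: "C i \<subseteq> S" "finite (C i)" "sum w (C i) \<le> 1 / 4 ^ d" if "i \<in> ?I" for i
  proof -
    have m: "C i \<in> set cs" using that cs by (simp add: C_def)
    then show "C i \<subseteq> S" using c by simp
    then show "finite (C i)" using S(1) finite_subset by blast
    show "sum w (C i) \<le> 1 / 4 ^ d" using c(2)[OF m] S(4) by (simp add: field_simps)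
  qed
  define D where "D = (\<lambda>i l. {p \<in> C i. on_line l p})"
  define a where "a = (\<lambda>i l. sum w (D i l))"
  define pr where "pr = (\<lambda>i l. \<Sum>(p, q)\<in>{(p, q) \<in> D i l \<times> D i l. p \<noteq> q}. w p * w q)"
  have fD: "finite (D i l)" "D i l \<subseteq> S" if "i \<in> ?I" for i l using C[OF that] by (auto simp: D_def)
  have pr_ge: "a i l * a i l - \<tau> * a i l \<le> pr i l" if "i \<in> ?I" for i l
  proof -
    have "a i l * a i l = (\<Sum>(p, q)\<in>D i l \<times> D i l. w p * w q)"
      by (simp add: a_def sum_product sum.cartesian_product)
    also have "\<dots> = pr i l + (\<Sum>(p, q)\<in>{(p, q) \<in> D i l \<times> D i l. p = q}. w p * w q)"
    proof -
      let ?X = "{(p, q) \<in> D i l \<times> D i l. p \<noteq> q}" and ?Y = "{(p, q) \<in> D i l \<times> D i l. p = q}"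
      have eq: "?X \<union> ?Y = D i l \<times> D i l" by auto
      have "finite ?X" "finite ?Y"
        by (rule finite_subset[OF _ finite_cartesian_product[OF fD(1)[OF that] fD(1)[OF that]]], auto)+
      then have "(\<Sum>(p, q)\<in>?X \<union> ?Y. w p * w q) = (\<Sum>(p, q)\<in>?X. w p * w q) + (\<Sum>(p, q)\<in>?Y. w p * w q)"
        by (rule sum.union_disjoint) auto
      then show ?thesis unfolding pr_def by (simp only: eq)
    qed
    also have "{(p, q) \<in> D i l \<times> D i l. p = q} = (\<lambda>p. (p, p)) ` D i l" by auto
    also have "(\<Sum>(p, q)\<in>(\<lambda>p. (p, p)) ` D i l. w p * w q) = (\<Sum>p\<in>D i l. w p * w p)"
      by (subst sum.reindex) (auto simp: inj_on_def)
    also have "\<dots> \<le> (\<Sum>p\<in>D i l. \<tau> * w p)" using fD(2)[OF that, of l] S(2,3) by (intro sum_mono mult_right_mono) blast+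
    finally show ?thesis by (simp add: a_def sum_distrib_left)
  qed
  have low: "\<theta>\<^sup>2 / (8 * 3 ^ d) \<le> (\<Sum>i\<in>?I. pr i l)" if l: "l \<in> L - K" for l
  proof -
    define A where "A = (\<Sum>i\<in>?I. a i l)"
    have sub: "{p \<in> S. on_line l p} \<subseteq> (\<Union>i\<in>?I. D i l) \<union> (\<Union>v\<in>V. {p \<in> S. on_line l p \<and> fst p = v})
        \<union> (\<Union>k\<in>K. {p \<in> S. on_line l p \<and> on_line k p})" (is "_ \<subseteq> ?A \<union> ?B \<union> ?C")
    proof
      fix p assume p: "p \<in> {p \<in> S. on_line l p}"
      show "p \<in> ?A \<union> ?B \<union> ?C"
      proof (cases "p \<in> \<Union>(set cs)")
        case True
        then obtain i where "i < length cs" "p \<in> cs ! i" by (metis UnionE in_set_conv_nth)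
        then show ?thesis using p cs by (auto simp: D_def C_def)
      next
        case False
        have pS: "p \<in> S" "on_line l p" using p by auto
        have "fst p \<in> V \<or> (\<exists>k\<in>K. on_line k p)" using cov[OF pS(1)] False by blast
        then have "p \<in> ?B \<or> p \<in> ?C" using pS by blast
        then show ?thesis by (elim disjE) (simp_all only: Un_iff simp_thms)
      qed
    qed
    have subS: "?A \<subseteq> S" "?B \<subseteq> S" "?C \<subseteq> S" using fD(2) by blast+
    then have fin: "finite ?A" "finite ?B" "finite ?C" using S(1) by (meson finite_subset)+
    have "\<theta> \<le> sum w {p \<in> S. on_line l p}" using L(2) l by simp
    also have "\<dots> \<le> sum w (?A \<union> ?B \<union> ?C)"
      by (rule sum_mono2) (use sub fin subS S(2) in blast)+
    also have "\<dots> \<le> sum w (?A \<union> ?B) + sum w ?C"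
      by (rule sum_Un_le_add) (use fin subS S(2) in blast)+
    also have "sum w (?A \<union> ?B) \<le> sum w ?A + sum w ?B"
      by (rule sum_Un_le_add) (use fin subS S(2) in blast)+
    also have "sum w ?A \<le> A" unfolding A_def a_def
      by (rule sum_UN_le) (use fD S(2) in blast)+
    also have "sum w ?B \<le> real (card V) * \<tau>"
    proof -
      have "sum w ?B \<le> (\<Sum>v\<in>V. sum w {p \<in> S. on_line l p \<and> fst p = v})" using V S by (intro sum_UN_le) auto
      also have "\<dots> \<le> (\<Sum>v\<in>V. \<tau>)"
        using S by (intro sum_mono sum_le_single) (auto simp: on_line_def prod_eq_iff)
      finally show ?thesis by simp
    qed
    also have "sum w ?C \<le> real (card K) * \<tau>"
    proof -
      have "sum w ?C \<le> (\<Sum>v\<in>K. sum w {p \<in> S. on_line l p \<and> on_line v p})" using K S by (intro sum_UN_le) auto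
      also have "\<dots> \<le> (\<Sum>v\<in>K. \<tau>)"
      proof (intro sum_mono sum_le_single)
        fix v p q assume "v \<in> K" "p \<in> {p \<in> S. on_line l p \<and> on_line v p}" "q \<in> {p \<in> S. on_line l p \<and> on_line v p}"
        then show "p = q" using lines_intersect_once[of l p q v] l by auto
      qed (use S in auto)
      finally show ?thesis by simp
    qed
    finally have 1: "\<theta> \<le> A + real (card V) * \<tau> + real (card K) * \<tau>" by simp
    have "real (card V) \<le> 4 ^ d" "real (card K) \<le> 4 ^ d"
      using V(2) K(2) by (metis (no_types, opaque_lifting) add_leE le_add2 mult_2 numeral_3_eq_3 of_nat_le_iff of_nat_numeral of_nat_power mult_Suc order_trans)+
    then have "real (card V) * \<tau> \<le> 4 ^ d * \<tau>" "real (card K) * \<tau> \<le> 4 ^ d * \<tau>"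
      using S(5) by (auto intro: mult_right_mono)
    then have A: "\<theta> / 2 \<le> A" using 1 \<theta> \<theta>0 by linarith
    have "A\<^sup>2 \<le> 3 ^ d * (\<Sum>i\<in>?I. (a i l)\<^sup>2)"
    proof -
      \<comment> \<open>Cauchy-Schwarz only over the cells that the line meets, which yields the
        factor \<open>3 ^ d\<close> instead of \<open>4 ^ d\<close>.\<close>
      define N where "N = {i \<in> ?I. \<exists>p\<in>C i. on_line l p}"
      have N: "finite N" "N \<subseteq> ?I" by (auto simp: N_def)
      have "card N \<le> 3 ^ d"
      proof -
        have "card N = length (filter (\<lambda>c. \<exists>p\<in>c. on_line l p) cs)"
          unfolding length_filter_conv_card N_def C_def using cs by (intro arg_cong[of _ _ card]) auto
        then show ?thesis using meet by simp
      qed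
      then have cN: "real (card N) \<le> 3 ^ d" by (metis of_nat_le_iff of_nat_numeral of_nat_power)
      have "A = (\<Sum>i\<in>N. a i l)" unfolding A_def
        using N by (intro sum.mono_neutral_right) (auto simp: N_def a_def D_def intro!: sum.neutral)
      then have "A\<^sup>2 \<le> (\<Sum>i\<in>N. (a i l)\<^sup>2) * card N" using sum_squared_le_sum_of_squares[of "\<lambda>i. a i l" N] by simp
      also have "\<dots> \<le> (\<Sum>i\<in>?I. (a i l)\<^sup>2) * 3 ^ d"
        using N cN by (intro mult_mono sum_mono2 sum_nonneg) auto
      finally show ?thesis by (simp add: mult.commute)
    qed
    then have "A * (A / 3 ^ d - \<tau>) \<le> (\<Sum>i\<in>?I. (a i l)\<^sup>2) - \<tau> * A"
      by (simp add: field_simps power2_eq_square)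
    also have "\<dots> = (\<Sum>i\<in>?I. a i l * a i l - \<tau> * a i l)"
      by (simp add: A_def sum_subtractf sum_distrib_left power2_eq_square)
    also have "\<dots> \<le> (\<Sum>i\<in>?I. pr i l)" by (intro sum_mono pr_ge)
    finally have 2: "A * (A / 3 ^ d - \<tau>) \<le> (\<Sum>i\<in>?I. pr i l)" .
    \<comment> \<open>Small enough for the diagonal pairs to take away at most half of the squared
      weight.\<close>
    have "\<tau> \<le> \<theta> / (4 * 3 ^ d)"
    proof -
      have "(3::real) ^ d \<le> 4 ^ d" by (intro power_mono) auto
      moreover have "(0::real) \<le> 4 ^ d" by simp
      ultimately have "4 * (3::real) ^ d \<le> 16 * 4 ^ d" by linarith
      then have "4 * 3 ^ d * \<tau> \<le> 16 * 4 ^ d * \<tau>" using S(5) by (intro mult_right_mono) auto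
      then show ?thesis using \<theta> by (simp add: field_simps)
    qed
    moreover have "\<theta> / 2 / 3 ^ d \<le> A / 3 ^ d" using A by (intro divide_right_mono) auto
    moreover have "\<theta> / 2 / 3 ^ d = 2 * (\<theta> / (4 * 3 ^ d))" by (simp add: field_simps)
    ultimately have "\<theta> / (4 * 3 ^ d) \<le> A / 3 ^ d - \<tau>" by linarith
    then have "\<theta> / 2 * (\<theta> / (4 * 3 ^ d)) \<le> A * (A / 3 ^ d - \<tau>)"
      using A \<theta>0 by (intro mult_mono) auto
    moreover have "\<theta> / 2 * (\<theta> / (4 * 3 ^ d)) = \<theta>\<^sup>2 / (8 * 3 ^ d)" by (simp add: power2_eq_square)
    ultimately show ?thesis using 2 by linarith
  qed
  \<comment> \<open>Pairs from different lines are disjoint, so within one cell all lines share the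
    pairs of that cell.\<close>
  have up: "(\<Sum>l\<in>L - K. pr i l) \<le> (1 / 4 ^ d)\<^sup>2" if i: "i \<in> ?I" for i
  proof -
    let ?P = "\<lambda>l. {(p, q) \<in> D i l \<times> D i l. p \<noteq> q}"
    have fP: "finite (?P l)" for l
      by (rule finite_subset[OF _ finite_cartesian_product[OF fD(1)[OF i, of l] fD(1)[OF i, of l]]]) auto
    have "(\<Sum>l\<in>L - K. pr i l) = (\<Sum>(p, q)\<in>(\<Union>l\<in>L - K. ?P l). w p * w q)"
      unfolding pr_def
    proof (rule sum.UNION_disjoint[symmetric])
      show "\<forall>l\<in>L - K. \<forall>k\<in>L - K. l \<noteq> k \<longrightarrow> ?P l \<inter> ?P k = {}"
        using lines_intersect_once by (fastforce simp: D_def)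
    qed (use L fP in auto)
    also have "\<dots> \<le> (\<Sum>(p, q)\<in>C i \<times> C i. w p * w q)"
    proof (rule sum_mono2)
      fix x assume "x \<in> C i \<times> C i - (\<Union>l\<in>L - K. ?P l)"
      then have "fst x \<in> S" "snd x \<in> S" using C(1)[OF i] by auto
      then show "0 \<le> (case x of (p, q) \<Rightarrow> w p * w q)" using S(2) by (auto split: prod.split)
    qed (use C(2)[OF i] in \<open>auto simp: D_def\<close>)
    also have "\<dots> = (sum w (C i))\<^sup>2"
      by (simp add: power2_eq_square sum_product sum.cartesian_product)
    also have "\<dots> \<le> (1 / 4 ^ d)\<^sup>2"
      using C[OF i] S(2) by (intro power_mono sum_nonneg) auto
    finally show ?thesis .
  qed
  have "real (card (L - K)) * (\<theta>\<^sup>2 / (8 * 3 ^ d)) = (\<Sum>l\<in>L - K. \<theta>\<^sup>2 / (8 * 3 ^ d))" by simp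
  also have "\<dots> \<le> (\<Sum>l\<in>L - K. \<Sum>i\<in>?I. pr i l)" using low by (intro sum_mono) auto
  also have "\<dots> = (\<Sum>i\<in>?I. \<Sum>l\<in>L - K. pr i l)" by (rule sum.swap)
  also have "\<dots> \<le> (\<Sum>i\<in>?I. (1 / 4 ^ d)\<^sup>2)" using up by (intro sum_mono) auto
  also have "\<dots> = 1 / 4 ^ d" by (simp add: power2_eq_square)
  finally have "real (card (L - K)) * \<theta>\<^sup>2 \<le> 8 * (3 / 4) ^ d"
    by (simp add: field_simps)
  moreover have "real (card L) \<le> real (card (L - K)) + 4 ^ d"
  proof -
    have "card L \<le> card (L - K) + card K" using L(1) K(1)
      by (metis card_Un_le card_mono finite_Diff finite_Un le_trans Un_Diff_cancel2 sup_ge1)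
    moreover have "card K \<le> 4 ^ d" using K(2) by simp
    ultimately have "card L \<le> card (L - K) + 4 ^ d" by simp
    then show ?thesis by (metis of_nat_add of_nat_le_iff of_nat_numeral of_nat_power)
  qed
  then have "real (card L) * \<theta>\<^sup>2 \<le> real (card (L - K)) * \<theta>\<^sup>2 + 4 ^ d * \<theta>\<^sup>2"
    by (metis distrib_right mult_right_mono zero_le_power2)
  ultimately show ?thesis by linarith
qed

lemma sum_geometric_le:
  assumes "0 \<le> (x::real)" "x < 1"
  shows "(\<Sum>s\<le>N. x ^ s) \<le> 1 / (1 - x)"
proof -
  have "(\<Sum>s\<le>N. x ^ s) = (1 - x ^ Suc N) / (1 - x)"
    using assms sum_gp_basic[of x N] by (simp add: field_simps)
  also have "\<dots> \<le> 1 / (1 - x)" using assms by (intro divide_right_mono) auto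
  finally show ?thesis .
qed

text \<open>The core of Beck's theorem: lines that are neither poor nor very rich carry few pairs.
  The lines are sorted by weight into scales \<open>\<delta> / 4 ^ n\<close>, and each scale gets
  its own depth of the cell decomposition. \<open>D\<close> and \<open>\<delta>\<close> are chosen
  so that the two resulting geometric series are at most half of \<open>\<epsilon>\<close>
  each.\<close>

lemma sum_squares_rich_lines:
  assumes "0 < (\<epsilon>::real)"
  shows "\<exists>\<delta>>0. \<exists>C. \<forall>S w \<tau> L. finite S \<longrightarrow> (\<forall>p\<in>S. 0 \<le> w p \<and> w p \<le> \<tau>) \<longrightarrow> sum w S \<le> 1 \<longrightarrow> 0 < \<tau> \<longrightarrow>
     finite L \<longrightarrow> (\<forall>l\<in>L. C * \<tau> < sum w {p \<in> S. on_line l p} \<and> sum w {p \<in> S. on_line l p} \<le> \<delta>) \<longrightarrow>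
     (\<Sum>l\<in>L. (sum w {p \<in> S. on_line l p})\<^sup>2) \<le> \<epsilon>"
proof -
  obtain D where D: "(3/4::real) ^ D < \<epsilon> / 2048"
    using real_arch_pow_inv[of "\<epsilon> / 2048" "3/4"] assms by auto
  define \<delta> where "\<delta> = min 1 (sqrt (\<epsilon> / (64 * 4 ^ D)))"
  define C where "C = 64 * (4::real) ^ D"
  have \<delta>: "\<delta> > 0" "64 * 4 ^ D * \<delta>\<^sup>2 \<le> \<epsilon>"
  proof -
    show "\<delta> > 0" using assms by (simp add: \<delta>_def)
    then have "\<delta>\<^sup>2 \<le> (sqrt (\<epsilon> / (64 * 4 ^ D)))\<^sup>2" by (intro power_mono) (auto simp: \<delta>_def)
    also have "\<dots> = \<epsilon> / (64 * 4 ^ D)" using assms by simp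
    finally show "64 * 4 ^ D * \<delta>\<^sup>2 \<le> \<epsilon>" by (simp add: field_simps)
  qed
  have "(\<Sum>l\<in>L. (sum w {p \<in> S. on_line l p})\<^sup>2) \<le> \<epsilon>"
    if S: "finite S" "\<forall>p\<in>S. 0 \<le> w p \<and> w p \<le> \<tau>" "sum w S \<le> 1" "0 < \<tau>"
      and L: "finite L" "\<forall>l\<in>L. C * \<tau> < sum w {p \<in> S. on_line l p} \<and> sum w {p \<in> S. on_line l p} \<le> \<delta>"
    for S w \<tau> L
  proof -
    define W where "W = (\<lambda>l. sum w {p \<in> S. on_line l p})"
    have W: "C * \<tau> < W l" "W l \<le> \<delta>" if "l \<in> L" for l using L(2) that by (auto simp: W_def)
    have C0: "C * \<tau> > 0" using S(4) by (simp add: C_def)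
    define s where "s = (\<lambda>l. LEAST n. \<delta> / 4 ^ Suc n < W l)"
    have s: "\<delta> / 4 ^ Suc (s l) < W l" "W l \<le> \<delta> / 4 ^ s l" if l: "l \<in> L" for l
    proof -
      have Wl: "W l > 0" using W(1)[OF l] C0 by linarith
      obtain n where n: "(1/4::real) ^ n < W l / \<delta>"
        using real_arch_pow_inv[of "W l / \<delta>" "1/4"] Wl \<delta> by auto
      have "\<delta> / 4 ^ Suc n \<le> \<delta> * (1/4) ^ n" using \<delta> by (simp add: power_divide field_simps)
      also have "\<dots> < W l" using n \<delta> by (simp add: field_simps)
      finally have ex: "\<delta> / 4 ^ Suc n < W l" .
      then show "\<delta> / 4 ^ Suc (s l) < W l" unfolding s_def by (rule LeastI)
      show "W l \<le> \<delta> / 4 ^ s l"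
      proof (cases "s l")
        case 0 then show ?thesis using W(2)[OF l] by simp
      next
        case (Suc m)
        then have "\<not> \<delta> / 4 ^ Suc m < W l" unfolding s_def by (intro not_less_Least) simp
        then show ?thesis using Suc by simp
      qed
    qed
    show ?thesis
    proof (cases "L = {}")
      case True then show ?thesis using assms by simp
    next
      case False
      define N where "N = Max (s ` L)"
      have sN: "s l \<le> N" if "l \<in> L" for l using that L(1) by (simp add: N_def)
      have "N \<in> s ` L" using False L(1) by (simp add: N_def)
      then obtain l0 where l0: "l0 \<in> L" "s l0 = N" by auto
      have NC: "C * \<tau> < \<delta> / 4 ^ N" using W(1)[OF l0(1)] s(2)[OF l0(1)] l0(2) by simp
      define Ls where "Ls = (\<lambda>n. {l \<in> L. s l = n})"
      have cls: "(\<Sum>l\<in>Ls n. (W l)\<^sup>2) \<le> 128 * (3/4) ^ D * ((3/4) ^ n + (3/4) ^ (N - n)) + 4 ^ D * \<delta>\<^sup>2 * (1/4) ^ n * 16"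
        if n: "n \<le> N" for n
      proof -
        define \<theta> where "\<theta> = \<delta> / 4 ^ Suc n"
        \<comment> \<open>The depth may exceed \<open>D\<close> by at most \<open>n\<close>, to keep
          the contribution of the cuts summable, and by at most \<open>N - n\<close>, because
          \<open>rich_lines_bound\<close> needs single points to be light compared with the scale
          \<open>\<theta>\<close>. The gain then decays geometrically away from both ends of the
          range of scales.\<close>
        define d where "d = D + min n (N - n)"
        have pw: "(4::real) ^ d \<le> 4 ^ D * 4 ^ (N - n)" "(4::real) ^ d \<le> 4 ^ D * 4 ^ n"
          by (auto simp: d_def power_add intro: power_increasing)
        have "16 * 4 ^ d * \<tau> \<le> 16 * (4 ^ D * 4 ^ (N - n)) * \<tau>"
          using pw(1) S(4) by (intro mult_right_mono mult_left_mono) auto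
        also have "\<dots> = C * \<tau> * 4 ^ (N - n) / 4" by (simp add: C_def)
        also have "\<dots> \<le> \<delta> / 4 ^ N * 4 ^ (N - n) / 4"
          using NC by (intro divide_right_mono mult_right_mono) auto
        also have "\<dots> = \<theta>" using n by (simp add: \<theta>_def power_diff)
        finally have "16 * 4 ^ d * \<tau> \<le> \<theta>" .
        then have "real (card (Ls n)) * \<theta>\<^sup>2 \<le> 8 * (3/4) ^ d + 4 ^ d * \<theta>\<^sup>2"
          using S L(1) s(1) by (intro rich_lines_bound[of S w \<tau>]) (auto simp: Ls_def \<theta>_def W_def less_imp_le)
        moreover have "(3/4::real) ^ d \<le> (3/4) ^ D * ((3/4) ^ n + (3/4) ^ (N - n))"
          by (auto simp: d_def power_add min_def)
        moreover have "4 ^ d * \<theta>\<^sup>2 \<le> 4 ^ D * \<delta>\<^sup>2 * (1/4) ^ n"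
        proof -
          have "4 ^ d * \<theta>\<^sup>2 \<le> 4 ^ D * 4 ^ n * \<theta>\<^sup>2" using pw(2) by (intro mult_right_mono) auto
          also have "\<theta>\<^sup>2 \<le> \<delta>\<^sup>2 * ((1/4) ^ n)\<^sup>2"
            unfolding \<theta>_def by (simp add: power_divide power_mult_distrib field_simps)
          finally have "4 ^ d * \<theta>\<^sup>2 \<le> 4 ^ D * 4 ^ n * (\<delta>\<^sup>2 * ((1/4) ^ n)\<^sup>2)" by simp
          also have "\<dots> = 4 ^ D * \<delta>\<^sup>2 * (1/4) ^ n" by (simp add: power2_eq_square power_divide)
          finally show ?thesis .
        qed
        moreover have "(\<Sum>l\<in>Ls n. (W l)\<^sup>2) \<le> 16 * (real (card (Ls n)) * \<theta>\<^sup>2)"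
        proof -
          have "(\<Sum>l\<in>Ls n. (W l)\<^sup>2) \<le> (\<Sum>l\<in>Ls n. 16 * \<theta>\<^sup>2)"
          proof (rule sum_mono)
            fix l assume l: "l \<in> Ls n"
            then have "W l \<le> 4 * \<theta>" using s(2)[of l] by (simp add: Ls_def \<theta>_def)
            moreover have "0 \<le> W l" using l W(1)[of l] C0 by (simp add: Ls_def)
            ultimately have "(W l)\<^sup>2 \<le> (4 * \<theta>)\<^sup>2" by (intro power_mono)
            then show "(W l)\<^sup>2 \<le> 16 * \<theta>\<^sup>2" by (simp add: power_mult_distrib)
          qed
          then show ?thesis by simp
        qed
        ultimately show ?thesis by (simp add: algebra_simps)
      qed
      have "(\<Sum>l\<in>L. (W l)\<^sup>2) = (\<Sum>n\<le>N. \<Sum>l\<in>Ls n. (W l)\<^sup>2)"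
        unfolding Ls_def using L(1) sN by (intro sum.group[symmetric]) auto
      also have "\<dots> \<le> (\<Sum>n\<le>N. 128 * (3/4) ^ D * ((3/4) ^ n + (3/4) ^ (N - n)) + 4 ^ D * \<delta>\<^sup>2 * (1/4) ^ n * 16)"
        using cls by (intro sum_mono) auto
      also have "\<dots> = 128 * (3/4) ^ D * ((\<Sum>n\<le>N. (3/4) ^ n) + (\<Sum>n\<le>N. (3/4) ^ (N - n))) + 4 ^ D * \<delta>\<^sup>2 * 16 * (\<Sum>n\<le>N. (1/4) ^ n)"
        by (simp add: sum.distrib sum_distrib_left algebra_simps)
      also have "(\<Sum>n\<le>N. (3/4::real) ^ (N - n)) = (\<Sum>n\<le>N. (3/4) ^ n)"
        by (rule sum.reindex_bij_witness[of _ "\<lambda>n. N - n" "\<lambda>n. N - n"]) auto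
      also have "128 * (3/4) ^ D * ((\<Sum>n\<le>N. (3/4) ^ n) + (\<Sum>n\<le>N. (3/4) ^ n)) + 4 ^ D * \<delta>\<^sup>2 * 16 * (\<Sum>n\<le>N. (1/4) ^ n)
         \<le> 128 * (3/4) ^ D * (4 + 4) + 4 ^ D * \<delta>\<^sup>2 * 16 * 2"
        using sum_geometric_le[of "3/4" N] sum_geometric_le[of "1/4" N] by (intro add_mono mult_left_mono) auto
      also have "\<dots> \<le> \<epsilon>" using D \<delta>(2) by simp
      finally show ?thesis by (simp add: W_def)
    qed
  qed
  then show ?thesis using \<delta>(1) by blast
qed

subsection \<open>Weighted Beck theorem for vector configurations\<close>

lemma span_insert_swap:
  fixes G :: "'v::real_vector set"
  assumes "y \<in> span (insert x G)" "y \<notin> span G"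
  shows "span (insert y G) = span (insert x G)"
proof -
  have "x \<in> span (insert y G)" using assms in_span_insert by blast
  then show ?thesis using assms(1)
    by (intro subset_antisym span_minimal) (auto intro: span_base span_mono[THEN subsetD])
qed

text \<open>A generic linear map \<open>(g, f, h)\<close> to three-dimensional space followed by the
  affine chart \<open>h = 1\<close>. Genericity means that \<open>h\<close> vanishes on none of the
  vectors, that \<open>g / h\<close> separates non-parallel ones, and that a dependent triple of
  images comes from a dependent triple of vectors.\<close>

lemma plane_coordinates:
  fixes \<psi> :: "'a \<Rightarrow> 'v::real_vector"
  assumes fin: "finite E" and nz: "\<And>x. x \<in> E \<Longrightarrow> \<psi> x \<noteq> 0"
  shows "\<exists>P :: 'a \<Rightarrow> real \<times> real.
     (\<forall>x\<in>E. \<forall>y\<in>E. \<psi> y \<in> span {\<psi> x} \<longleftrightarrow> P y = P x) \<and>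
     (\<forall>x\<in>E. \<forall>y\<in>E. P x \<noteq> P y \<longrightarrow> (\<exists>l. \<forall>z\<in>E. on_line l (P z) \<longleftrightarrow> \<psi> z \<in> span {\<psi> x, \<psi> y}))"
proof -
  obtain h :: "'v \<Rightarrow> real" where h: "linear h" "\<forall>v\<in>\<psi> ` E. h v \<noteq> 0"
    using exists_nonzero_functional[of "\<psi> ` E"] fin nz by (metis finite_imageI imageE)
  let ?N2 = "(\<lambda>(x, y). h (\<psi> y) *\<^sub>R \<psi> x - h (\<psi> x) *\<^sub>R \<psi> y) ` (E \<times> E)"
  obtain g :: "'v \<Rightarrow> real" where g: "linear g" "\<forall>v\<in>?N2 - {0}. g v \<noteq> 0"
    using exists_nonzero_functional[of "?N2 - {0}"] fin by auto
  \<comment> \<open>The combination whose coefficients are the minors of the rows \<open>g\<close>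
    and \<open>h\<close>: both functionals vanish on it, and \<open>f\<close> of it is the
    determinant of the three images. Choosing \<open>f\<close> nonzero on all nonzero combinations
    of this kind makes collinear images imply \<open>?v x y z = 0\<close>, a genuine
    dependence.\<close>
  let ?v = "\<lambda>x y z. (g (\<psi> y) * h (\<psi> z) - g (\<psi> z) * h (\<psi> y)) *\<^sub>R \<psi> x + (g (\<psi> z) * h (\<psi> x) - g (\<psi> x) * h (\<psi> z)) *\<^sub>R \<psi> y
     + (g (\<psi> x) * h (\<psi> y) - g (\<psi> y) * h (\<psi> x)) *\<^sub>R \<psi> z"
  let ?N3 = "(\<lambda>(x, y, z). ?v x y z) ` (E \<times> E \<times> E)"
  obtain f :: "'v \<Rightarrow> real" where f: "linear f" "\<forall>v\<in>?N3 - {0}. f v \<noteq> 0"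
    using exists_nonzero_functional[of "?N3 - {0}"] fin by auto
  define P where "P = (\<lambda>x. (g (\<psi> x) / h (\<psi> x), f (\<psi> x) / h (\<psi> x)))"
  have hn: "h (\<psi> x) \<noteq> 0" if "x \<in> E" for x using h(2) that by auto
  have par: "\<psi> y \<in> span {\<psi> x}" if "x \<in> E" "y \<in> E" "fst (P x) = fst (P y)" for x y
  proof -
    let ?u = "h (\<psi> y) *\<^sub>R \<psi> x - h (\<psi> x) *\<^sub>R \<psi> y"
    have "g ?u = 0" using that hn[of x] hn[of y] by (simp add: P_def linear_diff[OF g(1)] linear_scale[OF g(1)] field_simps)
    then have "?u = 0" using g(2) that by force
    then have "h (\<psi> x) *\<^sub>R \<psi> y = h (\<psi> y) *\<^sub>R \<psi> x" by simp
    then have "inverse (h (\<psi> x)) *\<^sub>R h (\<psi> x) *\<^sub>R \<psi> y = inverse (h (\<psi> x)) *\<^sub>R h (\<psi> y) *\<^sub>R \<psi> x" by simp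
    then have "\<psi> y = (inverse (h (\<psi> x)) * h (\<psi> y)) *\<^sub>R \<psi> x" using hn[OF that(1)] by simp
    then show ?thesis by (metis span_base span_scale singletonI)
  qed
  have par2: "P y = P x" if xy: "x \<in> E" "y \<in> E" "\<psi> y \<in> span {\<psi> x}" for x y
  proof -
    obtain c where c: "\<psi> y = c *\<^sub>R \<psi> x" using xy(3) by (auto simp: span_singleton)
    then have "c \<noteq> 0" using nz[OF xy(2)] by auto
    then show ?thesis using c by (simp add: P_def linear_scale[OF g(1)] linear_scale[OF f(1)] linear_scale[OF h(1)])
  qed
  have line: "\<exists>l. \<forall>z\<in>E. on_line l (P z) \<longleftrightarrow> \<psi> z \<in> span {\<psi> x, \<psi> y}"
    if x: "x \<in> E" and y: "y \<in> E" and xy: "P x \<noteq> P y" for x y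
  proof -
    have d: "fst (P x) \<noteq> fst (P y)" using par[OF x y] par2[OF x y] xy by auto
    define m where "m = (snd (P y) - snd (P x)) / (fst (P y) - fst (P x))"
    define k where "k = snd (P x) - m * fst (P x)"
    define F where "F = (\<lambda>v. f v - m * g v - k * h v)"
    have F: "F (u + v) = F u + F v" "F (c *\<^sub>R u) = c * F u" for u v c
      by (auto simp: F_def linear_add[OF f(1)] linear_add[OF g(1)] linear_add[OF h(1)]
          linear_scale[OF f(1)] linear_scale[OF g(1)] linear_scale[OF h(1)] algebra_simps)
    have on: "on_line (m, k) (P z) \<longleftrightarrow> F (\<psi> z) = 0" if "z \<in> E" for z
      using hn[OF that] by (auto simp: on_line_def P_def F_def field_simps)
    have "on_line (m, k) (P x)" by (simp add: on_line_def k_def)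
    then have Fx: "F (\<psi> x) = 0" using on x by simp
    have "m * (fst (P y) - fst (P x)) = snd (P y) - snd (P x)" using d by (simp add: m_def)
    then have "on_line (m, k) (P y)" by (simp add: on_line_def k_def algebra_simps)
    then have Fy: "F (\<psi> y) = 0" using on y by simp
    have "F (\<psi> z) = 0 \<longleftrightarrow> \<psi> z \<in> span {\<psi> x, \<psi> y}" if z: "z \<in> E" for z
    proof
      assume "\<psi> z \<in> span {\<psi> x, \<psi> y}"
      then obtain a where "\<psi> z - a *\<^sub>R \<psi> x \<in> span {\<psi> y}" by (auto simp: span_breakdown_eq)
      then obtain b where "\<psi> z - a *\<^sub>R \<psi> x = b *\<^sub>R \<psi> y" by (auto simp: span_singleton)
      then have "\<psi> z = a *\<^sub>R \<psi> x + b *\<^sub>R \<psi> y" by (simp add: algebra_simps)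
      then show "F (\<psi> z) = 0" using F Fx Fy by simp
    next
      assume Fz: "F (\<psi> z) = 0"
      let ?w = "?v x y z"
      have "F ?w = 0" using F Fx Fy Fz by simp
      moreover have "g ?w = 0" "h ?w = 0"
        unfolding linear_add[OF g(1)] linear_add[OF h(1)] linear_scale[OF g(1)] linear_scale[OF h(1)] real_scaleR_def
        by (simp_all add: algebra_simps)
      ultimately have "f ?w = 0" by (simp add: F_def)
      moreover have "?w \<in> ?N3" using x y z by force
      ultimately have w0: "?w = 0" using f(2) by blast
      define \<gamma> where "\<gamma> = g (\<psi> x) * h (\<psi> y) - g (\<psi> y) * h (\<psi> x)"
      have g0: "\<gamma> \<noteq> 0" using d hn[OF x] hn[OF y] by (auto simp: \<gamma>_def P_def field_simps)
      define u where "u = (g (\<psi> y) * h (\<psi> z) - g (\<psi> z) * h (\<psi> y)) *\<^sub>R \<psi> x + (g (\<psi> z) * h (\<psi> x) - g (\<psi> x) * h (\<psi> z)) *\<^sub>R \<psi> y"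
      have "u + \<gamma> *\<^sub>R \<psi> z = 0" using w0 unfolding u_def \<gamma>_def .
      then have "\<gamma> *\<^sub>R \<psi> z = - u" by (simp add: eq_neg_iff_add_eq_0 add.commute)
      moreover have "- u \<in> span {\<psi> x, \<psi> y}" unfolding u_def
        by (intro span_neg span_add span_scale span_base) auto
      ultimately have "\<gamma> *\<^sub>R \<psi> z \<in> span {\<psi> x, \<psi> y}" by simp
      then have "inverse \<gamma> *\<^sub>R \<gamma> *\<^sub>R \<psi> z \<in> span {\<psi> x, \<psi> y}" by (rule span_scale)
      then show "\<psi> z \<in> span {\<psi> x, \<psi> y}" using g0 by simp
    qed
    then show ?thesis using on by blast
  qed
  have "\<forall>x\<in>E. \<forall>y\<in>E. \<psi> y \<in> span {\<psi> x} \<longleftrightarrow> P y = P x" using par par2 by metis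
  then show ?thesis using line by blast
qed

text \<open>After contraction of \<open>G\<close> the elements fall into parallel classes; each
  class becomes one planar point with the total weight of the class. The constants depend on
  \<open>\<epsilon>\<close> alone, not on \<open>G\<close> or on the rank.\<close>

lemma weighted_beck:
  assumes "0 < (\<epsilon>::real)"
  shows "\<exists>\<delta>>0. \<exists>C. \<forall>(\<phi> :: 'a \<Rightarrow> 'v::real_vector) E G w \<tau>.
     finite E \<longrightarrow> (\<forall>x\<in>E. 0 \<le> w x) \<longrightarrow> sum w E \<le> 1 \<longrightarrow> 0 < \<tau> \<longrightarrow>
     (\<forall>x\<in>E. \<phi> x \<notin> span G \<longrightarrow> sum w {y\<in>E. \<phi> y \<notin> span G \<and> \<phi> y \<in> span (insert (\<phi> x) G)} \<le> \<tau>) \<longrightarrow>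
     (\<Sum>(x, y) | (x, y) \<in> E \<times> E \<and> \<phi> x \<notin> span G \<and> \<phi> y \<notin> span (insert (\<phi> x) G) \<and>
        C * \<tau> < sum w {z\<in>E. \<phi> z \<notin> span G \<and> \<phi> z \<in> span (insert (\<phi> x) (insert (\<phi> y) G))} \<and>
        sum w {z\<in>E. \<phi> z \<notin> span G \<and> \<phi> z \<in> span (insert (\<phi> x) (insert (\<phi> y) G))} \<le> \<delta>. w x * w y) \<le> \<epsilon>"
proof -
  from sum_squares_rich_lines[OF assms] obtain \<delta> C where \<delta>: "\<delta> > 0" and
    rich: "\<And>S w \<tau> L. finite S \<Longrightarrow> (\<forall>p\<in>S. 0 \<le> w p \<and> w p \<le> \<tau>) \<Longrightarrow> sum w S \<le> 1 \<Longrightarrow> 0 < \<tau> \<Longrightarrow>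
     finite L \<Longrightarrow> (\<forall>l\<in>L. C * \<tau> < sum w {p \<in> S. on_line l p} \<and> sum w {p \<in> S. on_line l p} \<le> \<delta>) \<Longrightarrow>
     (\<Sum>l\<in>L. (sum w {p \<in> S. on_line l p})\<^sup>2) \<le> \<epsilon>" by blast
  have main: "(\<Sum>(x, y) | (x, y) \<in> E \<times> E \<and> \<phi> x \<notin> span G \<and> \<phi> y \<notin> span (insert (\<phi> x) G) \<and>
        C * \<tau> < sum w {z\<in>E. \<phi> z \<notin> span G \<and> \<phi> z \<in> span (insert (\<phi> x) (insert (\<phi> y) G))} \<and>
        sum w {z\<in>E. \<phi> z \<notin> span G \<and> \<phi> z \<in> span (insert (\<phi> x) (insert (\<phi> y) G))} \<le> \<delta>. w x * w y) \<le> \<epsilon>"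
    if E: "finite E" and w: "\<And>x. x \<in> E \<Longrightarrow> 0 \<le> w x" and w1: "sum w E \<le> 1" and \<tau>: "0 < \<tau>"
      and cls: "\<And>x. x \<in> E \<Longrightarrow> \<phi> x \<notin> span G \<Longrightarrow> sum w {y\<in>E. \<phi> y \<notin> span G \<and> \<phi> y \<in> span (insert (\<phi> x) G)} \<le> \<tau>"
    for \<phi> :: "'a \<Rightarrow> 'v" and E G w \<tau>
  proof -
    obtain p :: "'v \<Rightarrow> 'v" where p: "linear p" "\<And>x. p x = 0 \<longleftrightarrow> x \<in> span G" using exists_projection by blast
    define E' where "E' = {x\<in>E. \<phi> x \<notin> span G}"
    have fE': "finite E'" using E by (simp add: E'_def)
    define \<psi> where "\<psi> = (\<lambda>x. p (\<phi> x))"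
    have nz: "\<psi> x \<noteq> 0" if "x \<in> E'" for x using that p by (simp add: E'_def \<psi>_def)
    have sp1: "\<psi> y \<in> span {\<psi> x} \<longleftrightarrow> \<phi> y \<in> span (insert (\<phi> x) G)" for x y
      using projection_in_span_iff[OF p, of "\<phi> y" "{\<phi> x}"] by (simp add: \<psi>_def)
    have sp2: "\<psi> z \<in> span {\<psi> x, \<psi> y} \<longleftrightarrow> \<phi> z \<in> span (insert (\<phi> x) (insert (\<phi> y) G))" for x y z
      using projection_in_span_iff[OF p, of "\<phi> z" "{\<phi> x, \<phi> y}"] by (simp add: \<psi>_def)
    obtain P :: "'a \<Rightarrow> real \<times> real" where
      P1: "\<And>x y. x \<in> E' \<Longrightarrow> y \<in> E' \<Longrightarrow> \<psi> y \<in> span {\<psi> x} \<longleftrightarrow> P y = P x" and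
      P2: "\<And>x y. x \<in> E' \<Longrightarrow> y \<in> E' \<Longrightarrow> P x \<noteq> P y \<Longrightarrow> (\<exists>l. \<forall>z\<in>E'. on_line l (P z) \<longleftrightarrow> \<psi> z \<in> span {\<psi> x, \<psi> y})"
      using plane_coordinates[of E' \<psi>, OF fE'] nz by blast
    \<comment> \<open>The weight of a planar point collects its whole parallel class, so the bound
      on classes becomes the bound \<open>\<tau>\<close> on single points.\<close>
    define W where "W = (\<lambda>q. sum w {x\<in>E'. P x = q})"
    define S where "S = P ` E'"
    have WS: "sum W {q\<in>S. R q} = sum w {x\<in>E'. R (P x)}" for R
    proof -
      have "sum w {x\<in>E'. R (P x)} = (\<Sum>q\<in>P ` {x\<in>E'. R (P x)}. sum w {x\<in>{x\<in>E'. R (P x)}. P x = q})"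
        using fE' by (intro sum.image_gen) auto
      also have "P ` {x\<in>E'. R (P x)} = {q\<in>S. R q}" by (auto simp: S_def)
      also have "(\<Sum>q\<in>{q\<in>S. R q}. sum w {x\<in>{x\<in>E'. R (P x)}. P x = q}) = (\<Sum>q\<in>{q\<in>S. R q}. W q)"
        by (intro sum.cong) (auto simp: W_def intro!: arg_cong[of _ _ "sum w"])
      finally show ?thesis by simp
    qed
    have w': "0 \<le> w x" if "x \<in> E'" for x using that w by (simp add: E'_def)
    let ?lw = "\<lambda>x y. sum w {z\<in>E. \<phi> z \<notin> span G \<and> \<phi> z \<in> span (insert (\<phi> x) (insert (\<phi> y) G))}"
    define B where "B = {(x, y). (x, y) \<in> E \<times> E \<and> \<phi> x \<notin> span G \<and> \<phi> y \<notin> span (insert (\<phi> x) G) \<and>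
        C * \<tau> < ?lw x y \<and> ?lw x y \<le> \<delta>}"
    have B': "x \<in> E'" "y \<in> E'" "P x \<noteq> P y" "C * \<tau> < ?lw x y" "?lw x y \<le> \<delta>" if "(x, y) \<in> B" for x y
    proof -
      show xy: "x \<in> E'" "y \<in> E'" "C * \<tau> < ?lw x y" "?lw x y \<le> \<delta>"
        using that by (auto simp: B_def E'_def intro: span_mono[THEN subsetD, of G])
      show "P x \<noteq> P y" using that sp1[of y x] P1[OF xy(1,2)] by (auto simp: B_def)
    qed
    have "\<forall>b. \<exists>l. b \<in> B \<longrightarrow> (\<forall>z\<in>E'. on_line l (P z) \<longleftrightarrow> \<psi> z \<in> span {\<psi> (fst b), \<psi> (snd b)})"
      using B'(1-3) P2 by (metis prod.collapse)
    then obtain ln where ln: "\<And>b z. b \<in> B \<Longrightarrow> z \<in> E' \<Longrightarrow> on_line (ln b) (P z) \<longleftrightarrow> \<psi> z \<in> span {\<psi> (fst b), \<psi> (snd b)}"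
      by metis
    have fB: "finite B" by (rule finite_subset[of _ "E \<times> E"]) (use E in \<open>auto simp: B_def\<close>)
    define Z where "Z = (\<lambda>l. {z\<in>E'. on_line l (P z)})"
    have Zl: "sum w (Z (ln (x, y))) = ?lw x y" if "(x, y) \<in> B" for x y
    proof -
      have "Z (ln (x, y)) = {z\<in>E. \<phi> z \<notin> span G \<and> \<phi> z \<in> span (insert (\<phi> x) (insert (\<phi> y) G))}"
        using ln[OF that] sp2 by (auto simp: Z_def E'_def)
      then show ?thesis by simp
    qed
    have ZW: "sum W {q\<in>S. on_line l q} = sum w (Z l)" for l using WS[of "on_line l"] by (simp add: Z_def)
    have "(\<Sum>l\<in>ln ` B. (sum W {q \<in> S. on_line l q})\<^sup>2) \<le> \<epsilon>"
    proof (rule rich[where \<tau>=\<tau>])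
      show "finite S" using fE' by (simp add: S_def)
      show "\<forall>q\<in>S. 0 \<le> W q \<and> W q \<le> \<tau>"
      proof
        fix q assume "q \<in> S"
        then obtain x where x: "x \<in> E'" "q = P x" by (auto simp: S_def)
        have "0 \<le> W q" using w' by (auto simp: W_def intro!: sum_nonneg)
        moreover have "{y\<in>E'. P y = q} = {y\<in>E. \<phi> y \<notin> span G \<and> \<phi> y \<in> span (insert (\<phi> x) G)}"
          using P1[OF x(1)] sp1[of _ x] x(2) by (auto simp: E'_def)
        then have "W q \<le> \<tau>" using cls[of x] x(1) by (simp add: W_def E'_def)
        ultimately show "0 \<le> W q \<and> W q \<le> \<tau>" by simp
      qed
      have "sum W S = sum w E'" using WS[of "\<lambda>_. True"] by simp
      also have "\<dots> \<le> sum w E" using E w by (intro sum_mono2) (auto simp: E'_def)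
      finally show "sum W S \<le> 1" using w1 by simp
      show "\<forall>l\<in>ln ` B. C * \<tau> < sum W {p \<in> S. on_line l p} \<and> sum W {p \<in> S. on_line l p} \<le> \<delta>"
        using ZW Zl B'(4,5) by auto
    qed (use \<tau> fB in auto)
    then have le: "(\<Sum>l\<in>ln ` B. (sum w (Z l))\<^sup>2) \<le> \<epsilon>" by (simp add: ZW)
    have "(\<Sum>(x, y)\<in>B. w x * w y) \<le> (\<Sum>(x, y)\<in>(\<Union>l\<in>ln ` B. Z l \<times> Z l). w x * w y)"
    proof (rule sum_mono2)
      show "finite (\<Union>l\<in>ln ` B. Z l \<times> Z l)" using fB fE' by (auto simp: Z_def)
      show "B \<subseteq> (\<Union>l\<in>ln ` B. Z l \<times> Z l)"
      proof
        fix b assume b: "b \<in> B"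
        obtain x y where xy: "b = (x, y)" by force
        have "x \<in> Z (ln b)" "y \<in> Z (ln b)" using ln[OF b] B'(1,2) b xy by (auto simp: Z_def intro: span_base)
        then show "b \<in> (\<Union>l\<in>ln ` B. Z l \<times> Z l)" using b xy by blast
      qed
      show "0 \<le> (case b of (x, y) \<Rightarrow> w x * w y)" if "b \<in> (\<Union>l\<in>ln ` B. Z l \<times> Z l) - B" for b
        using that w' by (auto simp: Z_def split: prod.split)
    qed
    also have "\<dots> \<le> (\<Sum>l\<in>ln ` B. \<Sum>(x, y)\<in>Z l \<times> Z l. w x * w y)"
      using fB fE' w' by (intro sum_UN_le) (auto simp: Z_def)
    also have "\<dots> = (\<Sum>l\<in>ln ` B. (sum w (Z l))\<^sup>2)"
      by (simp add: power2_eq_square sum_product sum.cartesian_product)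
    finally show ?thesis using le by (simp add: B_def)
  qed
  show ?thesis
    by (intro exI[of _ \<delta>] conjI exI[of _ C] allI impI) (rule \<delta>, rule main, simp_all)
qed

subsection \<open>Lines spanned by two random points\<close>

definition line_mass :: "('a \<Rightarrow> 'v::real_vector) \<Rightarrow> 'a set \<Rightarrow> 'v set \<Rightarrow> ('a \<Rightarrow> real) \<Rightarrow> 'a \<Rightarrow> 'a \<Rightarrow> real" where
  "line_mass f E G w x y = sum w {z\<in>E. f z \<notin> span G \<and> f z \<in> span (insert (f x) (insert (f y) G))}"

text \<open>The total may be less than 1 because the induction on slots later discards the elements
  of heavy parallel classes by setting their weight to 0.\<close>

definition spread_weight :: "('a \<Rightarrow> 'v::real_vector) \<Rightarrow> 'a set \<Rightarrow> 'v set \<Rightarrow> real \<Rightarrow> ('a \<Rightarrow> real) \<Rightarrow> bool" where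
  "spread_weight f E G \<kappa> w \<longleftrightarrow> (\<forall>x\<in>E. 0 \<le> w x) \<and> sum w E \<le> 1 \<and>
     (\<forall>x\<in>E. f x \<notin> span G \<longrightarrow> sum w {y\<in>E. f y \<notin> span G \<and> f y \<in> span (insert (f x) G)} \<le> \<kappa>)"

text \<open>The slot \<open>A\<close> is kept apart from the weight: discarding weight preserves
  this property, while the ranks of the slots must not change.\<close>

definition nonheavy :: "('a \<Rightarrow> 'v::real_vector) \<Rightarrow> 'a set \<Rightarrow> real \<Rightarrow> 'a set \<Rightarrow> ('a \<Rightarrow> real) \<Rightarrow> bool" where
  "nonheavy f E \<eta> A w \<longleftrightarrow> (\<forall>Q. finite Q \<longrightarrow> f ` A \<subseteq> span Q \<or> sum w {x\<in>E. f x \<in> span Q} \<le> \<eta>)"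

lemma sum_of_bool_filter:
  fixes w :: "'a \<Rightarrow> real"
  assumes "finite E"
  shows "(\<Sum>x\<in>E. w x * of_bool (R x)) = sum w {x\<in>E. R x}"
proof -
  have "sum w {x\<in>E. R x} = (\<Sum>x\<in>E. if R x then w x else 0)" using assms by (rule sum.inter_filter)
  also have "\<dots> = (\<Sum>x\<in>E. w x * of_bool (R x))" by (rule sum.cong) auto
  finally show ?thesis by simp
qed

lemma pair_sum_left:
  fixes a b :: "'a \<Rightarrow> real"
  assumes "finite E" "\<And>x. x \<in> E \<Longrightarrow> 0 \<le> a x" "\<And>x. x \<in> E \<Longrightarrow> 0 \<le> b x" "sum b E \<le> 1"
    and "sum a {x\<in>E. R x} \<le> c"
  shows "(\<Sum>x\<in>E. \<Sum>y\<in>E. a x * b y * of_bool (R x)) \<le> c"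
proof -
  have "(\<Sum>x\<in>E. \<Sum>y\<in>E. a x * b y * of_bool (R x)) = (\<Sum>x\<in>E. a x * of_bool (R x) * sum b E)"
    unfolding sum_distrib_left by (intro sum.cong refl) (simp add: mult_ac)
  also have "\<dots> \<le> (\<Sum>x\<in>E. a x * of_bool (R x) * 1)" using assms by (intro sum_mono mult_left_mono) auto
  also have "\<dots> \<le> c" using sum_of_bool_filter[OF assms(1), of a R] assms(5) by simp
  finally show ?thesis .
qed

lemma pair_sum_right:
  fixes a b :: "'a \<Rightarrow> real"
  assumes "finite E" "\<And>x. x \<in> E \<Longrightarrow> 0 \<le> a x" "sum a E \<le> 1" "0 \<le> c"
    and "\<And>x. x \<in> E \<Longrightarrow> sum b {y\<in>E. R x y} \<le> c"
  shows "(\<Sum>x\<in>E. \<Sum>y\<in>E. a x * b y * of_bool (R x y)) \<le> c"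
proof -
  have "(\<Sum>x\<in>E. \<Sum>y\<in>E. a x * b y * of_bool (R x y)) = (\<Sum>x\<in>E. a x * (\<Sum>y\<in>E. b y * of_bool (R x y)))"
    unfolding sum_distrib_left by (intro sum.cong refl) (simp add: mult_ac)
  also have "\<dots> \<le> (\<Sum>x\<in>E. a x * c)"
    using assms by (intro sum_mono mult_left_mono) (auto simp: sum_of_bool_filter[OF assms(1)])
  also have "\<dots> = sum a E * c" by (simp add: sum_distrib_right)
  also have "\<dots> \<le> 1 * c" using assms by (intro mult_right_mono) auto
  finally show ?thesis by simp
qed

text \<open>The lines through \<open>x\<close> are disjoint off the class of \<open>x\<close>, which
  has weight at most \<open>\<delta> / 2\<close>; so fewer than a constant number of them,
  \<open>2 / \<delta>\<close>, can be heavy. Each has rank two over \<open>G\<close> and cannot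
  contain \<open>B\<close>, by the hypothesis on \<open>x\<close>, so it receives at most
  \<open>\<eta>\<close> of the weight \<open>b\<close>.\<close>

lemma heavy_lines_through_point:
  fixes f :: "'a \<Rightarrow> 'v::real_vector"
  assumes E: "finite E" and G: "finite G" and \<delta>: "0 < \<delta>" "\<kappa> \<le> \<delta> / 2" and \<eta>: "0 \<le> \<eta>"
    and w: "spread_weight f E G \<kappa> w" and b: "spread_weight f E G \<kappa>' b" "nonheavy f E \<eta> B b"
    and B: "dim G + 2 \<le> dim (G \<union> f ` B)" "B \<subseteq> E"
    and x: "x \<in> E" "f x \<notin> span G" "\<not> (dim (G \<union> f ` B) = dim G + 2 \<and> f x \<in> span (G \<union> f ` B))"
  shows "sum b {y\<in>E. f y \<notin> span (insert (f x) G) \<and> \<delta> < line_mass f E G w x y} \<le> 2 / \<delta> * \<eta>"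
proof -
  define Y where "Y = {y\<in>E. f y \<notin> span (insert (f x) G) \<and> \<delta> < line_mass f E G w x y}"
  define D where "D = (\<lambda>y. {z\<in>E. f z \<notin> span (insert (f x) G) \<and> f z \<in> span (insert (f y) (insert (f x) G))})"
  have fY: "finite Y" "Y \<subseteq> E" using E by (auto simp: Y_def)
  have fD: "finite (D y)" "D y \<subseteq> E" for y using E by (auto simp: D_def)
  note xG = x(2)
  have w0: "\<And>x. x \<in> E \<Longrightarrow> 0 \<le> w x" "sum w E \<le> 1" and b0: "\<And>x. x \<in> E \<Longrightarrow> 0 \<le> b x"
    using w b(1) by (auto simp: spread_weight_def)
  have wD: "\<delta> / 2 \<le> sum w (D y)" if y: "y \<in> Y" for y
  proof -
    let ?c = "{z\<in>E. f z \<notin> span G \<and> f z \<in> span (insert (f x) G)}"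
    have "\<delta> < line_mass f E G w x y" using y by (simp add: Y_def)
    also have "\<dots> \<le> sum w (D y \<union> ?c)" unfolding line_mass_def
      using E w0 by (intro sum_mono2) (auto simp: D_def insert_commute)
    also have "\<dots> \<le> sum w (D y) + sum w ?c"
      by (rule sum_Un_le_add) (use E fD w0 in auto)
    also have "sum w ?c \<le> \<kappa>" using w x(1) xG by (simp add: spread_weight_def)
    finally show ?thesis using \<delta> by linarith
  qed
  have disj: "D y = D y'" if "z \<in> D y" "z \<in> D y'" for y y' z
    using that span_insert_swap[of "f z" "f y" "insert (f x) G"] span_insert_swap[of "f z" "f y'" "insert (f x) G"]
    by (simp add: D_def)
  have bD: "sum b (D y) \<le> \<eta>" if y: "y \<in> Y" for y
  proof -
    let ?Q = "insert (f y) (insert (f x) G)"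
    have "\<not> f ` B \<subseteq> span ?Q"
    proof
      assume "f ` B \<subseteq> span ?Q"
      then have sub: "G \<union> f ` B \<subseteq> span ?Q" by (auto intro: span_base)
      have "dim ?Q \<le> dim G + 2" using G by (simp add: dim_insert_finite)
      then have "span (G \<union> f ` B) = span ?Q"
        using sub B G E by (intro span_eq_of_dim_ge) (auto intro: finite_subset)
      moreover then have "dim (G \<union> f ` B) = dim ?Q" by (rule span_eq_dim)
      ultimately show False using x(3) B(1) \<open>dim ?Q \<le> dim G + 2\<close> by (auto intro: span_base)
    qed
    then have "sum b {z\<in>E. f z \<in> span ?Q} \<le> \<eta>"
      using b(2)[unfolded nonheavy_def, rule_format, of ?Q] G by blast
    moreover have "sum b (D y) \<le> sum b {z\<in>E. f z \<in> span ?Q}"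
      using E b0 by (intro sum_mono2) (auto simp: D_def)
    ultimately show ?thesis by linarith
  qed
  have fDY: "finite (D ` Y)" using fY by simp
  have "real (card (D ` Y)) * (\<delta> / 2) = (\<Sum>L\<in>D ` Y. \<delta> / 2)" by simp
  also have "\<dots> \<le> (\<Sum>L\<in>D ` Y. sum w L)" using wD by (intro sum_mono) auto
  also have "\<dots> = sum w (\<Union>(D ` Y))"
  proof -
    have "sum w (\<Union>(D ` Y)) = (sum \<circ> sum) w (D ` Y)"
      by (rule sum.Union_disjoint) (use fD(1) disj in blast)+
    then show ?thesis by simp
  qed
  also have "\<dots> \<le> sum w E" using E fD(2) w0 by (intro sum_mono2) auto
  finally have card: "real (card (D ` Y)) \<le> 2 / \<delta>" using w0(2) \<delta> by (simp add: field_simps)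
  have "sum b Y \<le> sum b (\<Union>L\<in>D ` Y. L)"
  proof (rule sum_mono2)
    show "Y \<subseteq> (\<Union>L\<in>D ` Y. L)"
    proof
      fix y assume y: "y \<in> Y"
      then have "y \<in> D y" by (auto simp: D_def Y_def intro: span_base)
      then show "y \<in> (\<Union>L\<in>D ` Y. L)" using y by blast
    qed
  qed (use fDY fD b0 in auto)
  also have "\<dots> \<le> (\<Sum>L\<in>D ` Y. sum b L)" by (rule sum_UN_le) (use fDY fD b0 in auto)
  also have "\<dots> \<le> (\<Sum>L\<in>D ` Y. \<eta>)" using bD by (intro sum_mono) auto
  also have "\<dots> = real (card (D ` Y)) * \<eta>" by simp
  also have "\<dots> \<le> 2 / \<delta> * \<eta>" by (rule mult_right_mono[OF card \<eta>])
  finally show ?thesis by (simp add: Y_def)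
qed

text \<open>The third weight \<open>\<zeta>\<close> is the one measured on the random line. It is
  used twice: as the weight of the second slot, to bound its parallel classes after a contraction,
  and as the counting weight of \<open>class_weight\<close>.\<close>

definition random_line_bound :: "('a \<Rightarrow> 'v::real_vector) \<Rightarrow> real \<Rightarrow> real \<Rightarrow> real \<Rightarrow> real \<Rightarrow> bool" where
  "random_line_bound f \<eta> K C \<epsilon> \<longleftrightarrow> (\<forall>E G \<tau> A B a b \<zeta>.
     finite E \<longrightarrow> finite G \<longrightarrow> 0 < \<tau> \<longrightarrow> A \<subseteq> E \<longrightarrow> B \<subseteq> E \<longrightarrow>
     spread_weight f E G (K * \<tau>) a \<longrightarrow> spread_weight f E G (K * \<tau>) b \<longrightarrow> spread_weight f E G (K * \<tau>) \<zeta> \<longrightarrow>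
     nonheavy f E \<eta> A a \<longrightarrow> nonheavy f E \<eta> B b \<longrightarrow>
     dim G + 2 \<le> dim (G \<union> f ` A) \<longrightarrow> dim G + 2 \<le> dim (G \<union> f ` B) \<longrightarrow> dim G + 3 \<le> dim (G \<union> f ` A \<union> f ` B) \<longrightarrow>
     (\<Sum>x\<in>E. \<Sum>y\<in>E. a x * b y * of_bool (f x \<in> span G \<or> f y \<in> span (insert (f x) G) \<or>
         C * \<tau> < line_mass f E G \<zeta> x y)) \<le> \<epsilon>)"

text \<open>The Beck bound removes the intermediate lines, and
  \<open>heavy_lines_through_point\<close> the very rich ones. \<open>\<eta>\<close> does not depend
  on \<open>K\<close>: in the induction over slots \<open>K\<close> grows with every
  contraction.\<close>

lemma random_line_mass:
  assumes "0 < (\<epsilon>::real)"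
  shows "\<exists>\<eta>>0. \<forall>K>0. \<exists>C>0. \<forall>f :: 'a \<Rightarrow> 'v::real_vector. random_line_bound f \<eta> K C \<epsilon>"
proof -
  have "0 < \<epsilon> / 18" using assms by simp
  from weighted_beck[OF this, where 'a='a and 'v='v, folded line_mass_def] obtain \<delta> CB where \<delta>: "\<delta> > 0" and
    beck: "\<forall>(f :: 'a \<Rightarrow> 'v) E G w \<tau>.
     finite E \<longrightarrow> (\<forall>x\<in>E. 0 \<le> w x) \<longrightarrow> sum w E \<le> 1 \<longrightarrow> 0 < \<tau> \<longrightarrow>
     (\<forall>x\<in>E. f x \<notin> span G \<longrightarrow> sum w {y\<in>E. f y \<notin> span G \<and> f y \<in> span (insert (f x) G)} \<le> \<tau>) \<longrightarrow>
     (\<Sum>(x, y) | (x, y) \<in> E \<times> E \<and> f x \<notin> span G \<and> f y \<notin> span (insert (f x) G) \<and>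
        CB * \<tau> < line_mass f E G w x y \<and> line_mass f E G w x y \<le> \<delta>. w x * w y) \<le> \<epsilon> / 18"
    by (elim exE conjE) (rule that, assumption+)
  define \<eta> where "\<eta> = min (\<epsilon> / 12) (\<epsilon> * \<delta> / 8)"
  have \<eta>: "\<eta> > 0" "3 * \<eta> \<le> \<epsilon> / 4" "2 / \<delta> * \<eta> \<le> \<epsilon> / 4"
    using assms \<delta> by (auto simp: \<eta>_def field_simps min_def)
  have main: "(\<Sum>x\<in>E. \<Sum>y\<in>E. a x * b y * of_bool (f x \<in> span G \<or> f y \<in> span (insert (f x) G) \<or>
         3 * max CB (2 / \<delta>) * K * \<tau> < line_mass f E G \<zeta> x y)) \<le> \<epsilon>"
    if K: "0 < K" and E: "finite E" and G: "finite G" and \<tau>: "0 < \<tau>" and A: "A \<subseteq> E" and B: "B \<subseteq> E" and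
      sp: "spread_weight f E G (K * \<tau>) a" "spread_weight f E G (K * \<tau>) b" "spread_weight f E G (K * \<tau>) \<zeta>" and
      nh: "nonheavy f E \<eta> A a" "nonheavy f E \<eta> B b" and
      dA: "dim G + 2 \<le> dim (G \<union> f ` A)" and dB: "dim G + 2 \<le> dim (G \<union> f ` B)" and
      dAB: "dim G + 3 \<le> dim (G \<union> f ` A \<union> f ` B)"
    for K and f :: "'a \<Rightarrow> 'v" and E G \<tau> A B a b \<zeta>
  proof -
    define \<kappa> where "\<kappa> = K * \<tau>"
    have \<kappa>: "\<kappa> > 0" using K \<tau> by (simp add: \<kappa>_def)
    \<comment> \<open>One weight dominating a third of each of the three, so that a single
      application of Beck's theorem covers \<open>a\<close>, \<open>b\<close> and
      \<open>\<zeta>\<close>. The factor 9 lost for pairs explains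
      \<open>\<epsilon> / 18\<close>.\<close>
    define w where "w = (\<lambda>x. (a x + b x + \<zeta> x) / 3)"
    have pos: "0 \<le> a x" "0 \<le> b x" "0 \<le> \<zeta> x" if "x \<in> E" for x using sp that by (auto simp: spread_weight_def)
    have tot: "sum a E \<le> 1" "sum b E \<le> 1" "sum \<zeta> E \<le> 1" using sp by (auto simp: spread_weight_def)
    have sumw: "sum w X = (sum a X + sum b X + sum \<zeta> X) / 3" for X
      by (simp add: w_def sum.distrib sum_divide_distrib[symmetric])
    have w: "spread_weight f E G \<kappa> w"
      unfolding spread_weight_def
    proof (intro conjI ballI impI)
      fix x assume x: "x \<in> E"
      show "0 \<le> w x" using pos[OF x] by (simp add: w_def)
      assume xG: "f x \<notin> span G"
      let ?c = "{y\<in>E. f y \<notin> span G \<and> f y \<in> span (insert (f x) G)}"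
      have "sum a ?c \<le> \<kappa>" "sum b ?c \<le> \<kappa>" "sum \<zeta> ?c \<le> \<kappa>" using sp x xG by (auto simp: spread_weight_def \<kappa>_def)
      then show "sum w ?c \<le> \<kappa>" unfolding sumw by simp
    next
      show "sum w E \<le> 1" unfolding sumw using tot by simp
    qed
    have w0: "0 \<le> w x" "a x \<le> 3 * w x" "b x \<le> 3 * w x" if "x \<in> E" for x using pos that by (auto simp: w_def)
    have lm1: "line_mass f E G w x y \<le> 1" for x y
    proof -
      have "line_mass f E G w x y \<le> sum w E" unfolding line_mass_def using E w0 by (intro sum_mono2) auto
      then show ?thesis using w by (simp add: spread_weight_def)
    qed
    have lmz: "line_mass f E G \<zeta> x y \<le> 3 * line_mass f E G w x y" for x y
      unfolding line_mass_def sumw using pos by (auto intro!: add_nonneg_nonneg sum_nonneg)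
    let ?R1 = "\<lambda>x. f x \<in> span G" and ?R2 = "\<lambda>x. dim (G \<union> f ` B) = dim G + 2 \<and> f x \<in> span (G \<union> f ` B)"
    let ?R3 = "\<lambda>x y. f y \<in> span (insert (f x) G)"
    let ?R4 = "\<lambda>x y. f x \<notin> span G \<and> f y \<notin> span (insert (f x) G) \<and>
        CB * \<kappa> < line_mass f E G w x y \<and> line_mass f E G w x y \<le> \<delta>"
    let ?R5 = "\<lambda>x y. \<kappa> \<le> \<delta> / 2 \<and> \<not> ?R1 x \<and> \<not> ?R2 x \<and> f y \<notin> span (insert (f x) G) \<and> \<delta> < line_mass f E G w x y"
    let ?bad = "\<lambda>x y. f x \<in> span G \<or> f y \<in> span (insert (f x) G) \<or>
         3 * max CB (2 / \<delta>) * K * \<tau> < line_mass f E G \<zeta> x y"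
    \<comment> \<open>A line of large \<open>\<zeta>\<close>-mass has \<open>w\<close>-mass above
      both \<open>CB * \<kappa>\<close> and \<open>2 / \<delta> * \<kappa>\<close>. Since masses are
      at most 1, the second bound forces \<open>\<kappa> \<le> \<delta> / 2\<close>, which the
      treatment of the very rich lines needs.\<close>
    have imp: "?R1 x \<or> ?R2 x \<or> ?R3 x y \<or> ?R4 x y \<or> ?R5 x y" if bad: "?bad x y" for x y
    proof (cases "?R1 x \<or> ?R2 x \<or> ?R3 x y")
      case False
      then have "3 * (max CB (2 / \<delta>) * \<kappa>) < line_mass f E G \<zeta> x y" using bad by (simp add: \<kappa>_def mult_ac)
      then have *: "max CB (2 / \<delta>) * \<kappa> < line_mass f E G w x y" using lmz[of x y] by linarith
      have "2 / \<delta> * \<kappa> \<le> max CB (2 / \<delta>) * \<kappa>" using \<kappa> by (intro mult_right_mono) auto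
      then have "2 / \<delta> * \<kappa> < 1" using * lm1[of x y] by linarith
      then have "\<kappa> \<le> \<delta> / 2" using \<delta> by (simp add: field_simps)
      moreover have "CB * \<kappa> \<le> max CB (2 / \<delta>) * \<kappa>" using \<kappa> by (intro mult_right_mono) auto
      then have "CB * \<kappa> < line_mass f E G w x y" using * by linarith
      ultimately show ?thesis using False by auto
    qed blast
    let ?ob = "of_bool :: bool \<Rightarrow> real"
    have ob: "?ob (?bad x y) \<le> ?ob (?R1 x) + ?ob (?R2 x) + ?ob (?R3 x y \<and> \<not> ?R1 x) + ?ob (?R4 x y) + ?ob (?R5 x y)" for x y
      using imp[of x y] by (auto simp: of_bool_def)
    have "(\<Sum>x\<in>E. \<Sum>y\<in>E. a x * b y * ?ob (?bad x y)) \<le>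
       (\<Sum>x\<in>E. \<Sum>y\<in>E. a x * b y * (?ob (?R1 x) + ?ob (?R2 x) + ?ob (?R3 x y \<and> \<not> ?R1 x) + ?ob (?R4 x y) + ?ob (?R5 x y)))"
      using pos ob by (intro sum_mono mult_left_mono) auto
    also have "\<dots> = (\<Sum>x\<in>E. \<Sum>y\<in>E. a x * b y * ?ob (?R1 x)) + (\<Sum>x\<in>E. \<Sum>y\<in>E. a x * b y * ?ob (?R2 x))
       + (\<Sum>x\<in>E. \<Sum>y\<in>E. a x * b y * ?ob (?R3 x y \<and> \<not> ?R1 x)) + (\<Sum>x\<in>E. \<Sum>y\<in>E. a x * b y * ?ob (?R4 x y))
       + (\<Sum>x\<in>E. \<Sum>y\<in>E. a x * b y * ?ob (?R5 x y))"
      by (simp only: distrib_left sum.distrib)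
    also have "\<dots> \<le> \<eta> + \<eta> + \<eta> + \<epsilon> / 2 + 2 / \<delta> * \<eta>"
    proof (intro add_mono)
      have fin: "finite (f ` A)" "finite (f ` B)" using A B E by (meson finite_imageI finite_subset)+
      show "(\<Sum>x\<in>E. \<Sum>y\<in>E. a x * b y * ?ob (?R1 x)) \<le> \<eta>"
      proof (rule pair_sum_left)
        have "\<not> f ` A \<subseteq> span G"
        proof
          assume "f ` A \<subseteq> span G"
          then have "dim (G \<union> f ` A) \<le> dim G" using G by (intro dim_mono_finite) (auto intro: span_base)
          then show False using dA by simp
        qed
        then show "sum a {x\<in>E. ?R1 x} \<le> \<eta>" using nh(1)[unfolded nonheavy_def, rule_format, of G] G by blast
      qed (use E pos tot in auto)
      show "(\<Sum>x\<in>E. \<Sum>y\<in>E. a x * b y * ?ob (?R2 x)) \<le> \<eta>"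
      proof (rule pair_sum_left)
        show "sum a {x\<in>E. ?R2 x} \<le> \<eta>"
        proof (cases "dim (G \<union> f ` B) = dim G + 2")
          case True
          have "\<not> f ` A \<subseteq> span (G \<union> f ` B)"
          proof
            assume "f ` A \<subseteq> span (G \<union> f ` B)"
            then have "dim (G \<union> f ` A \<union> f ` B) \<le> dim (G \<union> f ` B)" using G fin
              by (intro dim_mono_finite) (auto intro: span_base)
            then show False using dAB True by simp
          qed
          then show ?thesis using nh(1)[unfolded nonheavy_def, rule_format, of "G \<union> f ` B"] G fin True by simp
        qed (use \<eta> in auto)
      qed (use E pos tot in auto)
      show "(\<Sum>x\<in>E. \<Sum>y\<in>E. a x * b y * ?ob (?R3 x y \<and> \<not> ?R1 x)) \<le> \<eta>"
      proof (rule pair_sum_right)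
        fix x assume x: "x \<in> E"
        have "\<not> f ` B \<subseteq> span (insert (f x) G)"
        proof
          assume "f ` B \<subseteq> span (insert (f x) G)"
          then have "dim (G \<union> f ` B) \<le> dim (insert (f x) G)" using G
            by (intro dim_mono_finite) (auto intro: span_base)
          also have "\<dots> \<le> dim G + 1" using G by (simp add: dim_insert_finite)
          finally show False using dB by simp
        qed
        then have "sum b {y\<in>E. ?R3 x y} \<le> \<eta>" using nh(2)[unfolded nonheavy_def, rule_format, of "insert (f x) G"] G by blast
        moreover have "sum b {y\<in>E. ?R3 x y \<and> \<not> ?R1 x} \<le> sum b {y\<in>E. ?R3 x y}"
          using E pos by (intro sum_mono2) auto
        ultimately show "sum b {y\<in>E. ?R3 x y \<and> \<not> ?R1 x} \<le> \<eta>" by linarith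
      qed (use E pos tot \<eta> in auto)
      show "(\<Sum>x\<in>E. \<Sum>y\<in>E. a x * b y * ?ob (?R5 x y)) \<le> 2 / \<delta> * \<eta>"
      proof (rule pair_sum_right)
        fix x assume x: "x \<in> E"
        show "sum b {y\<in>E. ?R5 x y} \<le> 2 / \<delta> * \<eta>"
        proof (cases "\<kappa> \<le> \<delta> / 2 \<and> \<not> ?R1 x \<and> \<not> ?R2 x")
          case True
          then have "sum b {y\<in>E. f y \<notin> span (insert (f x) G) \<and> \<delta> < line_mass f E G w x y} \<le> 2 / \<delta> * \<eta>"
            using E G \<delta> \<eta> w sp(2) nh(2) dB B x by (intro heavy_lines_through_point) auto
          then show ?thesis using True by simp
        next
          case False
          then have "{y\<in>E. ?R5 x y} = {}" by blast
          then show ?thesis using \<eta> \<delta> by (simp only: sum.empty) simp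
        qed
      qed (use E pos tot \<eta> \<delta> in auto)
      show "(\<Sum>x\<in>E. \<Sum>y\<in>E. a x * b y * ?ob (?R4 x y)) \<le> \<epsilon> / 2"
      proof -
        have "(\<Sum>x\<in>E. \<Sum>y\<in>E. a x * b y * ?ob (?R4 x y)) \<le> (\<Sum>x\<in>E. \<Sum>y\<in>E. 9 * (w x * w y * ?ob (?R4 x y)))"
        proof (intro sum_mono)
          fix x y assume xy: "x \<in> E" "y \<in> E"
          have "a x * b y \<le> (3 * w x) * (3 * w y)" using w0[OF xy(1)] w0[OF xy(2)] pos[OF xy(1)] pos[OF xy(2)]
            by (intro mult_mono) auto
          then have "a x * b y * ?ob (?R4 x y) \<le> (3 * w x) * (3 * w y) * ?ob (?R4 x y)" by (rule mult_right_mono) auto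
          then show "a x * b y * ?ob (?R4 x y) \<le> 9 * (w x * w y * ?ob (?R4 x y))" by (simp add: mult_ac)
        qed
        also have "\<dots> = 9 * (\<Sum>(x, y)\<in>E \<times> E. w x * w y * ?ob (?R4 x y))"
          by (simp add: sum_distrib_left sum.cartesian_product split_def)
        also have "(\<Sum>(x, y)\<in>E \<times> E. w x * w y * ?ob (?R4 x y)) =
            (\<Sum>p | p \<in> E \<times> E \<and> ?R4 (fst p) (snd p). w (fst p) * w (snd p))"
          unfolding split_def by (rule sum_of_bool_filter) (use E in simp)
        also have "\<dots> = (\<Sum>(x, y) | (x, y) \<in> E \<times> E \<and> ?R4 x y. w x * w y)"
          by (rule sum.cong) auto
        also have "\<dots> \<le> \<epsilon> / 18"
          by (rule beck[rule_format]) (use E w0 w \<kappa> in \<open>auto simp: spread_weight_def\<close>)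
        finally show ?thesis by simp
      qed
    qed
    also have "\<dots> \<le> \<epsilon>" using \<eta>(2,3) by linarith
    finally show ?thesis .
  qed
  show ?thesis unfolding random_line_bound_def
    apply (rule exI[of _ \<eta>])
    apply (intro conjI allI impI)
     apply (rule \<eta>(1))
    apply (rule_tac x="3 * max CB (2 / \<delta>) * K" in exI)
    apply (intro conjI allI impI)
     apply (use \<delta> in \<open>simp add: less_max_iff_disj\<close>)
    apply (rule main; assumption)
    done
qed

subsection \<open>Flats spanned by random tuples\<close>

lemma PiE_sum_split:
  fixes \<mu> :: "'i \<Rightarrow> 'a \<Rightarrow> real"
  assumes "finite I" "a \<in> I"
  shows "(\<Sum>e\<in>PiE I (\<lambda>_. E). (\<Prod>i\<in>I. \<mu> i (e i)) * F e) =
     (\<Sum>x\<in>E. \<mu> a x * (\<Sum>e\<in>PiE (I - {a}) (\<lambda>_. E). (\<Prod>i\<in>I - {a}. \<mu> i (e i)) * F (e(a := x))))"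
proof -
  let ?J = "I - {a}"
  have I: "I = insert a ?J" "a \<notin> ?J" using assms by auto
  have "PiE I (\<lambda>_. E) = (\<lambda>(y, g). g(a := y)) ` (E \<times> PiE ?J (\<lambda>_. E))"
    using PiE_insert_eq[of a ?J "\<lambda>_. E"] I(1) by simp
  then have "(\<Sum>e\<in>PiE I (\<lambda>_. E). (\<Prod>i\<in>I. \<mu> i (e i)) * F e) =
     (\<Sum>(y, g)\<in>E \<times> PiE ?J (\<lambda>_. E). (\<Prod>i\<in>I. \<mu> i ((g(a := y)) i)) * F (g(a := y)))"
    using inj_combinator[OF I(2), of "\<lambda>_. E"] by (simp add: sum.reindex split_def)
  also have "\<dots> = (\<Sum>y\<in>E. \<Sum>g\<in>PiE ?J (\<lambda>_. E). (\<Prod>i\<in>I. \<mu> i ((g(a := y)) i)) * F (g(a := y)))"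
    by (simp add: sum.cartesian_product)
  also have "\<dots> = (\<Sum>y\<in>E. \<Sum>g\<in>PiE ?J (\<lambda>_. E). \<mu> a y * ((\<Prod>i\<in>?J. \<mu> i (g i)) * F (g(a := y))))"
  proof (intro sum.cong refl)
    fix y g
    have "(\<Prod>i\<in>I. \<mu> i ((g(a := y)) i)) = \<mu> a y * (\<Prod>i\<in>?J. \<mu> i ((g(a := y)) i))"
      using assms by (subst prod.remove[of I a]) auto
    also have "(\<Prod>i\<in>?J. \<mu> i ((g(a := y)) i)) = (\<Prod>i\<in>?J. \<mu> i (g i))" by (rule prod.cong) auto
    finally show "(\<Prod>i\<in>I. \<mu> i ((g(a := y)) i)) * F (g(a := y)) = \<mu> a y * ((\<Prod>i\<in>?J. \<mu> i (g i)) * F (g(a := y)))"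
      by simp
  qed
  finally show ?thesis by (simp add: sum_distrib_left)
qed

lemma PiE_sum_le_one:
  fixes \<mu> :: "'i \<Rightarrow> 'a \<Rightarrow> real"
  assumes "finite I" "finite E" "\<And>i x. i \<in> I \<Longrightarrow> x \<in> E \<Longrightarrow> 0 \<le> \<mu> i x" "\<And>i. i \<in> I \<Longrightarrow> sum (\<mu> i) E \<le> 1"
  shows "(\<Sum>e\<in>PiE I (\<lambda>_. E). \<Prod>i\<in>I. \<mu> i (e i)) \<le> 1"
proof -
  have "(\<Sum>e\<in>PiE I (\<lambda>_. E). \<Prod>i\<in>I. \<mu> i (e i)) = (\<Prod>i\<in>I. sum (\<mu> i) E)"
    using prod_sum_PiE[of I "\<lambda>_. E" \<mu>] assms by simp
  also have "\<dots> \<le> (\<Prod>i\<in>I. 1)" using assms by (intro prod_mono) (auto intro: sum_nonneg)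
  finally show ?thesis by simp
qed

lemma PiE_sum_marginal:
  fixes \<mu> :: "'i \<Rightarrow> 'a \<Rightarrow> real"
  assumes "finite I" "finite E" "\<And>i x. i \<in> I \<Longrightarrow> x \<in> E \<Longrightarrow> 0 \<le> \<mu> i x" "\<And>i. i \<in> I \<Longrightarrow> sum (\<mu> i) E \<le> 1"
    and "a \<in> I" "\<And>x. x \<in> E \<Longrightarrow> 0 \<le> F x"
  shows "(\<Sum>e\<in>PiE I (\<lambda>_. E). (\<Prod>i\<in>I. \<mu> i (e i)) * F (e a)) \<le> (\<Sum>x\<in>E. \<mu> a x * F x)"
proof -
  have "(\<Sum>e\<in>PiE I (\<lambda>_. E). (\<Prod>i\<in>I. \<mu> i (e i)) * F (e a)) =
     (\<Sum>x\<in>E. \<mu> a x * (\<Sum>e\<in>PiE (I - {a}) (\<lambda>_. E). (\<Prod>i\<in>I - {a}. \<mu> i (e i)) * F x))"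
    using PiE_sum_split[OF assms(1,5), where E=E and \<mu>=\<mu> and F="\<lambda>e. F (e a)"] by simp
  also have "\<dots> = (\<Sum>x\<in>E. \<mu> a x * F x * (\<Sum>e\<in>PiE (I - {a}) (\<lambda>_. E). \<Prod>i\<in>I - {a}. \<mu> i (e i)))"
    by (intro sum.cong refl) (simp add: sum_distrib_right[symmetric])
  also have "\<dots> \<le> (\<Sum>x\<in>E. \<mu> a x * F x * 1)"
    using assms by (intro sum_mono mult_left_mono PiE_sum_le_one) auto
  finally show ?thesis by simp
qed

lemma PiE_sum_marginal2:
  fixes \<mu> :: "'i \<Rightarrow> 'a \<Rightarrow> real"
  assumes "finite I" "finite E" "\<And>i x. i \<in> I \<Longrightarrow> x \<in> E \<Longrightarrow> 0 \<le> \<mu> i x" "\<And>i. i \<in> I \<Longrightarrow> sum (\<mu> i) E \<le> 1"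
    and "a \<in> I" "b \<in> I" "a \<noteq> b" "\<And>x y. x \<in> E \<Longrightarrow> y \<in> E \<Longrightarrow> 0 \<le> F x y"
  shows "(\<Sum>e\<in>PiE I (\<lambda>_. E). (\<Prod>i\<in>I. \<mu> i (e i)) * F (e a) (e b)) \<le> (\<Sum>x\<in>E. \<Sum>y\<in>E. \<mu> a x * \<mu> b y * F x y)"
proof -
  have "(\<Sum>e\<in>PiE I (\<lambda>_. E). (\<Prod>i\<in>I. \<mu> i (e i)) * F (e a) (e b)) =
     (\<Sum>x\<in>E. \<mu> a x * (\<Sum>e\<in>PiE (I - {a}) (\<lambda>_. E). (\<Prod>i\<in>I - {a}. \<mu> i (e i)) * F x (e b)))"
    using PiE_sum_split[OF assms(1,5), where E=E and \<mu>=\<mu> and F="\<lambda>e. F (e a) (e b)"] assms(7) by simp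
  also have "\<dots> \<le> (\<Sum>x\<in>E. \<mu> a x * (\<Sum>y\<in>E. \<mu> b y * F x y))"
    using assms by (intro sum_mono mult_left_mono PiE_sum_marginal) auto
  also have "\<dots> = (\<Sum>x\<in>E. \<Sum>y\<in>E. \<mu> a x * \<mu> b y * F x y)"
    by (simp add: sum_distrib_left mult.assoc)
  finally show ?thesis .
qed

text \<open>The points of the simplified contraction by \<open>G\<close>, each recorded as a
  subspace of rank one over \<open>G\<close>.\<close>

definition point_classes :: "('a \<Rightarrow> 'v::real_vector) \<Rightarrow> 'v set \<Rightarrow> 'a set \<Rightarrow> 'v set set" where
  "point_classes f G Z = (\<lambda>z. span (insert (f z) G)) ` {z\<in>Z. f z \<notin> span G}"

lemma point_classes_mono: "Z \<subseteq> Z' \<Longrightarrow> point_classes f G Z \<subseteq> point_classes f G Z'"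
  by (auto simp: point_classes_def)

lemma finite_point_classes: "finite Z \<Longrightarrow> finite (point_classes f G Z)"
  by (simp add: point_classes_def)

lemma span_insert_span: "span (insert v (span S)) = span (insert v (S::'v::real_vector set))"
  using span_Un_cong[of "span S" S "{v}"] by simp

lemma card_point_classes_contract:
  assumes "finite Z"
  shows "card (point_classes f (insert v G) Z) \<le> card (point_classes f G Z)"
proof -
  let ?Z' = "{z\<in>Z. f z \<notin> span (insert v G)}"
  have "point_classes f (insert v G) Z = (\<lambda>S. span (insert v S)) ` (\<lambda>z. span (insert (f z) G)) ` ?Z'"
    unfolding point_classes_def image_image
  proof (rule image_cong)
    fix z
    show "span (insert (f z) (insert v G)) = span (insert v (span (insert (f z) G)))"
      by (simp add: span_insert_span insert_commute)
  qed simp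
  also have "card \<dots> \<le> card ((\<lambda>z. span (insert (f z) G)) ` ?Z')" using assms by (intro card_image_le) simp
  also have "\<dots> \<le> card (point_classes f G Z)"
    unfolding point_classes_def using assms span_mono[of G "insert v G"] by (intro card_mono image_mono) auto
  finally show ?thesis .
qed

text \<open>A point off the span of \<open>G\<close>, \<open>a\<close>, \<open>b\<close> is determined by its projections from \<open>a\<close> and from \<open>b\<close>.\<close>

lemma card_point_classes_two_projections:
  assumes Z: "finite Z" and b: "f b \<notin> span (insert (f a) G)"
  shows "card (point_classes f G Z) \<le>
     card (point_classes f (insert (f a) G) Z) * card (point_classes f (insert (f b) G) Z)
     + card (point_classes f G {z\<in>Z. f z \<in> span (insert (f a) (insert (f b) G))})"
proof -
  let ?W = "span (insert (f a) (insert (f b) G))"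
  let ?Z1 = "{z\<in>Z. f z \<in> ?W}" and ?Z2 = "{z\<in>Z. f z \<notin> ?W}"
  let ?f = "\<lambda>S. (span (insert (f a) S), span (insert (f b) S))"
  have sp: "span (insert v (span (insert z G))) = span (insert z (insert v G))" for v z
    by (simp add: span_insert_span insert_commute)
  have "point_classes f G Z = point_classes f G ?Z1 \<union> point_classes f G ?Z2" by (auto simp: point_classes_def)
  then have "card (point_classes f G Z) \<le> card (point_classes f G ?Z1) + card (point_classes f G ?Z2)"
    by (simp only: card_Un_le)
  moreover have "card (point_classes f G ?Z2) \<le> card (point_classes f (insert (f a) G) Z \<times> point_classes f (insert (f b) G) Z)"
  proof (rule card_inj_on_le[of ?f])
    show "?f ` point_classes f G ?Z2 \<subseteq> point_classes f (insert (f a) G) Z \<times> point_classes f (insert (f b) G) Z"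
    proof -
      have "f z \<notin> span (insert (f a) G)" "f z \<notin> span (insert (f b) G)" if "f z \<notin> ?W" for z
        using that span_mono[of "insert (f a) G" "insert (f a) (insert (f b) G)"]
          span_mono[of "insert (f b) G" "insert (f a) (insert (f b) G)"] by blast+
      then show ?thesis unfolding point_classes_def by (auto simp: sp)
    qed
    show "inj_on ?f (point_classes f G ?Z2)"
    proof (rule inj_onI)
      fix S S' assume "S \<in> point_classes f G ?Z2" "S' \<in> point_classes f G ?Z2" and eq: "?f S = ?f S'"
      then obtain z z' where z: "S = span (insert (f z) G)" "f z \<notin> ?W" "f z \<notin> span G"
        and z': "S' = span (insert (f z') G)" "f z' \<notin> span G"
        by (auto simp: point_classes_def)
      have ea: "span (insert (f z) (insert (f a) G)) = span (insert (f z') (insert (f a) G))"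
        and eb: "span (insert (f z) (insert (f b) G)) = span (insert (f z') (insert (f b) G))"
        using eq unfolding z z' prod.inject sp by simp_all
      have "f z' \<in> span (insert (f z) G)"
      proof (rule ccontr)
        assume n: "f z' \<notin> span (insert (f z) G)"
        have "f z' \<in> span (insert (f b) (insert (f z) G))" using eb by (metis insertI1 insert_commute span_base)
        then have "f b \<in> span (insert (f z') (insert (f z) G))" using n in_span_insert by blast
        also have "\<dots> \<subseteq> span (insert (f z) (insert (f a) G))"
        proof (rule span_minimal)
          have "f z' \<in> span (insert (f z) (insert (f a) G))" using ea by (metis insertI1 span_base)
          then show "insert (f z') (insert (f z) G) \<subseteq> span (insert (f z) (insert (f a) G))"
            by (auto intro: span_base)
        qed simp
        finally have "f z \<in> span (insert (f b) (insert (f a) G))" using b in_span_insert by blast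
        then show False using z(2) by (simp add: insert_commute)
      qed
      then show "S = S'" unfolding z(1) z'(1) using z'(2) span_insert_swap by metis
    qed
  qed (use Z in \<open>simp add: finite_point_classes\<close>)
  ultimately show ?thesis by (simp add: card_cartesian_product)
qed

lemma nonheavy_mono: "nonheavy f E \<eta> A w \<Longrightarrow> \<eta> \<le> \<eta>' \<Longrightarrow> nonheavy f E \<eta>' A w"
  unfolding nonheavy_def by (meson order_trans)

lemma spread_weight_mono: "spread_weight f E G \<kappa> w \<Longrightarrow> \<kappa> \<le> \<kappa>' \<Longrightarrow> spread_weight f E G \<kappa>' w"
  unfolding spread_weight_def by (meson order_trans)

text \<open>Weight \<open>\<tau>\<close> on one representative of each class turns counting the
  classes on a line into measuring its mass, so that the bounds on masses also bound
  cardinalities.\<close>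

lemma class_weight:
  fixes f :: "'a \<Rightarrow> 'v::real_vector"
  assumes E: "finite E" and Z: "Z \<subseteq> E" and \<tau>: "0 < \<tau>" and card: "real (card (point_classes f G Z)) * \<tau> \<le> 1"
  shows "\<exists>\<zeta>. spread_weight f E G \<tau> \<zeta> \<and>
     (\<forall>x y. real (card (point_classes f G {z\<in>Z. f z \<in> span (insert (f x) (insert (f y) G))})) * \<tau> \<le> line_mass f E G \<zeta> x y)"
proof -
  let ?c = "\<lambda>z. span (insert (f z) G)"
  obtain Z0 where Z0: "Z0 \<subseteq> {z\<in>Z. f z \<notin> span G}" "inj_on ?c Z0" "point_classes f G Z = ?c ` Z0"
    using subset_image_inj[of "point_classes f G Z" ?c "{z\<in>Z. f z \<notin> span G}"] by (auto simp: point_classes_def)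
  have fZ0: "finite Z0" "Z0 \<subseteq> E" using Z0(1) Z E finite_subset[of Z0 E] by auto
  have cZ0: "card (point_classes f G Z) = card Z0" using Z0(2,3) by (simp add: card_image)
  define \<zeta> where "\<zeta> = (\<lambda>x. \<tau> * of_bool (x \<in> Z0))"
  have sz: "sum \<zeta> X = \<tau> * real (card (X \<inter> Z0))" if "finite X" for X
  proof -
    have "sum \<zeta> X = \<tau> * (\<Sum>x\<in>X. 1 * of_bool (x \<in> Z0))" by (simp add: \<zeta>_def sum_distrib_left)
    also have "\<dots> = \<tau> * real (card {x\<in>X. x \<in> Z0})" by (subst sum_of_bool_filter[OF that]) simp
    finally show ?thesis by (simp add: Int_def)
  qed
  have "spread_weight f E G \<tau> \<zeta>" unfolding spread_weight_def
  proof (intro conjI ballI impI)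
    show "0 \<le> \<zeta> x" for x using \<tau> by (simp add: \<zeta>_def)
    have "E \<inter> Z0 = Z0" using fZ0 by auto
    then show "sum \<zeta> E \<le> 1" using sz[OF E] card cZ0 by (simp add: mult.commute)
    fix x assume x: "f x \<notin> span G"
    let ?X = "{y \<in> E. f y \<notin> span G \<and> f y \<in> span (insert (f x) G)}"
    have "card (?X \<inter> Z0) \<le> Suc 0"
    proof (rule card_le_Suc0_iff_eq[THEN iffD2])
      show "\<forall>u\<in>?X \<inter> Z0. \<forall>v\<in>?X \<inter> Z0. u = v"
      proof (intro ballI)
        fix u v assume u: "u \<in> ?X \<inter> Z0" and v: "v \<in> ?X \<inter> Z0"
        have "?c u = ?c x" using u by (intro span_insert_swap) auto
        moreover have "?c v = ?c x" using v by (intro span_insert_swap) auto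
        ultimately show "u = v" using inj_onD[OF Z0(2), of u v] u v by simp
      qed
    qed (use fZ0 in simp)
    then have "\<tau> * real (card (?X \<inter> Z0)) \<le> \<tau> * 1" using \<tau> by (intro mult_left_mono) auto
    then show "sum \<zeta> ?X \<le> \<tau>" using sz[of ?X] E by simp
  qed
  moreover have "real (card (point_classes f G {z\<in>Z. f z \<in> span (insert (f x) (insert (f y) G))})) * \<tau> \<le> line_mass f E G \<zeta> x y" for x y
  proof -
    let ?W = "span (insert (f x) (insert (f y) G))"
    have GW: "span G \<subseteq> ?W" by (rule span_mono) auto
    let ?Y = "{z\<in>E. f z \<notin> span G \<and> f z \<in> ?W} \<inter> Z0"
    have "point_classes f G {z\<in>Z. f z \<in> ?W} \<subseteq> ?c ` ?Y"
    proof
      fix S assume "S \<in> point_classes f G {z\<in>Z. f z \<in> ?W}"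
      then obtain z where z: "z \<in> Z" "f z \<in> ?W" "f z \<notin> span G" "S = ?c z" by (auto simp: point_classes_def)
      then have "S \<in> ?c ` Z0" unfolding Z0(3)[symmetric] by (auto simp: point_classes_def)
      then obtain z0 where z0: "z0 \<in> Z0" "S = ?c z0" by auto
      have "f z0 \<in> ?c z" using z0(2) z(4) by (metis insertI1 span_base)
      also have "?c z \<subseteq> ?W" using z(2) GW by (intro span_minimal) (auto intro: span_base)
      finally show "S \<in> ?c ` ?Y" using z0 Z0(1) fZ0 by auto
    qed
    then have "card (point_classes f G {z\<in>Z. f z \<in> ?W}) \<le> card ?Y"
      using E by (meson card_image_le card_mono finite_Int finite_imageI fZ0(1) le_trans)
    moreover have "line_mass f E G \<zeta> x y = \<tau> * real (card ?Y)" unfolding line_mass_def using E by (intro sz) simp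
    ultimately show ?thesis using \<tau> by (simp add: mult.commute)
  qed
  ultimately show ?thesis by blast
qed

text \<open>The rank condition is the Dilworth condition relative to \<open>G\<close>. Its surplus
  of one is what lets it pass from \<open>G\<close> to \<open>G\<close> with an entry of one slot
  adjoined.\<close>

definition slot_system :: "('a \<Rightarrow> 'v::real_vector) \<Rightarrow> 'a set \<Rightarrow> 'v set \<Rightarrow> real \<Rightarrow> real \<Rightarrow> 'i set \<Rightarrow> ('i \<Rightarrow> 'a set) \<Rightarrow> ('i \<Rightarrow> 'a \<Rightarrow> real) \<Rightarrow> bool" where
  "slot_system f E G \<kappa> \<eta> I A \<mu> \<longleftrightarrow> (\<forall>i\<in>I. A i \<subseteq> E \<and> spread_weight f E G \<kappa> (\<mu> i) \<and> nonheavy f E \<eta> (A i) (\<mu> i)) \<and>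
     (\<forall>J\<subseteq>I. J \<noteq> {} \<longrightarrow> dim G + card J + 1 \<le> dim (G \<union> f ` (\<Union>i\<in>J. A i)))"

lemma slot_system_pair_bound:
  fixes f :: "'a \<Rightarrow> 'v::real_vector"
  assumes RL: "random_line_bound f \<eta> K C \<epsilon>"
    and "finite E" "finite G" "0 < \<tau>" and S: "slot_system f E G (K * \<tau>) \<eta> I A \<mu>"
    and ab: "a \<in> I" "b \<in> I" "a \<noteq> b" and "spread_weight f E G (K * \<tau>) \<zeta>"
  shows "(\<Sum>x\<in>E. \<Sum>y\<in>E. \<mu> a x * \<mu> b y * of_bool (f x \<in> span G \<or> f y \<in> span (insert (f x) G) \<or>
         C * \<tau> < line_mass f E G \<zeta> x y)) \<le> \<epsilon>"
proof -
  have dil: "dim G + card J + 1 \<le> dim (G \<union> f ` (\<Union>i\<in>J. A i))" if "J \<subseteq> I" "J \<noteq> {}" for J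
    using S that by (auto simp: slot_system_def)
  have "dim G + 2 \<le> dim (G \<union> f ` A a)" "dim G + 2 \<le> dim (G \<union> f ` A b)"
    using dil[of "{a}"] dil[of "{b}"] ab by auto
  moreover have "dim G + 3 \<le> dim (G \<union> f ` A a \<union> f ` A b)"
    using dil[of "{a, b}"] ab by (simp add: image_Un Un_assoc)
  ultimately show ?thesis
    using assms by (intro RL[unfolded random_line_bound_def, rule_format, of E G \<tau> "A a" "A b"]) (auto simp: slot_system_def)
qed

definition random_flat_bound :: "('a \<Rightarrow> 'v::real_vector) \<Rightarrow> real \<Rightarrow> real \<Rightarrow> nat \<Rightarrow> real \<Rightarrow> 'i set \<Rightarrow> bool" where
  "random_flat_bound f \<eta> K C \<epsilon> I \<longleftrightarrow> (\<forall>E G \<tau> A \<mu> Z.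
     finite E \<longrightarrow> finite G \<longrightarrow> 0 < \<tau> \<longrightarrow> slot_system f E G (K * \<tau>) \<eta> I A \<mu> \<longrightarrow>
     Z \<subseteq> E \<longrightarrow> real (card (point_classes f G Z)) * \<tau> \<le> 1 \<longrightarrow>
     (\<Sum>e\<in>PiE I (\<lambda>_. E). (\<Prod>i\<in>I. \<mu> i (e i)) *
        of_bool (C < card (point_classes f G {z\<in>Z. f z \<in> span (G \<union> f ` e ` I)}))) \<le> \<epsilon>)"

text \<open>Induction on the number of slots by contracting an entry. Seen from the entries of two
  slots \<open>a\<close> and \<open>b\<close>, the flat of the tuple contains at most
  \<open>C1\<close> classes each, by induction. Off the line through these two entries a class is
  determined by its two projections, giving \<open>C1 * C1\<close>; the line itself carries at most
  \<open>C2\<close> classes by \<open>random_line_mass\<close>.\<close>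

lemma random_flat_points:
  assumes "0 < (\<epsilon>::real)"
  shows "\<exists>\<eta>>0. \<forall>K>0. \<exists>C. \<forall>(f :: 'a \<Rightarrow> 'v::real_vector) (I :: 'i set).
     finite I \<longrightarrow> card I = k \<longrightarrow> random_flat_bound f \<eta> K C \<epsilon> I"
  (is "\<exists>\<eta>>0. \<forall>K>0. \<exists>C. ?P k \<epsilon> \<eta> K C")
  using assms
proof (induction k arbitrary: \<epsilon>)
  case 0
  have "?P 0 \<epsilon> 1 K 0" for K
  unfolding random_flat_bound_def
  proof (intro allI impI)
    fix f :: "'a \<Rightarrow> 'v" and I :: "'i set" and E G \<tau> A \<mu> Z
    assume "finite I" "card I = 0"
    then have "I = {}" by simp
    moreover have "point_classes f G {z\<in>Z. f z \<in> span G} = {}" by (auto simp: point_classes_def)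
    ultimately show "(\<Sum>e\<in>PiE I (\<lambda>_. E). (\<Prod>i\<in>I. \<mu> i (e i)) *
        of_bool (0 < card (point_classes f G {z\<in>Z. f z \<in> span (G \<union> f ` e ` I)}))) \<le> \<epsilon>"
      using 0 by simp
  qed
  note main = this
  show ?case
    apply (rule exI[of _ "1::real"])
    apply (rule conjI)
     apply simp
    apply (rule allI, rule impI, rule exI[of _ 0])
    apply (rule main)
    done
next
  case (Suc n)
  show ?case
  proof (cases "n = 0")
    case True
    have main: "?P (Suc n) \<epsilon> 1 K 1" for K
    unfolding random_flat_bound_def
    proof (intro allI impI)
      fix f :: "'a \<Rightarrow> 'v" and I :: "'i set" and E G \<tau> A \<mu> Z
      assume "finite I" "card I = Suc n"
      then obtain a where I: "I = {a}" using True by (auto simp: card_1_singleton_iff)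
      have "card (point_classes f G {z\<in>Z. f z \<in> span (G \<union> f ` e ` I)}) \<le> 1" for e
      proof -
        have "point_classes f G {z\<in>Z. f z \<in> span (G \<union> f ` e ` I)} \<subseteq> {span (insert (f (e a)) G)}"
        proof
          fix S assume "S \<in> point_classes f G {z\<in>Z. f z \<in> span (G \<union> f ` e ` I)}"
          then obtain z where "f z \<in> span (insert (f (e a)) G)" "f z \<notin> span G" "S = span (insert (f z) G)"
            by (auto simp: point_classes_def I)
          then show "S \<in> {span (insert (f (e a)) G)}" using span_insert_swap by blast
        qed
        from card_mono[OF _ this] show ?thesis by simp
      qed
      then show "(\<Sum>e\<in>PiE I (\<lambda>_. E). (\<Prod>i\<in>I. \<mu> i (e i)) *
          of_bool (1 < card (point_classes f G {z\<in>Z. f z \<in> span (G \<union> f ` e ` I)}))) \<le> \<epsilon>"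
        using Suc.prems by (simp add: not_less[symmetric])
    qed
    show ?thesis
      apply (rule exI[of _ "1::real"])
      apply (rule conjI)
       apply simp
      apply (rule allI, rule impI, rule exI[of _ 1])
      apply (rule main)
      done
  next
    case False
    have \<epsilon>: "\<epsilon> > 0" by fact
    then have "\<epsilon> / 8 > 0" by simp
    from Suc.IH[OF this] obtain \<eta>1 where \<eta>1: "\<eta>1 > 0" and IH: "\<forall>K>0. \<exists>C. ?P n (\<epsilon> / 8) \<eta>1 K C"
      by (elim exE conjE) (rule that, assumption+)
    define \<epsilon>2 where "\<epsilon>2 = \<epsilon> / (8 * real (Suc n))"
    have \<epsilon>2: "\<epsilon>2 > 0" "real n * \<epsilon>2 \<le> \<epsilon> / 8" "\<epsilon>2 \<le> \<epsilon> / 8"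
      using \<epsilon> by (auto simp: \<epsilon>2_def field_simps)
    from random_line_mass[OF \<epsilon>2(1), where 'a='a and 'v='v] obtain \<eta>2 where \<eta>2: "\<eta>2 > 0" and
      RL0: "\<forall>K>0. \<exists>C>0. \<forall>f :: 'a \<Rightarrow> 'v. random_line_bound f \<eta>2 K C \<epsilon>2"
      by (elim exE conjE) (rule that, assumption+)
    \<comment> \<open>The last bound pays for the at most \<open>2 ^ n\<close> subspaces, spanned by
      unions of the other slots, that an entry has to avoid.\<close>
    define \<eta> where "\<eta> = min (min \<eta>1 \<eta>2) (\<epsilon> / (8 * 2 ^ n))"
    have \<eta>: "\<eta> > 0" "\<eta> \<le> \<eta>1" "\<eta> \<le> \<eta>2" using \<eta>1 \<eta>2 \<epsilon> by (auto simp: \<eta>_def)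
    have "\<eta> \<le> \<epsilon> / (8 * 2 ^ n)" by (simp add: \<eta>_def)
    then have \<eta>4: "2 ^ n * \<eta> \<le> \<epsilon> / 8" by (simp add: field_simps)
    have "\<exists>C. ?P (Suc n) \<epsilon> \<eta> K C" if K: "K > 0" for K
    proof -
      define K1 where "K1 = max K 1"
      have K1: "K1 > 0" "K \<le> K1" "1 \<le> K1" by (auto simp: K1_def)
      obtain C2 where C2: "C2 > 0" and RL: "\<forall>f :: 'a \<Rightarrow> 'v. random_line_bound f \<eta>2 K1 C2 \<epsilon>2"
        using RL0[THEN spec[of _ K1], THEN mp[OF _ K1(1)]] by (elim exE conjE) (rule that, assumption+)
      \<comment> \<open>After contracting one entry the remaining parallel classes weigh up to
        \<open>C2 * \<tau>\<close>, so the induction hypothesis is used with \<open>K = C2\<close>,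
        a constant known only at this point.\<close>
      obtain C1 where C1: "?P n (\<epsilon> / 8) \<eta>1 C2 C1"
        using IH[THEN spec[of _ C2], THEN mp[OF _ C2]] by (elim exE) (rule that, assumption)
      have "?P (Suc n) \<epsilon> \<eta> K (C1 * C1 + nat \<lceil>C2\<rceil>)"
      unfolding random_flat_bound_def
      proof (intro allI impI)
        fix f :: "'a \<Rightarrow> 'v" and I :: "'i set" and E G \<tau> A \<mu> Z
        assume E: "finite E" and G: "finite G" and \<tau>: "0 < \<tau>" and I: "finite I" "card I = Suc n"
          and S: "slot_system f E G (K * \<tau>) \<eta> I A \<mu>" and Z: "Z \<subseteq> E"
          and card: "real (card (point_classes f G Z)) * \<tau> \<le> 1"
        have fZ: "finite Z" using Z E finite_subset by blast
        have S2: "slot_system f E G (K1 * \<tau>) \<eta>2 I A \<mu>"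
          using S \<eta>(3) mult_right_mono[OF K1(2), of \<tau>] \<tau> unfolding slot_system_def
          by (meson less_imp_le nonheavy_mono spread_weight_mono)
        have \<mu>: "\<And>i x. i \<in> I \<Longrightarrow> x \<in> E \<Longrightarrow> 0 \<le> \<mu> i x" "\<And>i. i \<in> I \<Longrightarrow> sum (\<mu> i) E \<le> 1"
          using S by (auto simp: slot_system_def spread_weight_def)
        have AE: "A i \<subseteq> E" if "i \<in> I" for i using S that by (auto simp: slot_system_def)
        have dil: "dim G + card J + 1 \<le> dim (G \<union> f ` (\<Union>i\<in>J. A i))" if "J \<subseteq> I" "J \<noteq> {}" for J
          using S that by (auto simp: slot_system_def)
        have fA: "finite (f ` (\<Union>i\<in>J. A i))" if "J \<subseteq> I" for J
          using that AE E I by (meson UN_least finite_imageI finite_subset subsetD)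
        obtain a b where ab: "a \<in> I" "b \<in> I" "a \<noteq> b"
          using I False by (metis One_nat_def Suc_inject card_1_singleton_iff card_le_Suc0_iff_eq nat_neq_iff not_less_eq_eq le_SucE le_zero_eq)
        obtain \<zeta> where \<zeta>: "spread_weight f E G \<tau> \<zeta>" and
          \<zeta>_le: "\<And>x y. real (card (point_classes f G {z\<in>Z. f z \<in> span (insert (f x) (insert (f y) G))})) * \<tau> \<le> line_mass f E G \<zeta> x y"
          using class_weight[OF E Z \<tau> card] by blast
        define PR where "PR = (\<lambda>F. \<Sum>e\<in>PiE I (\<lambda>_. E). (\<Prod>i\<in>I. \<mu> i (e i)) * of_bool (F e) :: real)"
        define H where "H = (\<lambda>e. {z\<in>Z. f z \<in> span (G \<union> f ` e ` I)})"
        define far where "far = (\<lambda>i e. C1 < card (point_classes f (insert (f (e i)) G) (H e)))"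
        define pb where "pb = (\<lambda>x y. f x \<in> span G \<or> f y \<in> span (insert (f x) G) \<or> C2 * \<tau> < line_mass f E G \<zeta> x y)"
        have PR_pb: "PR (\<lambda>e. pb (e a) (e b)) \<le> \<epsilon>2"
        proof -
          have "PR (\<lambda>e. pb (e a) (e b)) \<le> (\<Sum>x\<in>E. \<Sum>y\<in>E. \<mu> a x * \<mu> b y * of_bool (pb x y))"
            unfolding PR_def
            by (rule PiE_sum_marginal2[where F="\<lambda>x y. of_bool (pb x y)"]) (use I E \<mu> ab in auto)
          also have "\<dots> \<le> \<epsilon>2" unfolding pb_def
            by (rule slot_system_pair_bound[OF RL[THEN spec] E G \<tau> S2 ab])
              (use spread_weight_mono[OF \<zeta>, of "K1 * \<tau>"] K1(3) \<tau> in simp)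
          finally show ?thesis .
        qed
        have PR_far: "PR (far c) \<le> 3 * \<epsilon> / 8" if c: "c \<in> I" for c
        proof -
          define J where "J = I - {c}"
          have J: "finite J" "card J = n" "J \<subseteq> I" "c \<notin> J" using I c by (auto simp: J_def)
          define G' where "G' = (\<lambda>x. insert (f x) G)"
          have fG': "finite (G' x)" for x using G by (simp add: G'_def)
          have GG': "span G \<subseteq> span (G' x)" for x unfolding G'_def by (rule span_mono) auto
          define cm where "cm = (\<lambda>i x y. sum (\<mu> i) {z\<in>E. f z \<notin> span (G' x) \<and> f z \<in> span (insert (f y) (G' x))})"
          \<comment> \<open>Elements of slot \<open>i\<close> whose parallel class becomes too heavy
            once \<open>x\<close> is contracted. Such a class lies on a line of large mass through
            \<open>x\<close>, so \<open>random_line_mass\<close> bounds the expected loss.\<close>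
          define drop where "drop = (\<lambda>i x y. f y \<notin> span (G' x) \<and> C2 * \<tau> < cm i x y)"
          \<comment> \<open>An entry of slot \<open>c\<close> that lies by accident in the span of
            other slots would destroy the rank condition after its contraction.\<close>
          define atyp where "atyp = (\<lambda>x. \<exists>L\<subseteq>J. \<not> f ` A c \<subseteq> span (G \<union> f ` (\<Union>i\<in>L. A i)) \<and> f x \<in> span (G \<union> f ` (\<Union>i\<in>L. A i)))"
          define P where "P = (\<lambda>e. \<Prod>i\<in>J. \<mu> i (e i))"
          define Q where "Q = (\<lambda>x e. C1 < card (point_classes f (G' x) {z\<in>Z. f z \<in> span (G' x \<union> f ` e ` J)}))"
          define T where "T = (\<lambda>x. \<Sum>e\<in>PiE J (\<lambda>_. E). P e * of_bool (Q x e))"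
          define Dr where "Dr = (\<lambda>x. \<Sum>i\<in>J. \<Sum>y\<in>E. \<mu> i y * of_bool (drop i x y))"
          have \<mu>J: "\<And>i x. i \<in> J \<Longrightarrow> x \<in> E \<Longrightarrow> 0 \<le> \<mu> i x" "\<And>i. i \<in> J \<Longrightarrow> sum (\<mu> i) E \<le> 1" using \<mu> J by auto
          have P0: "0 \<le> P e" if "e \<in> PiE J (\<lambda>_. E)" for e unfolding P_def using that \<mu>J by (intro prod_nonneg) auto
          have Dr0: "0 \<le> Dr x" for x unfolding Dr_def using \<mu>J by (intro sum_nonneg mult_nonneg_nonneg) auto
          have "PR (far c) = (\<Sum>x\<in>E. \<mu> c x * T x)"
          proof -
            have im: "(e(c := x)) ` I = insert x (e ` J)" for e x using c J by (auto simp: J_def)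
            have "far c (e(c := x)) \<longleftrightarrow> Q x e" for e x
              unfolding far_def H_def Q_def G'_def im by simp
            then show ?thesis unfolding PR_def T_def P_def J_def
              using PiE_sum_split[OF I(1) c, where E=E and \<mu>=\<mu> and F="\<lambda>e. of_bool (far c e)"] by simp
          qed
          also have "\<dots> \<le> (\<Sum>x\<in>E. \<mu> c x * (of_bool (atyp x) + \<epsilon> / 8 + Dr x))"
          proof (intro sum_mono mult_left_mono)
            fix x assume x: "x \<in> E"
            show "0 \<le> \<mu> c x" using \<mu> c x by simp
            have T1: "T x \<le> 1"
            proof -
              have "T x \<le> (\<Sum>e\<in>PiE J (\<lambda>_. E). P e)" unfolding T_def using P0 by (intro sum_mono) auto
              also have "\<dots> \<le> 1" unfolding P_def using J E \<mu>J by (intro PiE_sum_le_one) auto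
              finally show ?thesis .
            qed
            show "T x \<le> of_bool (atyp x) + \<epsilon> / 8 + Dr x"
            proof (cases "atyp x")
              case True
              have "0 \<le> \<epsilon> / 8 + Dr x" using Dr0[of x] \<epsilon> by simp
              then show ?thesis using T1 True by simp
            next
              case nat: False
              have notG: "f x \<notin> span G"
              proof
                assume xG: "f x \<in> span G"
                have "\<not> f ` A c \<subseteq> span G"
                proof
                  assume "f ` A c \<subseteq> span G"
                  then have "dim (G \<union> f ` A c) \<le> dim G" using G by (intro dim_mono_finite) (auto intro: span_base)
                  then show False using dil[of "{c}"] c by simp
                qed
                then show False using nat xG unfolding atyp_def by (metis UN_empty Un_empty_right empty_subsetI image_empty)
              qed
              \<comment> \<open>Whole parallel classes are discarded, which makes the new weights
                spread at scale \<open>C2 * \<tau>\<close> over the contraction.\<close>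
              define \<mu>' where "\<mu>' = (\<lambda>i y. \<mu> i y * of_bool (\<not> drop i x y))"
              have \<mu>': "0 \<le> \<mu>' i y" "\<mu>' i y \<le> \<mu> i y" if "i \<in> J" "y \<in> E" for i y
                using \<mu>J that by (auto simp: \<mu>'_def)
              have \<mu>'s: "sum (\<mu>' i) X \<le> sum (\<mu> i) X" if "i \<in> J" "X \<subseteq> E" for i X
                using \<mu>' that by (intro sum_mono) auto
              have S': "slot_system f E (G' x) (C2 * \<tau>) \<eta>1 J A \<mu>'"
                unfolding slot_system_def
              proof (intro conjI ballI allI impI)
                fix i assume i: "i \<in> J"
                show "A i \<subseteq> E" using AE i J by auto
                show "nonheavy f E \<eta>1 (A i) (\<mu>' i)" unfolding nonheavy_def
                proof (intro allI impI)
                  fix Q :: "'v set" assume Q: "finite Q"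
                  have "nonheavy f E \<eta> (A i) (\<mu> i)" using S i J by (auto simp: slot_system_def)
                  then have "f ` A i \<subseteq> span Q \<or> sum (\<mu> i) {x\<in>E. f x \<in> span Q} \<le> \<eta>"
                    unfolding nonheavy_def using Q by blast
                  moreover have "sum (\<mu>' i) {x\<in>E. f x \<in> span Q} \<le> sum (\<mu> i) {x\<in>E. f x \<in> span Q}"
                    using i by (intro \<mu>'s) auto
                  ultimately show "f ` A i \<subseteq> span Q \<or> sum (\<mu>' i) {x\<in>E. f x \<in> span Q} \<le> \<eta>1"
                    using \<eta>(2) by linarith
                qed
                show "spread_weight f E (G' x) (C2 * \<tau>) (\<mu>' i)" unfolding spread_weight_def
                proof (intro conjI ballI impI)
                  show "0 \<le> \<mu>' i y" if "y \<in> E" for y using \<mu>' i that by simp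
                  show "sum (\<mu>' i) E \<le> 1" using \<mu>'s[OF i, of E] \<mu>J(2)[OF i] by simp
                  fix y assume y: "y \<in> E" "f y \<notin> span (G' x)"
                  let ?X = "{z\<in>E. f z \<notin> span (G' x) \<and> f z \<in> span (insert (f y) (G' x))}"
                  show "sum (\<mu>' i) ?X \<le> C2 * \<tau>"
                  proof (cases "drop i x y")
                    case True
                    have "drop i x z" if z: "z \<in> ?X" for z
                    proof -
                      have "span (insert (f z) (G' x)) = span (insert (f y) (G' x))" using z by (intro span_insert_swap) auto
                      then show ?thesis using True z by (simp add: drop_def cm_def)
                    qed
                    then have "sum (\<mu>' i) ?X = 0" by (intro sum.neutral) (simp add: \<mu>'_def)
                    then show ?thesis using C2 \<tau> by simp
                  next
                    case False
                    then have "cm i x y \<le> C2 * \<tau>" using y by (simp add: drop_def)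
                    then show ?thesis using \<mu>'s[OF i, of ?X] by (simp add: cm_def)
                  qed
                qed
              next
                \<comment> \<open>If \<open>f x\<close> is outside the span of the slots in
                  \<open>L\<close>, the contraction costs them no rank. Otherwise, \<open>x\<close>
                  not being atypical, that span contains all of \<open>A c\<close>, and the rank
                  condition for \<open>insert c L\<close> supplies the missing one.\<close>
                fix L assume L: "L \<subseteq> J" "L \<noteq> {}"
                let ?U = "f ` (\<Union>i\<in>L. A i)"
                have fL: "finite (G \<union> ?U)" using G fA[of L] L J by auto
                have cL: "card (insert c L) = Suc (card L)" using L J finite_subset[of L J] by (subst card_insert_disjoint) auto
                have dG': "dim (G' x) = Suc (dim G)" using notG G by (simp add: G'_def dim_insert_finite)
                have "dim G + card L + 2 \<le> dim (insert (f x) (G \<union> ?U))"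
                proof (cases "f x \<in> span (G \<union> ?U)")
                  case False
                  then show ?thesis using dil[of L] L J fL by (simp add: dim_insert_finite)
                next
                  case True
                  then have "f ` A c \<subseteq> span (G \<union> ?U)" using nat L(1) by (auto simp: atyp_def)
                  then have "dim (G \<union> f ` (\<Union>i\<in>insert c L. A i)) \<le> dim (G \<union> ?U)"
                    using fL by (intro dim_mono_finite) (auto intro: span_base)
                  moreover have "insert c L \<subseteq> I" using L J c by auto
                  then have "dim G + card (insert c L) + 1 \<le> dim (G \<union> f ` (\<Union>i\<in>insert c L. A i))"
                    by (intro dil) auto
                  ultimately have "dim G + card L + 2 \<le> dim (G \<union> ?U)" unfolding cL by linarith
                  then show ?thesis using True fL by (simp add: dim_insert_finite)
                qed
                then show "dim (G' x) + card L + 1 \<le> dim (G' x \<union> ?U)" using dG' by (simp add: G'_def)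
              qed
              have "(\<Sum>e\<in>PiE J (\<lambda>_. E). (\<Prod>i\<in>J. \<mu>' i (e i)) * of_bool (Q x e)) \<le> \<epsilon> / 8"
                unfolding Q_def
              proof (rule C1[unfolded random_flat_bound_def, rule_format])
                have "card (point_classes f (G' x) Z) \<le> card (point_classes f G Z)"
                  unfolding G'_def by (rule card_point_classes_contract[OF fZ])
                then have "real (card (point_classes f (G' x) Z)) * \<tau> \<le> real (card (point_classes f G Z)) * \<tau>"
                  using \<tau> by (intro mult_right_mono) auto
                then show "real (card (point_classes f (G' x) Z)) * \<tau> \<le> 1" using card by linarith
              qed (use E fG' \<tau> J S' Z in auto)
              moreover have "T x \<le> (\<Sum>e\<in>PiE J (\<lambda>_. E). (\<Prod>i\<in>J. \<mu>' i (e i)) * of_bool (Q x e)) + Dr x"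
              proof -
                have "T x \<le> (\<Sum>e\<in>PiE J (\<lambda>_. E). (\<Prod>i\<in>J. \<mu>' i (e i)) * of_bool (Q x e) + (\<Sum>i\<in>J. P e * of_bool (drop i x (e i))))"
                  unfolding T_def
                proof (rule sum_mono)
                  fix e assume e: "e \<in> PiE J (\<lambda>_. E)"
                  have nn: "0 \<le> (\<Prod>i\<in>J. \<mu>' i (e i)) * of_bool (Q x e)" using e \<mu>' by (intro mult_nonneg_nonneg prod_nonneg) auto
                  have nn2: "0 \<le> (\<Sum>i\<in>J. P e * of_bool (drop i x (e i)))" using P0[OF e] by (intro sum_nonneg) auto
                  show "P e * of_bool (Q x e) \<le> (\<Prod>i\<in>J. \<mu>' i (e i)) * of_bool (Q x e) + (\<Sum>i\<in>J. P e * of_bool (drop i x (e i)))"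
                  proof (cases "\<exists>i\<in>J. drop i x (e i)")
                    case True
                    then obtain i where i: "i \<in> J" "drop i x (e i)" by blast
                    then have "P e * of_bool (drop i x (e i)) \<le> (\<Sum>i\<in>J. P e * of_bool (drop i x (e i)))"
                      using J(1) P0[OF e] by (intro member_le_sum) auto
                    moreover have "P e * of_bool (Q x e) \<le> P e" using P0[OF e] by auto
                    ultimately show ?thesis using i nn by simp
                  next
                    case False
                    then have "P e = (\<Prod>i\<in>J. \<mu>' i (e i))" by (simp add: P_def \<mu>'_def)
                    then show ?thesis using nn2 by simp
                  qed
                qed
                also have "\<dots> = (\<Sum>e\<in>PiE J (\<lambda>_. E). (\<Prod>i\<in>J. \<mu>' i (e i)) * of_bool (Q x e))
                    + (\<Sum>i\<in>J. \<Sum>e\<in>PiE J (\<lambda>_. E). P e * of_bool (drop i x (e i)))"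
                  by (simp add: sum.distrib sum.swap[of _ J])
                also have "(\<Sum>i\<in>J. \<Sum>e\<in>PiE J (\<lambda>_. E). P e * of_bool (drop i x (e i))) \<le> Dr x"
                  unfolding Dr_def P_def
                  by (intro sum_mono PiE_sum_marginal[where F="\<lambda>y. of_bool (drop _ x y)"]) (use J E \<mu>J in auto)
                finally show ?thesis by simp
              qed
              ultimately show ?thesis by simp
            qed
          qed
          also have "\<dots> = (\<Sum>x\<in>E. \<mu> c x * of_bool (atyp x)) + sum (\<mu> c) E * (\<epsilon> / 8) + (\<Sum>x\<in>E. \<mu> c x * Dr x)"
            by (simp add: distrib_left sum.distrib sum_distrib_right)
          also have "\<dots> \<le> \<epsilon> / 8 + \<epsilon> / 8 + \<epsilon> / 8"
          proof (intro add_mono)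
            have "(\<Sum>x\<in>E. \<mu> c x * of_bool (atyp x)) = sum (\<mu> c) {x\<in>E. atyp x}" by (rule sum_of_bool_filter[OF E])
            also have "\<dots> \<le> sum (\<mu> c) (\<Union>L\<in>Pow J. {x\<in>E. \<not> f ` A c \<subseteq> span (G \<union> f ` (\<Union>i\<in>L. A i)) \<and> f x \<in> span (G \<union> f ` (\<Union>i\<in>L. A i))})"
              (is "_ \<le> sum _ ?U")
            proof (rule sum_mono2)
              show "finite ?U" using E J by auto
              show "{x\<in>E. atyp x} \<subseteq> ?U" unfolding atyp_def by blast
            qed (use \<mu> c in auto)
            also have "\<dots> \<le> (\<Sum>L\<in>Pow J. sum (\<mu> c) {x\<in>E. \<not> f ` A c \<subseteq> span (G \<union> f ` (\<Union>i\<in>L. A i)) \<and> f x \<in> span (G \<union> f ` (\<Union>i\<in>L. A i))})"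
              using E J \<mu> c by (intro sum_UN_le) auto
            also have "\<dots> \<le> (\<Sum>L\<in>Pow J. \<eta>)"
            proof (rule sum_mono)
              fix L assume L: "L \<in> Pow J"
              let ?S = "G \<union> f ` (\<Union>i\<in>L. A i)"
              have "nonheavy f E \<eta> (A c) (\<mu> c)" using S c by (auto simp: slot_system_def)
              moreover have "finite ?S" using G fA[of L] L J by auto
              ultimately have "f ` A c \<subseteq> span ?S \<or> sum (\<mu> c) {x\<in>E. f x \<in> span ?S} \<le> \<eta>"
                unfolding nonheavy_def by blast
              then show "sum (\<mu> c) {x\<in>E. \<not> f ` A c \<subseteq> span ?S \<and> f x \<in> span ?S} \<le> \<eta>"
                using \<eta>(1) by (cases "f ` A c \<subseteq> span ?S") auto
            qed
            also have "\<dots> = 2 ^ n * \<eta>" using J by (simp add: card_Pow)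
            finally show "(\<Sum>x\<in>E. \<mu> c x * of_bool (atyp x)) \<le> \<epsilon> / 8" using \<eta>4 by simp
            show "sum (\<mu> c) E * (\<epsilon> / 8) \<le> \<epsilon> / 8" using \<mu>(2)[OF c] \<epsilon> by (simp add: mult_left_le_one_le sum_nonneg \<mu> c)
            have "(\<Sum>x\<in>E. \<mu> c x * Dr x) = (\<Sum>i\<in>J. \<Sum>x\<in>E. \<Sum>y\<in>E. \<mu> c x * \<mu> i y * of_bool (drop i x y))"
              unfolding Dr_def sum_distrib_left by (subst sum.swap) (simp add: mult.assoc)
            also have "\<dots> \<le> (\<Sum>i\<in>J. \<epsilon>2)"
            proof (rule sum_mono)
              fix i assume i: "i \<in> J"
              then have ic: "i \<in> I" "c \<noteq> i" using J by auto
              have "(\<Sum>x\<in>E. \<Sum>y\<in>E. \<mu> c x * \<mu> i y * of_bool (drop i x y)) \<le>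
                 (\<Sum>x\<in>E. \<Sum>y\<in>E. \<mu> c x * \<mu> i y * of_bool (f x \<in> span G \<or> f y \<in> span (insert (f x) G) \<or>
                    C2 * \<tau> < line_mass f E G (\<mu> i) x y))"
              proof (intro sum_mono mult_left_mono)
                fix x y assume xy: "x \<in> E" "y \<in> E"
                show "0 \<le> \<mu> c x * \<mu> i y" using \<mu> c ic xy by simp
                have "cm i x y \<le> line_mass f E G (\<mu> i) x y"
                  unfolding cm_def line_mass_def using E \<mu> ic GG'[of x]
                  by (intro sum_mono2) (auto simp: G'_def insert_commute)
                then show "of_bool (drop i x y) \<le> (of_bool (f x \<in> span G \<or> f y \<in> span (insert (f x) G) \<or>
                    C2 * \<tau> < line_mass f E G (\<mu> i) x y) :: real)" by (auto simp: drop_def)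
              qed
              also have "\<dots> \<le> \<epsilon>2"
                by (rule slot_system_pair_bound[OF RL[THEN spec] E G \<tau> S2 c ic]) (use S2 ic in \<open>auto simp: slot_system_def\<close>)
              finally show "(\<Sum>x\<in>E. \<Sum>y\<in>E. \<mu> c x * \<mu> i y * of_bool (drop i x y)) \<le> \<epsilon>2" .
            qed
            also have "\<dots> \<le> \<epsilon> / 8" using J \<epsilon>2 by simp
            finally show "(\<Sum>x\<in>E. \<mu> c x * Dr x) \<le> \<epsilon> / 8" .
          qed
          finally show ?thesis by simp
        qed
        have "PR (\<lambda>e. C1 * C1 + nat \<lceil>C2\<rceil> < card (point_classes f G (H e)))
           \<le> PR (\<lambda>e. pb (e a) (e b)) + PR (far a) + PR (far b)"
          unfolding PR_def sum.distrib[symmetric] distrib_left[symmetric]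
        proof (intro sum_mono mult_left_mono)
          fix e assume e: "e \<in> PiE I (\<lambda>_. E)"
          show "0 \<le> (\<Prod>i\<in>I. \<mu> i (e i))" using e \<mu> by (intro prod_nonneg) auto
          have "pb (e a) (e b) \<or> far a e \<or> far b e"
            if many: "C1 * C1 + nat \<lceil>C2\<rceil> < card (point_classes f G (H e))"
          proof (rule ccontr)
            assume not: "\<not> ?thesis"
            have fH: "finite (H e)" using fZ by (simp add: H_def)
            let ?W = "\<lambda>z. f z \<in> span (insert (f (e a)) (insert (f (e b)) G))"
            have "card (point_classes f G (H e)) \<le>
               card (point_classes f (insert (f (e a)) G) (H e)) * card (point_classes f (insert (f (e b)) G) (H e))
               + card (point_classes f G {z\<in>H e. ?W z})"
              using not by (intro card_point_classes_two_projections fH) (auto simp: pb_def)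
            also have "\<dots> \<le> C1 * C1 + nat \<lceil>C2\<rceil>"
            proof (intro add_mono mult_mono)
              have "card (point_classes f G {z\<in>H e. ?W z}) \<le> card (point_classes f G {z\<in>Z. ?W z})"
                using fZ by (intro card_mono finite_point_classes point_classes_mono) (auto simp: H_def)
              moreover have "real (card (point_classes f G {z\<in>Z. ?W z})) * \<tau> \<le> C2 * \<tau>"
                using \<zeta>_le[of "e a" "e b"] not by (auto simp: pb_def)
              then have "real (card (point_classes f G {z\<in>Z. ?W z})) \<le> C2" using \<tau> by simp
              then have "card (point_classes f G {z\<in>Z. ?W z}) \<le> nat \<lceil>C2\<rceil>" by linarith
              ultimately show "card (point_classes f G {z\<in>H e. ?W z}) \<le> nat \<lceil>C2\<rceil>" by linarith
            qed (use not in \<open>auto simp: far_def\<close>)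
            finally show False using many by simp
          qed
          then show "of_bool (C1 * C1 + nat \<lceil>C2\<rceil> < card (point_classes f G (H e)))
            \<le> of_bool (pb (e a) (e b)) + of_bool (far a e) + (of_bool (far b e) :: real)" by auto
        qed
        also have "\<dots> \<le> \<epsilon>2 + 3 * \<epsilon> / 8 + 3 * \<epsilon> / 8" using PR_pb PR_far ab by (intro add_mono) auto
        also have "\<dots> \<le> \<epsilon>" using \<epsilon>2(3) \<epsilon> by linarith
        finally show "(\<Sum>e\<in>PiE I (\<lambda>_. E). (\<Prod>i\<in>I. \<mu> i (e i)) *
          of_bool (C1 * C1 + nat \<lceil>C2\<rceil> < card (point_classes f G {z\<in>Z. f z \<in> span (G \<union> f ` e ` I)}))) \<le> \<epsilon>"
          by (simp add: PR_def H_def)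
      qed
      then show ?thesis by blast
    qed
    then show ?thesis using \<eta>(1) by blast
  qed
qed

subsection \<open>Vector configurations behind the numbers \<open>b k t\<close>\<close>

text \<open>The conditions (C1)--(C3) for a set \<open>B\<close> of blue and a set \<open>R\<close> of red vectors. By (C3) the
  blue vectors span.\<close>

definition blue_red_conf :: "nat \<Rightarrow> 'v::real_vector set \<Rightarrow> 'v set \<Rightarrow> bool" where
  "blue_red_conf k B R \<longleftrightarrow> finite B \<and> finite R \<and> dim B = k + 1 \<and> R \<subseteq> span B \<and> 0 \<notin> B \<union> R \<and> B \<inter> R = {} \<and>
     (\<forall>x\<in>B \<union> R. \<forall>y\<in>B \<union> R. x \<noteq> y \<longrightarrow> y \<notin> span {x}) \<and>
     (\<forall>S\<subseteq>B. dim S = k \<longrightarrow> (\<exists>r\<in>R. r \<in> span S)) \<and>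
     (\<forall>x\<in>B. \<forall>y\<in>B. x \<noteq> y \<longrightarrow> (\<exists>S\<subseteq>B. dim S + 1 = k \<and> dim (insert x (insert y S)) = k + 1 \<and> (\<forall>r\<in>R. r \<notin> span S)))"

lemma blue_red_confD:
  assumes "blue_red_conf k B R"
  shows "finite B" "finite R" "dim B = k + 1" "R \<subseteq> span B" "0 \<notin> B \<union> R" "B \<inter> R = {}"
    and "x \<in> B \<union> R \<Longrightarrow> y \<in> B \<union> R \<Longrightarrow> x \<noteq> y \<Longrightarrow> y \<notin> span {x}"
    and "S \<subseteq> B \<Longrightarrow> dim S = k \<Longrightarrow> \<exists>r\<in>R. r \<in> span S"
    and "x \<in> B \<Longrightarrow> y \<in> B \<Longrightarrow> x \<noteq> y \<Longrightarrow>
      \<exists>S\<subseteq>B. dim S + 1 = k \<and> dim (insert x (insert y S)) = k + 1 \<and> (\<forall>r\<in>R. r \<notin> span S)"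
  using assms unfolding blue_red_conf_def by simp_all

section \<open>Blue hyperplanes that avoid a given red point\<close>

lemma subset_of_dim:
  fixes B :: "'v::real_vector set"
  assumes "finite B" "m \<le> dim B"
  shows "\<exists>S\<subseteq>B. dim S = m"
  using assms
proof (induction B rule: finite_induct)
  case empty then show ?case by auto
next
  case (insert x F)
  show ?case
  proof (cases "m \<le> dim F")
    case True then show ?thesis using insert by blast
  next
    case False
    then have "m = dim (insert x F)" using insert.prems insert.hyps by (auto simp: dim_insert_finite split: if_splits)
    then show ?thesis by blast
  qed
qed

lemma exchange_two:
  fixes S :: "'v::real_vector set"
  assumes "r \<in> span (insert x S)" "r \<in> span (insert y S)" "r \<notin> span S"
  shows "y \<in> span (insert x S)"
proof -
  have "y \<in> span (insert r S)" using assms in_span_insert by blast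
  also have "\<dots> \<subseteq> span (insert x S)" using assms(1) by (intro span_minimal) (auto intro: span_base)
  finally show ?thesis .
qed

lemma insert_dim_Suc_notin:
  fixes S :: "'v::real_vector set"
  assumes "finite S" "dim (insert x (insert y S)) = dim S + 2"
  shows "x \<notin> span (insert y S)" "y \<notin> span (insert x S)" "x \<notin> span S" "y \<notin> span S"
proof -
  show "x \<notin> span (insert y S)" "y \<notin> span S" using assms by (auto simp: dim_insert_finite split: if_splits)
  show "y \<notin> span (insert x S)" "x \<notin> span S"
    using assms(2) assms(1) unfolding insert_commute[of x y] by (auto simp: dim_insert_finite split: if_splits)
qed

text \<open>A red point can block the hyperplanes off at most one blue point. Otherwise take the
  red-free \<open>S\<close> given by (C3) at \<open>x\<close> and \<open>y\<close>: the hyperplanes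
  of \<open>S\<close> with \<open>x\<close> and of \<open>S\<close> with \<open>y\<close> would both
  contain \<open>r\<close>, which is not in \<open>span S\<close>, and would coincide.\<close>

lemma conf_hyperplane_unique:
  assumes c: "blue_red_conf k B R" and r: "r \<in> R" and xy: "x \<in> B" "y \<in> B" "x \<noteq> y"
    and bad: "\<forall>S\<subseteq>B. dim S = k \<longrightarrow> x \<notin> span S \<longrightarrow> r \<in> span S"
  shows "\<exists>S\<subseteq>B. dim S = k \<and> y \<notin> span S \<and> r \<notin> span S"
proof (rule ccontr)
  assume bad': "\<not> ?thesis"
  have fB: "finite B" using c by (simp add: blue_red_conf_def)
  obtain S where S: "S \<subseteq> B" "dim S + 1 = k" "dim (insert x (insert y S)) = k + 1" "\<forall>r\<in>R. r \<notin> span S"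
    using blue_red_confD(9)[OF c xy] by blast
  have fS: "finite S" using S(1) fB finite_subset by blast
  have n: "x \<notin> span (insert y S)" "y \<notin> span (insert x S)" "x \<notin> span S" "y \<notin> span S"
    using insert_dim_Suc_notin[OF fS, of x y] S by auto
  have "dim (insert y S) = k" "dim (insert x S) = k" using n fS S(2) by (auto simp: dim_insert_finite)
  then have "r \<in> span (insert y S)" "r \<in> span (insert x S)"
    using bad bad' n S(1) xy by (metis insert_subset)+
  then show False using exchange_two[of r x S y] S(4) r n(2) by blast
qed

text \<open>Suppose \<open>r\<close> blocks every hyperplane off \<open>x\<close>, and let
  \<open>C\<close> be a minimal set spanning \<open>x\<close> without using \<open>x\<close>. Some
  hyperplane \<open>S\<close> avoids \<open>r\<close> and an element \<open>w\<close> of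
  \<open>C\<close>, and it contains \<open>x\<close>. Inside it a hyperplane \<open>D\<close> of
  \<open>span S\<close> avoids \<open>x\<close> and contains the part of \<open>C\<close> in
  \<open>S\<close>. All extensions of \<open>D\<close> by points off \<open>S\<close> contain
  \<open>r\<close>, so they coincide; the common one contains \<open>C\<close>, hence
  \<open>x\<close>.\<close>

lemma conf_avoiding_hyperplane:
  assumes c: "blue_red_conf k B R" and r: "r \<in> R" and x: "x \<in> B" "x \<in> span (B - {x})"
  shows "\<exists>S\<subseteq>B. dim S = k \<and> x \<notin> span S \<and> r \<notin> span S"
proof (rule ccontr)
  assume "\<not> ?thesis"
  then have bad: "\<forall>S\<subseteq>B. dim S = k \<longrightarrow> x \<notin> span S \<longrightarrow> r \<in> span S" by blast
  have fB: "finite B" and x0: "x \<noteq> 0" using c x by (auto simp: blue_red_conf_def)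
  let ?G = "{C. C \<subseteq> B - {x} \<and> x \<in> span C}"
  have fG: "finite ?G" using fB by simp
  have inG: "B - {x} \<in> ?G" using x by simp
  obtain C where CG: "C \<in> ?G" and Cm: "\<forall>D\<in>?G. D \<le> C \<longrightarrow> C = D"
    using finite_has_minimal2[OF fG inG] by blast
  have C: "C \<subseteq> B - {x}" "x \<in> span C" using CG by auto
  have Cmin: "D = C" if "D \<subseteq> B - {x}" "x \<in> span D" "D \<subseteq> C" for D
  proof -
    have "D \<in> ?G" using that by simp
    then show ?thesis using Cm that(3) by metis
  qed
  have "C \<noteq> {}" using C(2) x0 by auto
  then obtain w where w: "w \<in> C" by blast
  obtain S where S: "S \<subseteq> B" "dim S = k" "w \<notin> span S" "r \<notin> span S"
    using conf_hyperplane_unique[OF c r x(1), of w] bad w C(1) by blast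
  have xS: "x \<in> span S" using bad S by blast
  define C1 where "C1 = {c\<in>C. c \<in> span S}"
  have "C1 \<subset> C" using w S(3) by (auto simp: C1_def)
  then have xC1: "x \<notin> span C1" using Cmin[of C1] C(1) by auto
  let ?F = "{D. D \<subseteq> B \<inter> span S \<and> C1 \<subseteq> D \<and> x \<notin> span D}"
  have fF: "finite ?F" using fB by simp
  have inF: "C1 \<in> ?F" using xC1 C(1) by (auto simp: C1_def)
  obtain D where DF: "D \<in> ?F" and Dm: "\<forall>D'\<in>?F. D \<le> D' \<longrightarrow> D = D'"
    using finite_has_maximal2[OF fF inF] by blast
  have D: "D \<subseteq> B" "D \<subseteq> span S" "C1 \<subseteq> D" "x \<notin> span D" using DF by auto
  have Dmax: "D = D'" if "D' \<in> ?F" "D \<subseteq> D'" for D' using Dm that by metis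
  have fD: "finite D" using D(1) fB finite_subset by blast
  have "S \<subseteq> span (insert x D)"
  proof
    fix b assume b: "b \<in> S"
    show "b \<in> span (insert x D)"
    proof (cases "b \<in> D")
      case True then show ?thesis by (simp add: span_base)
    next
      case False
      then have "x \<in> span (insert b D)" using Dmax[of "insert b D"] D b S(1) by (auto intro: span_base)
      then show ?thesis using D(4) in_span_insert by blast
    qed
  qed
  then have eqH: "span (insert x D) = span S"
    using xS D(2) by (intro subset_antisym span_minimal) auto
  then have "dim (insert x D) = k" using S(2) span_eq_dim by metis
  then have dD: "dim D + 1 = k" using D(4) fD by (simp add: dim_insert_finite)
  have DS: "span D \<subseteq> span S" using D(2) by (simp add: span_minimal)
  \<comment> \<open>If this extension contained \<open>x\<close>, exchange would put
    \<open>c\<close> into \<open>span (insert x D) = span S\<close>. So it avoids \<open>x\<close>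
    and by assumption contains \<open>r\<close>.\<close>
  have hyp: "r \<in> span (insert c D)" "x \<notin> span (insert c D)" if c: "c \<in> B" "c \<notin> span S" for c
  proof -
    show "x \<notin> span (insert c D)"
    proof
      assume "x \<in> span (insert c D)"
      then have "c \<in> span (insert x D)" using D(4) in_span_insert by blast
      then show False using eqH c(2) by simp
    qed
    moreover have "dim (insert c D) = k" using dD fD c(2) DS by (auto simp: dim_insert_finite)
    ultimately show "r \<in> span (insert c D)" using bad D(1) c(1) by blast
  qed
  have wB: "w \<in> B" using w C(1) by auto
  have "c \<in> span (insert w D)" if "c \<in> C" for c
  proof (cases "c \<in> span S")
    case True
    then have "c \<in> D" using that D(3) by (auto simp: C1_def)
    then show ?thesis by (simp add: span_base)
  next
    case False
    have "c \<in> B" using that C(1) by auto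
    then show ?thesis using exchange_two[of r w D c] hyp[OF wB S(3)] hyp[of c] False S(4) DS by blast
  qed
  then have "span C \<subseteq> span (insert w D)" by (intro span_minimal) auto
  then show False using C(2) hyp(2)[OF wB S(3)] by blast
qed

section \<open>Splitting off the coloops\<close>

lemma coloop_dim:
  fixes B :: "'v::real_vector set"
  assumes "finite B" "X \<subseteq> B" "\<And>x. x \<in> X \<Longrightarrow> x \<notin> span (B - {x})"
  shows "dim B = dim (B - X) + card X"
proof -
  have "finite X" using assms finite_subset by blast
  then show ?thesis using assms(2,3)
  proof (induction X rule: finite_induct)
    case empty then show ?case by simp
  next
    case (insert x X)
    have "x \<notin> span (B - insert x X)" using insert.prems(2)[of x] span_mono[of "B - insert x X" "B - {x}"] by blast
    moreover have "insert x (B - insert x X) = B - X" using insert by auto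
    ultimately have "dim (B - X) = Suc (dim (B - insert x X))"
      using dim_insert_finite[of "B - insert x X" x] assms(1) by simp
    then show ?case using insert by auto
  qed
qed

lemma dim_Un_independent:
  fixes B0 :: "'v::real_vector set"
  assumes "finite B0" "finite X" "dim (B0 \<union> X) = dim B0 + card X"
    and "S \<subseteq> span B0" "finite S" "Y \<subseteq> X"
  shows "dim (S \<union> Y) = dim S + card Y"
proof -
  have fY: "finite Y" using assms finite_subset by blast
  have "dim (B0 \<union> X) \<le> dim (B0 \<union> Y) + card (X - Y)"
  proof -
    have "dim ((B0 \<union> Y) \<union> (X - Y)) \<le> dim (B0 \<union> Y) + dim (X - Y)" using assms fY by (intro dim_Un_le) auto
    moreover have "(B0 \<union> Y) \<union> (X - Y) = B0 \<union> X" using assms by auto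
    moreover have "dim (X - Y) \<le> card (X - Y)" using assms by (intro dim_card_le) auto
    ultimately show ?thesis by simp
  qed
  moreover have "card X = card Y + card (X - Y)" using assms fY by (metis card_Diff_subset card_mono le_add_diff_inverse)
  moreover have "dim (Y \<union> B0) + dim S \<le> dim (Y \<union> S) + dim B0" using assms fY by (intro dim_Un_Diff_le) auto
  moreover have "dim (S \<union> Y) \<le> dim S + card Y" using dim_Un_le[of S Y] dim_card_le[OF fY] assms fY by simp
  ultimately show ?thesis using assms(3) by (simp add: Un_commute)
qed

lemma in_span_Un_independent:
  fixes B0 :: "'v::real_vector set"
  assumes "finite B0" "finite X" "dim (B0 \<union> X) = dim B0 + card X"
    and "S \<subseteq> span B0" "finite S" "Y \<subseteq> X" "u \<in> span B0" "u \<in> span (S \<union> Y)"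
  shows "u \<in> span S"
proof (rule ccontr)
  assume n: "u \<notin> span S"
  have fY: "finite Y" using assms finite_subset by blast
  have "dim (insert u S \<union> Y) = dim (insert u S) + card Y"
    by (rule dim_Un_independent[OF assms(1-3)]) (use assms(4-7) in simp_all)
  moreover have "dim (S \<union> Y) = dim S + card Y"
    by (rule dim_Un_independent[OF assms(1-3)]) (use assms(4-7) in simp_all)
  moreover have "dim (insert u (S \<union> Y)) = dim (S \<union> Y)" using assms(5,8) fY by (simp add: dim_insert_finite)
  ultimately show False using n assms(5) by (simp add: dim_insert_finite)
qed

text \<open>The part of a configuration that survives the removal of the coloops: \<open>h i\<close> are the
  projections of the red points, and the last condition is available for all of them.\<close>

definition core_system :: "nat \<Rightarrow> 'v::real_vector set \<Rightarrow> (nat \<Rightarrow> 'v) \<Rightarrow> nat \<Rightarrow> bool" where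
  "core_system q B h t \<longleftrightarrow> finite B \<and> dim B = q \<and> 0 \<notin> B \<and> (\<forall>x\<in>B. \<forall>y\<in>B. x \<noteq> y \<longrightarrow> y \<notin> span {x}) \<and>
     (\<forall>i<t. h i \<in> span B \<and> h i \<noteq> 0) \<and>
     (\<forall>S\<subseteq>B. dim S + 1 = q \<longrightarrow> (\<exists>i<t. h i \<in> span S)) \<and>
     (\<forall>x\<in>B. \<forall>y\<in>B. x \<noteq> y \<longrightarrow> (\<exists>S\<subseteq>B. dim S + 2 = q \<and> dim (insert x (insert y S)) = q \<and> (\<forall>i<t. h i \<notin> span S))) \<and>
     (\<forall>i<t. \<forall>y\<in>B. \<exists>S\<subseteq>B. dim S + 1 = q \<and> y \<notin> span S \<and> h i \<notin> span S)"

lemma core_systemD: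
  assumes "core_system q B h t"
  shows "finite B" "dim B = q" "0 \<notin> B" "x \<in> B \<Longrightarrow> y \<in> B \<Longrightarrow> x \<noteq> y \<Longrightarrow> y \<notin> span {x}"
    and "i < t \<Longrightarrow> h i \<in> span B" "i < t \<Longrightarrow> h i \<noteq> 0"
    and "S \<subseteq> B \<Longrightarrow> dim S + 1 = q \<Longrightarrow> \<exists>i<t. h i \<in> span S"
    and "x \<in> B \<Longrightarrow> y \<in> B \<Longrightarrow> x \<noteq> y \<Longrightarrow>
      \<exists>S\<subseteq>B. dim S + 2 = q \<and> dim (insert x (insert y S)) = q \<and> (\<forall>i<t. h i \<notin> span S)"
    and "i < t \<Longrightarrow> y \<in> B \<Longrightarrow> \<exists>S\<subseteq>B. dim S + 1 = q \<and> y \<notin> span S \<and> h i \<notin> span S"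
  using assms unfolding core_system_def by simp_all

text \<open>The filler is a generic point in no proper blue subspace: it adds no obstruction to
  (C3), avoids every blue hyperplane, and may be repeated, since the \<open>h i\<close> form a
  family and not a set.\<close>

lemma core_system_extend:
  assumes c: "core_system q B h t" and t: "0 < t" "t \<le> T" and q: "0 < q"
  shows "\<exists>h'. core_system q B h' T"
proof -
  have fB: "finite B" and dB: "dim B = q" using c by (auto simp: core_system_def)
  let ?Q = "span ` {S. S \<subseteq> B \<and> dim S < q}"
  have "\<exists>p\<in>span B. \<forall>Q\<in>?Q. p \<notin> Q"
  proof (rule exists_avoiding_subspaces)
    show "finite ?Q" using fB by simp
    fix Q assume "Q \<in> ?Q"
    then obtain S where S: "S \<subseteq> B" "dim S < q" "Q = span S" by blast
    show "\<not> span B \<subseteq> Q"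
    proof
      assume "span B \<subseteq> Q"
      then have "dim B \<le> dim S" using S fB finite_subset by (intro dim_mono_finite) (auto intro: span_base)
      then show False using dB S by simp
    qed
  qed auto
  then obtain p where p1: "p \<in> span B" and p2: "\<forall>Q\<in>?Q. p \<notin> Q" by (elim bexE)
  have p: "p \<in> span B" "\<And>S. S \<subseteq> B \<Longrightarrow> dim S < q \<Longrightarrow> p \<notin> span S" using p1 p2 by auto
  have p0: "p \<noteq> 0" using p(2)[of "{}"] q by auto
  define h' where "h' = (\<lambda>i. if i < t then h i else p)"
  have "core_system q B h' T" unfolding core_system_def
  proof (intro conjI allI impI ballI)
    fix i assume i: "i < T"
    show "h' i \<in> span B" "h' i \<noteq> 0" using core_systemD(5,6)[OF c] p(1) p0 by (auto simp: h'_def)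
    fix y assume y: "y \<in> B"
    obtain S0 where S0: "S0 \<subseteq> B" "dim S0 + 1 = q" "y \<notin> span S0"
      using core_systemD(9)[OF c t(1) y] by blast
    show "\<exists>S\<subseteq>B. dim S + 1 = q \<and> y \<notin> span S \<and> h' i \<notin> span S"
    proof (cases "i < t")
      case True then show ?thesis using core_systemD(9)[OF c True y] by (simp add: h'_def)
    next
      case False then show ?thesis using S0 p(2)[OF S0(1)] by (auto simp: h'_def)
    qed
  next
    fix S assume "S \<subseteq> B" "dim S + 1 = q"
    then obtain i where "i < t" "h i \<in> span S" using core_systemD(7)[OF c] by blast
    then show "\<exists>i<T. h' i \<in> span S" using t by (intro exI[of _ i]) (simp add: h'_def)
  next
    fix x y assume "x \<in> B" "y \<in> B" "x \<noteq> y"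
    then obtain S where S: "S \<subseteq> B" "dim S + 2 = q" "dim (insert x (insert y S)) = q" "\<forall>i<t. h i \<notin> span S"
      using core_systemD(8)[OF c] by blast
    then have "\<forall>i<T. h' i \<notin> span S" using p(2)[of S] by (auto simp: h'_def)
    then show "\<exists>S\<subseteq>B. dim S + 2 = q \<and> dim (insert x (insert y S)) = q \<and> (\<forall>i<T. h' i \<notin> span S)" using S by blast
  qed (use core_systemD(1-4)[OF c] in blast)+
  then show ?thesis by blast
qed

text \<open>The blue span is the direct sum of \<open>span (B - X)\<close> and
  \<open>span X\<close>; red points are projected along \<open>X\<close>. Subspaces containing all
  coloops correspond to subspaces of the core, and the witnesses of (C3) at two non-coloops are of
  this kind. The last condition of the core comes from
  \<open>conf_avoiding_hyperplane\<close>.\<close>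

lemma core_system_of_conf:
  assumes c: "blue_red_conf k B R" and X: "X = {x\<in>B. x \<notin> span (B - {x})}"
  shows "dim (B - X) + card X = k + 1" "B - X \<noteq> {} \<Longrightarrow> \<exists>h. core_system (dim (B - X)) (B - X) h (card R)"
proof -
  define B0 where "B0 = B - X"
  define q where "q = dim B0"
  have fB: "finite B" and fR: "finite R" and dB: "dim B = k + 1" using c by (auto simp: blue_red_conf_def)
  have XB: "X \<subseteq> B" using X by auto
  have fX: "finite X" "finite B0" using fB XB finite_subset by (auto simp: B0_def)
  have UB: "B0 \<union> X = B" using XB by (auto simp: B0_def)
  have dd: "dim (B0 \<union> X) = dim B0 + card X"
    using coloop_dim[OF fB XB] X UB by (simp add: B0_def)
  show qk: "dim (B - X) + card X = k + 1" using dd UB dB by (simp add: B0_def)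
  have dimSX: "dim (S \<union> X) = dim S + card X" if "S \<subseteq> B0" for S
    using that fX finite_subset by (intro dim_Un_independent[OF fX(2,1) dd]) (auto intro: span_base)
  have qk': "q + card X = k + 1" using qk by (simp add: q_def B0_def)
  have "\<exists>u. u \<in> span B0 \<and> r - u \<in> span X" if "r \<in> R" for r
  proof -
    have "r \<in> span (B0 \<union> X)" using c that UB by (auto simp: blue_red_conf_def)
    then obtain u v where "u \<in> span B0" "v \<in> span X" "r = u + v" unfolding span_Un by auto
    then show ?thesis by (intro exI[of _ u]) auto
  qed
  then obtain pr where pr: "\<And>r. r \<in> R \<Longrightarrow> pr r \<in> span B0" "\<And>r. r \<in> R \<Longrightarrow> r - pr r \<in> span X" by metis
  have prS: "r \<in> span (S \<union> X) \<longleftrightarrow> pr r \<in> span S" if r: "r \<in> R" and S: "S \<subseteq> B0" for r S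
  proof -
    have d: "r - pr r \<in> span (S \<union> X)" using pr(2)[OF r] span_mono[of X "S \<union> X"] by blast
    have "r \<in> span (S \<union> X) \<longleftrightarrow> pr r \<in> span (S \<union> X)"
      using span_diff[OF _ d, of r] span_add[OF _ d, of "pr r"] by auto
    also have "\<dots> \<longleftrightarrow> pr r \<in> span S"
      using in_span_Un_independent[OF fX(2,1) dd, of S X "pr r"] S fX finite_subset pr(1)[OF r] span_mono[of S "S \<union> X"] span_superset[of B0]
      by blast
    finally show ?thesis .
  qed
  obtain g where g: "bij_betw g {0..<card R} R" using ex_bij_betw_nat_finite[OF fR] by blast
  then have gR: "g i \<in> R" if "i < card R" for i using that by (auto simp: bij_betw_def)
  have gs: "\<exists>i<card R. r = g i" if "r \<in> R" for r using g that by (auto simp: bij_betw_def image_iff atLeast0LessThan)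
  define h where "h = (\<lambda>i. pr (g i))"
  \<comment> \<open>A set that spans everything together with two non-coloops must contain every
    coloop.\<close>
  have Xin: "X \<subseteq> S" if S: "S \<subseteq> B" and sp: "dim (insert x (insert y S)) = k + 1" "x \<in> B0" "y \<in> B0" for S x y
  proof (rule ccontr)
    assume "\<not> X \<subseteq> S"
    then obtain z where z: "z \<in> X" "z \<notin> S" by blast
    have "insert x (insert y S) \<subseteq> B - {z}" using S sp z XB by (auto simp: B0_def)
    then have "dim (insert x (insert y S)) \<le> dim (B - {z})" using fB by (intro dim_mono_finite) (auto intro: span_base)
    moreover have "dim B = Suc (dim (B - {z}))"
      using dim_insert_finite[of "B - {z}" z] z X XB fB by (simp add: insert_absorb)
    ultimately show False using sp dB by simp
  qed
  have F3: "\<exists>S\<subseteq>B0. dim S + 1 = q \<and> y \<notin> span S \<and> h i \<notin> span S"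
    if i: "i < card R" and y: "y \<in> B0" for i y
  proof -
    have yB: "y \<in> B" "y \<in> span (B - {y})" using y X by (auto simp: B0_def)
    from conf_avoiding_hyperplane[OF c gR[OF i] yB] obtain S where
      S: "S \<subseteq> B" "dim S = k" "y \<notin> span S" "g i \<notin> span S" by blast
    have fS: "finite S" using S fB finite_subset by blast
    have XS: "X \<subseteq> span S"
    proof
      fix x assume x: "x \<in> X"
      show "x \<in> span S"
      proof (rule ccontr)
        assume n: "x \<notin> span S"
        then have "S \<subseteq> B - {x}" using S(1) by (auto intro: span_base)
        moreover have "dim B = Suc (dim (B - {x}))"
          using dim_insert_finite[of "B - {x}" x] x X XB fB by (simp add: insert_absorb)
        ultimately have "span S = span (B - {x})"
          using S(2) dB fB fS by (intro span_eq_of_dim_ge) (auto intro: span_base)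
        then show False using S(3) yB(1) x y by (auto simp: B0_def intro: span_base)
      qed
    qed
    define S0 where "S0 = B0 \<inter> span S"
    have eq: "span (S0 \<union> X) = span S"
      using XS S(1) UB by (intro subset_antisym span_minimal) (auto simp: S0_def intro: span_base)
    then have "dim S0 + card X = k" using dimSX[of S0] S(2) span_eq_dim by (metis S0_def inf_le1)
    then have "dim S0 + 1 = q" using qk' by simp
    moreover have "y \<notin> span S0" using S(3) eq span_mono[of S0 "S0 \<union> X"] by blast
    moreover have "h i \<notin> span S0" using prS[OF gR[OF i], of S0] S(4) eq by (simp add: S0_def h_def)
    ultimately show ?thesis by (metis S0_def inf_le1)
  qed
  have "core_system q B0 h (card R)" if ne: "B0 \<noteq> {}"
    unfolding core_system_def
  proof (intro conjI allI impI ballI)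
    show "finite B0" "dim B0 = q" "0 \<notin> B0" using fX c by (auto simp: q_def B0_def blue_red_conf_def)
    show "y \<notin> span {x}" if "x \<in> B0" "y \<in> B0" "x \<noteq> y" for x y
      using c that by (auto simp: blue_red_conf_def B0_def)
  next
    fix S assume S: "S \<subseteq> B0" "dim S + 1 = q"
    then have "dim (S \<union> X) = k" using dimSX qk' by simp
    moreover have "S \<union> X \<subseteq> B" using S UB by auto
    ultimately obtain r where r: "r \<in> R" "r \<in> span (S \<union> X)" using blue_red_confD(8)[OF c] by blast
    then have "pr r \<in> span S" using prS S by blast
    moreover obtain i where "i < card R" "r = g i" using gs[OF r(1)] by blast
    ultimately show "\<exists>i<card R. h i \<in> span S" by (auto simp: h_def)
  next
    fix x y assume xy: "x \<in> B0" "y \<in> B0" "x \<noteq> y"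
    then obtain S where S: "S \<subseteq> B" "dim S + 1 = k" "dim (insert x (insert y S)) = k + 1" "\<forall>r\<in>R. r \<notin> span S"
      using blue_red_confD(9)[OF c, of x y] by (auto simp: B0_def)
    have XS: "X \<subseteq> S" using Xin[OF S(1,3) xy(1,2)] .
    define S0 where "S0 = S - X"
    have S0: "S0 \<subseteq> B0" "S = S0 \<union> X" using S XS by (auto simp: S0_def B0_def)
    have "dim S0 + 2 = q" using dimSX[OF S0(1)] S0(2) S(2) qk' by simp
    moreover have "insert x (insert y S) = insert x (insert y S0) \<union> X" using S0 by auto
    then have "dim (insert x (insert y S0)) = q"
      using dimSX[of "insert x (insert y S0)"] S0(1) xy S(3) qk' by simp
    moreover have "\<forall>i<card R. h i \<notin> span S0" using S(4) prS[OF gR S0(1)] S0(2) gR by (auto simp: h_def)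
    ultimately show "\<exists>S\<subseteq>B0. dim S + 2 = q \<and> dim (insert x (insert y S)) = q \<and> (\<forall>i<card R. h i \<notin> span S)"
      using S0(1) by blast
  next
    fix i y assume "i < card R" "y \<in> B0"
    then show "\<exists>S\<subseteq>B0. dim S + 1 = q \<and> y \<notin> span S \<and> h i \<notin> span S" by (rule F3)
  next
    fix i assume i: "i < card R"
    show "h i \<in> span B0" using pr gR[OF i] by (simp add: h_def)
    obtain y where "y \<in> B0" using ne by blast
    then show "h i \<noteq> 0" using F3[OF i] span_zero by metis
  qed
  then show "B - X \<noteq> {} \<Longrightarrow> \<exists>h. core_system (dim (B - X)) (B - X) h (card R)" by (auto simp: q_def B0_def)
qed

type_synonym rvec = "nat \<Rightarrow>\<^sub>0 real"

section \<open>Rebuilding a configuration from its core with a prescribed number of coloops\<close>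

lemma exists_outside_span:
  fixes S :: "rvec set"
  assumes "finite S"
  shows "\<exists>v. v \<notin> span S"
proof -
  define N where "N = Suc (Max (insert 0 (\<Union>x\<in>S. Poly_Mapping.keys x)))"
  have N: "Poly_Mapping.lookup x N = 0" if "x \<in> S" for x
  proof (rule ccontr)
    assume "Poly_Mapping.lookup x N \<noteq> 0"
    then have "N \<in> insert 0 (\<Union>x\<in>S. Poly_Mapping.keys x)" using that by (auto simp: in_keys_iff)
    then have "N \<le> Max (insert 0 (\<Union>x\<in>S. Poly_Mapping.keys x))" using assms by (intro Max_ge) auto
    then show False by (simp add: N_def)
  qed
  have "Poly_Mapping.lookup x N = 0" if "x \<in> span S" for x
    using that
  proof (induction rule: span_induct_alt)
    case base then show ?case by simp
  next
    case (step c x y)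
    then show ?case using N by (simp add: lookup_add scaleR_poly_mapping_def)
  qed
  moreover have "Poly_Mapping.lookup (Poly_Mapping.single N 1 :: rvec) N \<noteq> 0" by simp
  ultimately show ?thesis by metis
qed

lemma exists_independent_over:
  fixes S :: "rvec set"
  assumes "finite S"
  shows "\<exists>X. finite X \<and> card X = s \<and> dim (S \<union> X) = dim S + s \<and> X \<inter> S = {}"
proof (induction s)
  case 0 then show ?case by (intro exI[of _ "{}"]) simp
next
  case (Suc s)
  then obtain X where X: "finite X" "card X = s" "dim (S \<union> X) = dim S + s" "X \<inter> S = {}" by blast
  obtain v where v: "v \<notin> span (S \<union> X)" using exists_outside_span[of "S \<union> X"] assms X by auto
  have "v \<notin> S \<union> X" using v span_base by blast
  moreover have "dim (insert v (S \<union> X)) = Suc (dim (S \<union> X))" using v assms X by (simp add: dim_insert_finite)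
  ultimately show ?case using X by (intro exI[of _ "insert v X"]) auto
qed

lemma exists_coordinates:
  fixes B0 :: "'v::real_vector set"
  assumes B0: "finite B0" and X: "finite X" and d: "dim (B0 \<union> X) = dim B0 + card X"
  shows "\<exists>f :: 'v \<Rightarrow> 'v \<Rightarrow> real. \<forall>x\<in>X. linear (f x) \<and> (\<forall>u\<in>span B0. f x u = 0) \<and> (\<forall>y\<in>X. f x y = (if x = y then 1 else 0))"
proof -
  obtain C where C: "C \<subseteq> B0" "independent C" "B0 \<subseteq> span C" using maximal_independent_subset[of B0] by blast
  have sC: "span C = span B0" using C span_eq_of_subsets by metis
  have XC: "x \<notin> span (C \<union> (X - {x}))" if "x \<in> X" for x
  proof
    assume "x \<in> span (C \<union> (X - {x}))"
    then have "x \<in> span (B0 \<union> (X - {x}))" using span_mono[of "C \<union> (X - {x})" "B0 \<union> (X - {x})"] C(1) by blast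
    moreover have "insert x (B0 \<union> (X - {x})) = B0 \<union> X" using that by auto
    ultimately have "dim (B0 \<union> X) = dim (B0 \<union> (X - {x}))"
      using dim_insert_finite[of "B0 \<union> (X - {x})" x] B0 X by simp
    also have "\<dots> \<le> dim B0 + card (X - {x})" using dim_Un_le[of B0 "X - {x}"] dim_card_le[of "X - {x}"] B0 X by simp
    also have "card (X - {x}) < card X" using that X by (metis card_Diff1_less)
    finally show False using d by simp
  qed
  have ind: "independent (C \<union> X)"
  proof
    assume "dependent (C \<union> X)"
    have "dim (C \<union> X) = dim C + card X"
      using dim_Un_independent[OF B0 X d, of C X] C(1) B0 finite_subset span_superset by blast
    moreover have "dim C = card C" using C(2) by (rule dim_eq_card_independent)
    moreover have "card (C \<union> X) \<le> card C + card X" by (rule card_Un_le)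
    ultimately have "card (C \<union> X) \<le> dim (C \<union> X)" by simp
    moreover obtain D where D: "D \<subseteq> C \<union> X" "independent D" "C \<union> X \<subseteq> span D" "card D = dim (C \<union> X)"
      using basis_exists by metis
    have "finite (C \<union> X)" using C(1) B0 X finite_subset by blast
    ultimately have "D = C \<union> X" using D by (metis card_seteq)
    then show False using D(2) \<open>dependent (C \<union> X)\<close> by simp
  qed
  have XnC: "x \<notin> C" if "x \<in> X" for x using XC[OF that] by (auto intro: span_base)
  have "\<exists>f :: 'v \<Rightarrow> real. linear f \<and> (\<forall>u\<in>span B0. f u = 0) \<and> (\<forall>y\<in>X. f y = (if x = y then 1 else 0))" if x: "x \<in> X" for x
  proof -
    obtain f :: "'v \<Rightarrow> real" where f: "linear f" "\<forall>y\<in>C \<union> X. f y = (if x = y then 1 else 0)"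
      using linear_independent_extend[OF ind, of "\<lambda>y. if x = y then 1 else 0"] by blast
    have "f u = 0" if "u \<in> span C" for u
      using that
    proof (induction rule: span_induct_alt)
      case base then show ?case using linear_0[OF f(1)] by simp
    next
      case (step c u v)
      then show ?case using f XnC[OF x] by (auto simp: linear_add linear_scale)
    qed
    then show ?thesis using f sC by blast
  qed
  then show ?thesis by metis
qed

lemma linear_vanishes_on_span:
  fixes f :: "'v::real_vector \<Rightarrow> real"
  assumes "linear f" "\<And>x. x \<in> S \<Longrightarrow> f x = 0" "u \<in> span S"
  shows "f u = 0"
  using assms(3)
proof (induction rule: span_induct_alt)
  case base then show ?case using linear_0[OF assms(1)] by simp
next
  case (step c u v) then show ?case using assms by (auto simp: linear_add linear_scale)
qed

text \<open>Adding a coloop \<open>b m\<close> for \<open>m < s\<close> and lifting \<open>h i\<close> generically, except that its \<open>b i\<close>-coordinate stays zero.\<close>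

lemma conf_of_core_system:
  fixes B :: "rvec set"
  assumes c: "core_system q B h T" and s: "q + s = K + 1" "2 \<le> s" "s \<le> T" and q: "0 < q"
  shows "\<exists>(B' :: rvec set) R'. blue_red_conf K B' R' \<and> card R' = T \<and> card B' = card B + s"
proof -
  note C = core_systemD[OF c]
  obtain X where X: "finite X" "card X = s" "dim (B \<union> X) = dim B + s" "X \<inter> B = {}"
    using exists_independent_over[OF C(1)] by blast
  have dX: "dim (B \<union> X) = dim B + card X" using X by simp
  obtain b where b: "bij_betw b {0..<s} X" using ex_bij_betw_nat_finite[OF X(1)] X(2) by blast
  have bX: "b m \<in> X" if "m < s" for m using b that by (auto simp: bij_betw_def)
  have Xb: "\<exists>m<s. x = b m" if "x \<in> X" for x using b that by (auto simp: bij_betw_def image_iff atLeast0LessThan)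
  have binj: "b m = b l \<longleftrightarrow> m = l" if "m < s" "l < s" for m l using b that by (auto simp: bij_betw_def inj_on_def)
  obtain f :: "rvec \<Rightarrow> rvec \<Rightarrow> real" where f: "\<forall>x\<in>X. linear (f x) \<and> (\<forall>u\<in>span B. f x u = 0) \<and> (\<forall>y\<in>X. f x y = (if x = y then 1 else 0))"
    using exists_coordinates[OF C(1) X(1) dX] by blast
  define F where "F = (\<lambda>m. f (b m))"
  have Flin: "linear (F m)" if "m < s" for m using f bX[OF that] by (simp add: F_def)
  have FB: "F m u = 0" if "m < s" "u \<in> span B" for m u using f bX[OF that(1)] that by (simp add: F_def)
  have Fb: "F m (b l) = (if m = l then 1 else 0)" if "m < s" "l < s" for m l
    using f bX that binj[OF that] by (simp add: F_def)
  \<comment> \<open>The zero at \<open>i = m\<close> puts the red point \<open>i\<close> into the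
    hyperplane complementary to the coloop \<open>b i\<close>; \<open>s \<le> T\<close> provides one
    for every coloop. The value \<open>i + 1\<close> in coordinate 1 keeps different red points from
    being parallel, and \<open>2 \<le> s\<close> leaves a nonzero coordinate for each.\<close>
  define co where "co = (\<lambda>i m. if i = m then 0 else if m = 1 then real i + 1 else 1 :: real)"
  define red where "red = (\<lambda>i. h i + (\<Sum>m<s. co i m *\<^sub>R b m))"
  have Fred: "F l (red i) = co i l" if "l < s" "i < T" for l i
  proof -
    have "F l (red i) = F l (h i) + (\<Sum>m<s. co i m * F l (b m))"
      using Flin[OF that(1)] by (simp add: red_def linear_add linear_sum linear_scale)
    also have "(\<Sum>m<s. co i m * F l (b m)) = (\<Sum>m<s. if m = l then co i m else 0)"
      using Fb[OF that(1)] by (intro sum.cong) auto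
    finally show ?thesis using FB[OF that(1) C(5)[OF that(2)]] that by simp
  qed
  have co: "\<exists>m<s. co i m \<noteq> 0" for i
  proof (cases "i = 0")
    case True then show ?thesis using s(2) by (intro exI[of _ 1]) (simp add: co_def)
  next
    case False then show ?thesis using s(2) by (intro exI[of _ 0]) (simp add: co_def)
  qed
  have redX: "red i - h i \<in> span X" for i
    unfolding red_def using bX by (auto intro!: span_sum span_scale intro: span_base)
  have hX: "h i \<notin> span X" if "i < T" for i
  proof
    assume "h i \<in> span X"
    then have "h i \<in> span {}"
      using in_span_Un_independent[OF C(1) X(1) dX, of "{}" X "h i"] C(5)[OF that] by simp
    then show False using C(6)[OF that] by simp
  qed
  let ?B = "B \<union> X" and ?R = "red ` {..<T}"
  have fB': "finite ?B" using C(1) X(1) by simp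
  have hspan: "h i \<in> span S" if i: "i < T" and S: "S \<subseteq> B" and r: "red i \<in> span (S \<union> X')" and X': "X' \<subseteq> X" for i S X'
  proof -
    have "red i \<in> span (S \<union> X)" using r X' span_mono[of "S \<union> X'" "S \<union> X"] by blast
    moreover have "red i - h i \<in> span (S \<union> X)" using redX[of i] span_mono[of X "S \<union> X"] by blast
    ultimately have "red i - (red i - h i) \<in> span (S \<union> X)" by (rule span_diff)
    then show ?thesis using in_span_Un_independent[OF C(1) X(1) dX, of S X "h i"] S C(5)[OF i] C(1) finite_subset[OF S] span_superset[of B]
      by simp
  qed
  have coord: "F m u = 0" if "m < s" "u \<in> span (S \<union> X')" "S \<subseteq> B" "X' \<subseteq> X - {b m}" for m u S X'
  proof (rule linear_vanishes_on_span[OF Flin[OF that(1)] _ that(2)])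
    fix x assume "x \<in> S \<union> X'"
    then show "F m x = 0"
    proof
      assume "x \<in> S" then show ?thesis using FB that(1,3) by (auto intro: span_base)
    next
      assume "x \<in> X'"
      then have x: "x \<in> X" "x \<noteq> b m" using that(4) by auto
      then obtain l where "l < s" "x = b l" using Xb by blast
      then show ?thesis using Fb[OF that(1)] x(2) by auto
    qed
  qed
  have dimSX: "dim (S \<union> Y) = dim S + card Y" if "S \<subseteq> B" "Y \<subseteq> X" for S Y
    using dim_Un_independent[OF C(1) X(1) dX, of S Y] that finite_subset[OF that(1) C(1)] span_superset[of B] by blast
  have scal: "\<exists>a. v = a *\<^sub>R u" if "v \<in> span {u}" for u v :: rvec using that by (auto simp: span_singleton)
  have Fs: "F m (a *\<^sub>R u) = a * F m u" if "m < s" for m a u using Flin[OF that] by (simp add: linear_scale)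
  have notpar: "v \<notin> span {u}"
    if uv: "u \<in> ?B \<union> ?R" "v \<in> ?B \<union> ?R" "u \<noteq> v" for u v
  proof
    assume "v \<in> span {u}"
    then obtain a where a: "v = a *\<^sub>R u" using scal by blast
    have a0: "a \<noteq> 0"
    proof
      assume "a = 0"
      then have v0: "v = 0" using a by simp
      show False using uv(2)
      proof (elim UnE)
        assume "v \<in> B" then show False using C(3) v0 by simp
      next
        assume "v \<in> X" then obtain m where "m < s" "v = b m" using Xb by blast
        then show False using Fb[of m m] v0 Flin[of m] by (simp add: linear_0)
      next
        assume "v \<in> ?R" then obtain i where i: "i < T" "v = red i" by auto
        obtain m where "m < s" "co i m \<noteq> 0" using co by blast
        then show False using Fred[of m i] i v0 Flin[of m] by (simp add: linear_0)
      qed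
    qed
    have Fa: "F m v = a * F m u" if "m < s" for m using Fs[OF that] a by simp
    have typeB: "F m w = 0" if "w \<in> B" "m < s" for w m using FB that by (auto intro: span_base)
    have mixed: False if w: "w \<in> X" "w' \<in> ?R" "w' = c *\<^sub>R w" for w w' c
    proof -
      obtain i where i: "i < T" "w' = red i" using w(2) by auto
      have "red i \<in> span X" using w i by (auto intro: span_scale span_base)
      then have "red i - (red i - h i) \<in> span X" using redX by (rule span_diff)
      then show False using hX[OF i(1)] by simp
    qed
    have u': "u = (1 / a) *\<^sub>R v" using a a0 by simp
    show False
    proof (cases "u \<in> B")
      case u: True
      show False
      proof (cases "v \<in> B")
        case True then show False using C(4)[OF u True uv(3)] \<open>v \<in> span {u}\<close> by simp
      next
        case False
        have "\<exists>m<s. F m v \<noteq> 0"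
        proof (cases "v \<in> X")
          case True then show ?thesis using Xb Fb by (metis zero_neq_one)
        next
          case vr: False
          then obtain i where "i < T" "v = red i" using uv(2) False by auto
          then show ?thesis using co[of i] Fred by auto
        qed
        then show False using Fa typeB[OF u] by auto
      qed
    next
      case u: False
      show False
      proof (cases "u \<in> X")
        case uX: True
        then obtain m where m: "m < s" "u = b m" using Xb by blast
        show False
        proof (cases "v \<in> X")
          case True
          then obtain l where l: "l < s" "v = b l" using Xb by blast
          have "l \<noteq> m" using l m uv(3) by auto
          then show False using Fa[OF l(1)] Fb[OF l(1) l(1)] Fb[OF l(1) m(1)] m l by simp
        next
          case vX: False
          show False
          proof (cases "v \<in> B")
            case True then show False using Fa[OF m(1)] Fb[OF m(1) m(1)] m typeB[OF True m(1)] a0 by simp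
          next
            case False then show False using mixed[OF uX _ a] vX uv(2) by auto
          qed
        qed
      next
        case uX: False
        then obtain i where i: "i < T" "u = red i" using u uv(1) by auto
        obtain m where m: "m < s" "co i m \<noteq> 0" using co by blast
        show False
        proof (cases "v \<in> B")
          case True then show False using Fa[OF m(1)] Fred[OF m(1) i(1)] i m typeB[OF True m(1)] a0 by simp
        next
          case vB: False
          show False
          proof (cases "v \<in> X")
            case True then show False using mixed[OF True _ u'] i by auto
          next
            case False
            then obtain j where j: "j < T" "v = red j" using vB uv(2) by auto
            have ij: "i \<noteq> j" using i j uv(3) by auto
            have e: "co j m = a * co i m" if "m < s" for m using Fa[OF that] Fred[OF that] i j by simp
            have c0: "i = 0 \<or> co i 0 = 1" "co i i = 0" "co j j = 0" "i \<noteq> 1 \<Longrightarrow> co i 1 = real i + 1" "j \<noteq> 1 \<Longrightarrow> co j 1 = real j + 1"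
              "j = 0 \<or> co j 0 = 1" "co j i \<noteq> 0" "co i j \<noteq> 0"
              using ij by (auto simp: co_def)
            have "\<not> i < s" using e[of i] c0 by auto
            moreover have "\<not> j < s" using e[of j] c0 a0 by auto
            ultimately show False using e[of 0] e[of 1] c0 s(2) ij by auto
          qed
        qed
      qed
    qed
  qed
  have redspan: "red i \<in> span (B \<union> (X - {b i}))" if "i < T" "i < s" for i
  proof -
    have "red i = h i + (\<Sum>m\<in>{..<s} - {i}. co i m *\<^sub>R b m)"
      unfolding red_def using that by (subst sum.remove[of _ i]) (auto simp: co_def)
    also have "\<dots> \<in> span (B \<union> (X - {b i}))"
    proof (intro span_add span_sum span_scale)
      show "h i \<in> span (B \<union> (X - {b i}))" using C(5)[OF that(1)] span_mono[of B "B \<union> (X - {b i})"] by blast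
      show "b m \<in> span (B \<union> (X - {b i}))" if "m \<in> {..<s} - {i}" for m
        using bX[of m] binj[of m i] that \<open>i < s\<close> by (auto intro: span_base)
    qed
    finally show ?thesis .
  qed
  have inX: "red i \<notin> ?B" if "i < T" for i
  proof
    assume "red i \<in> ?B"
    obtain m where m: "m < s" "co i m \<noteq> 0" using co by blast
    from \<open>red i \<in> ?B\<close> show False
    proof
      assume "red i \<in> B"
      from FB[OF m(1) span_base[OF this]] show False using Fred[OF m(1) that] m(2) by simp
    next
      assume "red i \<in> X"
      from span_diff[OF span_base[OF this] redX[of i]] show False using hX[OF that] by simp
    qed
  qed
  have "blue_red_conf K ?B ?R" unfolding blue_red_conf_def
  proof (intro conjI ballI allI impI)
    show "finite ?B" "finite ?R" using fB' by auto
    show "dim ?B = K + 1" using X C(2) s by simp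
    show "?R \<subseteq> span ?B"
    proof
      fix r assume "r \<in> ?R"
      then obtain i where i: "i < T" "r = red i" by auto
      have "h i \<in> span ?B" "red i - h i \<in> span ?B" using C(5)[OF i(1)] redX[of i] span_mono[of B ?B] span_mono[of X ?B] by blast+
      then have "h i + (red i - h i) \<in> span ?B" by (rule span_add)
      then show "r \<in> span ?B" using i by simp
    qed
    show "?B \<inter> ?R = {}" using inX by auto
    show "0 \<notin> ?B \<union> ?R"
    proof
      assume z: "0 \<in> ?B \<union> ?R"
      obtain x where "x \<in> X" using s X by fastforce
      moreover then have "x \<noteq> 0" using Xb Fb Flin linear_0 by (metis zero_neq_one)
      ultimately have "0 \<notin> span {x}" using notpar[of x 0] z by auto
      then show False by (simp add: span_zero)
    qed
    show "v \<notin> span {u}" if "u \<in> ?B \<union> ?R" "v \<in> ?B \<union> ?R" "u \<noteq> v" for u v using notpar that by blast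
  next
    fix S assume S: "S \<subseteq> ?B" "dim S = K"
    show "\<exists>r\<in>?R. r \<in> span S"
    proof (cases "X \<subseteq> S")
      case True
      then have eq: "S = (S \<inter> B) \<union> X" using S(1) by auto
      then have "dim (S \<inter> B) + s = K" using dimSX[of "S \<inter> B" X] S(2) X(2) by simp
      then obtain i where i: "i < T" "h i \<in> span (S \<inter> B)" using C(7)[of "S \<inter> B"] s by auto
      have "h i \<in> span S" "red i - h i \<in> span S" using i(2) redX[of i] span_mono[of "S \<inter> B" S] span_mono[OF True] by blast+
      then have "h i + (red i - h i) \<in> span S" by (rule span_add)
      then show ?thesis using i by auto
    next
      case False
      then obtain m where m: "m < s" "b m \<notin> S" using Xb by blast
      have sub: "S \<subseteq> B \<union> (X - {b m})" using S(1) m by auto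
      have "dim (B \<union> (X - {b m})) = q + (s - 1)" using dimSX[of B "X - {b m}"] C(2) X bX[OF m(1)] by simp
      then have "span S = span (B \<union> (X - {b m}))"
        using S(2) s sub C(1) X(1) finite_subset[OF S(1) fB'] by (intro span_eq_of_dim_ge) (auto intro: span_base)
      then show ?thesis using redspan[of m] m s by auto
    qed
  next
    fix x y assume x: "x \<in> ?B" and y: "y \<in> ?B" and xy: "x \<noteq> y"
    \<comment> \<open>For a core point \<open>x\<close> and a coloop \<open>b m\<close>, only the
      red point \<open>m\<close> has a vanishing \<open>b m\<close>-coordinate. Its projection
      \<open>h m\<close> is avoided together with \<open>x\<close> by the last condition of the
      core.\<close>
    have case_BX: "\<exists>S\<subseteq>?B. dim S + 1 = K \<and> dim (insert x (insert y S)) = K + 1 \<and> (\<forall>r\<in>?R. r \<notin> span S)"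
      if x: "x \<in> B" and y: "y \<in> X" for x y
    proof -
      obtain m where m: "m < s" "y = b m" using Xb[OF y] by blast
      obtain S where S: "S \<subseteq> B" "dim S + 1 = q" "x \<notin> span S" "h m \<notin> span S" using C(9)[of m x] m s x by auto
      let ?S = "S \<union> (X - {b m})"
      have "dim ?S + 1 = q + (s - 1)" using dimSX[of S "X - {b m}"] S X bX[OF m(1)] by simp
      then have 1: "dim ?S + 1 = K" using s by simp
      have "insert x (insert y ?S) = insert x S \<union> X" using m bX[OF m(1)] by auto
      moreover have "dim (insert x S) = q" using S C(1) finite_subset[OF S(1)] by (simp add: dim_insert_finite)
      ultimately have 2: "dim (insert x (insert y ?S)) = K + 1" using dimSX[of "insert x S" X] S x X s by simp
      have 3: "red i \<notin> span ?S" if i: "i < T" for i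
      proof
        assume r: "red i \<in> span ?S"
        then have "co i m = 0" using coord[OF m(1) r S(1)] Fred[OF m(1) i] by simp
        then have "i = m" by (auto simp: co_def split: if_splits)
        then show False using hspan[OF i S(1) r] S(4) by auto
      qed
      show ?thesis using 1 2 3 S(1) by (intro exI[of _ ?S]) auto
    qed
    show "\<exists>S\<subseteq>?B. dim S + 1 = K \<and> dim (insert x (insert y S)) = K + 1 \<and> (\<forall>r\<in>?R. r \<notin> span S)"
    proof (cases "x \<in> B")
      case xB: True
      show ?thesis
      proof (cases "y \<in> B")
        case yB: True
        obtain S where S: "S \<subseteq> B" "dim S + 2 = q" "dim (insert x (insert y S)) = q" "\<forall>i<T. h i \<notin> span S"
          using C(8)[OF xB yB xy] by blast
        have "dim (S \<union> X) + 1 = K" using dimSX[of S X] S X s by simp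
        moreover have "dim (insert x (insert y (S \<union> X))) = K + 1"
          using dimSX[of "insert x (insert y S)" X] S X s xB yB by simp
        moreover have "red i \<notin> span (S \<union> X)" if "i < T" for i using hspan[OF that S(1), of X] S(4) that by blast
        ultimately show ?thesis using S(1) by (intro exI[of _ "S \<union> X"]) auto
      next
        case False then show ?thesis using case_BX xB y by blast
      qed
    next
      case xX: False
      show ?thesis
      proof (cases "y \<in> B")
        case True then show ?thesis using case_BX[of y x] xX x by (simp add: insert_commute)
      next
        case False
        then obtain m l where m: "m < s" "x = b m" and l: "l < s" "y = b l" using xX x y Xb by (metis UnE)
        have ml: "m \<noteq> l" using m l xy by auto
        let ?S = "B \<union> (X - {x, y})"
        have xyX: "x \<in> X" "y \<in> X" using m l bX by auto
        have "card (X - {x, y}) + 2 = s" using xyX xy X by (simp add: card_Diff_subset card_insert_if) (metis One_nat_def Suc_1 Suc_diff_le diff_Suc_1 le_antisym s(2) add_2_eq_Suc' le_add_diff_inverse2)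
        then have "dim ?S + 1 = K" using dimSX[of B "X - {x, y}"] C(2) s by auto
        moreover have "insert x (insert y ?S) = ?B" using xyX by auto
        then have "dim (insert x (insert y ?S)) = K + 1" using X C(2) s by simp
        moreover have "red i \<notin> span ?S" if i: "i < T" for i
        proof
          assume r: "red i \<in> span ?S"
          have "co i m = 0" using coord[OF m(1) r] Fred[OF m(1) i] m by auto
          moreover have "co i l = 0" using coord[OF l(1) r] Fred[OF l(1) i] l by auto
          ultimately show False using ml by (auto simp: co_def split: if_splits)
        qed
        ultimately show ?thesis by (intro exI[of _ ?S]) auto
      qed
    qed
  qed
  moreover have "card ?R = T"
  proof -
    have "inj_on red {..<T}"
    proof (rule inj_onI)
      fix i j assume ij: "i \<in> {..<T}" "j \<in> {..<T}" "red i = red j"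
      have "co i m = co j m" if "m < s" for m using Fred[OF that] ij by (metis lessThan_iff)
      from this[of 0] this[of 1] this[of i] this[of j] show "i = j" using s(2) by (auto simp: co_def split: if_splits)
    qed
    then show ?thesis by (simp add: card_image)
  qed
  moreover have "card ?B = card B + s" using X C(1) by (subst card_Un_disjoint) auto
  ultimately show ?thesis by blast
qed

text \<open>Four vectors with sum 0, any three of them independent, and the three sums of two of them: a
  quadrangle and its diagonal points.\<close>

lemma core_system_quadrangle: "\<exists>(B :: rvec set) h. core_system 3 B h 3 \<and> card B = 4"
proof -
  obtain X :: "rvec set" where X: "finite X" "card X = 3" "dim X = 3"
    using exists_independent_over[of "{}" 3] by auto
  obtain u v w where uvw: "X = {u, v, w}" "u \<noteq> v" "u \<noteq> w" "v \<noteq> w" using X(2) by (auto simp: card_3_iff)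
  have le2: "dim {a, b} \<le> 2" for a b :: rvec
    using dim_card_le[of "{a, b}"] by (simp add: card_insert_if split: if_splits)
  have ind: "u \<notin> span {v, w}" "w \<notin> span {u, v}"
    using X(3) uvw(1) le2[of v w] le2[of u v] dim_insert_finite[of "{v, w}" u] dim_insert_finite[of "{u, v}" w]
    by (auto simp: insert_commute)
  define z where "z = - (u + v + w)"
  define B where "B = {u, v, w, z}"
  define h where "h = (\<lambda>i::nat. if i = 0 then u + v else if i = 1 then u + w else v + w)"
  have comb: "- (a + b + c) \<in> span {a, b, c}" for a b c :: rvec
    by (intro span_neg span_add span_base) auto
  have s0: "u + v + w + z = 0" by (simp add: z_def)
  have z: "z \<noteq> u" "z \<noteq> v" "z \<noteq> w"
  proof -
    have "w = - (u + u + v)" if "z = u" unfolding eq_neg_iff_add_eq_0 using s0 that by (simp add: add_ac)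
    then show "z \<noteq> u" using ind(2) comb[of u u v] by auto
    have "w = - (u + v + v)" if "z = v" unfolding eq_neg_iff_add_eq_0 using s0 that by (simp add: add_ac)
    then show "z \<noteq> v" using ind(2) comb[of u v v] by auto
    have "u = - (v + w + w)" if "z = w" unfolding eq_neg_iff_add_eq_0 using s0 that by (simp add: add_ac)
    then show "z \<noteq> w" using ind(1) comb[of v w w] by auto
  qed
  have B: "finite B" "card B = 4" "\<Sum>B = 0" using uvw(2-4) z by (auto simp: B_def z_def)
  have dB: "dim B = 3"
  proof -
    have "z \<in> span {u, v, w}" unfolding z_def by (rule comb)
    then have "span {u, v, w} = span B" by (intro span_eq_of_subsets) (auto simp: B_def intro: span_base)
    then show ?thesis using X(3) uvw(1) span_eq_dim by metis
  qed
  \<comment> \<open>If one of three vectors depended on the other two, the fourth, being minus the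
    sum of the three, would lie in their span as well, and the rank would be at most 2.\<close>
  have tri: "a \<notin> span {b, c}" if abc: "a \<in> B" "b \<in> B" "c \<in> B" "a \<noteq> b" "a \<noteq> c" "b \<noteq> c" for a b c
  proof
    assume a: "a \<in> span {b, c}"
    have sub: "{a, b, c} \<subseteq> B" using abc by auto
    have "card (B - {a, b, c}) = 1" using B(1,2) sub abc(4-6) by (simp add: card_Diff_subset)
    then obtain d where d: "B - {a, b, c} = {d}" by (auto simp: card_1_singleton_iff)
    have "d + (a + b + c) = 0"
      using sum.subset_diff[OF sub B(1), of "\<lambda>x. x"] d abc(4-6) B(3) by (simp add: add.assoc)
    then have "d = - (a + b + c)" by (simp only: eq_neg_iff_add_eq_0)
    then have "d \<in> span {b, c}" using a by (auto intro!: span_neg span_add intro: span_base simp del: minus_add_distrib)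
    moreover have "B = {a, b, c, d}" using d sub by auto
    ultimately have "dim B \<le> dim {b, c}" using a by (intro dim_mono_finite) (auto intro: span_base)
    then show False using dB le2[of b c] by simp
  qed
  have third: "\<exists>a\<in>B. a \<noteq> x \<and> a \<noteq> y" for x y
  proof -
    have "card {x, y} \<le> 2" by (simp add: card_insert_if)
    then have "\<not> B \<subseteq> {x, y}" using card_mono[of "{x, y}" B] B(2) by auto
    then show ?thesis by auto
  qed
  have par: "y \<notin> span {x}" if xy: "x \<in> B" "y \<in> B" "x \<noteq> y" for x y
  proof -
    obtain a where "a \<in> B" "a \<noteq> x" "a \<noteq> y" using third by blast
    then have "y \<notin> span {x, a}" using xy by (intro tri) auto
    then show ?thesis using span_mono[of "{x}" "{x, a}"] by auto
  qed
  have nz: "x \<noteq> 0" if x: "x \<in> B" for x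
  proof -
    obtain y where "y \<in> B" "y \<noteq> x" using third by blast
    then have "x \<notin> span {y}" using x by (intro par) auto
    then show ?thesis using span_zero by metis
  qed
  have d1: "dim {x} = 1" if "x \<in> B" for x using nz[OF that] dim_insert_finite[of "{}" x] by simp
  have d2: "dim {y, x} = 2" if "x \<in> B" "y \<in> B" "x \<noteq> y" for x y
    using par[OF that] d1[OF that(1)] dim_insert_finite[of "{x}" y] by simp
  have add: "p + q \<notin> span S" if q: "q \<notin> span (insert p S)" for p q :: rvec and S
  proof
    assume "p + q \<in> span S"
    then have "p + q \<in> span (insert p S)" using span_mono[of S "insert p S"] by blast
    then have "(p + q) - p \<in> span (insert p S)" by (rule span_diff) (simp add: span_base)
    then show False using q by simp
  qed
  have split: "\<exists>p\<in>B. \<exists>p'\<in>B. \<exists>q\<in>B. p \<noteq> p' \<and> p \<noteq> q \<and> p' \<noteq> q \<and> p \<noteq> y \<and> q \<noteq> y \<and> h i = p + p'" if i: "i < 3" for i y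
  proof -
    have part: ?thesis if "{a, b, c, d} \<subseteq> B" "distinct [a, b, c, d]" "h i = a + b" for a b c d
      by (insert that, rule bexI[of _ "if y = a then b else a"], rule bexI[of _ "if y = a then a else b"],
        rule bexI[of _ "if y = c then d else c"]) (auto simp: add.commute)
    consider "i = 0" | "i = 1" | "i = 2" using i by linarith
    then show ?thesis
    proof cases
      case 1 show ?thesis by (rule part[of u v w z]) (use 1 uvw z in \<open>auto simp: B_def h_def\<close>)
    next
      case 2 show ?thesis by (rule part[of u w v z]) (use 2 uvw z in \<open>auto simp: B_def h_def\<close>)
    next
      case 3 show ?thesis by (rule part[of v w u z]) (use 3 uvw z in \<open>auto simp: B_def h_def\<close>)
    qed
  qed
  have pt: "h i \<notin> span {a}" if i: "i < 3" and a: "a \<in> B" for i a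
  proof -
    obtain p p' where p: "p \<in> B" "p' \<in> B" "p \<noteq> p'" "p \<noteq> a" "h i = p + p'" using split[OF i, of a] by blast
    show ?thesis
    proof (cases "p' = a")
      case True
      then have "p \<notin> span (insert p' {a})" using par[of a p] p a by simp
      then show ?thesis using add[of p p' "{a}"] p(5) by (simp add: add.commute)
    next
      case False
      then have "p' \<notin> span {p, a}" using tri[of p' p a] p a by auto
      then show ?thesis using add[of p' p "{a}"] p(5) by simp
    qed
  qed
  \<comment> \<open>The four vectors have sum 0, so the sums of complementary pairs are opposite.
    Hence each of the six lines of the quadrangle passes through one of only three diagonal
    points.\<close>
  define opp where "opp = (\<lambda>s. \<exists>i<3. h i = s \<or> h i = - s)"
  have "opp (u + v)" "opp (w + z)" unfolding opp_def by (rule exI[of _ 0], simp add: h_def z_def)+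
  moreover have "opp (u + w)" "opp (v + z)" unfolding opp_def by (rule exI[of _ 1], simp add: h_def z_def)+
  moreover have "opp (v + w)" "opp (u + z)" unfolding opp_def by (rule exI[of _ 2], simp add: h_def z_def)+
  ultimately have pair: "opp (a + b)" if "a \<in> B" "b \<in> B" "a \<noteq> b" for a b
    using that by (auto simp: B_def add.commute)
  have "core_system 3 B h 3" unfolding core_system_def
  proof (intro conjI)
    show "finite B" "dim B = 3" "0 \<notin> B" "\<forall>x\<in>B. \<forall>y\<in>B. x \<noteq> y \<longrightarrow> y \<notin> span {x}" using B(1) dB nz par by auto
    have "h i \<in> span B" for i by (auto simp: h_def B_def intro!: span_add intro: span_base)
    moreover have "h i \<noteq> 0" if "i < 3" for i using pt[OF that, of u] span_zero[of "{u}"] by (auto simp: B_def)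
    ultimately show "\<forall>i<3. h i \<in> span B \<and> h i \<noteq> 0" by blast
    show "\<forall>S\<subseteq>B. dim S + 1 = 3 \<longrightarrow> (\<exists>i<3. h i \<in> span S)"
    proof (intro allI impI)
      fix S assume S: "S \<subseteq> B" "dim S + 1 = 3"
      have fS: "finite S" using S(1) B(1) by (rule finite_subset)
      have "\<not> card S \<le> Suc 0" using dim_card_le[OF fS] S(2) by simp
      then obtain a b where ab: "a \<in> S" "b \<in> S" "a \<noteq> b" using card_le_Suc0_iff_eq[OF fS] by blast
      have s: "a + b \<in> span S" using ab by (intro span_add span_base)
      obtain i where "i < 3" "h i = a + b \<or> h i = - (a + b)" using pair[of a b] ab S(1) by (auto simp: opp_def)
      then show "\<exists>i<3. h i \<in> span S" using s span_neg[OF s] by metis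
    qed
    show "\<forall>x\<in>B. \<forall>y\<in>B. x \<noteq> y \<longrightarrow> (\<exists>S\<subseteq>B. dim S + 2 = 3 \<and> dim (insert x (insert y S)) = 3 \<and> (\<forall>i<3. h i \<notin> span S))"
    proof (intro ballI impI)
      fix x y assume xy: "x \<in> B" "y \<in> B" "x \<noteq> y"
      obtain a where a: "a \<in> B" "a \<noteq> x" "a \<noteq> y" using third by blast
      have "x \<notin> span {y, a}" using tri[of x y a] xy a by auto
      then have "dim (insert x (insert y {a})) = 3" using d2[OF a(1) xy(2)] a(3) dim_insert_finite[of "{y, a}" x] by simp
      then show "\<exists>S\<subseteq>B. dim S + 2 = 3 \<and> dim (insert x (insert y S)) = 3 \<and> (\<forall>i<3. h i \<notin> span S)"
        using a(1) d1[OF a(1)] pt by (intro exI[of _ "{a}"]) auto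
    qed
    show "\<forall>i<3. \<forall>y\<in>B. \<exists>S\<subseteq>B. dim S + 1 = 3 \<and> y \<notin> span S \<and> h i \<notin> span S"
    proof (intro allI impI ballI)
      fix i :: nat and y assume i: "i < 3" and y: "y \<in> B"
      obtain p p' q where p: "p \<in> B" "p' \<in> B" "q \<in> B" "p \<noteq> p'" "p \<noteq> q" "p' \<noteq> q" "p \<noteq> y" "q \<noteq> y" "h i = p + p'"
        using split[OF i, of y] by blast
      have "p' \<notin> span (insert p {p, q})" using tri[of p' p q] p by auto
      then have "h i \<notin> span {p, q}" using add[of p' p "{p, q}"] p(9) by simp
      moreover have "y \<notin> span {p, q}" using tri[of y p q] p y by auto
      moreover have "dim {p, q} = 2" using d2[of q p] p by auto
      ultimately show "\<exists>S\<subseteq>B. dim S + 1 = 3 \<and> y \<notin> span S \<and> h i \<notin> span S" using p by (intro exI[of _ "{p, q}"]) auto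
    qed
  qed
  then show ?thesis using B(2) by blast
qed

section \<open>Monotonicity of the number of blue points in the parameters\<close>

lemma conf_coloop_blocked:
  assumes c: "blue_red_conf k B R" and x: "x \<in> B" "x \<notin> span (B - {x})"
  shows "\<exists>r\<in>R. r \<in> span (B - {x}) \<and> (\<forall>S\<subseteq>B. dim S = k \<longrightarrow> x \<notin> span S \<longrightarrow> r \<in> span S)"
proof -
  have fB: "finite B" using blue_red_confD(1)[OF c] .
  have "dim B = Suc (dim (B - {x}))" using dim_insert_finite[of "B - {x}" x] x fB by (simp add: insert_absorb)
  then have d: "dim (B - {x}) = k" using blue_red_confD(3)[OF c] by simp
  obtain r where r: "r \<in> R" "r \<in> span (B - {x})" using blue_red_confD(8)[OF c _ d] by blast
  have "r \<in> span S" if S: "S \<subseteq> B" "dim S = k" "x \<notin> span S" for S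
  proof -
    have "S \<subseteq> B - {x}" using S by (auto intro: span_base)
    then have "span S = span (B - {x})" using S d fB finite_subset[OF S(1) fB]
      by (intro span_eq_of_dim_ge) (auto intro: span_base)
    then show ?thesis using r by simp
  qed
  then show ?thesis using r by blast
qed

text \<open>Each coloop is assigned a red point in its complementary hyperplane, the only blue
  hyperplane avoiding it; \<open>conf_hyperplane_unique\<close> makes the assignment
  injective.\<close>

lemma conf_coloops_le_red:
  assumes c: "blue_red_conf k B R" and X: "X = {x\<in>B. x \<notin> span (B - {x})}"
  shows "card X \<le> card R"
proof -
  have "\<exists>g. \<forall>x\<in>X. g x \<in> R \<and> (\<forall>S\<subseteq>B. dim S = k \<longrightarrow> x \<notin> span S \<longrightarrow> g x \<in> span S)"
  proof (rule bchoice, rule ballI)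
    fix x assume "x \<in> X"
    then show "\<exists>r. r \<in> R \<and> (\<forall>S\<subseteq>B. dim S = k \<longrightarrow> x \<notin> span S \<longrightarrow> r \<in> span S)"
      using conf_coloop_blocked[OF c, of x] X by blast
  qed
  then obtain g where g: "\<And>x. x \<in> X \<Longrightarrow> g x \<in> R"
    "\<And>x. x \<in> X \<Longrightarrow> \<forall>S\<subseteq>B. dim S = k \<longrightarrow> x \<notin> span S \<longrightarrow> g x \<in> span S" by blast
  have "inj_on g X"
  proof (rule inj_onI, rule ccontr)
    fix x y assume xy: "x \<in> X" "y \<in> X" "g x = g y" "x \<noteq> y"
    then have "\<exists>S\<subseteq>B. dim S = k \<and> y \<notin> span S \<and> g x \<notin> span S"
      using conf_hyperplane_unique[OF c g(1)[OF xy(1)] _ _ xy(4) g(2)[OF xy(1)]] X by blast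
    then show False using g(2)[OF xy(2)] xy(3) by auto
  qed
  then show ?thesis using g(1) blue_red_confD(2)[OF c] by (intro card_inj_on_le[of g]) auto
qed

text \<open>With a core of rank 2, every core point spans a hyperplane together with the coloops,
  and this contains a red point. Two core points sharing one would violate (C3), because the witness
  \<open>S\<close> has the same span as \<open>X\<close>.\<close>

lemma conf_noncoloops_le_red:
  assumes c: "blue_red_conf k B R" and X: "X = {x\<in>B. x \<notin> span (B - {x})}" and q: "dim (B - X) = 2"
  shows "card (B - X) \<le> card R"
proof -
  define B0 where "B0 = B - X"
  have fB: "finite B" using blue_red_confD(1)[OF c] .
  have fX: "finite X" "finite B0" using fB X by (auto simp: B0_def)
  have XB: "X \<subseteq> B" using X by auto
  have cX: "card X + 1 = k" using core_system_of_conf(1)[OF c X] q by simp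
  have dX: "dim (S \<union> X) = dim S + card X" if "S \<subseteq> B0" for S
  proof (rule dim_Un_independent[OF fX(2,1)])
    have "B0 \<union> X = B" using X by (auto simp: B0_def)
    then show "dim (B0 \<union> X) = dim B0 + card X" using coloop_dim[OF fB XB] X by (simp add: B0_def)
  qed (use that fX finite_subset span_superset in blast)+
  have "\<exists>g. \<forall>y\<in>B0. g y \<in> R \<and> g y \<in> span (insert y X)"
  proof (rule bchoice, rule ballI)
    fix y assume y: "y \<in> B0"
    then have "y \<noteq> 0" using blue_red_confD(5)[OF c] by (auto simp: B0_def)
    then have "dim {y} = 1" using dim_insert_finite[of "{}" y] by simp
    then have "dim (insert y X) = k" using dX[of "{y}"] y cX by simp
    moreover have "insert y X \<subseteq> B" using y XB by (auto simp: B0_def)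
    ultimately show "\<exists>r. r \<in> R \<and> r \<in> span (insert y X)" using blue_red_confD(8)[OF c] by blast
  qed
  then obtain g where g: "\<And>y. y \<in> B0 \<Longrightarrow> g y \<in> R" "\<And>y. y \<in> B0 \<Longrightarrow> g y \<in> span (insert y X)" by blast
  have "inj_on g B0"
  proof (rule inj_onI, rule ccontr)
    fix x y assume xy: "x \<in> B0" "y \<in> B0" "g x = g y" "x \<noteq> y"
    then obtain S where S: "S \<subseteq> B" "dim S + 1 = k" "dim (insert x (insert y S)) = k + 1" "\<forall>r\<in>R. r \<notin> span S"
      using blue_red_confD(9)[OF c, of x y] by (auto simp: B0_def)
    have fS: "finite S" using S(1) fB finite_subset by blast
    have XS: "X \<subseteq> S"
    proof
      fix z assume z: "z \<in> X"
      show "z \<in> S"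
      proof (rule ccontr)
        assume "z \<notin> S"
        then have "insert x (insert y S) \<subseteq> B - {z}" using S(1) xy z by (auto simp: B0_def)
        then have "dim (insert x (insert y S)) \<le> dim (B - {z})" using fB by (intro dim_mono_finite) (auto intro: span_base)
        moreover have "dim B = Suc (dim (B - {z}))"
          using dim_insert_finite[of "B - {z}" z] z X XB fB by (simp add: insert_absorb)
        ultimately show False using S(3) blue_red_confD(3)[OF c] by simp
      qed
    qed
    have "dim X = card X" using dX[of "{}"] by simp
    then have eq: "span X = span S" using S(2) cX fS XS fX by (intro span_eq_of_dim_ge) (auto intro: span_base)
    have ndS: "y \<notin> span (insert x S)" using insert_dim_Suc_notin[OF fS, of x y] S by simp
    have "g x \<notin> span X" using S(4) g(1)[OF xy(1)] eq by simp
    then have "y \<in> span (insert x X)" using exchange_two[of "g x" x X y] g(2)[OF xy(1)] g(2)[OF xy(2)] xy(3) by simp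
    moreover have "span (insert x X) \<subseteq> span (insert x S)" using XS by (intro span_mono) auto
    ultimately show False using ndS by blast
  qed
  then show ?thesis using g(1) blue_red_confD(2)[OF c] unfolding B0_def[symmetric]
    by (intro card_inj_on_le[of g]) auto
qed

text \<open>Keep the core and change the number of coloops. If the core has rank \<open>q\<close> at
  least 3, then \<open>s = K + 1 - q\<close> coloops are at most the \<open>K - 2\<close> red points
  available. They are at least two, since there are at least two red points and hence
  \<open>k + 2 \<le> K\<close>. A smaller core forces so few blue points that a quadrangle with
  \<open>K - 2\<close> coloops does at least as well.\<close>

lemma conf_monotone:
  fixes B :: "rvec set"
  assumes c: "blue_red_conf k B R" and k: "2 \<le> k" "k + card R \<le> K"
  shows "\<exists>(B' :: rvec set) R'. blue_red_conf K B' R' \<and> card R' = K - 2 \<and> card B \<le> card B'"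
proof -
  define X where "X = {x\<in>B. x \<notin> span (B - {x})}"
  define B0 where "B0 = B - X"
  define q where "q = dim B0"
  have fB: "finite B" using blue_red_confD(1)[OF c] .
  have fX: "finite X" "finite B0" using fB by (auto simp: X_def B0_def)
  have XB: "X \<subseteq> B" by (auto simp: X_def)
  have qX: "q + card X = k + 1" using core_system_of_conf(1)[OF c X_def] by (simp add: q_def B0_def)
  have cB: "card B = card B0 + card X" unfolding B0_def using fX(1) XB fB
    by (metis card_Diff_subset card_mono le_add_diff_inverse2)
  have X_R: "card X \<le> card R" by (rule conf_coloops_le_red[OF c X_def])
  show ?thesis
  proof (cases "3 \<le> q")
    case q3: True
    then have ne: "B0 \<noteq> {}" by (auto simp: q_def)
    obtain h where h: "core_system q B0 h (card R)"
      using core_system_of_conf(2)[OF c X_def] ne by (auto simp: q_def B0_def)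
    have R0: "0 < card R"
    proof -
      obtain S where "S \<subseteq> B0" "dim S = q - 1" using subset_of_dim[of B0 "q - 1"] fX by (auto simp: q_def)
      then have "\<exists>i<card R. h i \<in> span S" using core_systemD(7)[OF h, of S] q3 by auto
      then show ?thesis by auto
    qed
    have R1: "card R \<noteq> 1"
    proof
      assume R1: "card R = 1"
      obtain y where y: "y \<in> B0" using ne by blast
      obtain S where "S \<subseteq> B0" "dim S + 1 = q" "h 0 \<notin> span S" using core_systemD(9)[OF h R0 y] by blast
      then show False using core_systemD(7)[OF h, of S] R1 by auto
    qed
    have "\<exists>h'. core_system q B0 h' (K - 2)"
      by (rule core_system_extend[OF h R0]) (use k q3 in auto)
    then obtain h' where h': "core_system q B0 h' (K - 2)" by blast
    have "\<exists>(B' :: rvec set) R'. blue_red_conf K B' R' \<and> card R' = K - 2 \<and> card B' = card B0 + (K + 1 - q)"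
      by (rule conf_of_core_system[OF h']) (use k q3 qX R0 R1 in auto)
    moreover have "card B \<le> card B0 + (K + 1 - q)" using cB qX k by simp
    ultimately show ?thesis by (metis (no_types))
  next
    case q2: False
    have nz: "\<And>x. x \<in> B0 \<Longrightarrow> x \<noteq> 0" using blue_red_confD(5)[OF c] by (auto simp: B0_def)
    \<comment> \<open>\<open>K + 2\<close> is the size of the quadrangle extended by
      \<open>K - 2\<close> coloops, and three red points are what the quadrangle itself
      uses.\<close>
    have big: "3 \<le> card R \<and> card B \<le> K + 2"
    proof (cases "q = 2")
      case True
      have "card B0 \<le> card R" using conf_noncoloops_le_red[OF c X_def] True by (simp add: q_def B0_def)
      moreover have "3 \<le> card B0"
      proof (rule ccontr)
        assume "\<not> 3 \<le> card B0"
        moreover have "2 \<le> card B0" using dim_card_le[OF fX(2)] True by (simp add: q_def)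
        ultimately have c2: "card B0 = 2" by simp
        then obtain y where y: "y \<in> B0" by fastforce
        then have yB: "y \<in> B" "y \<in> span (B - {y})" by (auto simp: B0_def X_def)
        have "card (B - {y}) = k" using cB c2 qX True yB(1) fB by simp
        then have "dim (B - {y}) \<le> k" using dim_card_le[of "B - {y}"] fB by simp
        moreover have "dim B = dim (B - {y})"
          using dim_insert_finite[of "B - {y}" y] yB fB by (simp add: insert_absorb)
        ultimately show False using blue_red_confD(3)[OF c] by simp
      qed
      ultimately show ?thesis using cB qX k True by simp
    next
      case False
      have "card B0 \<le> 1"
      proof -
        have "a = b" if ab: "a \<in> B0" "b \<in> B0" for a b
        proof (rule ccontr)
          assume "a \<noteq> b"
          then have "b \<notin> span {a}" using blue_red_confD(7)[OF c, of a b] ab by (auto simp: B0_def)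
          then have "dim {b, a} = 2" using nz[OF ab(1)] dim_insert_finite[of "{}" a] dim_insert_finite[of "{a}" b] by simp
          moreover have "dim {b, a} \<le> q" unfolding q_def using ab fX by (intro dim_mono_finite) (auto intro: span_base)
          ultimately show False using False q2 by simp
        qed
        then show ?thesis using card_le_Suc0_iff_eq[OF fX(2)] by simp
      qed
      moreover have "B0 = {}"
      proof (rule ccontr)
        assume "B0 \<noteq> {}"
        then obtain y where y: "y \<in> B0" by blast
        then have B0: "B0 = {y}" using \<open>card B0 \<le> 1\<close> fX card_le_Suc0_iff_eq[OF fX(2)] by auto
        then have "q = 1" using nz[OF y] dim_insert_finite[of "{}" y] by (simp add: q_def)
        have yB: "y \<in> B" "y \<in> span (B - {y})" using y by (auto simp: B0_def X_def)
        have "card (B - {y}) = k" using cB B0 qX \<open>q = 1\<close> yB(1) fB by simp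
        then have "dim (B - {y}) \<le> k" using dim_card_le[of "B - {y}"] fB by simp
        moreover have "dim B = dim (B - {y})"
          using dim_insert_finite[of "B - {y}" y] yB fB by (simp add: insert_absorb)
        ultimately show False using blue_red_confD(3)[OF c] by simp
      qed
      then have "q = 0" by (simp add: q_def)
      ultimately show ?thesis using X_R cB qX k \<open>B0 = {}\<close> by simp
    qed
    obtain Q :: "rvec set" and h where Q: "core_system 3 Q h 3" "card Q = 4" using core_system_quadrangle by blast
    have "\<exists>h'. core_system 3 Q h' (K - 2)"
      by (rule core_system_extend[OF Q(1)]) (use k big in auto)
    then obtain h' where h': "core_system 3 Q h' (K - 2)" by blast
    have "\<exists>(B' :: rvec set) R'. blue_red_conf K B' R' \<and> card R' = K - 2 \<and> card B' = card Q + (K - 2)"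
      by (rule conf_of_core_system[OF h']) (use k big in auto)
    moreover have "card B \<le> card Q + (K - 2)" using big Q(2) k by simp
    ultimately show ?thesis by (metis (no_types))
  qed
qed

subsection \<open>Represented matroids\<close>

definition represents :: "'a matroid \<Rightarrow> ('a \<Rightarrow> 'v::real_vector) \<Rightarrow> bool" where
  "represents M f \<longleftrightarrow> (\<forall>I\<subseteq>ground M. indep M I \<longleftrightarrow> inj_on f I \<and> independent (f ` I))"

lemma real_representable_iff: "real_representable M \<longleftrightarrow> (\<exists>f :: 'a \<Rightarrow> rvec. represents M f)"
  by (simp add: real_representable_def represents_def)

lemma matroid_rank_eq_dim:
  assumes M: "finite (ground M)" "represents M f" and X: "X \<subseteq> ground M"
  shows "matroid_rank M X = dim (f ` X)"
  unfolding matroid_rank_def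
proof (rule Max_eqI)
  have fX: "finite X" using M(1) X finite_subset by blast
  have ind: "indep M I \<longleftrightarrow> inj_on f I \<and> independent (f ` I)" if "I \<subseteq> X" for I
    using M(2) that X by (auto simp: represents_def)
  have "{card I |I. I \<subseteq> X \<and> indep M I} \<subseteq> card ` Pow X" by auto
  then show "finite {card I |I. I \<subseteq> X \<and> indep M I}" using fX finite_subset by blast
  fix n assume "n \<in> {card I |I. I \<subseteq> X \<and> indep M I}"
  then obtain I where I: "n = card I" "I \<subseteq> X" "inj_on f I" "independent (f ` I)" using ind by auto
  have "card I = card (f ` I)" using I(3) by (simp add: card_image)
  also have "\<dots> \<le> dim (f ` X)" using fX I by (intro independent_card_le_dim_finite(2)) (auto intro: span_base)
  finally show "n \<le> dim (f ` X)" using I by simp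
next
  obtain B where B: "B \<subseteq> f ` X" "independent B" "f ` X \<subseteq> span B" "card B = dim (f ` X)" using basis_exists by metis
  obtain I where I: "I \<subseteq> X" "inj_on f I" "B = f ` I" using B(1) by (meson subset_image_inj)
  have "indep M I" using M(2) I B(2) X by (auto simp: represents_def)
  moreover have "card I = dim (f ` X)" using I B(4) by (simp add: card_image)
  ultimately show "dim (f ` X) \<in> {card I |I. I \<subseteq> X \<and> indep M I}" using I(1) by (intro CollectI exI[of _ I]) auto
qed

lemma flat_iff_span:
  assumes M: "finite (ground M)" "represents M f"
  shows "flat M F \<longleftrightarrow> F \<subseteq> ground M \<and> (\<forall>x\<in>ground M - F. f x \<notin> span (f ` F))"
proof -
  have "matroid_rank M F < matroid_rank M (insert x F) \<longleftrightarrow> f x \<notin> span (f ` F)"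
    if "F \<subseteq> ground M" "x \<in> ground M" for x
    using matroid_rank_eq_dim[OF M, of F] matroid_rank_eq_dim[OF M, of "insert x F"] that finite_subset[OF that(1) M(1)]
    by (simp add: dim_insert_finite)
  then show ?thesis by (auto simp: flat_def)
qed

lemma matroid_rank_restrict: "F \<subseteq> X \<Longrightarrow> matroid_rank (restrict M X) F = matroid_rank M F"
  unfolding matroid_rank_def restrict_def
  by (rule arg_cong[of _ _ Max]) auto

lemma represents_restrict: "represents M f \<Longrightarrow> represents (restrict M X) f"
  unfolding represents_def restrict_def by auto

lemma finite_ground_restrict: "finite (ground M) \<Longrightarrow> finite (ground (restrict M X))"
  by (simp add: restrict_def)

definition vector_matroid :: "'a set \<Rightarrow> ('a \<Rightarrow> 'v::real_vector) \<Rightarrow> 'a matroid" where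
  "vector_matroid E f = \<lparr>ground = E, indep = (\<lambda>I. I \<subseteq> E \<and> inj_on f I \<and> independent (f ` I))\<rparr>"

lemma vector_matroid:
  fixes f :: "'a \<Rightarrow> 'v::real_vector"
  assumes E: "finite E"
  shows "matroid (vector_matroid E f)" "represents (vector_matroid E f) f" "ground (vector_matroid E f) = E"
proof -
  show "represents (vector_matroid E f) f" "ground (vector_matroid E f) = E"
    by (simp_all add: represents_def vector_matroid_def)
  show "matroid (vector_matroid E f)"
  proof
    fix I J assume "indep (vector_matroid E f) I" "indep (vector_matroid E f) J" and card: "card I < card J"
    then have I: "I \<subseteq> E" "inj_on f I" "independent (f ` I)" and J: "J \<subseteq> E" "inj_on f J" "independent (f ` J)"
      by (auto simp: vector_matroid_def)
    have fin: "finite I" "finite J" using I J E finite_subset by auto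
    have "\<exists>x\<in>J. f x \<notin> span (f ` I)"
    proof (rule ccontr)
      assume "\<not> ?thesis"
      then have "f ` J \<subseteq> span (f ` I)" by auto
      then have "card (f ` J) \<le> card (f ` I)" using independent_span_bound[OF _ J(3)] fin by blast
      then show False using card I J by (simp add: card_image)
    qed
    then obtain x where x: "x \<in> J" "f x \<notin> span (f ` I)" by blast
    have "x \<in> J - I" using x by (auto intro: span_base)
    moreover have "indep (vector_matroid E f) (insert x I)"
      using I J x independent_insertI[OF x(2) I(3)] by (auto simp: vector_matroid_def intro: span_base)
    ultimately show "\<exists>x\<in>J - I. indep (vector_matroid E f) (insert x I)" by blast
  next
    fix I J assume J: "indep (vector_matroid E f) J" "I \<subseteq> J"
    then have "independent (f ` I)" using independent_mono[of "f ` J" "f ` I"] by (auto simp: vector_matroid_def)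
    moreover have "inj_on f I" using J by (auto simp: vector_matroid_def intro: inj_on_subset)
    ultimately show "indep (vector_matroid E f) I" using J by (auto simp: vector_matroid_def)
  qed (use E in \<open>auto simp: vector_matroid_def independent_empty\<close>)
qed

lemma two_points_spanning:
  fixes T :: "'v::real_vector set"
  assumes "finite T" "dim T = 2"
  shows "\<exists>x\<in>T. \<exists>y\<in>T. x \<noteq> y \<and> span {x, y} = span T"
proof -
  obtain B where B: "B \<subseteq> T" "independent B" "T \<subseteq> span B" "card B = dim T" using basis_exists by metis
  then obtain x y where xy: "B = {x, y}" "x \<noteq> y" using assms(2) by (auto simp: card_2_iff)
  have "span B = span T" using B span_eq_of_subsets by blast
  then show ?thesis using xy B(1) by auto
qed

text \<open>A hyperplane without red elements is spanned by blue ones, and a line of the blue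
  restriction is spanned by two of its points; so the conditions on blue subsets suffice for (C2)
  and (C3).\<close>

lemma conf_in_blue_counts:
  fixes B :: "rvec set"
  assumes c: "blue_red_conf k B R" and k: "1 \<le> k"
  shows "card B \<in> blue_counts k (card R)"
proof -
  note C = blue_red_confD[OF c]
  have fBR: "finite (B \<union> R)" using C(1,2) by simp
  obtain h where h: "bij_betw h {0..<card (B \<union> R)} (B \<union> R)" using ex_bij_betw_nat_finite[OF fBR] by blast
  define E where "E = {0..<card (B \<union> R)}"
  have hE: "inj_on h E" "h ` E = B \<union> R" using h by (auto simp: bij_betw_def E_def)
  have fE: "finite E" by (simp add: E_def)
  define M where "M = vector_matroid E h"
  note V = vector_matroid[OF fE, of h, folded M_def]
  have gM: "finite (ground M)" using V(3) fE by simp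
  have rk: "matroid_rank M X = dim (h ` X)" if "X \<subseteq> E" for X using matroid_rank_eq_dim[OF gM V(2)] that V(3) by simp
  define Bn where "Bn = {x\<in>E. h x \<in> B}"
  define Rn where "Rn = {x\<in>E. h x \<in> R}"
  have img: "h ` Bn = B" "h ` Rn = R" using hE(2) by (auto simp: Bn_def Rn_def)
  have inj: "inj_on h Bn" "inj_on h Rn" using hE(1) by (auto simp: Bn_def Rn_def intro: inj_on_subset)
  have cards: "card Bn = card B" "card Rn = card R" using inj img by (metis card_image)+
  have "simple_matroid M" unfolding simple_matroid_def
  proof (intro ballI)
    fix x y assume xy: "x \<in> ground M" "y \<in> ground M"
    then have E': "x \<in> E" "y \<in> E" using V(3) by auto
    have hx: "h x \<in> B \<union> R" "h y \<in> B \<union> R" using hE(2) E' by auto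
    have "independent {h x, h y}"
    proof (cases "x = y")
      case True then show ?thesis using C(5) hx by auto
    next
      case False
      then have ne: "h x \<noteq> h y" using hE(1) E' by (auto dest: inj_onD)
      have "h y \<notin> span {h x}" using C(7)[OF hx ne] .
      moreover have "independent {h x}" using C(5) hx by auto
      ultimately have "independent (insert (h y) {h x})" by (rule independent_insertI)
      then show ?thesis by (simp add: insert_commute)
    qed
    then show "indep M {x, y}" using E' hE(1) by (auto simp: M_def vector_matroid_def inj_on_def)
  qed
  moreover have "real_representable M" unfolding real_representable_iff using V(2) by blast
  moreover have rkE: "matroid_rank M (ground M) = k + 1"
  proof -
    have "span (B \<union> R) = span B" using span_Un_absorb[OF C(4)] .
    then have "dim (B \<union> R) = dim B" by (rule span_eq_dim)
    then show ?thesis using rk[of E] hE(2) C(3) V(3) by simp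
  qed
  moreover have "two_colouring M Rn Bn"
    using hE(2) C(6) V(3) by (auto simp: two_colouring_def Bn_def Rn_def)
  moreover have "matroid_rank M Bn \<ge> 2" using rk[of Bn] img C(3) k by (auto simp: Bn_def)
  moreover have "H \<inter> Rn \<noteq> {}" if H: "hyperplane M H" for H
  proof
    assume empty: "H \<inter> Rn = {}"
    have HE: "H \<subseteq> E" using H V(3) by (auto simp: hyperplane_def flat_def)
    have HB: "h ` H \<subseteq> B" using HE empty hE(2) by (auto simp: Rn_def)
    have "dim (h ` H) = k" using H rk[OF HE] rkE by (simp add: hyperplane_def)
    then obtain r where r: "r \<in> R" "r \<in> span (h ` H)" using C(8)[OF HB] by blast
    obtain i where i: "i \<in> Rn" "r = h i" using r(1) img(2) by auto
    have "i \<in> ground M - H" using i empty V(3) by (auto simp: Rn_def)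
    then show False using H r(2) i(2) flat_iff_span[OF gM V(2), of H] by (auto simp: hyperplane_def)
  qed
  moreover have "\<exists>F. flat M F \<and> matroid_rank M F = k - 1 \<and> skew M F L \<and> F \<inter> Rn = {}"
    if L: "line (restrict M Bn) L" for L
  proof -
    have LB: "L \<subseteq> Bn" using L by (auto simp: line_def flat_def restrict_def)
    have LE: "L \<subseteq> E" using LB by (auto simp: Bn_def)
    have rL: "matroid_rank M L = 2" using L matroid_rank_restrict[OF LB] by (simp add: line_def)
    then have dL: "dim (h ` L) = 2" using rk[OF LE] by simp
    have fL: "finite (h ` L)" using LE fE finite_subset by blast
    obtain x y where xy: "x \<in> h ` L" "y \<in> h ` L" "x \<noteq> y" "span {x, y} = span (h ` L)"
      using two_points_spanning[OF fL dL] by blast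
    have xyB: "x \<in> B" "y \<in> B" using xy LB by (auto simp: Bn_def)
    obtain S where S: "S \<subseteq> B" "dim S + 1 = k" "dim (insert x (insert y S)) = k + 1" "\<forall>r\<in>R. r \<notin> span S"
      using C(9)[OF xyB xy(3)] by blast
    define F where "F = {i\<in>E. h i \<in> span S}"
    have FE: "F \<subseteq> E" by (auto simp: F_def)
    have "S \<subseteq> h ` F"
    proof
      fix x assume x: "x \<in> S"
      then have "x \<in> h ` E" using S(1) hE(2) by auto
      then show "x \<in> h ` F" using span_base[OF x] by (auto simp: F_def)
    qed
    moreover have "h ` F \<subseteq> span S" by (auto simp: F_def)
    ultimately have sF: "span (h ` F) = span S" by (metis span_eq_of_subsets)
    have "flat M F" unfolding flat_iff_span[OF gM V(2)] sF using V(3) by (auto simp: F_def)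
    moreover have rF: "matroid_rank M F = k - 1" using rk[OF FE] span_eq_dim[OF sF] S(2) by simp
    moreover have "skew M F L"
    proof -
      have "F \<union> L \<subseteq> E" using FE LE by auto
      then have "matroid_rank M (F \<union> L) = dim (h ` F \<union> h ` L)" using rk by (simp add: image_Un)
      also have "span (h ` F \<union> h ` L) = span (S \<union> {x, y})"
        using span_Un_cong[OF sF, of "h ` L"] span_Un_cong[OF xy(4), of S] by (simp add: Un_commute)
      then have "dim (h ` F \<union> h ` L) = dim (S \<union> {x, y})" by (rule span_eq_dim)
      also have "\<dots> = k + 1" using S(3) by simp
      finally show ?thesis using rF rL k by (simp add: skew_def)
    qed
    moreover have "F \<inter> Rn = {}" using S(4) by (auto simp: F_def Rn_def)
    ultimately show ?thesis by blast
  qed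
  ultimately show ?thesis unfolding blue_counts_def using V(1) cards by blast
qed

text \<open>Makes \<open>Max\<close> in \<open>max_blue\<close> meaningful. For two points
  \<open>x\<close>, \<open>y\<close> of a blue set \<open>P\<close> take the red-free
  \<open>F\<close> of (C3). By (C2) every blue point off \<open>F\<close> lies in the hyperplane
  spanned by \<open>F\<close> and one of the \<open>t\<close> red points, and these hyperplanes also
  contain \<open>F\<close>. None of them contains both \<open>x\<close> and \<open>y\<close>, so
  each meets \<open>P\<close> in smaller rank; induct on the rank.\<close>

lemma blue_counts_bounded:
  assumes "n \<in> blue_counts k t" and k: "1 \<le> k"
  shows "n \<le> max 1 t ^ k"
proof -
  from assms(1) obtain M :: "nat matroid" and R B where M: "matroid M" "simple_matroid M" "real_representable M"
    "matroid_rank M (ground M) = k + 1" "two_colouring M R B" "card R = t" "card B = n"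
    and C2: "\<And>H. hyperplane M H \<Longrightarrow> H \<inter> R \<noteq> {}"
    and C3: "\<And>L. line (restrict M B) L \<Longrightarrow> \<exists>F. flat M F \<and> matroid_rank M F = k - 1 \<and> skew M F L \<and> F \<inter> R = {}"
    unfolding blue_counts_def by blast
  obtain f :: "nat \<Rightarrow> rvec" where f: "represents M f" using M(3) real_representable_iff by blast
  have fE: "finite (ground M)" using M(1) by (simp add: matroid_def)
  have RB: "R \<subseteq> ground M" "B \<subseteq> ground M" using M(5) by (auto simp: two_colouring_def)
  have fin: "finite R" "finite B" using RB fE finite_subset by auto
  note rk = matroid_rank_eq_dim[OF fE f] and fl = flat_iff_span[OF fE f]
  have d2: "dim {f x, f y} = 2" if "x \<in> B" "y \<in> B" "x \<noteq> y" for x y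
  proof -
    have xy: "{x, y} \<subseteq> ground M" using that RB by auto
    then have "indep M {x, y}" using M(2) by (auto simp: simple_matroid_def)
    then have "inj_on f {x, y}" "independent (f ` {x, y})" using f xy by (auto simp: represents_def)
    then have "dim (f ` {x, y}) = card {x, y}" by (metis dim_eq_card_independent card_image)
    then show ?thesis using that by simp
  qed
  have "card P \<le> max 1 t ^ d" if "P \<subseteq> B" "dim (f ` P) \<le> Suc d" for d P
    using that
  proof (induction d arbitrary: P)
    case 0
    have fP: "finite P" using 0(1) fin finite_subset by blast
    have "x = y" if xy: "x \<in> P" "y \<in> P" for x y
    proof (rule ccontr)
      assume "x \<noteq> y"
      then have "dim {f x, f y} = 2" using d2 xy 0(1) by blast
      moreover have "dim {f x, f y} \<le> dim (f ` P)"
        using fP xy by (intro dim_mono_finite) (auto intro: span_base)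
      ultimately have "2 \<le> dim (f ` P)" by simp
      then show False using 0 by simp
    qed
    then show ?case using card_le_Suc0_iff_eq[OF fP] by simp
  next
    case (Suc d)
    have fP: "finite P" using Suc(2) fin finite_subset by blast
    show ?case
    proof (cases "card P \<le> 1")
      case True
      have "(1::nat) \<le> max 1 t ^ Suc d" by (rule one_le_power) simp
      then show ?thesis using True by linarith
    next
      case False
      then obtain x y where xy: "x \<in> P" "y \<in> P" "x \<noteq> y" using card_le_Suc0_iff_eq[OF fP] by auto
      have xyB: "x \<in> B" "y \<in> B" using xy Suc(2) by auto
      define L where "L = {z\<in>B. f z \<in> span {f x, f y}}"
      have LB: "L \<subseteq> B" by (auto simp: L_def)
      have "{f x, f y} \<subseteq> f ` L" using xyB by (auto simp: L_def intro: span_base)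
      moreover have "f ` L \<subseteq> span {f x, f y}" by (auto simp: L_def)
      ultimately have sL: "span {f x, f y} = span (f ` L)" by (rule span_eq_of_subsets)
      have rL: "matroid_rank M L = 2" using rk[of L] LB RB d2[OF xyB xy(3)] span_eq_dim[OF sL] by auto
      have "line (restrict M B) L" unfolding line_def
      proof
        have "ground (restrict M B) = B" using RB by (auto simp: restrict_def)
        then show "flat (restrict M B) L"
          using flat_iff_span[OF finite_ground_restrict[OF fE] represents_restrict[OF f], of B L] sL[symmetric]
          by (auto simp: L_def)
        show "matroid_rank (restrict M B) L = 2" using matroid_rank_restrict[OF LB] rL by simp
      qed
      from C3[OF this] obtain F where F: "flat M F" "matroid_rank M F = k - 1" "skew M F L" "F \<inter> R = {}" by blast
      have FE: "F \<subseteq> ground M" using F(1) by (simp add: flat_def)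
      have fF: "finite (f ` F)" using FE fE finite_subset by blast
      have dF: "dim (f ` F) = k - 1" using F(2) rk[OF FE] by simp
      have dFxy: "dim (insert (f x) (insert (f y) (f ` F))) = k + 1"
      proof -
        have "matroid_rank M (F \<union> L) = k + 1" using F(2,3) rL k by (simp add: skew_def)
        moreover have "F \<union> L \<subseteq> ground M" using FE LB RB by auto
        ultimately have "dim (f ` F \<union> f ` L) = k + 1" using rk by (simp add: image_Un)
        moreover have "span (f ` F \<union> f ` L) = span (f ` F \<union> {f x, f y})" using span_Un_cong[OF sL] by simp
        ultimately show ?thesis using span_eq_dim by (metis Un_insert_right Un_empty_right)
      qed
      have n: "f x \<notin> span (f ` F)" using insert_dim_Suc_notin[OF fF, of "f x" "f y"] dFxy dF k by simp
      have RF: "f \<rho> \<notin> span (f ` F)" if "\<rho> \<in> R" for \<rho> using F(1,4) that RB fl[of F] by auto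
      have red: "\<exists>\<rho>\<in>R. f z \<in> span (insert (f \<rho>) (f ` F))" if z: "z \<in> B" "f z \<notin> span (f ` F)" for z
      proof -
        define H where "H = {i\<in>ground M. f i \<in> span (insert (f z) (f ` F))}"
        have HE: "H \<subseteq> ground M" by (auto simp: H_def)
        have "insert (f z) (f ` F) \<subseteq> f ` H" using FE z RB by (auto simp: H_def intro: span_base)
        moreover have "f ` H \<subseteq> span (insert (f z) (f ` F))" by (auto simp: H_def)
        ultimately have sH: "span (insert (f z) (f ` F)) = span (f ` H)" by (rule span_eq_of_subsets)
        have "hyperplane M H" unfolding hyperplane_def
        proof
          show "flat M H" using fl[of H] sH[symmetric] by (auto simp: H_def)
          show "matroid_rank M H + 1 = matroid_rank M (ground M)"
            using rk[OF HE] span_eq_dim[OF sH] dim_insert_finite[OF fF, of "f z"] z(2) dF k M(4) by simp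
        qed
        then obtain \<rho> where "\<rho> \<in> H" "\<rho> \<in> R" using C2 by blast
        then show ?thesis using in_span_insert[OF _ RF] by (auto simp: H_def)
      qed
      define P' where "P' = (\<lambda>\<rho>. {z\<in>P. f z \<in> span (insert (f \<rho>) (f ` F))})"
      have "card (P' \<rho>) \<le> max 1 t ^ d" for \<rho>
      proof (rule Suc.IH)
        show "P' \<rho> \<subseteq> B" using Suc(2) by (auto simp: P'_def)
        show "dim (f ` P' \<rho>) \<le> Suc d"
        proof (rule ccontr)
          assume "\<not> dim (f ` P' \<rho>) \<le> Suc d"
          then have "span (f ` P' \<rho>) = span (f ` P)"
            using Suc(3) fP by (intro span_eq_of_dim_ge) (auto simp: P'_def intro: span_base)
          then have "f x \<in> span (f ` P' \<rho>)" "f y \<in> span (f ` P' \<rho>)" using xy by (auto intro: span_base)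
          moreover have "span (f ` P' \<rho>) \<subseteq> span (insert (f \<rho>) (f ` F))" by (intro span_minimal) (auto simp: P'_def)
          ultimately have "insert (f x) (insert (f y) (f ` F)) \<subseteq> span (insert (f \<rho>) (f ` F))"
            by (auto intro: span_base)
          then have "k + 1 \<le> dim (insert (f \<rho>) (f ` F))" using dFxy fF dim_mono_finite by (metis finite_insert)
          then show False using dF dim_insert_finite[OF fF, of "f \<rho>"] k by (simp split: if_splits)
        qed
      qed
      note cP = this
      have "P \<subseteq> (\<Union>\<rho>\<in>R. P' \<rho>)"
      proof
        fix z assume z: "z \<in> P"
        show "z \<in> (\<Union>\<rho>\<in>R. P' \<rho>)"
        proof (cases "f z \<in> span (f ` F)")
          case True
          obtain \<rho> where "\<rho> \<in> R" using red[OF xyB(1) n] by blast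
          moreover have "f z \<in> span (insert (f \<rho>) (f ` F))" using True span_mono[of "f ` F" "insert (f \<rho>) (f ` F)"] by blast
          ultimately show ?thesis using z by (auto simp: P'_def)
        next
          case False
          then show ?thesis using red[of z] z Suc(2) by (auto simp: P'_def)
        qed
      qed
      then have "card P \<le> card (\<Union>\<rho>\<in>R. P' \<rho>)" using fin fP by (intro card_mono) (auto simp: P'_def)
      also have "\<dots> \<le> (\<Sum>\<rho>\<in>R. card (P' \<rho>))" using fin by (intro card_UN_le) auto
      also have "\<dots> \<le> (\<Sum>\<rho>\<in>R. max 1 t ^ d)" using cP by (intro sum_mono) auto
      also have "\<dots> \<le> max 1 t ^ Suc d" using M(6) by simp
      finally show ?thesis .
    qed
  qed
  note main = this
  have "dim (f ` B) \<le> dim (f ` ground M)" using RB fE by (intro dim_mono_finite) (auto intro: span_base)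
  also have "\<dots> = Suc k" using rk[of "ground M"] M(4) by simp
  finally show ?thesis using main[of B k] M(7) by simp
qed

lemma conf_card_le_max_blue:
  fixes B :: "rvec set"
  assumes "blue_red_conf k B R" "2 \<le> k" "k + card R \<le> K"
  shows "card B \<le> max_blue K (K - 2)"
proof -
  obtain B' R' :: "rvec set" where B': "blue_red_conf K B' R'" "card R' = K - 2" "card B \<le> card B'"
    using conf_monotone[OF assms] by blast
  have K: "1 \<le> K" using assms by simp
  have in': "card B' \<in> blue_counts K (K - 2)" using conf_in_blue_counts[OF B'(1) K] B'(2) by simp
  have "finite (blue_counts K (K - 2))"
    by (rule finite_subset[of _ "{..max 1 (K - 2) ^ K}"]) (use blue_counts_bounded K in auto)
  then have "card B' \<le> max_blue K (K - 2)" using in' by (auto simp: max_blue_def)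
  then show ?thesis using B'(3) by simp
qed

subsection \<open>Covering blocked sets\<close>

text \<open>Priced for the return from the contraction, when each slot whose red point lies in
  \<open>Q\<close> adds one to the rank and to the cost. A subspace with a red point can leave the
  minimal charge of 1 to such a slot; one without must pay it itself. In particular a single red
  point costs nothing.\<close>

definition cover_cost :: "'v::real_vector set \<Rightarrow> 'v set \<Rightarrow> nat" where
  "cover_cost R Q = (if \<exists>r\<in>R. r \<in> span Q then dim Q - 1 else max (dim Q - 1) 1)"

definition red_cover :: "('a \<Rightarrow> 'v::real_vector) \<Rightarrow> 'a set \<Rightarrow> 'v set \<Rightarrow> nat \<Rightarrow> 'v set set \<Rightarrow> bool" where
  "red_cover \<psi> U R c \<Q> \<longleftrightarrow> finite \<Q> \<and> (\<forall>Q\<in>\<Q>. finite Q) \<and> (\<forall>u\<in>U. \<exists>Q\<in>\<Q>. \<psi> u \<in> span Q) \<and>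
     (\<Sum>Q\<in>\<Q>. cover_cost R Q) \<le> c"

lemma red_coverD:
  assumes "red_cover \<psi> U R c \<Q>"
  shows "finite \<Q>" "Q \<in> \<Q> \<Longrightarrow> finite Q" "u \<in> U \<Longrightarrow> \<exists>Q\<in>\<Q>. \<psi> u \<in> span Q" "(\<Sum>Q\<in>\<Q>. cover_cost R Q) \<le> c"
  using assms unfolding red_cover_def by blast+

lemma cover_cost_le: "cover_cost R Q \<le> max (dim Q - 1) 1"
  by (simp add: cover_cost_def)

lemma cover_cost_eq: "r \<in> R \<Longrightarrow> r \<in> span Q \<Longrightarrow> cover_cost R Q = dim Q - 1"
  by (auto simp: cover_cost_def)

lemma span_singleton_sym:
  fixes x y :: "'v::real_vector"
  shows "x \<in> span {y} \<Longrightarrow> x \<noteq> 0 \<Longrightarrow> y \<in> span {x}"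
  using in_span_insert[of x y "{}"] by auto

lemma span_trans_subset: "x \<in> span S \<Longrightarrow> S \<subseteq> span T \<Longrightarrow> x \<in> span (T::'v::real_vector set)"
  using span_minimal[of S "span T"] by auto

lemma dim_pos:
  fixes T :: "'v::real_vector set"
  assumes "finite T" "x \<in> span T" "x \<noteq> 0"
  shows "1 \<le> dim T"
  using dim_mono_finite[of T "{x}"] dim_insert_finite[of "{}" x] assms by auto

text \<open>Sharing \<open>r\<close> saves one rank in the union by submodularity, exactly the one
  that \<open>dim - 1\<close> would otherwise deduct a second time.\<close>

lemma cover_cost_merge:
  fixes P Q :: "'v::real_vector set"
  assumes "finite P" "finite Q" "r \<in> R" "r \<noteq> 0" "r \<in> span P" "r \<in> span Q"
  shows "cover_cost R (P \<union> Q) \<le> cover_cost R P + cover_cost R Q"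
proof -
  have "r \<in> span (P \<union> Q)" using assms(5) span_mono[of P "P \<union> Q"] by blast
  then have "cover_cost R (P \<union> Q) = dim (P \<union> Q) - 1" using cover_cost_eq assms(3) by blast
  moreover have "dim (P \<union> Q) + dim {r} \<le> dim P + dim Q" using assms by (intro dim_submodular) auto
  moreover have "dim {r} = 1" using dim_insert_finite[of "{}" r] assms(4) by simp
  moreover have "1 \<le> dim P" "1 \<le> dim Q" using dim_pos assms by blast+
  ultimately show ?thesis using cover_cost_eq[of r R P] cover_cost_eq[of r R Q] assms by simp
qed

lemma red_cover_merge:
  fixes \<psi> :: "'a \<Rightarrow> 'v::real_vector"
  assumes "0 \<notin> R" "red_cover \<psi> U R c \<Q>"
  shows "\<exists>\<Q>'. red_cover \<psi> U R c \<Q>' \<and> (\<forall>x. (\<exists>Q\<in>\<Q>. x \<in> span Q) \<longrightarrow> (\<exists>Q\<in>\<Q>'. x \<in> span Q)) \<and>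
    (\<forall>r\<in>R. \<forall>P\<in>\<Q>'. \<forall>Q\<in>\<Q>'. r \<in> span P \<longrightarrow> r \<in> span Q \<longrightarrow> P = Q)"
  using assms(2)
proof (induction "card \<Q>" arbitrary: \<Q> rule: less_induct)
  case less
  note C = red_coverD[OF less.prems]
  show ?case
  proof (cases "\<forall>r\<in>R. \<forall>P\<in>\<Q>. \<forall>Q\<in>\<Q>. r \<in> span P \<longrightarrow> r \<in> span Q \<longrightarrow> P = Q")
    case True then show ?thesis using less.prems by blast
  next
    case False
    then obtain r P Q where r: "r \<in> R" "P \<in> \<Q>" "Q \<in> \<Q>" "r \<in> span P" "r \<in> span Q" "P \<noteq> Q" by blast
    define \<P> where "\<P> = insert (P \<union> Q) (\<Q> - {P, Q})"
    have f: "finite (\<Q> - {P, Q})" using C(1) by simp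
    have "card \<P> \<le> Suc (card (\<Q> - {P, Q}))" unfolding \<P>_def by (rule card_insert_le_m1) (use f in auto)
    also have "\<dots> < card \<Q>"
    proof -
      have "card (\<Q> - {P, Q}) = card \<Q> - card {P, Q}" using r C(1) by (intro card_Diff_subset) auto
      moreover have "card {P, Q} \<le> card \<Q>" using r C(1) by (intro card_mono) auto
      ultimately show ?thesis using r(6) by simp
    qed
    finally have less': "card \<P> < card \<Q>" .
    have cov: "\<exists>Q'\<in>\<P>. x \<in> span Q'" if "Q0 \<in> \<Q>" "x \<in> span Q0" for x Q0
    proof (cases "Q0 = P \<or> Q0 = Q")
      case True
      then have "x \<in> span (P \<union> Q)" using that(2) span_mono[of Q0 "P \<union> Q"] by blast
      then show ?thesis by (auto simp: \<P>_def)
    next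
      case False then show ?thesis using that by (auto simp: \<P>_def)
    qed
    have "red_cover \<psi> U R c \<P>" unfolding red_cover_def
    proof (intro conjI ballI)
      show "finite \<P>" using f by (simp add: \<P>_def)
      show "finite Q'" if "Q' \<in> \<P>" for Q' using that C(2) r(2,3) by (auto simp: \<P>_def)
      show "\<exists>Q'\<in>\<P>. \<psi> u \<in> span Q'" if "u \<in> U" for u using C(3)[OF that] cov by blast
      have "(\<Sum>Q'\<in>\<P>. cover_cost R Q') \<le> cover_cost R (P \<union> Q) + (\<Sum>Q'\<in>\<Q> - {P, Q}. cover_cost R Q')"
        unfolding \<P>_def by (cases "P \<union> Q \<in> \<Q> - {P, Q}") (use f in \<open>auto simp: insert_absorb\<close>)
      also have "\<dots> \<le> (cover_cost R P + cover_cost R Q) + (\<Sum>Q'\<in>\<Q> - {P, Q}. cover_cost R Q')"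
        using cover_cost_merge[of P Q r R] C(2) r assms(1) by (intro add_right_mono) blast
      also have "\<dots> = (\<Sum>Q'\<in>\<Q>. cover_cost R Q')"
        using sum.subset_diff[of "{P, Q}" \<Q> "cover_cost R"] C(1) r by simp
      finally show "(\<Sum>Q'\<in>\<P>. cover_cost R Q') \<le> c" using C(4) by simp
    qed
    from less.hyps[OF less' this] obtain \<Q>' where Q': "red_cover \<psi> U R c \<Q>'"
      "\<forall>x. (\<exists>Q\<in>\<P>. x \<in> span Q) \<longrightarrow> (\<exists>Q\<in>\<Q>'. x \<in> span Q)"
      "\<forall>r\<in>R. \<forall>P\<in>\<Q>'. \<forall>Q\<in>\<Q>'. r \<in> span P \<longrightarrow> r \<in> span Q \<longrightarrow> P = Q"
    by (elim exE conjE) (rule that, assumption+)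
    have "\<forall>x. (\<exists>Q\<in>\<Q>. x \<in> span Q) \<longrightarrow> (\<exists>Q\<in>\<Q>'. x \<in> span Q)" using Q'(2) cov by blast
    then show ?thesis using Q'(1,3) by (intro exI[of _ \<Q>'] conjI)
  qed
qed

lemma red_singletons_cost:
  assumes "finite R"
  shows "(\<Sum>Q\<in>(\<lambda>r. {r}) ` R. cover_cost R Q) = 0"
proof (rule sum.neutral, rule ballI)
  fix Q assume "Q \<in> (\<lambda>r. {r}) ` R"
  then obtain r where r: "r \<in> R" "Q = {r}" by blast
  have "cover_cost R Q = dim {r} - 1" using cover_cost_eq[of r R Q] r by (simp add: span_base)
  also have "dim {r} \<le> 1" using dim_card_le[of "{r}"] by simp
  finally show "cover_cost R Q = 0" by simp
qed

text \<open>Add the free subspaces spanned by single red points and then merge members with a common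
  red point. Uniqueness ensures that later every slot is paid for once.\<close>

lemma normal_red_cover:
  fixes \<psi> :: "'a \<Rightarrow> 'v::real_vector"
  assumes "0 \<notin> R" "finite R" "red_cover \<psi> U R c \<Q>"
  shows "\<exists>\<Q>'. red_cover \<psi> U R c \<Q>' \<and> (\<forall>r\<in>R. \<exists>!Q. Q \<in> \<Q>' \<and> r \<in> span Q)"
proof -
  note C = red_coverD[OF assms(3)]
  define \<P> where "\<P> = \<Q> \<union> (\<lambda>r. {r}) ` R"
  have "red_cover \<psi> U R c \<P>" unfolding red_cover_def
  proof (intro conjI ballI)
    show "finite \<P>" using C(1) assms(2) by (simp add: \<P>_def)
    show "finite Q'" if "Q' \<in> \<P>" for Q' using that C(2) by (auto simp: \<P>_def)
    show "\<exists>Q'\<in>\<P>. \<psi> u \<in> span Q'" if "u \<in> U" for u using C(3)[OF that] by (auto simp: \<P>_def)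
    have "(\<Sum>Q'\<in>\<P>. cover_cost R Q') \<le> (\<Sum>Q'\<in>\<Q>. cover_cost R Q') + (\<Sum>Q'\<in>(\<lambda>r. {r}) ` R. cover_cost R Q')"
      unfolding \<P>_def using C(1) assms(2) by (simp add: sum_Un_nat)
    then show "(\<Sum>Q'\<in>\<P>. cover_cost R Q') \<le> c" using C(4) red_singletons_cost[OF assms(2)] by simp
  qed
  from red_cover_merge[OF assms(1) this] obtain \<Q>' where Q': "red_cover \<psi> U R c \<Q>'"
      "\<forall>x. (\<exists>Q\<in>\<P>. x \<in> span Q) \<longrightarrow> (\<exists>Q\<in>\<Q>'. x \<in> span Q)"
      "\<forall>r\<in>R. \<forall>P\<in>\<Q>'. \<forall>Q\<in>\<Q>'. r \<in> span P \<longrightarrow> r \<in> span Q \<longrightarrow> P = Q"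
    by (elim exE conjE) (rule that, assumption+)
  have "\<exists>!Q. Q \<in> \<Q>' \<and> r \<in> span Q" if r: "r \<in> R" for r
  proof -
    have "{r} \<in> \<P>" "r \<in> span {r}" using r by (auto simp: \<P>_def span_base)
    then obtain Q where Q: "Q \<in> \<Q>'" "r \<in> span Q" using Q'(2) by meson
    show ?thesis
    proof (rule ex1I)
      show "Q \<in> \<Q>' \<and> r \<in> span Q" using Q by (rule conjI)
      fix P assume "P \<in> \<Q>' \<and> r \<in> span P"
      then show "P = Q" using Q'(3) r Q by meson
    qed
  qed
  then show ?thesis using Q'(1) by (intro exI[of _ \<Q>'] conjI ballI)
qed

lemma exists_parallel_representatives:
  fixes R :: "'v::real_vector set"
  assumes "finite R" "0 \<notin> R"
  shows "\<exists>R0\<subseteq>R. (\<forall>x\<in>R0. \<forall>y\<in>R0. x \<noteq> y \<longrightarrow> y \<notin> span {x}) \<and> (\<forall>r\<in>R. \<exists>x\<in>R0. x \<in> span {r})"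
  using assms
proof (induction R rule: finite_induct)
  case empty then show ?case by auto
next
  case (insert z R)
  then obtain R0 where R0: "R0 \<subseteq> R" "\<forall>x\<in>R0. \<forall>y\<in>R0. x \<noteq> y \<longrightarrow> y \<notin> span {x}" "\<forall>r\<in>R. \<exists>x\<in>R0. x \<in> span {r}"
    by auto
  show ?case
  proof (cases "\<exists>x\<in>R0. x \<in> span {z}")
    case True then show ?thesis using R0 by (intro exI[of _ R0]) auto
  next
    case False
    have n: "z \<notin> span {x}" if "x \<in> R0" for x
      using False that span_singleton_sym[of z x] insert.prems by auto
    show ?thesis
    proof (intro exI[of _ "insert z R0"] conjI)
      show "insert z R0 \<subseteq> insert z R" using R0 by auto
      show "\<forall>x\<in>insert z R0. \<forall>y\<in>insert z R0. x \<noteq> y \<longrightarrow> y \<notin> span {x}" using R0(2) False n by auto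
      have "z \<in> span {z}" by (simp add: span_base)
      then show "\<forall>r\<in>insert z R. \<exists>x\<in>insert z R0. x \<in> span {r}" using R0(3) by auto
    qed
  qed
qed

text \<open>
  If the unblocked blue points span too much to be covered by one flat, then by \<open>conf_card_le_max_blue\<close>
  they violate condition (C3) at some pair \<open>u, v\<close>; a generic point of the line through them is
  contracted, which makes that line a new red point.
\<close>

lemma conf_failure:
  fixes \<psi> :: "'a \<Rightarrow> rvec"
  assumes fin: "finite U" "finite R" and R0: "0 \<notin> R" and U0: "\<And>u. u \<in> U \<Longrightarrow> \<psi> u \<noteq> 0"
    and par: "\<And>u v. u \<in> U \<Longrightarrow> v \<in> U \<Longrightarrow> u \<noteq> v \<Longrightarrow> \<psi> v \<notin> span {\<psi> u}"
    and unred: "\<And>u r. u \<in> U \<Longrightarrow> r \<in> R \<Longrightarrow> r \<notin> span {\<psi> u}"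
    and dimU: "dim (\<psi> ` U) = m + 1" and RU: "R \<subseteq> span (\<psi> ` U)"
    and card: "card R + m \<le> k" and m: "2 \<le> m"
    and blocked: "\<And>S. S \<subseteq> U \<Longrightarrow> dim (\<psi> ` S) = m \<Longrightarrow> \<exists>r\<in>R. r \<in> span (\<psi> ` S)"
    and large: "max_blue k (k - 2) < card U"
  shows "\<exists>u\<in>U. \<exists>v\<in>U. u \<noteq> v \<and> (\<forall>S\<subseteq>U. dim (\<psi> ` S) + 1 = m \<longrightarrow>
    dim (insert (\<psi> u) (insert (\<psi> v) (\<psi> ` S))) = m + 1 \<longrightarrow> (\<exists>r\<in>R. r \<in> span (\<psi> ` S)))"
proof (rule ccontr)
  assume neg: "\<not> ?thesis"
  \<comment> \<open>Contractions can make red points parallel, whereas a configuration requires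
    pairwise non-parallel vectors. Representatives block the same subspaces.\<close>
  obtain P where P: "P \<subseteq> R" "\<forall>x\<in>P. \<forall>y\<in>P. x \<noteq> y \<longrightarrow> y \<notin> span {x}" "\<forall>r\<in>R. \<exists>x\<in>P. x \<in> span {r}"
    using exists_parallel_representatives[OF fin(2) R0] by blast
  have PR: "\<exists>x\<in>P. x \<in> span T" if r: "r \<in> R" "r \<in> span T" for r T
  proof -
    obtain x where x: "x \<in> P" "x \<in> span {r}" using P(3) r(1) by blast
    then show ?thesis using span_trans_subset[OF x(2), of T] r(2) by blast
  qed
  have "blue_red_conf m (\<psi> ` U) P" unfolding blue_red_conf_def
  proof (intro conjI)
    show "finite (\<psi> ` U)" "finite P" using fin P(1) finite_subset by auto
    show "dim (\<psi> ` U) = m + 1" "P \<subseteq> span (\<psi> ` U)" using dimU RU P(1) by auto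
    show "0 \<notin> \<psi> ` U \<union> P" using R0 U0 P(1) by auto
    show "\<psi> ` U \<inter> P = {}" using unred P(1) span_base by fastforce
    show "\<forall>x\<in>\<psi> ` U \<union> P. \<forall>y\<in>\<psi> ` U \<union> P. x \<noteq> y \<longrightarrow> y \<notin> span {x}"
    proof (intro ballI impI)
      fix x y assume xy: "x \<in> \<psi> ` U \<union> P" "y \<in> \<psi> ` U \<union> P" "x \<noteq> y"
      consider "x \<in> \<psi> ` U" "y \<in> \<psi> ` U" | "x \<in> \<psi> ` U" "y \<in> P" | "x \<in> P" "y \<in> \<psi> ` U" | "x \<in> P" "y \<in> P"
        using xy by blast
      then show "y \<notin> span {x}"
      proof cases
        case 1 then show ?thesis using par xy(3) by blast
      next
        case 2 then show ?thesis using unred P(1) by blast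
      next
        case 3
        then obtain u where u: "u \<in> U" "y = \<psi> u" by blast
        have "x \<notin> span {y}" using unred[OF u(1), of x] 3(1) P(1) u(2) by blast
        moreover have "y \<noteq> 0" using U0 u by simp
        ultimately show ?thesis using span_singleton_sym[of y x] by metis
      next
        case 4 then show ?thesis using P(2) xy(3) by blast
      qed
    qed
    show "\<forall>S\<subseteq>\<psi> ` U. dim S = m \<longrightarrow> (\<exists>r\<in>P. r \<in> span S)"
    proof (intro allI impI)
      fix S assume S: "S \<subseteq> \<psi> ` U" "dim S = m"
      obtain S' where S': "S' \<subseteq> U" "S = \<psi> ` S'" using S(1) by (meson subset_imageE)
      then show "\<exists>r\<in>P. r \<in> span S" using blocked[OF S'(1)] S(2) PR by blast
    qed
    show "\<forall>x\<in>\<psi> ` U. \<forall>y\<in>\<psi> ` U. x \<noteq> y \<longrightarrow>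
      (\<exists>S\<subseteq>\<psi> ` U. dim S + 1 = m \<and> dim (insert x (insert y S)) = m + 1 \<and> (\<forall>r\<in>P. r \<notin> span S))"
    proof (intro ballI impI)
      fix x y assume xy: "x \<in> \<psi> ` U" "y \<in> \<psi> ` U" "x \<noteq> y"
      then obtain u v where uv: "u \<in> U" "v \<in> U" "u \<noteq> v" "x = \<psi> u" "y = \<psi> v" by blast
      have "\<exists>S\<subseteq>U. dim (\<psi> ` S) + 1 = m \<and> dim (insert (\<psi> u) (insert (\<psi> v) (\<psi> ` S))) = m + 1 \<and> (\<forall>r\<in>R. r \<notin> span (\<psi> ` S))"
        using neg uv(1-3) by meson
      then obtain S where S: "S \<subseteq> U" "dim (\<psi> ` S) + 1 = m" "dim (insert (\<psi> u) (insert (\<psi> v) (\<psi> ` S))) = m + 1"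
        "\<forall>r\<in>R. r \<notin> span (\<psi> ` S)" by (elim exE conjE) (rule that, assumption+)
      show "\<exists>S\<subseteq>\<psi> ` U. dim S + 1 = m \<and> dim (insert x (insert y S)) = m + 1 \<and> (\<forall>r\<in>P. r \<notin> span S)"
        using S P(1) uv by (intro exI[of _ "\<psi> ` S"]) auto
    qed
  qed
  moreover have "card P \<le> card R" using P(1) fin(2) by (rule card_mono[rotated])
  ultimately have "card (\<psi> ` U) \<le> max_blue k (k - 2)" using conf_card_le_max_blue[of m "\<psi> ` U" P k] m card by simp
  moreover have "inj_on \<psi> U"
    using par by (auto simp: inj_on_def) (metis insertI1 span_base)
  ultimately show False using large by (simp add: card_image)
qed

text \<open>Induction on the rank. Contracting \<open>p\<close> lowers the rank by one and creates
  one red point, so \<open>card R + Suc m \<le> k\<close> persists. The discarded set is handed back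
  unchanged, and lifting the cover raises the rank only of the one member through the new red point:
  total cost grows by one, as does \<open>m\<close>. When \<open>m = 0\<close> every blue point is
  parallel to a red one.\<close>

lemma blocked_cover:
  fixes \<psi> :: "'a \<Rightarrow> rvec"
  assumes "finite U" "finite R" "0 \<notin> R" "\<And>u. u \<in> U \<Longrightarrow> \<psi> u \<noteq> 0"
    and "\<And>u v. u \<in> U \<Longrightarrow> v \<in> U \<Longrightarrow> u \<noteq> v \<Longrightarrow> \<psi> v \<in> span {\<psi> u} \<Longrightarrow> \<exists>r\<in>R. r \<in> span {\<psi> u}"
    and "dim (\<psi> ` U \<union> R) \<le> Suc m + 1" and "card R + Suc m \<le> k"
    and "\<And>S. S \<subseteq> U \<Longrightarrow> dim (\<psi> ` S) = Suc m \<Longrightarrow> \<exists>r\<in>R. r \<in> span (\<psi> ` S)"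
  shows "\<exists>U'\<subseteq>U. card (U - U') \<le> max_blue k (k - 2) \<and> (\<exists>\<Q>. red_cover \<psi> U' R m \<Q>)"
  using assms
proof (induction m arbitrary: \<psi> R)
  case 0
  have "red_cover \<psi> U R 0 ((\<lambda>r. {r}) ` R)" unfolding red_cover_def
  proof (intro conjI ballI)
    fix u assume u: "u \<in> U"
    have "dim (\<psi> ` {u}) = Suc 0" using 0(4)[OF u] dim_insert_finite[of "{}" "\<psi> u"] by simp
    then obtain r where r: "r \<in> R" "r \<in> span {\<psi> u}" using 0(8)[of "{u}"] u by auto
    then have "\<psi> u \<in> span {r}" using span_singleton_sym 0(3) by metis
    then show "\<exists>Q\<in>(\<lambda>r. {r}) ` R. \<psi> u \<in> span Q" using r by blast
  next
    show "(\<Sum>Q\<in>(\<lambda>r. {r}) ` R. cover_cost R Q) \<le> 0" using red_singletons_cost[OF 0(2)] by linarith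
  qed (use 0(2) in auto)
  then show ?case by (intro exI[of _ U]) auto
next
  case (Suc m)
  note fin = Suc.prems(1,2) and R0 = Suc.prems(3) and U0 = Suc.prems(4) and par = Suc.prems(5)
    and dimUR = Suc.prems(6) and cardR = Suc.prems(7) and blocked = Suc.prems(8)
  \<comment> \<open>Elements parallel to a red point are covered at no cost; only the others can
    form a configuration.\<close>
  define U1 where "U1 = {u\<in>U. \<forall>r\<in>R. r \<notin> span {\<psi> u}}"
  have U1: "U1 \<subseteq> U" "finite U1" using fin by (auto simp: U1_def)
  have covered: "\<exists>Q\<in>(\<lambda>r. {r}) ` R. \<psi> u \<in> span Q" if "u \<in> U - U1" for u
  proof -
    obtain r where r: "r \<in> R" "r \<in> span {\<psi> u}" using \<open>u \<in> U - U1\<close> by (auto simp: U1_def)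
    then have "\<psi> u \<in> span {r}" using span_singleton_sym R0 by metis
    then show ?thesis using r by blast
  qed
  have dimle: "dim (\<psi> ` U1) \<le> dim (\<psi> ` U \<union> R)"
    using fin U1 by (intro dim_mono_finite) (auto intro: span_base)
  \<comment> \<open>Few such elements are discarded, elements of deficient rank form one member of
    the cover, and in the remaining case (C3) must fail.\<close>
  consider (small) "card U1 \<le> max_blue k (k - 2)" | (low) "dim (\<psi> ` U1) \<le> Suc (Suc m)"
    | (large) "max_blue k (k - 2) < card U1" "dim (\<psi> ` U1) = Suc (Suc m) + 1"
    using dimle dimUR by linarith
  then show ?case
  proof cases
    case small
    have "red_cover \<psi> (U - U1) R (Suc m) ((\<lambda>r. {r}) ` R)" unfolding red_cover_def
    proof (intro conjI ballI)
      show "(\<Sum>Q\<in>(\<lambda>r. {r}) ` R. cover_cost R Q) \<le> Suc m" using red_singletons_cost[OF fin(2)] by linarith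
    qed (use covered fin in auto)
    moreover have "U - (U - U1) = U1" using U1 by auto
    ultimately show ?thesis using small by (intro exI[of _ "U - U1"]) auto
  next
    case low
    have "red_cover \<psi> U R (Suc m) (insert (\<psi> ` U1) ((\<lambda>r. {r}) ` R))" unfolding red_cover_def
    proof (intro conjI ballI)
      fix u assume u: "u \<in> U"
      show "\<exists>Q\<in>insert (\<psi> ` U1) ((\<lambda>r. {r}) ` R). \<psi> u \<in> span Q"
        using covered[of u] u by (cases "u \<in> U1") (auto intro: span_base)
    next
      have "(\<Sum>Q\<in>insert (\<psi> ` U1) ((\<lambda>r. {r}) ` R). cover_cost R Q)
        \<le> cover_cost R (\<psi> ` U1) + (\<Sum>Q\<in>(\<lambda>r. {r}) ` R. cover_cost R Q)"
        by (cases "\<psi> ` U1 \<in> (\<lambda>r. {r}) ` R") (use fin in \<open>auto simp: insert_absorb\<close>)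
      also have "\<dots> \<le> Suc m" using red_singletons_cost[OF fin(2)] cover_cost_le[of R "\<psi> ` U1"] low by simp
      finally show "(\<Sum>Q\<in>insert (\<psi> ` U1) ((\<lambda>r. {r}) ` R). cover_cost R Q) \<le> Suc m" .
    qed (use fin U1 in auto)
    then show ?thesis by (intro exI[of _ U]) auto
  next
    case large
    have spanU: "span (\<psi> ` U1) = span (\<psi> ` U \<union> R)"
      using fin U1 dimUR large(2) by (intro span_eq_of_dim_ge) (auto intro: span_base)
    have "\<exists>u\<in>U1. \<exists>v\<in>U1. u \<noteq> v \<and> (\<forall>S\<subseteq>U1. dim (\<psi> ` S) + 1 = Suc (Suc m) \<longrightarrow>
      dim (insert (\<psi> u) (insert (\<psi> v) (\<psi> ` S))) = Suc (Suc m) + 1 \<longrightarrow> (\<exists>r\<in>R. r \<in> span (\<psi> ` S)))"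
    proof (rule conf_failure[OF U1(2) fin(2) R0 _ _ _ large(2) _ cardR _ _ large(1)])
      show "\<psi> u \<noteq> 0" if "u \<in> U1" for u using that U0 U1(1) by blast
      show "\<psi> v \<notin> span {\<psi> u}" if "u \<in> U1" "v \<in> U1" "u \<noteq> v" for u v
        using par[of u v] that by (auto simp: U1_def)
      show "r \<notin> span {\<psi> u}" if "u \<in> U1" "r \<in> R" for u r using that by (auto simp: U1_def)
      show "R \<subseteq> span (\<psi> ` U1)" unfolding spanU by (auto intro: span_base)
      show "\<exists>r\<in>R. r \<in> span (\<psi> ` S)" if "S \<subseteq> U1" "dim (\<psi> ` S) = Suc (Suc m)" for S
        using blocked[of S] that U1(1) by blast
    qed simp
    then obtain u v where uv: "u \<in> U1" "v \<in> U1" "u \<noteq> v" and fail: "\<And>S. S \<subseteq> U1 \<Longrightarrow> dim (\<psi> ` S) + 1 = Suc (Suc m) \<Longrightarrow>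
      dim (insert (\<psi> u) (insert (\<psi> v) (\<psi> ` S))) = Suc (Suc m) + 1 \<Longrightarrow> \<exists>r\<in>R. r \<in> span (\<psi> ` S)" by metis
    have uvU: "u \<in> U" "v \<in> U" using uv U1 by auto
    have unred: "r \<notin> span {\<psi> u}" if "r \<in> R" for r using uv(1) that by (auto simp: U1_def)
    have npar: "\<psi> v \<notin> span {\<psi> u}" using par[OF uvU uv(3)] unred by blast
    \<comment> \<open>A point of the line so generic that any subspace spanned by elements and red
      points which contains \<open>p\<close> contains the whole line.\<close>
    have "\<exists>p\<in>span {\<psi> u, \<psi> v}. \<forall>Q\<in>{span T |T. T \<subseteq> \<psi> ` U \<union> R \<and> \<not> span {\<psi> u, \<psi> v} \<subseteq> span T}. p \<notin> Q"
    proof (rule exists_avoiding_subspaces)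
      have "finite (span ` Pow (\<psi> ` U \<union> R))" using fin by simp
      then show "finite {span T |T. T \<subseteq> \<psi> ` U \<union> R \<and> \<not> span {\<psi> u, \<psi> v} \<subseteq> span T}"
        by (rule rev_finite_subset) auto
    qed auto
    then obtain p where p: "p \<in> span {\<psi> u, \<psi> v}"
      and avoid: "\<forall>Q\<in>{span T |T. T \<subseteq> \<psi> ` U \<union> R \<and> \<not> span {\<psi> u, \<psi> v} \<subseteq> span T}. p \<notin> Q"
      by (elim bexE) (rule that)
    have gen: "span {\<psi> u, \<psi> v} \<subseteq> span T" if T: "T \<subseteq> \<psi> ` U \<union> R" "p \<in> span T" for T
    proof (rule ccontr)
      assume "\<not> span {\<psi> u, \<psi> v} \<subseteq> span T"
      then have "p \<notin> span T" using T(1) by (intro avoid[rule_format] CollectI exI[of _ T]) simp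
      then show False using T(2) by simp
    qed
    have gen': "\<psi> u \<in> span T" "\<psi> v \<in> span T" if "T \<subseteq> \<psi> ` U \<union> R" "p \<in> span T" for T
      using gen[OF that] span_base[of _ "{\<psi> u, \<psi> v}"] by auto
    have punu: "p \<notin> span {\<psi> u}" using gen'(2)[of "{\<psi> u}"] npar uvU by auto
    have p0: "p \<noteq> 0" using punu span_0 by metis
    obtain \<pi> :: "rvec \<Rightarrow> rvec" where lin: "linear \<pi>" and ker: "\<And>x. \<pi> x = 0 \<longleftrightarrow> x \<in> span {p}"
      using exists_projection[of "{p}"] by blast
    note pin = projection_in_span_iff[OF lin ker]
    have pmem: "\<pi> x \<in> span (\<pi> ` T)" if "x \<in> span T" for x T
      using that pin[of x T] span_mono[of T "T \<union> {p}"] by blast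
    have pdim: "dim (\<pi> ` T) + 1 = dim (insert p T)" if "finite T" for T
      using projection_dim[OF lin ker _ that] dim_insert_finite[of "{}" p] p0 by simp
    define \<psi>' where "\<psi>' = (\<lambda>x. \<pi> (\<psi> x))"
    define R' where "R' = insert (\<pi> (\<psi> u)) (\<pi> ` R)"
    have img: "\<psi>' ` S = \<pi> ` \<psi> ` S" for S by (auto simp: \<psi>'_def)
    have U0': "\<pi> (\<psi> x) \<noteq> 0" if x: "x \<in> U" for x
    proof
      assume "\<pi> (\<psi> x) = 0"
      then have "p \<in> span {\<psi> x}" using ker span_singleton_sym U0[OF x] by blast
      then have "\<psi> u \<in> span {\<psi> x}" "\<psi> v \<in> span {\<psi> x}" using gen'[of "{\<psi> x}"] x by auto
      moreover have "\<psi> x \<in> span {\<psi> u}" using calculation(1) span_singleton_sym U0[OF uvU(1)] by blast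
      ultimately show False using npar span_trans_subset[of "\<psi> v" "{\<psi> x}" "{\<psi> u}"] by blast
    qed
    have R0': "0 \<notin> R'"
    proof -
      have "\<pi> r \<noteq> 0" if r: "r \<in> R" for r
      proof
        assume "\<pi> r = 0"
        then have "p \<in> span {r}" using ker span_singleton_sym R0 r by metis
        then have "\<psi> u \<in> span {r}" using gen'[of "{r}"] r by auto
        then show False using span_singleton_sym U0[OF uvU(1)] unred[OF r] by blast
      qed
      then show ?thesis using U0'[OF uvU(1)] by (auto simp: R'_def)
    qed
    have "\<exists>U'\<subseteq>U. card (U - U') \<le> max_blue k (k - 2) \<and> (\<exists>\<Q>. red_cover \<psi>' U' R' m \<Q>)"
    proof (rule Suc.IH)
      show "finite U" "finite R'" "0 \<notin> R'" using fin R0' by (auto simp: R'_def)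
      show "\<psi>' x \<noteq> 0" if "x \<in> U" for x using U0'[OF that] by (simp add: \<psi>'_def)
      show "\<exists>r\<in>R'. r \<in> span {\<psi>' x}" if xy: "x \<in> U" "y \<in> U" "x \<noteq> y" "\<psi>' y \<in> span {\<psi>' x}" for x y
      proof (cases "\<psi> y \<in> span {\<psi> x}")
        case True
        then obtain r where "r \<in> R" "r \<in> span {\<psi> x}" using par xy by blast
        then show ?thesis using pmem[of r "{\<psi> x}"] by (auto simp: R'_def \<psi>'_def)
      next
        \<comment> \<open>A new parallelism means that the line through \<open>x\<close> and
          \<open>y\<close> contains \<open>p\<close>, hence also \<open>u\<close>. The common image
          is then the new red point.\<close>
        case False
        have "\<psi> y \<in> span (insert p {\<psi> x})" using pin[of "\<psi> y" "{\<psi> x}"] xy(4) by (simp add: \<psi>'_def insert_commute)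
        then have "span (insert (\<psi> y) {\<psi> x}) = span (insert p {\<psi> x})" using False by (rule span_insert_swap)
        moreover from this have "p \<in> span (insert (\<psi> y) {\<psi> x})" by (simp add: span_base)
        then have "\<psi> u \<in> span (insert (\<psi> y) {\<psi> x})" using gen'(1)[of "insert (\<psi> y) {\<psi> x}"] xy by auto
        ultimately have "\<pi> (\<psi> u) \<in> span (\<pi> ` {\<psi> x})" using pin[of "\<psi> u" "{\<psi> x}"] by (simp add: insert_commute)
        then show ?thesis by (auto simp: R'_def \<psi>'_def)
      qed
      show "dim (\<psi>' ` U \<union> R') \<le> Suc m + 1"
      proof -
        have "\<psi>' ` U \<union> R' = \<pi> ` (\<psi> ` U \<union> R)" using uvU by (auto simp: \<psi>'_def R'_def)
        moreover have "dim (insert p (\<psi> ` U \<union> R)) = dim (\<psi> ` U \<union> R)"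
        proof -
          have "p \<in> span (\<psi> ` U \<union> R)" by (rule span_trans_subset[OF p]) (use uvU in \<open>auto intro: span_base\<close>)
          then show ?thesis using fin by (simp add: dim_insert_finite)
        qed
        ultimately show ?thesis using pdim[of "\<psi> ` U \<union> R"] fin dimUR by simp
      qed
      have "card R' \<le> Suc (card (\<pi> ` R))" unfolding R'_def by (rule card_insert_le_m1) (use fin in auto)
      also have "card (\<pi> ` R) \<le> card R" using fin(2) by (rule card_image_le)
      finally show "card R' + Suc m \<le> k" using cardR by simp
      show "\<exists>r\<in>R'. r \<in> span (\<psi>' ` S)" if S: "S \<subseteq> U" "dim (\<psi>' ` S) = Suc m" for S
      proof (cases "\<exists>r\<in>R. r \<in> span (\<psi> ` S)")
        case True
        then obtain r where r: "r \<in> R" "r \<in> span (\<psi> ` S)" by blast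
        have "\<pi> r \<in> span (\<psi>' ` S)" using pmem[OF r(2)] img by simp
        then show ?thesis using r(1) by (auto simp: R'_def)
      next
        case nored: False
        have fS: "finite (\<psi> ` S)" using S(1) fin(1) finite_subset by blast
        have SU1: "S \<subseteq> U1"
        proof
          fix x assume x: "x \<in> S"
          have "span {\<psi> x} \<subseteq> span (\<psi> ` S)" using x by (intro span_mono) auto
          then show "x \<in> U1" using x S(1) nored by (auto simp: U1_def)
        qed
        have d: "dim (insert p (\<psi> ` S)) = Suc (Suc m)" using pdim[OF fS] S(2) img by simp
        show ?thesis
        proof (cases "\<psi> u \<in> span (insert p (\<psi> ` S))")
          case True
          then have "\<pi> (\<psi> u) \<in> span (\<pi> ` \<psi> ` S)" using pin[of "\<psi> u" "\<psi> ` S"] by simp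
          then show ?thesis using img by (auto simp: R'_def)
        next
          case False
          \<comment> \<open>\<open>p\<close> in the span would bring \<open>u\<close> along by
            genericity. So the set had rank one less before being joined by \<open>p\<close>, and
            together with \<open>u\<close> and \<open>v\<close> it spans everything; the failure of
            (C3) at \<open>u\<close>, \<open>v\<close> makes it contain an old red point.\<close>
          have pS: "p \<notin> span (\<psi> ` S)" using gen'(1)[of "\<psi> ` S"] False S(1) span_mono[of "\<psi> ` S" "insert p (\<psi> ` S)"] by blast
          then have "dim (\<psi> ` S) + 1 = Suc (Suc m)" using d dim_insert_finite[OF fS, of p] by simp
          moreover have "dim (insert (\<psi> u) (insert (\<psi> v) (\<psi> ` S))) = Suc (Suc m) + 1"
          proof -
            have "span (insert p {\<psi> u}) = span (insert (\<psi> v) {\<psi> u})"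
              using p punu by (intro span_insert_swap) (auto simp: insert_commute)
            then have "span (\<psi> ` S \<union> insert p {\<psi> u}) = span (\<psi> ` S \<union> insert (\<psi> v) {\<psi> u})" by (rule span_Un_cong)
            then have "dim (\<psi> ` S \<union> insert p {\<psi> u}) = dim (\<psi> ` S \<union> insert (\<psi> v) {\<psi> u})" by (rule span_eq_dim)
            moreover have "dim (insert (\<psi> u) (insert p (\<psi> ` S))) = Suc (Suc m) + 1"
              using d False fS dim_insert_finite[of "insert p (\<psi> ` S)" "\<psi> u"] by simp
            ultimately show ?thesis by (simp add: insert_commute)
          qed
          ultimately show ?thesis using fail[OF SU1] nored by blast
        qed
      qed
    qed
    then obtain U' \<Q>0 where U': "U' \<subseteq> U" "card (U - U') \<le> max_blue k (k - 2)" "red_cover \<psi>' U' R' m \<Q>0"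
      by blast
    have fR': "finite R'" using fin by (simp add: R'_def)
    obtain \<Q> where Q: "red_cover \<psi>' U' R' m \<Q>" "\<forall>r\<in>R'. \<exists>!Q. Q \<in> \<Q> \<and> r \<in> span Q"
      using normal_red_cover[OF R0' fR' U'(3)] by (elim exE conjE) (rule that)
    note C = red_coverD[OF Q(1)]
    define z where "z = \<pi> (\<psi> u)"
    have zR: "z \<in> R'" by (simp add: R'_def z_def)
    have z0: "z \<noteq> 0" using U0'[OF uvU(1)] by (simp add: z_def)
    \<comment> \<open>A member through the new red point regains \<open>u\<close> and
      \<open>v\<close>, hence \<open>p\<close>. Any other member cannot contain \<open>p\<close>,
      and its rank does not rise.\<close>
    define lift where "lift = (\<lambda>Q. {y\<in>\<psi> ` U' \<union> R. \<pi> y \<in> span Q} \<union> (if z \<in> span Q then {\<psi> u, \<psi> v} else {}))"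
    have pv: "\<pi> (\<psi> v) \<in> span {z}"
    proof -
      have "span (insert p {\<psi> u}) = span (insert (\<psi> v) {\<psi> u})"
        using p punu by (intro span_insert_swap) (auto simp: insert_commute)
      then have "\<psi> v \<in> span ({\<psi> u} \<union> {p})" by (simp add: insert_commute span_base)
      then show ?thesis using pin[of "\<psi> v" "{\<psi> u}"] by (simp add: z_def)
    qed
    have lsub: "lift Q \<subseteq> \<psi> ` U \<union> R" for Q using U'(1) uvU by (auto simp: lift_def)
    have lfin: "finite (lift Q)" for Q using finite_subset[OF lsub] fin by auto
    have lpi: "\<pi> ` lift Q \<subseteq> span Q" for Q
    proof -
      have "\<pi> (\<psi> v) \<in> span Q" if "z \<in> span Q" using span_trans_subset[OF pv, of Q] that by simp
      then show ?thesis by (auto simp: lift_def z_def)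
    qed
    have ldim: "dim (insert p (lift Q)) \<le> dim Q + 1" if "Q \<in> \<Q>" for Q
      using pdim[OF lfin, of Q] dim_mono_finite[OF C(2)[OF that] lpi] by simp
    have cost: "cover_cost R (lift Q) \<le> cover_cost R' Q + of_bool (z \<in> span Q)" if QQ: "Q \<in> \<Q>" for Q
    proof (cases "z \<in> span Q")
      case True
      have "dim (lift Q) \<le> dim Q + 1"
        using ldim[OF QQ] dim_insert_finite[OF lfin, of p Q] by (simp split: if_splits)
      moreover have "1 \<le> dim Q" using dim_pos[OF C(2)[OF QQ] True z0] .
      ultimately show ?thesis using cover_cost_le[of R "lift Q"] cover_cost_eq[OF zR True] True by simp
    next
      case False
      have "p \<notin> span (lift Q)"
      proof
        assume "p \<in> span (lift Q)"
        then have "\<psi> u \<in> span (lift Q)" using gen'(1) lsub by blast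
        then have "z \<in> span (\<pi> ` lift Q)" using pmem by (simp add: z_def)
        then show False using False span_trans_subset lpi by blast
      qed
      then have d: "dim (lift Q) \<le> dim Q" using ldim[OF QQ] dim_insert_finite[OF lfin, of p Q] by simp
      show ?thesis
      proof (cases "\<exists>r\<in>R'. r \<in> span Q")
        case True
        then obtain r where r: "r \<in> R" "\<pi> r \<in> span Q" using False by (auto simp: R'_def z_def)
        then have "r \<in> span (lift Q)" by (auto simp: lift_def intro!: span_base)
        then have "cover_cost R (lift Q) = dim (lift Q) - 1" using cover_cost_eq r(1) by blast
        moreover have "cover_cost R' Q = dim Q - 1" using True by (simp add: cover_cost_def)
        ultimately show ?thesis using d by simp
      next
        case F2: False
        then have "cover_cost R' Q = max (dim Q - 1) 1" by (simp add: cover_cost_def)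
        moreover have "cover_cost R (lift Q) \<le> max (dim (lift Q) - 1) 1" by (rule cover_cost_le)
        ultimately show ?thesis using d by linarith
      qed
    qed
    have "red_cover \<psi> U' R (Suc m) (lift ` \<Q>)" unfolding red_cover_def
    proof (intro conjI ballI)
      show "finite (lift ` \<Q>)" using C(1) by simp
      show "finite Q" if "Q \<in> lift ` \<Q>" for Q using that lfin by auto
      show "\<exists>Q\<in>lift ` \<Q>. \<psi> x \<in> span Q" if x: "x \<in> U'" for x
      proof -
        obtain Q where Q: "Q \<in> \<Q>" "\<psi>' x \<in> span Q" using C(3)[OF x] by blast
        then have "\<psi> x \<in> lift Q" using x by (auto simp: lift_def \<psi>'_def)
        then show ?thesis using Q(1) span_base by blast
      qed
      have "(\<Sum>Q\<in>lift ` \<Q>. cover_cost R Q) \<le> (\<Sum>Q\<in>\<Q>. cover_cost R (lift Q))"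
        using sum_image_le[OF C(1), of "cover_cost R" lift] by (simp add: o_def)
      also have "\<dots> \<le> (\<Sum>Q\<in>\<Q>. cover_cost R' Q + of_bool (z \<in> span Q))" using cost by (rule sum_mono)
      also have "\<dots> = (\<Sum>Q\<in>\<Q>. cover_cost R' Q) + card {Q\<in>\<Q>. z \<in> span Q}"
        using C(1) by (simp add: sum.distrib sum_of_bool_eq Int_def)
      also have "card {Q\<in>\<Q>. z \<in> span Q} = 1"
      proof -
        have "\<exists>!Q. Q \<in> \<Q> \<and> z \<in> span Q" using Q(2) zR by (rule bspec)
        then obtain Q where "{Q\<in>\<Q>. z \<in> span Q} = {Q}" by (auto elim!: ex1E)
        then show ?thesis by simp
      qed
      finally show "(\<Sum>Q\<in>lift ` \<Q>. cover_cost R Q) \<le> Suc m" using C(4) by simp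
    qed
    then show ?thesis using U'(1,2) by blast
  qed
qed

subsection \<open>Covers by flats\<close>

lemma dim_image_mono: "finite Y \<Longrightarrow> X \<subseteq> Y \<Longrightarrow> dim (f ` X) \<le> dim ((f :: 'a \<Rightarrow> 'v::real_vector) ` Y)"
  by (rule dim_mono_finite) (auto intro: span_base)

text \<open>A relaxed form of \<open>degenerate\<close>: members are arbitrary spanning sets, and
  one of rank below two is charged 1, as it can be enlarged to rank two. Cost \<open>c\<close>
  corresponds to degeneracy \<open>c + 1\<close>.\<close>

definition flat_cover :: "('a \<Rightarrow> 'v::real_vector) \<Rightarrow> 'a set \<Rightarrow> nat \<Rightarrow> 'a set \<Rightarrow> bool" where
  "flat_cover f E c X \<longleftrightarrow> (\<exists>\<T>. finite \<T> \<and> (\<forall>T\<in>\<T>. T \<subseteq> E) \<and> (\<forall>x\<in>X. \<exists>T\<in>\<T>. f x \<in> span (f ` T)) \<and>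
     (\<Sum>T\<in>\<T>. max (dim (f ` T) - 1) 1) \<le> c)"

lemma flat_cover_mono:
  assumes "flat_cover f E c X" "Y \<subseteq> X" "c \<le> d"
  shows "flat_cover f E d Y"
proof -
  obtain \<T> where "finite \<T>" "\<forall>T\<in>\<T>. T \<subseteq> E" "\<forall>x\<in>X. \<exists>T\<in>\<T>. f x \<in> span (f ` T)"
     "(\<Sum>T\<in>\<T>. max (dim (f ` T) - 1) 1) \<le> c" using assms(1) unfolding flat_cover_def by (elim exE conjE) (rule that)
  then show ?thesis using assms(2,3) unfolding flat_cover_def by (intro exI[of _ \<T>]) auto
qed

lemma flat_cover_zero:
  assumes "flat_cover f E 0 X"
  shows "X = {}"
proof -
  obtain \<T> where T: "finite \<T>" "\<forall>x\<in>X. \<exists>T\<in>\<T>. f x \<in> span (f ` T)"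
     "(\<Sum>T\<in>\<T>. max (dim (f ` T) - 1) 1) \<le> 0" using assms(1) unfolding flat_cover_def by (elim exE conjE) (rule that)
  then have "\<T> = {}" by auto
  then show ?thesis using T by auto
qed

definition spreading :: "('a \<Rightarrow> 'v::real_vector) \<Rightarrow> real \<Rightarrow> 'a set \<Rightarrow> bool" where
  "spreading f \<eta> A \<longleftrightarrow> (\<forall>Q. finite Q \<longrightarrow> f ` A \<subseteq> span Q \<or> real (card {x\<in>A. f x \<in> span Q}) \<le> \<eta> * real (card A))"

text \<open>While some subspace captures too much without capturing everything, pass to the captured
  part. The rank drops each time, so this happens at most \<open>d\<close> times and each time at
  most a factor \<open>\<eta>\<close> of the size is lost.\<close>

lemma exists_spreading_subset:
  fixes f :: "'a \<Rightarrow> 'v::real_vector"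
  assumes "finite U" "0 < \<eta>" "\<eta> \<le> 1" "dim (f ` U) \<le> d"
  shows "\<exists>A\<subseteq>U. \<eta> ^ d * real (card U) \<le> real (card A) \<and> spreading f \<eta> A"
  using assms(1,4)
proof (induction d arbitrary: U)
  case 0
  have "f ` U \<subseteq> span Q" for Q
  proof
    fix y assume y: "y \<in> f ` U"
    have "y = 0"
    proof (rule ccontr)
      assume "y \<noteq> 0"
      then have "1 \<le> dim (f ` U)" using 0(1) y by (intro dim_pos[of _ y]) (auto intro: span_base)
      then show False using 0(2) by simp
    qed
    then show "y \<in> span Q" by (simp add: span_0)
  qed
  then show ?case by (intro exI[of _ U]) (auto simp: spreading_def)
next
  case (Suc d)
  show ?case
  proof (cases "spreading f \<eta> U")
    case True
    have "\<eta> ^ Suc d * real (card U) \<le> 1 * real (card U)"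
      using assms(2,3) by (intro mult_right_mono power_le_one) auto
    then show ?thesis using True by (intro exI[of _ U]) auto
  next
    case False
    then obtain Q where Q: "finite Q" "\<not> f ` U \<subseteq> span Q" "\<eta> * real (card U) < real (card {x\<in>U. f x \<in> span Q})"
      unfolding spreading_def by (auto simp: not_le)
    define U' where "U' = {x\<in>U. f x \<in> span Q}"
    have U': "U' \<subseteq> U" "finite U'" using Suc.prems(1) by (auto simp: U'_def)
    have "dim (f ` U') \<le> d"
    proof (rule ccontr)
      assume "\<not> dim (f ` U') \<le> d"
      then have "span (f ` U') = span (f ` U)"
        using Suc.prems U' by (intro span_eq_of_dim_ge) (auto intro: span_base)
      moreover have "span (f ` U') \<subseteq> span Q" by (intro span_minimal) (auto simp: U'_def)
      ultimately show False using Q(2) span_superset[of "f ` U"] by auto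
    qed
    then obtain A where A: "A \<subseteq> U'" "\<eta> ^ d * real (card U') \<le> real (card A)" "spreading f \<eta> A"
      using Suc.IH[OF U'(2)] by blast
    have "\<eta> ^ Suc d * real (card U) = \<eta> ^ d * (\<eta> * real (card U))" by simp
    also have "\<dots> \<le> \<eta> ^ d * real (card U')" using Q(3) assms(2) by (intro mult_left_mono) (auto simp: U'_def)
    finally show ?thesis using A U'(1) by (intro exI[of _ A]) auto
  qed
qed

section \<open>Greedy choice of slots and their tight unions\<close>

definition slot_union :: "(nat \<Rightarrow> 'a set) \<Rightarrow> nat set \<Rightarrow> 'a set" where
  "slot_union A J = (\<Union>i\<in>J. A i)"

text \<open>Independence of the slots, seen as subspaces, in the Dilworth truncation, which is
  induced by the function \<open>dim - 1\<close>.\<close>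

definition dilworth :: "('a \<Rightarrow> 'v::real_vector) \<Rightarrow> nat \<Rightarrow> (nat \<Rightarrow> 'a set) \<Rightarrow> bool" where
  "dilworth f j A \<longleftrightarrow> (\<forall>J\<subseteq>{..<j}. J \<noteq> {} \<longrightarrow> card J + 1 \<le> dim (f ` slot_union A J))"

definition tight :: "('a \<Rightarrow> 'v::real_vector) \<Rightarrow> (nat \<Rightarrow> 'a set) \<Rightarrow> nat set \<Rightarrow> bool" where
  "tight f A J \<longleftrightarrow> J \<noteq> {} \<and> dim (f ` slot_union A J) = card J + 1"

definition tight_part :: "('a \<Rightarrow> 'v::real_vector) \<Rightarrow> 'a set \<Rightarrow> (nat \<Rightarrow> 'a set) \<Rightarrow> nat \<Rightarrow> 'a set" where
  "tight_part f E A j = {x\<in>E. \<exists>J\<subseteq>{..<j}. tight f A J \<and> f x \<in> span (f ` slot_union A J)}"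

lemma slot_union_insert: "slot_union A (insert i J) = A i \<union> slot_union A J"
  by (auto simp: slot_union_def)

lemma slot_union_mono: "J \<subseteq> J' \<Longrightarrow> slot_union A J \<subseteq> slot_union A J'"
  by (auto simp: slot_union_def)

lemma slot_union_upd: "J \<subseteq> {..<j} \<Longrightarrow> slot_union (A(j := B)) J = slot_union A J"
  by (auto simp: slot_union_def)

lemma finite_slot_union: "(\<And>i. i < j \<Longrightarrow> finite (A i)) \<Longrightarrow> J \<subseteq> {..<j} \<Longrightarrow> finite (slot_union A J)"
  unfolding slot_union_def by (rule finite_UN_I) (auto intro: finite_subset)

lemma tight_upd: "J \<subseteq> {..<j} \<Longrightarrow> tight f (A(j := B)) J \<longleftrightarrow> tight f A J"
  by (simp add: tight_def slot_union_upd)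

text \<open>Uncrossing: the rank is submodular and the condition is also available for the nonempty
  intersection, so no slack is left for the union.\<close>

lemma tight_Un:
  fixes f :: "'a \<Rightarrow> 'v::real_vector"
  assumes dil: "dilworth f j A" and fin: "\<And>i. i < j \<Longrightarrow> finite (A i)"
    and J: "J \<subseteq> {..<j}" "tight f A J" and J': "J' \<subseteq> {..<j}" "tight f A J'" and ne: "J \<inter> J' \<noteq> {}"
  shows "tight f A (J \<union> J')"
proof -
  let ?S = "\<lambda>J. f ` slot_union A J"
  have fJ: "finite J" "finite J'" using J J' finite_subset by auto
  have f: "finite (?S J)" "finite (?S J')" using finite_slot_union[OF fin] J(1) J'(1) by auto
  have "dim (?S J \<union> ?S J') + dim (?S (J \<inter> J')) \<le> dim (?S J) + dim (?S J')"
    using f by (intro dim_submodular) (auto intro: span_base simp: slot_union_def)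
  moreover have "card (J \<inter> J') + 1 \<le> dim (?S (J \<inter> J'))" using dil ne J(1) unfolding dilworth_def by (meson le_infI1)
  moreover have "card (J \<union> J') + 1 \<le> dim (?S (J \<union> J'))"
  proof -
    have "J \<union> J' \<subseteq> {..<j}" "J \<union> J' \<noteq> {}" using J(1) J'(1) ne by auto
    then show ?thesis using dil unfolding dilworth_def by meson
  qed
  moreover have "?S (J \<union> J') = ?S J \<union> ?S J'" by (auto simp: slot_union_def)
  moreover have "card (J \<union> J') + card (J \<inter> J') = card J + card J'" using card_Un_Int[OF fJ] by simp
  ultimately have "dim (?S (J \<union> J')) = card (J \<union> J') + 1" using J(2) J'(2) by (simp add: tight_def)
  then show ?thesis using J(2) by (simp add: tight_def)
qed

text \<open>Maximal tight sets of slots are disjoint by uncrossing, and the span of a tight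
  \<open>J\<close> costs \<open>card J\<close>; so together they cost at most the number of
  slots.\<close>

lemma tight_part_cover:
  fixes f :: "'a \<Rightarrow> 'v::real_vector"
  assumes dil: "dilworth f j A" and E: "finite E" and A: "\<And>i. i < j \<Longrightarrow> A i \<subseteq> E"
  shows "flat_cover f E j (tight_part f E A j)"
proof -
  have fin: "\<And>i. i < j \<Longrightarrow> finite (A i)" using A E finite_subset by metis
  define \<J> where "\<J> = {J. J \<subseteq> {..<j} \<and> tight f A J}"
  define \<M> where "\<M> = {J\<in>\<J>. \<forall>J'\<in>\<J>. J \<subseteq> J' \<longrightarrow> J = J'}"
  have fJ: "finite \<J>" by (rule finite_subset[of _ "Pow {..<j}"]) (auto simp: \<J>_def)
  have fM: "finite \<M>" using fJ by (auto simp: \<M>_def)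
  have MJ: "J \<subseteq> {..<j}" "tight f A J" if "J \<in> \<M>" for J using that by (auto simp: \<M>_def \<J>_def)
  have disj: "J \<inter> J' = {}" if JJ: "J \<in> \<M>" "J' \<in> \<M>" "J \<noteq> J'" for J J'
  proof (rule ccontr)
    assume "J \<inter> J' \<noteq> {}"
    then have "tight f A (J \<union> J')" using tight_Un[OF dil fin MJ(1,2)[OF JJ(1)] MJ(1,2)[OF JJ(2)]] by simp
    then have "J \<union> J' \<in> \<J>" using MJ(1)[OF JJ(1)] MJ(1)[OF JJ(2)] by (simp add: \<J>_def)
    then have "J = J \<union> J'" "J' = J \<union> J'" using JJ(1,2) by (auto simp: \<M>_def)
    then show False using JJ(3) by simp
  qed
  show ?thesis unfolding flat_cover_def
  proof (intro exI[of _ "slot_union A ` \<M>"] conjI ballI)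
    show "finite (slot_union A ` \<M>)" using fM by simp
    fix T assume "T \<in> slot_union A ` \<M>"
    then obtain J where J: "J \<in> \<M>" "T = slot_union A J" by blast
    have "A i \<subseteq> E" if "i \<in> J" for i using MJ(1)[OF J(1)] that A by blast
    then show "T \<subseteq> E" unfolding J(2) slot_union_def by (rule UN_least)
  next
    fix x assume "x \<in> tight_part f E A j"
    then obtain J where J: "J \<in> \<J>" "f x \<in> span (f ` slot_union A J)" by (auto simp: tight_part_def \<J>_def)
    obtain J' where J': "J' \<in> \<J>" "J \<subseteq> J'" "\<forall>b\<in>\<J>. J' \<subseteq> b \<longrightarrow> J' = b"
      using finite_has_maximal2[OF fJ J(1)] by auto
    then have "J' \<in> \<M>" by (auto simp: \<M>_def)
    moreover have "f x \<in> span (f ` slot_union A J')"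
      using J(2) span_mono[of "f ` slot_union A J" "f ` slot_union A J'"] slot_union_mono[OF J'(2), of A] by blast
    ultimately show "\<exists>T\<in>slot_union A ` \<M>. f x \<in> span (f ` T)" by blast
  next
    have "(\<Sum>T\<in>slot_union A ` \<M>. max (dim (f ` T) - 1) 1) \<le> (\<Sum>J\<in>\<M>. max (dim (f ` slot_union A J) - 1) 1)"
      using sum_image_le[OF fM, of "\<lambda>T. max (dim (f ` T) - 1) 1" "slot_union A"] by (simp add: o_def)
    also have "\<dots> = (\<Sum>J\<in>\<M>. card J)"
    proof (rule sum.cong)
      fix J assume "J \<in> \<M>"
      then have "dim (f ` slot_union A J) = card J + 1" "card J \<noteq> 0"
        using MJ[of J] finite_subset[of J "{..<j}"] by (auto simp: tight_def)
      then show "max (dim (f ` slot_union A J) - 1) 1 = card J" by simp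
    qed simp
    also have "\<dots> = card (\<Union>\<M>)"
    proof (rule card_Union_disjoint[symmetric])
      show "pairwise disjnt \<M>" using disj by (auto simp: pairwise_def disjnt_def)
      show "finite J" if "J \<in> \<M>" for J using MJ(1)[OF that] finite_subset by blast
    qed
    also have "\<dots> \<le> card {..<j}" using MJ(1) by (intro card_mono) auto
    finally show "(\<Sum>T\<in>slot_union A ` \<M>. max (dim (f ` T) - 1) 1) \<le> j" by simp
  qed
qed

text \<open>A set of old slots that is not tight already has the additional rank to spare, and a
  tight one gains it from any element of \<open>B\<close>, which lies outside its span. For
  \<open>B\<close> alone rank two is assumed.\<close>

lemma dilworth_extend:
  fixes f :: "'a \<Rightarrow> 'v::real_vector"
  assumes dil: "dilworth f j A" and E: "finite E" and A: "\<And>i. i < j \<Longrightarrow> A i \<subseteq> E"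
    and B: "B \<subseteq> E - tight_part f E A j" "2 \<le> dim (f ` B)"
  shows "dilworth f (Suc j) (A(j := B))"
  unfolding dilworth_def
proof (intro allI impI)
  fix J assume J: "J \<subseteq> {..<Suc j}" "J \<noteq> {}"
  have fin: "\<And>i. i < j \<Longrightarrow> finite (A i)" using A E finite_subset by metis
  have fB: "finite B" using B(1) E finite_subset by blast
  show "card J + 1 \<le> dim (f ` slot_union (A(j := B)) J)"
  proof (cases "j \<in> J")
    case False
    then have "J \<subseteq> {..<j}" using J(1) by (auto simp: less_Suc_eq)
    then show ?thesis using dil J(2) by (simp add: dilworth_def slot_union_upd)
  next
    case True
    define J' where "J' = J - {j}"
    have J': "J' \<subseteq> {..<j}" "J = insert j J'" "j \<notin> J'" using J(1) True by (auto simp: J'_def less_Suc_eq)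
    have fJ': "finite J'" using J'(1) finite_subset by blast
    have cJ: "card J = Suc (card J')" using J' fJ' by simp
    have U: "slot_union (A(j := B)) J = B \<union> slot_union A J'"
      using slot_union_upd[OF J'(1), of A B] by (simp add: J'(2) slot_union_insert)
    have fU: "finite (slot_union A J')" using finite_slot_union[OF fin J'(1)] .
    have le: "dim (f ` slot_union A J') \<le> dim (f ` (B \<union> slot_union A J'))" "dim (f ` B) \<le> dim (f ` (B \<union> slot_union A J'))"
      using fU fB by (auto intro!: dim_image_mono)
    consider "J' = {}" | "J' \<noteq> {}" "\<not> tight f A J'" | "tight f A J'" by blast
    then show ?thesis
    proof cases
      case 1 then show ?thesis using le(2) B(2) U cJ by simp
    next
      case 2
      have "card J' + 1 \<le> dim (f ` slot_union A J')" using dil J'(1) 2(1) by (simp add: dilworth_def)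
      then have "card J' + 2 \<le> dim (f ` slot_union A J')" using 2 by (simp add: tight_def)
      then show ?thesis using le(1) U cJ by simp
    next
      case 3
      obtain b where b: "b \<in> B" using B(2) by (cases "B = {}") auto
      have "f b \<notin> span (f ` slot_union A J')" using b B(1) 3 J'(1) by (auto simp: tight_part_def)
      then have "Suc (dim (f ` slot_union A J')) = dim (insert (f b) (f ` slot_union A J'))"
        using dim_insert_finite[of "f ` slot_union A J'" "f b"] fU by simp
      also have "\<dots> \<le> dim (f ` (B \<union> slot_union A J'))"
        using fU fB b by (intro dim_mono_finite) (auto intro!: span_base)
      finally show ?thesis using 3 U cJ by (simp add: tight_def)
    qed
  qed
qed

text \<open>
  Slots are chosen greedily: \<open>A j\<close> lies outside the tight part of the earlier slots, as long as what is left
  there has at least \<open>\<Lambda> j\<close> elements. A slot that lies in no tight set is mostly outside the tight part.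
\<close>

definition slot_state :: "nat \<Rightarrow> (nat \<Rightarrow> real) \<Rightarrow> (nat \<Rightarrow> nat) \<Rightarrow> real \<Rightarrow> ('a \<Rightarrow> 'v::real_vector) \<Rightarrow> 'a set \<Rightarrow> nat \<Rightarrow> (nat \<Rightarrow> 'a set) \<Rightarrow> bool" where
  "slot_state k \<eta> \<Lambda> K f E j A \<longleftrightarrow>
     (\<forall>i<j. A i \<subseteq> E \<and> spreading f (\<eta> i) (A i) \<and> 2 * \<Lambda> (Suc i) + 2 \<le> card (A i) \<and>
        real (card (E - tight_part f E A i)) \<le> K * real (card (A i))) \<and>
     dilworth f j A \<and>
     (\<forall>i<j. (\<exists>T\<subseteq>{..<j}. i \<in> T \<and> tight f A T \<and> (\<forall>m\<in>T. real (card (A i)) \<le> K * real (card (A m)))) \<or>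
        (\<forall>m<j. real (card (A i)) \<le> K * real (card (A m))))"

lemma slot_stateD:
  assumes "slot_state k \<eta> \<Lambda> K f E j A"
  shows "i < j \<Longrightarrow> A i \<subseteq> E" "i < j \<Longrightarrow> spreading f (\<eta> i) (A i)" "i < j \<Longrightarrow> 2 * \<Lambda> (Suc i) + 2 \<le> card (A i)"
    "i < j \<Longrightarrow> real (card (E - tight_part f E A i)) \<le> K * real (card (A i))"
    "dilworth f j A"
    "i < j \<Longrightarrow> (\<exists>T\<subseteq>{..<j}. i \<in> T \<and> tight f A T \<and> (\<forall>m\<in>T. real (card (A i)) \<le> K * real (card (A m)))) \<or>
        (\<forall>m<j. real (card (A i)) \<le> K * real (card (A m)))"
  using assms unfolding slot_state_def by blast+

text \<open>A tight set without \<open>i\<close> cannot span \<open>A i\<close>, since adjoining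
  \<open>i\<close> has to raise the rank. By spreading, its span then takes only the fraction
  \<open>\<eta> i\<close> of \<open>A i\<close>, and there are at most \<open>2 ^ j\<close> tight
  sets.\<close>

lemma untight_slot:
  fixes f :: "'a \<Rightarrow> 'v::real_vector"
  assumes st: "slot_state k \<eta> \<Lambda> K f E j A" and E: "finite E" and \<eta>: "0 \<le> \<eta> i" "\<eta> i * 2 ^ j \<le> 1 / 2"
    and i: "i < j" "\<And>J. J \<subseteq> {..<j} \<Longrightarrow> tight f A J \<Longrightarrow> i \<notin> J"
  shows "card (A i) \<le> 2 * card (E - tight_part f E A j)"
proof -
  note S = slot_stateD[OF st]
  have fA: "finite (A i)" using S(1)[OF i(1)] E finite_subset by blast
  define \<J> where "\<J> = {J. J \<subseteq> {..<j} \<and> tight f A J}"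
  have JP: "\<J> \<subseteq> Pow {..<j}" by (auto simp: \<J>_def)
  have fJ: "finite \<J>" by (rule finite_subset[OF JP]) simp
  have cJ: "card \<J> \<le> 2 ^ j" using card_mono[OF _ JP] by (simp add: card_Pow)
  have b: "real (card {x\<in>A i. f x \<in> span (f ` slot_union A J)}) \<le> \<eta> i * real (card (A i))" if J: "J \<in> \<J>" for J
  proof -
    have J': "J \<subseteq> {..<j}" "tight f A J" using J by (auto simp: \<J>_def)
    have fU: "finite (slot_union A J)" using finite_slot_union[OF _ J'(1)] S(1) E finite_subset by metis
    have iJ: "i \<notin> J" using i(2) J' by blast
    have "\<not> f ` A i \<subseteq> span (f ` slot_union A J)"
    proof
      assume "f ` A i \<subseteq> span (f ` slot_union A J)"
      then have "span (f ` slot_union A J \<union> f ` A i) = span (f ` slot_union A J)" by (rule span_Un_absorb)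
      then have "dim (f ` slot_union A (insert i J)) = dim (f ` slot_union A J)"
        using span_eq_dim by (metis slot_union_insert image_Un Un_commute)
      moreover have "card (insert i J) + 1 \<le> dim (f ` slot_union A (insert i J))"
        using S(5) J'(1) i(1) by (simp add: dilworth_def)
      ultimately show False using J'(2) iJ finite_subset[OF J'(1)] by (simp add: tight_def)
    qed
    then show ?thesis using S(2)[OF i(1)] fU unfolding spreading_def by blast
  qed
  have "A i \<inter> tight_part f E A j \<subseteq> (\<Union>J\<in>\<J>. {x\<in>A i. f x \<in> span (f ` slot_union A J)})"
    by (auto simp: tight_part_def \<J>_def)
  then have "card (A i \<inter> tight_part f E A j) \<le> card (\<Union>J\<in>\<J>. {x\<in>A i. f x \<in> span (f ` slot_union A J)})"
    using fJ fA by (intro card_mono) auto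
  also have "\<dots> \<le> (\<Sum>J\<in>\<J>. card {x\<in>A i. f x \<in> span (f ` slot_union A J)})" using fJ by (rule card_UN_le)
  finally have "real (card (A i \<inter> tight_part f E A j)) \<le> real (\<Sum>J\<in>\<J>. card {x\<in>A i. f x \<in> span (f ` slot_union A J)})"
    by (simp only: of_nat_le_iff)
  also have "\<dots> = (\<Sum>J\<in>\<J>. real (card {x\<in>A i. f x \<in> span (f ` slot_union A J)}))" by (rule of_nat_sum)
  also have "\<dots> \<le> (\<Sum>J\<in>\<J>. \<eta> i * real (card (A i)))" using b by (rule sum_mono)
  also have "\<dots> = real (card \<J>) * (\<eta> i * real (card (A i)))" by simp
  also have "\<dots> \<le> 2 ^ j * (\<eta> i * real (card (A i)))"
  proof (rule mult_right_mono)
    have "real (card \<J>) \<le> real (2 ^ j)" using cJ by (simp only: of_nat_le_iff)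
    then show "real (card \<J>) \<le> 2 ^ j" by simp
  qed (use \<eta>(1) in simp)
  also have "\<dots> = (\<eta> i * 2 ^ j) * real (card (A i))" by simp
  also have "\<dots> \<le> 1 / 2 * real (card (A i))" using \<eta>(2) by (rule mult_right_mono) simp
  finally have h: "2 * card (A i \<inter> tight_part f E A j) \<le> card (A i)" by simp
  have "card (A i) = card (A i \<inter> tight_part f E A j) + card (A i - tight_part f E A j)"
    using card_Un_disjoint[of "A i \<inter> tight_part f E A j" "A i - tight_part f E A j"] fA by (simp add: Int_Diff_Un Int_Diff_disjoint)
  moreover have "card (A i - tight_part f E A j) \<le> card (E - tight_part f E A j)"
    using S(1)[OF i(1)] E by (intro card_mono) auto
  ultimately show ?thesis using h by linarith
qed

lemma tight_part_antimono:
  assumes "i \<le> j" shows "tight_part f E A i \<subseteq> tight_part f E A j"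
proof
  fix x assume "x \<in> tight_part f E A i"
  then obtain J where "x \<in> E" "J \<subseteq> {..<i}" "tight f A J" "f x \<in> span (f ` slot_union A J)"
    by (auto simp: tight_part_def)
  then show "x \<in> tight_part f E A j" using assms unfolding tight_part_def
    by (intro CollectI conjI exI[of _ J]) auto
qed

lemma tight_part_upd:
  assumes "i \<le> j" shows "tight_part f E (A(j := B)) i = tight_part f E A i"
proof -
  have "J \<subseteq> {..<i} \<and> tight f (A(j := B)) J \<and> f x \<in> span (f ` slot_union (A(j := B)) J) \<longleftrightarrow>
    J \<subseteq> {..<i} \<and> tight f A J \<and> f x \<in> span (f ` slot_union A J)" for J x
  proof (cases "J \<subseteq> {..<i}")
    case True
    then have "J \<subseteq> {..<j}" using assms by auto
    then show ?thesis by (simp add: tight_upd slot_union_upd)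
  qed simp
  then show ?thesis unfolding tight_part_def by simp
qed

text \<open>A slot cut from a remainder of at least \<open>\<Lambda> i\<close> elements keeps the
  fraction \<open>\<eta> i ^ (k + 1)\<close> and so has more than twice
  \<open>\<Lambda> (i + 1)\<close> elements: too many to lie half in a later remainder below its
  threshold. The 2 in the condition on \<open>K\<close> absorbs the factor lost in
  \<open>untight_slot\<close>.\<close>

locale slot_constants =
  fixes k :: nat and \<eta> :: "nat \<Rightarrow> real" and \<Lambda> :: "nat \<Rightarrow> nat" and K :: real
  assumes \<eta>: "i < k \<Longrightarrow> 0 < \<eta> i" "i < k \<Longrightarrow> \<eta> i * 2 ^ k \<le> 1 / 2"
    and \<Lambda>: "i < k \<Longrightarrow> real (2 * \<Lambda> (Suc i) + 2) \<le> \<eta> i ^ (k + 1) * real (\<Lambda> i)" "0 < \<Lambda> k"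
    and K: "i < k \<Longrightarrow> 2 \<le> K * \<eta> i ^ (k + 1)"
begin

lemma \<eta>_le: "i < k \<Longrightarrow> \<eta> i \<le> 1" "i < k \<Longrightarrow> j \<le> k \<Longrightarrow> \<eta> i * 2 ^ j \<le> 1 / 2"
proof -
  assume i: "i < k"
  have le: "\<eta> i * 2 ^ j \<le> 1 / 2" if "j \<le> k" for j
  proof -
    have "\<eta> i * 2 ^ j \<le> \<eta> i * 2 ^ k" using \<eta>(1)[OF i] that by (intro mult_left_mono power_increasing) auto
    then show ?thesis using \<eta>(2)[OF i] by simp
  qed
  show "j \<le> k \<Longrightarrow> \<eta> i * 2 ^ j \<le> 1 / 2" by (rule le)
  show "\<eta> i \<le> 1" using le[of 0] by simp
qed

lemma \<Lambda>_Suc: "i < k \<Longrightarrow> 2 * \<Lambda> (Suc i) + 2 \<le> \<Lambda> i"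
proof -
  assume i: "i < k"
  have "\<eta> i ^ (k + 1) * real (\<Lambda> i) \<le> 1 * real (\<Lambda> i)"
    using \<eta>(1)[OF i] \<eta>_le(1)[OF i] by (intro mult_right_mono power_le_one) auto
  then have "real (2 * \<Lambda> (Suc i) + 2) \<le> real (\<Lambda> i)" using \<Lambda>(1)[OF i] by linarith
  then show ?thesis by linarith
qed

lemma \<Lambda>_antimono: "i \<le> j \<Longrightarrow> j \<le> k \<Longrightarrow> \<Lambda> j \<le> \<Lambda> i"
proof (induction j rule: dec_induct)
  case (step j)
  then show ?case using \<Lambda>_Suc[of j] by simp
qed simp

lemma K_pos: "0 < k \<Longrightarrow> 0 < K"
  using K[of 0] \<eta>(1)[of 0] by (smt (verit) mult_nonpos_nonneg zero_le_power)

text \<open>A slot in no tight set yet is at most twice as large as the present remainder, hence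
  comparable to the new slot. Once it lies in a tight set, the comparison within that set is already
  settled and later slots do not matter.\<close>

lemma exists_next_slot:
  fixes f :: "'a \<Rightarrow> 'v::real_vector"
  assumes st: "slot_state k \<eta> \<Lambda> K f E j A" and E: "finite E" and j: "j < k"
    and simple: "\<And>x y. x \<in> E \<Longrightarrow> y \<in> E \<Longrightarrow> x \<noteq> y \<Longrightarrow> dim {f x, f y} = 2"
    and dimE: "dim (f ` E) \<le> k + 1"
    and large: "\<Lambda> j \<le> card (E - tight_part f E A j)"
  shows "\<exists>B. slot_state k \<eta> \<Lambda> K f E (Suc j) (A(j := B))"
proof -
  note S = slot_stateD[OF st]
  define U where "U = E - tight_part f E A j"
  have fU: "finite U" using E by (simp add: U_def)
  have UE: "U \<subseteq> E" by (auto simp: U_def)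
  have "dim (f ` U) \<le> k + 1" using dim_image_mono[OF E UE, of f] dimE by simp
  then obtain B where B: "B \<subseteq> U" "\<eta> j ^ (k + 1) * real (card U) \<le> real (card B)" "spreading f (\<eta> j) B"
    using exists_spreading_subset[OF fU \<eta>(1)[OF j] \<eta>_le(1)[OF j]] by blast
  have fB: "finite B" using B(1) fU finite_subset by blast
  have KU: "2 * real (card U) \<le> K * real (card B)"
  proof -
    have "2 * real (card U) \<le> K * \<eta> j ^ (k + 1) * real (card U)" using K[OF j] by (rule mult_right_mono) simp
    also have "\<dots> = K * (\<eta> j ^ (k + 1) * real (card U))" by simp
    also have "\<dots> \<le> K * real (card B)" using B(2) K_pos j by (intro mult_left_mono) auto
    finally show ?thesis .
  qed
  have cB: "2 * \<Lambda> (Suc j) + 2 \<le> card B"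
  proof -
    have "real (2 * \<Lambda> (Suc j) + 2) \<le> \<eta> j ^ (k + 1) * real (\<Lambda> j)" by (rule \<Lambda>(1)[OF j])
    also have "\<dots> \<le> \<eta> j ^ (k + 1) * real (card U)"
      using large \<eta>(1)[OF j] by (intro mult_left_mono) (auto simp: U_def)
    finally show ?thesis using B(2) by linarith
  qed
  have "2 \<le> dim (f ` B)"
  proof -
    obtain x y where xy: "x \<in> B" "y \<in> B" "x \<noteq> y"
      using cB card_le_Suc0_iff_eq[OF fB] by (metis One_nat_def add_leD2 not_less_eq_eq numeral_2_eq_2)
    then have "dim {f x, f y} = 2" using simple B(1) UE by blast
    moreover have "dim {f x, f y} \<le> dim (f ` B)" using xy fB by (intro dim_mono_finite) (auto intro: span_base)
    ultimately show ?thesis by simp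
  qed
  then have dil: "dilworth f (Suc j) (A(j := B))"
    using dilworth_extend[OF S(5) E S(1)] B(1) by (simp add: U_def)
  have tp: "tight_part f E (A(j := B)) i = tight_part f E A i" if "i \<le> j" for i using tight_part_upd[OF that] .
  have small: "real (card B) \<le> K * real (card ((A(j := B)) m))" if m: "m < Suc j" for m
  proof (cases "m = j")
    case True
    have "real (card B) \<le> real (card U)" using B(1) fU by (simp add: card_mono)
    then show ?thesis using KU True by simp
  next
    case False
    then have m': "m < j" using m by simp
    have "card B \<le> card (E - tight_part f E A m)"
      using B(1) E tight_part_antimono[of m j f E A] m' by (intro card_mono) (auto simp: U_def)
    then show ?thesis using S(4)[OF m'] False by simp
  qed
  have "slot_state k \<eta> \<Lambda> K f E (Suc j) (A(j := B))" unfolding slot_state_def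
  proof (intro conjI allI impI dil)
    fix i assume i: "i < Suc j"
    show "(A(j := B)) i \<subseteq> E" "spreading f (\<eta> i) ((A(j := B)) i)" "2 * \<Lambda> (Suc i) + 2 \<le> card ((A(j := B)) i)"
      using i S(1,2,3)[of i] B UE cB by (auto simp: less_Suc_eq)
    show "real (card (E - tight_part f E (A(j := B)) i)) \<le> K * real (card ((A(j := B)) i))"
    proof (cases "i = j")
      case True
      have "tight_part f E (A(j := B)) i = tight_part f E A j" using tp[of i] True by simp
      then show ?thesis using KU True by (simp add: U_def)
    next
      case False
      then show ?thesis using tp[of i] S(4)[of i] i by simp
    qed
    let ?P = "\<lambda>i m. real (card ((A(j := B)) i)) \<le> K * real (card ((A(j := B)) m))"
    show "(\<exists>T\<subseteq>{..<Suc j}. i \<in> T \<and> tight f (A(j := B)) T \<and> (\<forall>m\<in>T. ?P i m)) \<or> (\<forall>m<Suc j. ?P i m)"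
    proof (cases "i = j")
      case True
      then show ?thesis using small by simp
    next
      case False
      then have i': "i < j" using i by simp
      show ?thesis
      proof (cases "\<exists>T\<subseteq>{..<j}. i \<in> T \<and> tight f A T")
        case True
        then obtain T where T: "T \<subseteq> {..<j}" "i \<in> T" "tight f A T" by blast
        have "\<exists>T\<subseteq>{..<j}. i \<in> T \<and> tight f A T \<and> (\<forall>m\<in>T. real (card (A i)) \<le> K * real (card (A m)))"
          using S(6)[OF i']
        proof
          assume "\<forall>m<j. real (card (A i)) \<le> K * real (card (A m))"
          then show ?thesis using T by (intro exI[of _ T]) auto
        qed
        then obtain T where T: "T \<subseteq> {..<j}" "i \<in> T" "tight f A T" "\<forall>m\<in>T. real (card (A i)) \<le> K * real (card (A m))"
          by (elim exE conjE) (rule that)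
        have "tight f (A(j := B)) T" using T(3) by (simp add: tight_upd[OF T(1)])
        moreover have "?P i m" if "m \<in> T" for m using T(1,4) that i' by auto
        ultimately show ?thesis using T(1,2) by (intro disjI1 exI[of _ T]) auto
      next
        case False
        then have "card (A i) \<le> 2 * card U"
          using untight_slot[OF st E _ _ i'] \<eta>(1)[of i] \<eta>_le(2)[of i j] i' j by (auto simp: U_def)
        then have h: "real (card (A i)) \<le> K * real (card B)" using KU by linarith
        have all: "\<forall>m<j. real (card (A i)) \<le> K * real (card (A m))" using S(6)[OF i'] False by blast
        have "?P i m" if "m < Suc j" for m
          using h all i' that by (cases "m = j") auto
        then show ?thesis by blast
      qed
    qed
  qed
  then show ?thesis by blast
qed

text \<open>The choice must stop: \<open>k\<close> slots span rank \<open>k + 1\<close>, hence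
  everything, and nothing remains outside the tight part. At the stop the remainder is below its
  threshold, so no slot is outside all tight sets, because half of it would remain.\<close>

lemma exists_slots:
  fixes f :: "'a \<Rightarrow> 'v::real_vector"
  assumes E: "finite E" and simple: "\<And>x y. x \<in> E \<Longrightarrow> y \<in> E \<Longrightarrow> x \<noteq> y \<Longrightarrow> dim {f x, f y} = 2"
    and dimE: "dim (f ` E) \<le> k + 1" and k: "0 < k"
  shows "\<exists>j\<le>k. \<exists>A. slot_state k \<eta> \<Lambda> K f E j A \<and> card (E - tight_part f E A j) < \<Lambda> j \<and>
    (\<forall>i<j. \<exists>T\<subseteq>{..<j}. i \<in> T \<and> tight f A T \<and> (\<forall>m\<in>T. real (card (A i)) \<le> K * real (card (A m))))"
proof -
  have "\<exists>j\<le>k. \<exists>A. slot_state k \<eta> \<Lambda> K f E j A \<and> card (E - tight_part f E A j) < \<Lambda> j"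
  proof (rule ccontr)
    assume neg: "\<not> ?thesis"
    have "\<exists>A. slot_state k \<eta> \<Lambda> K f E j A" if "j \<le> k" for j
      using that
    proof (induction j)
      case 0
      show ?case unfolding slot_state_def dilworth_def by auto
    next
      case (Suc j)
      then obtain A where A: "slot_state k \<eta> \<Lambda> K f E j A" by auto
      have "\<Lambda> j \<le> card (E - tight_part f E A j)" using neg A Suc(2) by (meson Suc_leD not_less)
      then show ?case using exists_next_slot[OF A E _ simple dimE] Suc(2) by (meson Suc_le_lessD)
    qed
    then obtain A where A: "slot_state k \<eta> \<Lambda> K f E k A" by blast
    note S = slot_stateD[OF A]
    have "slot_union A {..<k} \<subseteq> E" using S(1) by (auto simp: slot_union_def)
    then have sub: "f ` slot_union A {..<k} \<subseteq> span (f ` E)" "finite (slot_union A {..<k})"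
      using E finite_subset by (auto intro: span_base)
    have d: "k + 1 \<le> dim (f ` slot_union A {..<k})" using S(5) k by (auto simp: dilworth_def)
    have d2: "dim (f ` slot_union A {..<k}) \<le> dim (f ` E)" using sub E by (intro dim_mono_finite) auto
    have "span (f ` slot_union A {..<k}) = span (f ` E)"
      using sub E d dimE by (intro span_eq_of_dim_ge) auto
    moreover have "tight f A {..<k}" using d d2 dimE k by (auto simp: tight_def)
    ultimately have "tight_part f E A k = E" by (auto simp: tight_part_def intro!: exI[of _ "{..<k}"] intro: span_base)
    then have "card (E - tight_part f E A k) < \<Lambda> k" using \<Lambda>(2) by simp
    then show False using neg A by blast
  qed
  then obtain j A where j: "j \<le> k" and A: "slot_state k \<eta> \<Lambda> K f E j A" and few: "card (E - tight_part f E A j) < \<Lambda> j"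
    by blast
  note S = slot_stateD[OF A]
  have "\<exists>T\<subseteq>{..<j}. i \<in> T \<and> tight f A T \<and> (\<forall>m\<in>T. real (card (A i)) \<le> K * real (card (A m)))" if i: "i < j" for i
  proof -
    have "\<exists>T\<subseteq>{..<j}. i \<in> T \<and> tight f A T"
    proof (rule ccontr)
      assume "\<not> ?thesis"
      then have "card (A i) \<le> 2 * card (E - tight_part f E A j)"
        using untight_slot[OF A E _ _ i] \<eta>(1)[of i] \<eta>_le(2)[of i j] i j by auto
      moreover have "\<Lambda> j \<le> \<Lambda> (Suc i)" using \<Lambda>_antimono[of "Suc i" j] i j by simp
      ultimately show False using few S(3)[OF i] by linarith
    qed
    then obtain T where T: "T \<subseteq> {..<j}" "i \<in> T" "tight f A T" by blast
    show ?thesis using S(6)[OF i]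
    proof
      assume "\<forall>m<j. real (card (A i)) \<le> K * real (card (A m))"
      then show ?thesis using T by (intro exI[of _ T]) auto
    qed
  qed
  then show ?thesis using j A few by blast
qed

end

subsection \<open>Counting tuples of slot elements\<close>

text \<open>With uniform weights on the slots, the weighted sums of the random-flat estimates become
  plain proportions of tuples.\<close>

lemma slot_probability:
  fixes A :: "'i \<Rightarrow> 'a set"
  assumes fin: "finite I" "finite E" and A: "\<And>i. i \<in> I \<Longrightarrow> A i \<subseteq> E"
  shows "(\<Sum>e\<in>PiE I (\<lambda>_. E). (\<Prod>i\<in>I. of_bool (e i \<in> A i) / real (card (A i))) * of_bool (P e))
    = real (card {e\<in>PiE I A. P e}) / (\<Prod>i\<in>I. real (card (A i)))"
proof -
  have fP: "finite (PiE I (\<lambda>_. E))" using fin by (intro finite_PiE) auto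
  have "(\<Sum>e\<in>PiE I (\<lambda>_. E). (\<Prod>i\<in>I. of_bool (e i \<in> A i) / real (card (A i))) * of_bool (P e))
    = (\<Sum>e\<in>PiE I (\<lambda>_. E). if e \<in> PiE I A \<and> P e then 1 / (\<Prod>i\<in>I. real (card (A i))) else 0)"
  proof (rule sum.cong)
    fix e assume e: "e \<in> PiE I (\<lambda>_. E)"
    show "(\<Prod>i\<in>I. of_bool (e i \<in> A i) / real (card (A i))) * of_bool (P e)
      = (if e \<in> PiE I A \<and> P e then 1 / (\<Prod>i\<in>I. real (card (A i))) else 0)"
    proof (cases "\<forall>i\<in>I. e i \<in> A i")
      case True
      then have "e \<in> PiE I A" using e by (auto simp: PiE_def)
      moreover have "(\<Prod>i\<in>I. of_bool (e i \<in> A i) / real (card (A i))) = 1 / (\<Prod>i\<in>I. real (card (A i)))"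
        using True by (simp add: prod_dividef)
      ultimately show ?thesis by simp
    next
      case False
      then obtain i where i: "i \<in> I" "e i \<notin> A i" by blast
      then have "e \<notin> PiE I A" by (auto simp: PiE_def Pi_def)
      moreover have "(\<Prod>i\<in>I. of_bool (e i \<in> A i) / real (card (A i))) = 0" using i fin(1) by (intro prod_zero) auto
      ultimately show ?thesis by simp
    qed
  qed simp
  also have "\<dots> = (\<Sum>e\<in>{e\<in>PiE I (\<lambda>_. E). e \<in> PiE I A \<and> P e}. 1 / (\<Prod>i\<in>I. real (card (A i))))"
    using fP by (rule sum.inter_filter[symmetric])
  also have "{e\<in>PiE I (\<lambda>_. E). e \<in> PiE I A \<and> P e} = {e\<in>PiE I A. P e}" using PiE_mono[of I A "\<lambda>_. E"] A by blast
  finally show ?thesis by simp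
qed

lemma card_PiE_coordinate:
  fixes A :: "'i \<Rightarrow> 'a set"
  assumes I: "finite I" "a \<in> I" and fA: "\<And>i. i \<in> I \<Longrightarrow> finite (A i)"
    and b: "\<And>e. e \<in> PiE (I - {a}) A \<Longrightarrow> real (card {x\<in>A a. P (e(a := x))}) \<le> c * real (card (A a))"
  shows "real (card {e\<in>PiE I A. P e}) \<le> c * (\<Prod>i\<in>I. real (card (A i)))"
proof -
  define S where "S = (SIGMA e:PiE (I - {a}) A. {x\<in>A a. P (e(a := x))})"
  have fP: "finite (PiE (I - {a}) A)" using I fA by (intro finite_PiE) auto
  have fS: "finite S" unfolding S_def using fP fA I(2) by (intro finite_SigmaI) auto
  have "{e\<in>PiE I A. P e} \<subseteq> (\<lambda>(e, x). e(a := x)) ` S"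
  proof
    fix e assume e: "e \<in> {e\<in>PiE I A. P e}"
    define e' where "e' = FuncSet.restrict e (I - {a})"
    have ee: "e = e'(a := e a)" using e by (auto simp: e'_def PiE_def extensional_def FuncSet.restrict_def fun_eq_iff)
    have "e' \<in> PiE (I - {a}) A" using e by (auto simp: e'_def PiE_def Pi_def)
    moreover have "e a \<in> A a" using e I(2) by (auto simp: PiE_def Pi_def)
    moreover have "P (e'(a := e a))" using e ee by simp
    ultimately have "(e', e a) \<in> S" by (simp add: S_def)
    then show "e \<in> (\<lambda>(e, x). e(a := x)) ` S" using ee by (intro image_eqI[of _ _ "(e', e a)"]) auto
  qed
  then have "card {e\<in>PiE I A. P e} \<le> card S" using fS by (rule surj_card_le[rotated])
  also have "card S = (\<Sum>e\<in>PiE (I - {a}) A. card {x\<in>A a. P (e(a := x))})"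
    unfolding S_def using fP fA I(2) by (intro card_SigmaI) auto
  finally have "real (card {e\<in>PiE I A. P e}) \<le> real (\<Sum>e\<in>PiE (I - {a}) A. card {x\<in>A a. P (e(a := x))})"
    by (simp only: of_nat_le_iff)
  also have "\<dots> = (\<Sum>e\<in>PiE (I - {a}) A. real (card {x\<in>A a. P (e(a := x))}))" by (rule of_nat_sum)
  also have "\<dots> \<le> (\<Sum>e\<in>PiE (I - {a}) A. c * real (card (A a)))" using b by (rule sum_mono)
  also have "\<dots> = real (card (PiE (I - {a}) A)) * (c * real (card (A a)))" by simp
  also have "card (PiE (I - {a}) A) = (\<Prod>i\<in>I - {a}. card (A i))" using I(1) by (simp add: card_PiE)
  also have "real (\<Prod>i\<in>I - {a}. card (A i)) * (c * real (card (A a))) = c * (real (card (A a)) * (\<Prod>i\<in>I - {a}. real (card (A i))))"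
    by simp
  also have "real (card (A a)) * (\<Prod>i\<in>I - {a}. real (card (A i))) = (\<Prod>i\<in>I. real (card (A i)))"
    using I by (simp add: prod.remove)
  finally show ?thesis .
qed

lemma card_PiE_restrict:
  fixes A :: "'i \<Rightarrow> 'a set"
  assumes I: "finite I" "T \<subseteq> I" and fA: "\<And>i. i \<in> I \<Longrightarrow> finite (A i)"
    and b: "real (card {e\<in>PiE T A. P e}) \<le> c * (\<Prod>i\<in>T. real (card (A i)))"
  shows "real (card {e\<in>PiE I A. P (FuncSet.restrict e T)}) \<le> c * (\<Prod>i\<in>I. real (card (A i)))"
proof -
  have fT: "finite T" using I finite_subset by blast
  have "card {e\<in>PiE I A. P (FuncSet.restrict e T)} \<le> card ({e\<in>PiE T A. P e} \<times> PiE (I - T) A)"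
  proof (rule card_inj_on_le)
    show "inj_on (\<lambda>e. (FuncSet.restrict e T, FuncSet.restrict e (I - T))) {e\<in>PiE I A. P (FuncSet.restrict e T)}"
    proof (rule inj_onI)
      fix e e' assume e: "e \<in> {e\<in>PiE I A. P (FuncSet.restrict e T)}" "e' \<in> {e\<in>PiE I A. P (FuncSet.restrict e T)}"
        and eq: "(FuncSet.restrict e T, FuncSet.restrict e (I - T)) = (FuncSet.restrict e' T, FuncSet.restrict e' (I - T))"
      show "e = e'"
      proof
        fix x
        consider "x \<in> T" | "x \<in> I - T" | "x \<notin> I" by blast
        then show "e x = e' x"
        proof cases
          case 1 then show ?thesis using eq by (metis prod.inject restrict_apply')
        next
          case 2 then show ?thesis using eq by (metis prod.inject restrict_apply')
        next
          case 3 then show ?thesis using e by (auto simp: PiE_def extensional_def)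
        qed
      qed
    qed
    show "(\<lambda>e. (FuncSet.restrict e T, FuncSet.restrict e (I - T))) ` {e\<in>PiE I A. P (FuncSet.restrict e T)} \<subseteq> {e\<in>PiE T A. P e} \<times> PiE (I - T) A"
      using I(2) by (auto simp: PiE_def Pi_def)
    show "finite ({e\<in>PiE T A. P e} \<times> PiE (I - T) A)"
    proof -
      have "finite (PiE T A)" "finite (PiE (I - T) A)" using I fT fA by (auto intro!: finite_PiE)
      then show ?thesis by simp
    qed
  qed
  then have "card {e\<in>PiE I A. P (FuncSet.restrict e T)} \<le> card {e\<in>PiE T A. P e} * (\<Prod>i\<in>I - T. card (A i))"
    using I(1) by (simp add: card_cartesian_product card_PiE)
  then have "real (card {e\<in>PiE I A. P (FuncSet.restrict e T)}) \<le> real (card {e\<in>PiE T A. P e} * (\<Prod>i\<in>I - T. card (A i)))"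
    by (simp only: of_nat_le_iff)
  also have "\<dots> = real (card {e\<in>PiE T A. P e}) * (\<Prod>i\<in>I - T. real (card (A i)))" by simp
  also have "\<dots> \<le> (c * (\<Prod>i\<in>T. real (card (A i)))) * (\<Prod>i\<in>I - T. real (card (A i)))"
    using b by (rule mult_right_mono) (simp add: prod_nonneg)
  also have "\<dots> = c * (\<Prod>i\<in>I. real (card (A i)))"
    using prod.subset_diff[OF I(2,1), of "\<lambda>i. real (card (A i))"] by (simp add: mult.commute)
  finally show ?thesis .
qed

lemma spreading_mono: "spreading f \<eta> A \<Longrightarrow> \<eta> \<le> \<eta>' \<Longrightarrow> spreading f \<eta>' A"
  unfolding spreading_def
proof (intro allI impI)
  fix Q :: "'b set"
  assume s: "\<forall>Q. finite Q \<longrightarrow> f ` A \<subseteq> span Q \<or> real (card {x\<in>A. f x \<in> span Q}) \<le> \<eta> * real (card A)" and le: "\<eta> \<le> \<eta>'"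
    and Q: "finite Q"
  have "\<eta> * real (card A) \<le> \<eta>' * real (card A)" using le by (rule mult_right_mono) simp
  then show "f ` A \<subseteq> span Q \<or> real (card {x\<in>A. f x \<in> span Q}) \<le> \<eta>' * real (card A)"
    using s[rule_format, OF Q] by linarith
qed

text \<open>The counting form of \<open>random_flat_bound\<close> for \<open>G = {}\<close> and a
  simple configuration, where point classes are just elements. \<open>Z\<close> need not be one of
  the slots; it must only be comparable in size to each of them.\<close>

definition slot_flat_bound :: "('a \<Rightarrow> 'v::real_vector) \<Rightarrow> real \<Rightarrow> real \<Rightarrow> nat \<Rightarrow> real \<Rightarrow> nat set \<Rightarrow> bool" where
  "slot_flat_bound f \<eta> K C \<epsilon> I \<longleftrightarrow> (\<forall>E A Z. finite E \<longrightarrow>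
     (\<forall>x\<in>E. f x \<noteq> 0) \<longrightarrow> (\<forall>x\<in>E. \<forall>y\<in>E. x \<noteq> y \<longrightarrow> f y \<notin> span {f x}) \<longrightarrow>
     (\<forall>i\<in>I. A i \<subseteq> E \<and> A i \<noteq> {} \<and> spreading f \<eta> (A i)) \<longrightarrow>
     (\<forall>J\<subseteq>I. J \<noteq> {} \<longrightarrow> card J + 1 \<le> dim (f ` slot_union A J)) \<longrightarrow>
     Z \<subseteq> E \<longrightarrow> (\<forall>i\<in>I. real (card Z) \<le> K * real (card (A i))) \<longrightarrow>
     real (card {e\<in>PiE I A. C < card {z\<in>Z. f z \<in> span (f ` e ` I)}}) \<le> \<epsilon> * (\<Prod>i\<in>I. real (card (A i))))"

lemma slot_flat_boundD:
  assumes "slot_flat_bound f \<eta> K C \<epsilon> I" "finite E" "\<forall>x\<in>E. f x \<noteq> 0" "\<forall>x\<in>E. \<forall>y\<in>E. x \<noteq> y \<longrightarrow> f y \<notin> span {f x}"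
    "\<forall>i\<in>I. A i \<subseteq> E \<and> A i \<noteq> {} \<and> spreading f \<eta> (A i)"
    "\<forall>J\<subseteq>I. J \<noteq> {} \<longrightarrow> card J + 1 \<le> dim (f ` slot_union A J)"
    "Z \<subseteq> E" "\<forall>i\<in>I. real (card Z) \<le> K * real (card (A i))"
  shows "real (card {e\<in>PiE I A. C < card {z\<in>Z. f z \<in> span (f ` e ` I)}}) \<le> \<epsilon> * (\<Prod>i\<in>I. real (card (A i)))"
proof -
  note b = assms(1)[unfolded slot_flat_bound_def, THEN spec[of _ E], THEN spec[of _ A], THEN spec[of _ Z]]
  show ?thesis using assms(2-8) by (intro b[THEN mp, THEN mp, THEN mp, THEN mp, THEN mp, THEN mp, THEN mp])
qed

lemma slot_flat_bound_mono:
  assumes b: "slot_flat_bound f \<eta> K C \<epsilon> I" and le: "\<eta>' \<le> \<eta>" "C \<le> C'" and I: "finite I"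
  shows "slot_flat_bound f \<eta>' K C' \<epsilon> I"
  unfolding slot_flat_bound_def
proof (intro allI impI)
  fix E A Z
  assume h: "finite E" "\<forall>x\<in>E. f x \<noteq> 0" "\<forall>x\<in>E. \<forall>y\<in>E. x \<noteq> y \<longrightarrow> f y \<notin> span {f x}"
    and A: "\<forall>i\<in>I. A i \<subseteq> E \<and> A i \<noteq> {} \<and> spreading f \<eta>' (A i)"
    and h2: "\<forall>J\<subseteq>I. J \<noteq> {} \<longrightarrow> card J + 1 \<le> dim (f ` slot_union A J)"
     "Z \<subseteq> E" "\<forall>i\<in>I. real (card Z) \<le> K * real (card (A i))"
  have A': "\<forall>i\<in>I. A i \<subseteq> E \<and> A i \<noteq> {} \<and> spreading f \<eta> (A i)" using A spreading_mono[OF _ le(1)] by blast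
  have fA: "finite (A i)" if "i \<in> I" for i using that A h(1) finite_subset by blast
  have "finite (PiE I A)" using I fA by (intro finite_PiE) auto
  then have "card {e\<in>PiE I A. C' < card {z\<in>Z. f z \<in> span (f ` e ` I)}} \<le> card {e\<in>PiE I A. C < card {z\<in>Z. f z \<in> span (f ` e ` I)}}"
    using le(2) by (intro card_mono) auto
  then have "real (card {e\<in>PiE I A. C' < card {z\<in>Z. f z \<in> span (f ` e ` I)}}) \<le> real (card {e\<in>PiE I A. C < card {z\<in>Z. f z \<in> span (f ` e ` I)}})"
    by (simp only: of_nat_le_iff)
  also have "\<dots> \<le> \<epsilon> * (\<Prod>i\<in>I. real (card (A i)))"
    by (rule slot_flat_boundD[OF b h A' h2])
  finally show "real (card {e\<in>PiE I A. C' < card {z\<in>Z. f z \<in> span (f ` e ` I)}}) \<le> \<epsilon> * (\<Prod>i\<in>I. real (card (A i)))" .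
qed

text \<open>Uniform weight on every slot and \<open>\<tau> = 1 / card Z\<close>. A single element of
  slot \<open>i\<close> then weighs \<open>1 / card (A i)\<close>, at most \<open>K * \<tau>\<close>
  because \<open>Z\<close> is not much larger than the slot.\<close>

lemma slot_flat_bound_exact:
  assumes \<epsilon>: "0 < (\<epsilon>::real)"
  shows "\<exists>\<eta>>0. \<forall>K>0. \<exists>C. \<forall>(f :: 'a \<Rightarrow> 'v::real_vector) I. finite I \<longrightarrow> card I = m \<longrightarrow> slot_flat_bound f \<eta> K C \<epsilon> I"
proof -
  obtain \<eta> where \<eta>: "0 < \<eta>"
    and RF: "\<forall>K>0. \<exists>C. \<forall>(f :: 'a \<Rightarrow> 'v) (I :: nat set). finite I \<longrightarrow> card I = m \<longrightarrow> random_flat_bound f \<eta> K C \<epsilon> I"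
    using random_flat_points[OF \<epsilon>, where k = m] by (elim exE conjE) (rule that)
  show ?thesis
  proof (intro exI[of _ \<eta>] conjI \<eta> allI impI)
    fix K :: real assume K: "0 < K"
    obtain C where C: "\<forall>(f :: 'a \<Rightarrow> 'v) (I :: nat set). finite I \<longrightarrow> card I = m \<longrightarrow> random_flat_bound f \<eta> K C \<epsilon> I"
      using RF[THEN spec, THEN mp, OF K] by (elim exE) (rule that)
    show "\<exists>C. \<forall>(f :: 'a \<Rightarrow> 'v) I. finite I \<longrightarrow> card I = m \<longrightarrow> slot_flat_bound f \<eta> K C \<epsilon> I"
    proof (rule exI[of _ C], intro allI impI)
      fix f :: "'a \<Rightarrow> 'v" and I :: "nat set"
      assume I: "finite I" "card I = m"
      show "slot_flat_bound f \<eta> K C \<epsilon> I" unfolding slot_flat_bound_def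
      proof (intro allI impI)
        fix E A Z
        assume E: "finite E" and nz: "\<forall>x\<in>E. f x \<noteq> 0" and simple: "\<forall>x\<in>E. \<forall>y\<in>E. x \<noteq> y \<longrightarrow> f y \<notin> span {f x}"
          and A: "\<forall>i\<in>I. A i \<subseteq> E \<and> A i \<noteq> {} \<and> spreading f \<eta> (A i)"
          and dil: "\<forall>J\<subseteq>I. J \<noteq> {} \<longrightarrow> card J + 1 \<le> dim (f ` slot_union A J)"
          and Z: "Z \<subseteq> E" and ZA: "\<forall>i\<in>I. real (card Z) \<le> K * real (card (A i))"
        have fA: "finite (A i)" and cA: "0 < real (card (A i))" if "i \<in> I" for i
        proof -
          show "finite (A i)" using that A E finite_subset by blast
          then show "0 < real (card (A i))" using that A by (simp add: card_gt_0_iff)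
        qed
        have fZ: "finite Z" using Z E finite_subset by blast
        have pos: "0 < (\<Prod>i\<in>I. real (card (A i)))" using cA by (rule prod_pos)
        show "real (card {e\<in>PiE I A. C < card {z\<in>Z. f z \<in> span (f ` e ` I)}}) \<le> \<epsilon> * (\<Prod>i\<in>I. real (card (A i)))"
        proof (cases "Z = {}")
          case True
          then show ?thesis using pos \<epsilon> by simp
        next
          case False
          then have cZ: "0 < real (card Z)" using fZ by (simp add: card_gt_0_iff)
          define \<mu> where "\<mu> = (\<lambda>i x. of_bool (x \<in> A i) / real (card (A i)))"
          have sum\<mu>: "sum (\<mu> i) {x\<in>E. P x} = real (card {x\<in>A i. P x}) / real (card (A i))" if i: "i \<in> I" for i P
          proof -
            have "sum (\<mu> i) {x\<in>E. P x} = (\<Sum>x\<in>{x\<in>E. P x}. of_bool (x \<in> A i)) / real (card (A i))"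
              by (simp add: \<mu>_def sum_divide_distrib)
            also have "(\<Sum>x\<in>{x\<in>E. P x}. of_bool (x \<in> A i)) = real (card {x\<in>{x\<in>E. P x}. x \<in> A i})"
              using E by (simp add: sum_of_bool_eq Int_def)
            also have "{x\<in>{x\<in>E. P x}. x \<in> A i} = {x\<in>A i. P x}" using A i by blast
            finally show ?thesis .
          qed
          have ss: "slot_system f E {} (K * (1 / real (card Z))) \<eta> I A \<mu>" unfolding slot_system_def
          proof (intro conjI ballI allI impI)
            fix i assume i: "i \<in> I"
            show "A i \<subseteq> E" using A i by blast
            show "spread_weight f E {} (K * (1 / real (card Z))) (\<mu> i)" unfolding spread_weight_def
            proof (intro conjI ballI impI)
              show "0 \<le> \<mu> i x" for x by (simp add: \<mu>_def)
              show "sum (\<mu> i) E \<le> 1" using sum\<mu>[OF i, of "\<lambda>_. True"] cA[OF i] by simp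
              fix x assume x: "x \<in> E"
              have "{y\<in>E. f y \<notin> span {} \<and> f y \<in> span {f x}} \<subseteq> {x}"
              proof
                fix y assume "y \<in> {y\<in>E. f y \<notin> span {} \<and> f y \<in> span {f x}}"
                then show "y \<in> {x}" using simple[rule_format, OF x, of y] by auto
              qed
              then have "sum (\<mu> i) {y\<in>E. f y \<notin> span {} \<and> f y \<in> span {f x}} \<le> sum (\<mu> i) {x}"
                by (intro sum_mono2) (auto simp: \<mu>_def)
              also have "\<dots> \<le> 1 / real (card (A i))" by (simp add: \<mu>_def divide_right_mono)
              also have "\<dots> \<le> K * (1 / real (card Z))" using ZA i cA[OF i] cZ by (simp add: field_simps)
              finally show "sum (\<mu> i) {y\<in>E. f y \<notin> span {} \<and> f y \<in> span {f x}} \<le> K * (1 / real (card Z))" .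
            qed
            show "nonheavy f E \<eta> (A i) (\<mu> i)" unfolding nonheavy_def
            proof (intro allI impI)
              fix Q :: "'v set" assume Q: "finite Q"
              have "f ` A i \<subseteq> span Q \<or> real (card {x\<in>A i. f x \<in> span Q}) \<le> \<eta> * real (card (A i))"
                using A i Q unfolding spreading_def by blast
              then show "f ` A i \<subseteq> span Q \<or> sum (\<mu> i) {x\<in>E. f x \<in> span Q} \<le> \<eta>"
                using sum\<mu>[OF i] cA[OF i] by (simp add: pos_divide_le_eq)
            qed
          next
            fix J assume "J \<subseteq> I" "J \<noteq> {}"
            then show "dim ({}::'v set) + card J + 1 \<le> dim ({} \<union> f ` (\<Union>i\<in>J. A i))"
              using dil by (simp add: slot_union_def)
          qed
          have cpc: "card (point_classes f {} Y) = card Y" if Y: "Y \<subseteq> E" for Y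
          proof -
            have "{z\<in>Y. f z \<notin> span {}} = Y" using Y nz by auto
            moreover have "inj_on (\<lambda>z. span {f z}) Y"
            proof (rule inj_onI)
              fix x y assume xy: "x \<in> Y" "y \<in> Y" "span {f x} = span {f y}"
              have "f y \<in> span {f x}" unfolding xy(3) by (simp add: span_base)
              then show "x = y" using simple xy(1,2) Y by blast
            qed
            ultimately show ?thesis by (simp add: point_classes_def card_image)
          qed
          have pc: "real (card (point_classes f {} Z)) * (1 / real (card Z)) \<le> 1" using cpc[OF Z] cZ by simp
          have "0 < 1 / real (card Z)" using cZ by simp
          then have le: "(\<Sum>e\<in>PiE I (\<lambda>_. E). (\<Prod>i\<in>I. \<mu> i (e i)) *
            of_bool (C < card (point_classes f {} {z\<in>Z. f z \<in> span ({} \<union> f ` e ` I)}))) \<le> \<epsilon>"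
            by (rule C[rule_format, OF I, unfolded random_flat_bound_def, rule_format, OF E finite.emptyI _ ss Z pc])
          have "card (point_classes f {} {z\<in>Z. P z}) = card {z\<in>Z. P z}" for P using Z by (intro cpc) auto
          then have "real (card {e\<in>PiE I A. C < card {z\<in>Z. f z \<in> span (f ` e ` I)}}) / (\<Prod>i\<in>I. real (card (A i))) \<le> \<epsilon>"
            using le slot_probability[OF I(1) E, of A "\<lambda>e. C < card {z\<in>Z. f z \<in> span (f ` e ` I)}"] A
            by (simp add: \<mu>_def)
          then show ?thesis using pos by (simp add: pos_divide_le_eq)
        qed
      qed
    qed
  qed
qed

lemma exists_slot_flat_bound:
  assumes \<epsilon>: "0 < (\<epsilon>::real)"
  shows "\<exists>\<eta>>0. \<forall>K>0. \<exists>C. \<forall>(f :: 'a \<Rightarrow> 'v::real_vector) I. finite I \<longrightarrow> card I < n \<longrightarrow> slot_flat_bound f \<eta> K C \<epsilon> I"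
proof (induction n)
  case 0
  show ?case by (intro exI[of _ 1]) simp
next
  case (Suc n)
  obtain \<eta> where \<eta>: "0 < \<eta>" and B: "\<forall>K>0. \<exists>C. \<forall>(f :: 'a \<Rightarrow> 'v) I. finite I \<longrightarrow> card I < n \<longrightarrow> slot_flat_bound f \<eta> K C \<epsilon> I"
    using Suc by (elim exE conjE) (rule that)
  obtain \<eta>' where \<eta>': "0 < \<eta>'" and B': "\<forall>K>0. \<exists>C. \<forall>(f :: 'a \<Rightarrow> 'v) I. finite I \<longrightarrow> card I = n \<longrightarrow> slot_flat_bound f \<eta>' K C \<epsilon> I"
    using slot_flat_bound_exact[OF \<epsilon>, where m = n] by (elim exE conjE) (rule that)
  show ?case
  proof (intro exI[of _ "min \<eta> \<eta>'"] conjI allI impI)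
    show "0 < min \<eta> \<eta>'" using \<eta> \<eta>' by simp
    fix K :: real assume K: "0 < K"
    obtain C where C: "\<forall>(f :: 'a \<Rightarrow> 'v) I. finite I \<longrightarrow> card I < n \<longrightarrow> slot_flat_bound f \<eta> K C \<epsilon> I"
      using B K by meson
    obtain C' where C': "\<forall>(f :: 'a \<Rightarrow> 'v) I. finite I \<longrightarrow> card I = n \<longrightarrow> slot_flat_bound f \<eta>' K C' \<epsilon> I"
      using B' K by meson
    show "\<exists>C. \<forall>(f :: 'a \<Rightarrow> 'v) I. finite I \<longrightarrow> card I < Suc n \<longrightarrow> slot_flat_bound f (min \<eta> \<eta>') K C \<epsilon> I"
    proof (rule exI[of _ "max C C'"], intro allI impI)
      fix f :: "'a \<Rightarrow> 'v" and I :: "nat set" assume I: "finite I" "card I < Suc n"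
      show "slot_flat_bound f (min \<eta> \<eta>') K (max C C') \<epsilon> I"
      proof (cases "card I = n")
        case True
        then have "slot_flat_bound f \<eta>' K C' \<epsilon> I" using C' I by blast
        then show ?thesis by (rule slot_flat_bound_mono) (use I in auto)
      next
        case False
        then have "slot_flat_bound f \<eta> K C \<epsilon> I" using C I by simp
        then show ?thesis by (rule slot_flat_bound_mono) (use I in auto)
      qed
    qed
  qed
qed

subsection \<open>Typical tuples\<close>

text \<open>Each entry avoids every span built from whole slots, leftover elements and other entries
  that does not contain its slot anyway. There are at most \<open>j * 4 ^ j * 2 ^ card U\<close>
  such conditions, which is why the spread has to be small compared with the size of
  \<open>U\<close>.\<close>

definition typical :: "('a \<Rightarrow> 'v::real_vector) \<Rightarrow> nat \<Rightarrow> (nat \<Rightarrow> 'a set) \<Rightarrow> 'a set \<Rightarrow> (nat \<Rightarrow> 'a) \<Rightarrow> bool" where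
  "typical f j A U e \<longleftrightarrow> (\<forall>i<j. \<forall>J\<subseteq>{..<j}. \<forall>W\<subseteq>U. \<forall>J'\<subseteq>{..<j} - {i}.
     f ` A i \<subseteq> span (f ` (slot_union A J \<union> W \<union> e ` J')) \<or> f (e i) \<notin> span (f ` (slot_union A J \<union> W \<union> e ` J')))"

text \<open>Union bound. The span to be avoided by entry \<open>i\<close> does not involve entry
  \<open>i\<close>, so with the other entries fixed, spreading bounds the fraction of bad
  choices.\<close>

lemma card_atypical:
  fixes f :: "'a \<Rightarrow> 'v::real_vector"
  assumes A: "\<And>i. i < j \<Longrightarrow> finite (A i)" "\<And>i. i < j \<Longrightarrow> spreading f \<eta> (A i)" and U: "finite U" and \<eta>: "0 \<le> \<eta>"
  shows "real (card {e\<in>PiE {..<j} A. \<not> typical f j A U e}) \<le> real j * 4 ^ j * 2 ^ card U * \<eta> * (\<Prod>i<j. real (card (A i)))"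
proof -
  define bad where "bad = (\<lambda>(i, J, W, J') e. \<not> f ` A i \<subseteq> span (f ` (slot_union A J \<union> W \<union> e ` J')) \<and>
     f (e i) \<in> span (f ` (slot_union A J \<union> W \<union> e ` J')))"
  define X where "X = (SIGMA i:{..<j}. Pow {..<j} \<times> Pow U \<times> Pow ({..<j} - {i}))"
  define N where "N = (\<Prod>i<j. real (card (A i)))"
  have fX: "finite X" using U by (auto simp: X_def)
  have cX: "card X \<le> j * 4 ^ j * 2 ^ card U"
  proof -
    have "card X = (\<Sum>i<j. 2 ^ j * (2 ^ card U * 2 ^ (j - 1)))"
      using U by (simp add: X_def card_SigmaI card_cartesian_product card_Pow)
    also have "\<dots> \<le> (\<Sum>i<j. 2 ^ j * (2 ^ card U * 2 ^ j))" by (intro sum_mono mult_left_mono power_increasing) auto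
    also have "\<dots> = j * (2 ^ j * 2 ^ j) * 2 ^ card U" by simp
    also have "2 ^ j * 2 ^ j = (4::nat) ^ j" by (simp flip: power_mult_distrib)
    finally show ?thesis .
  qed
  have fP: "finite (PiE {..<j} A)" using A(1) by (intro finite_PiE) auto
  have one: "real (card {e\<in>PiE {..<j} A. bad p e}) \<le> \<eta> * N" if p: "p \<in> X" for p
  proof -
    obtain i J W J' where pp: "p = (i, J, W, J')" "i < j" "J \<subseteq> {..<j}" "W \<subseteq> U" "J' \<subseteq> {..<j} - {i}"
      using p by (auto simp: X_def)
    show ?thesis unfolding N_def
    proof (rule card_PiE_coordinate)
      show "finite {..<j}" "i \<in> {..<j}" using pp(2) by auto
      show "finite (A l)" if "l \<in> {..<j}" for l using that A(1) by simp
      fix e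
      define Q where "Q = f ` (slot_union A J \<union> W \<union> e ` J')"
      have "finite (slot_union A J)" using finite_slot_union[OF A(1) pp(3)] .
      moreover have "finite W" using pp(4) U finite_subset by blast
      moreover have "finite J'" using pp(5) finite_subset by blast
      ultimately have fQ: "finite Q" by (simp add: Q_def)
      have eq: "(e(i := x)) ` J' = e ` J'" for x using pp(5) by (intro image_cong) auto
      have "real (card {x\<in>A i. bad p (e(i := x))}) = real (card {x\<in>A i. \<not> f ` A i \<subseteq> span Q \<and> f x \<in> span Q})"
        unfolding pp(1) bad_def split_conv eq Q_def by simp
      also have "\<dots> \<le> \<eta> * real (card (A i))"
        using A(2)[OF pp(2), unfolded spreading_def, rule_format, OF fQ] \<eta> by (cases "f ` A i \<subseteq> span Q") auto
      finally show "real (card {x\<in>A i. bad p (e(i := x))}) \<le> \<eta> * real (card (A i))" .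
    qed
  qed
  have "{e\<in>PiE {..<j} A. \<not> typical f j A U e} \<subseteq> (\<Union>p\<in>X. {e\<in>PiE {..<j} A. bad p e})"
  proof
    fix e assume e: "e \<in> {e\<in>PiE {..<j} A. \<not> typical f j A U e}"
    then have "\<not> typical f j A U e" by simp
    then obtain i J W J' where p: "i < j" "J \<subseteq> {..<j}" "W \<subseteq> U" "J' \<subseteq> {..<j} - {i}"
      "\<not> (f ` A i \<subseteq> span (f ` (slot_union A J \<union> W \<union> e ` J')) \<or> f (e i) \<notin> span (f ` (slot_union A J \<union> W \<union> e ` J')))"
      unfolding typical_def not_all not_imp by (elim exE conjE) (rule that)
    then have "(i, J, W, J') \<in> X" "bad (i, J, W, J') e" by (auto simp: X_def bad_def)
    then show "e \<in> (\<Union>p\<in>X. {e\<in>PiE {..<j} A. bad p e})" using e by blast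
  qed
  then have "card {e\<in>PiE {..<j} A. \<not> typical f j A U e} \<le> card (\<Union>p\<in>X. {e\<in>PiE {..<j} A. bad p e})"
    using fX fP by (intro card_mono) auto
  also have "\<dots> \<le> (\<Sum>p\<in>X. card {e\<in>PiE {..<j} A. bad p e})" using fX by (rule card_UN_le)
  finally have "real (card {e\<in>PiE {..<j} A. \<not> typical f j A U e}) \<le> real (\<Sum>p\<in>X. card {e\<in>PiE {..<j} A. bad p e})"
    by (simp only: of_nat_le_iff)
  also have "\<dots> = (\<Sum>p\<in>X. real (card {e\<in>PiE {..<j} A. bad p e}))" by (rule of_nat_sum)
  also have "\<dots> \<le> (\<Sum>p\<in>X. \<eta> * N)" using one by (rule sum_mono)
  also have "\<dots> = real (card X) * (\<eta> * N)" by simp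
  also have "\<dots> \<le> real (j * 4 ^ j * 2 ^ card U) * (\<eta> * N)"
  proof (rule mult_right_mono)
    show "real (card X) \<le> real (j * 4 ^ j * 2 ^ card U)" using cX by (simp only: of_nat_le_iff)
    show "0 \<le> \<eta> * N" using \<eta> by (simp add: N_def prod_nonneg)
  qed
  finally show ?thesis by (simp add: N_def)
qed

text \<open>Recursion from the last slot backwards, with \<open>L d\<close> standing for the
  threshold at \<open>k - d\<close>: \<open>\<eta> i\<close> is computed from
  \<open>\<Lambda> (i + 1)\<close>, and \<open>\<Lambda> i\<close> from both. \<open>K\<close> is
  taken large enough for all slots at once.\<close>

lemma exists_slot_constants:
  assumes c: "0 < (c::real)" "c * 2 ^ k \<le> 1 / 2"
  shows "\<exists>\<eta> \<Lambda> K. slot_constants k \<eta> \<Lambda> K \<and> 0 < K \<and> (\<forall>i<k. \<eta> i * 2 ^ \<Lambda> (Suc i) \<le> c)"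
proof -
  define L where "L = rec_nat (2::nat) (\<lambda>_ l. nat \<lceil>real (2 * l + 2) / (c / 2 ^ l) ^ (k + 1)\<rceil>)"
  define \<Lambda> where "\<Lambda> = (\<lambda>i. L (k - i))"
  define \<eta> where "\<eta> = (\<lambda>i. c / 2 ^ L (k - Suc i))"
  define K where "K = 1 + (\<Sum>i<k. 2 / \<eta> i ^ (k + 1))"
  have \<eta>pos: "0 < \<eta> i" for i using c(1) by (simp add: \<eta>_def)
  have \<eta>c: "\<eta> i * 2 ^ \<Lambda> (Suc i) = c" for i by (simp add: \<eta>_def \<Lambda>_def)
  have LS: "L (Suc d) = nat \<lceil>real (2 * L d + 2) / (c / 2 ^ L d) ^ (k + 1)\<rceil>" for d by (simp add: L_def)
  have "slot_constants k \<eta> \<Lambda> K"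
  proof
    fix i assume i: "i < k"
    show "0 < \<eta> i" by (rule \<eta>pos)
    have "\<eta> i \<le> c" using c(1) by (simp add: \<eta>_def divide_le_eq)
    then have "\<eta> i * 2 ^ k \<le> c * 2 ^ k" by (rule mult_right_mono) simp
    then show "\<eta> i * 2 ^ k \<le> 1 / 2" using c(2) by linarith
    have ki: "k - i = Suc (k - Suc i)" using i by simp
    have "real (2 * \<Lambda> (Suc i) + 2) / \<eta> i ^ (k + 1) \<le> real (\<Lambda> i)"
      unfolding \<Lambda>_def \<eta>_def ki LS by (simp add: real_nat_ceiling_ge del: of_nat_add of_nat_mult power_Suc)
    then show "real (2 * \<Lambda> (Suc i) + 2) \<le> \<eta> i ^ (k + 1) * real (\<Lambda> i)"
      using \<eta>pos[of i] by (simp add: pos_divide_le_eq mult.commute del: power_Suc)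
    have "2 / \<eta> i ^ (k + 1) \<le> (\<Sum>i<k. 2 / \<eta> i ^ (k + 1))"
      using i \<eta>pos by (intro member_le_sum) (auto intro!: divide_nonneg_nonneg zero_le_power less_imp_le)
    then have "2 / \<eta> i ^ (k + 1) \<le> K" by (simp add: K_def)
    then show "2 \<le> K * \<eta> i ^ (k + 1)" using \<eta>pos[of i] by (simp add: pos_divide_le_eq del: power_Suc)
  next
    show "0 < \<Lambda> k" by (simp add: \<Lambda>_def L_def)
  qed
  moreover have "0 \<le> (\<Sum>i<k. 2 / \<eta> i ^ (k + 1))" using \<eta>pos by (intro sum_nonneg divide_nonneg_nonneg zero_le_power less_imp_le) auto
  then have "0 < K" by (simp add: K_def)
  ultimately show ?thesis using \<eta>c by (intro exI[of _ \<eta>] exI[of _ \<Lambda>] exI[of _ K]) auto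
qed

locale typical_tuple =
  fixes k j :: nat and f :: "'a \<Rightarrow> rvec" and E :: "'a set" and A :: "nat \<Rightarrow> 'a set" and e :: "nat \<Rightarrow> 'a"
  assumes E: "finite E" and jk: "j \<le> k" and dimE: "dim (f ` E) \<le> k + 1"
    and nz: "x \<in> E \<Longrightarrow> f x \<noteq> 0" and simple: "x \<in> E \<Longrightarrow> y \<in> E \<Longrightarrow> x \<noteq> y \<Longrightarrow> f y \<notin> span {f x}"
    and A: "i < j \<Longrightarrow> A i \<subseteq> E" and dil: "dilworth f j A"
    and tight_set: "i < j \<Longrightarrow> \<exists>T\<subseteq>{..<j}. i \<in> T \<and> tight f A T"
    and e: "i < j \<Longrightarrow> e i \<in> A i" and is_typical: "typical f j A (E - tight_part f E A j) e"
begin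

definition U :: "'a set" where "U = E - tight_part f E A j"

definition G :: "rvec set" where "G = f ` e ` {..<j}"

lemma U_sub: "U \<subseteq> E" and finite_U: "finite U" and finite_G: "finite G" and finite_A: "i < j \<Longrightarrow> finite (A i)"
  using E A by (auto simp: U_def G_def intro: finite_subset)

lemma eG: "J \<subseteq> {..<j} \<Longrightarrow> f ` e ` J \<subseteq> G"
  by (auto simp: G_def)

lemma typicalD:
  assumes "i < j" "J \<subseteq> {..<j}" "W \<subseteq> U" "J' \<subseteq> {..<j}" "i \<notin> J'" "\<not> f ` A i \<subseteq> span (f ` (slot_union A J \<union> W \<union> e ` J'))"
  shows "f (e i) \<notin> span (f ` (slot_union A J \<union> W \<union> e ` J'))"
proof -
  have "J' \<subseteq> {..<j} - {i}" using assms(4,5) by blast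
  then show ?thesis using is_typical assms unfolding typical_def U_def[symmetric] by meson
qed

text \<open>Adjoin the entries one at a time: each faces a span that does not contain its slot, and
  typicality keeps the entry out of it.\<close>

lemma dim_with_entries:
  assumes J: "J \<subseteq> {..<j}" and W: "W \<subseteq> U" and N: "N \<subseteq> {..<j}"
    and free: "\<And>i. i \<in> N \<Longrightarrow> \<not> f ` A i \<subseteq> span (f ` (slot_union A J \<union> W \<union> e ` N))"
  shows "dim (f ` (slot_union A J \<union> W \<union> e ` N)) = dim (f ` (slot_union A J \<union> W)) + card N"
proof -
  let ?R = "slot_union A J \<union> W"
  have "finite W" using W finite_U by (rule finite_subset)
  then have fR: "finite ?R" using finite_slot_union[OF finite_A J] by simp
  have fN: "finite N" using N finite_subset by blast
  have "M \<subseteq> N \<Longrightarrow> dim (f ` (?R \<union> e ` M)) = dim (f ` ?R) + card M" if "finite M" for M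
    using that
  proof (induction M rule: finite_induct)
    case empty then show ?case by simp
  next
    case (insert i M)
    have "span (f ` (?R \<union> e ` M)) \<subseteq> span (f ` (?R \<union> e ` N))" using insert.prems by (intro span_mono) auto
    then have "\<not> f ` A i \<subseteq> span (f ` (?R \<union> e ` M))" using free[of i] insert.prems by blast
    then have "f (e i) \<notin> span (f ` (?R \<union> e ` M))"
      using insert.prems insert.hyps(2) N J W by (intro typicalD) auto
    moreover have "f ` (?R \<union> e ` insert i M) = insert (f (e i)) (f ` (?R \<union> e ` M))" by auto
    ultimately show ?case
      using insert dim_insert_finite[of "f ` (?R \<union> e ` M)" "f (e i)"] fR by simp
  qed
  then show ?thesis using fN by blast
qed

text \<open>If some slots, with index set \<open>K\<close>, were contained in \<open>span G\<close>,
  they would have rank at least \<open>card K + 1\<close>, and every other entry would add one more.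
  This exceeds \<open>j\<close>, the number of generators of \<open>G\<close>.\<close>

lemma slot_not_in_span:
  assumes i: "i < j"
  shows "\<not> f ` A i \<subseteq> span G"
proof
  assume iG: "f ` A i \<subseteq> span G"
  define K where "K = {m\<in>{..<j}. f ` A m \<subseteq> span G}"
  define N where "N = {..<j} - K"
  have K: "K \<subseteq> {..<j}" "N \<subseteq> {..<j}" "K \<noteq> {}" using i iG by (auto simp: K_def N_def)
  have sub: "f ` (slot_union A K \<union> {} \<union> e ` N) \<subseteq> span G"
  proof -
    have "f ` slot_union A K \<subseteq> span G" by (auto simp: K_def slot_union_def)
    moreover have "f ` e ` N \<subseteq> span G" using eG[OF K(2)] span_superset[of G] by blast
    ultimately show ?thesis by (simp add: image_Un)
  qed
  have "dim (f ` (slot_union A K \<union> {} \<union> e ` N)) = dim (f ` (slot_union A K \<union> {})) + card N"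
  proof (rule dim_with_entries)
    fix m assume m: "m \<in> N"
    have "span (f ` (slot_union A K \<union> {} \<union> e ` N)) \<subseteq> span G" using sub by (rule span_minimal) simp
    then show "\<not> f ` A m \<subseteq> span (f ` (slot_union A K \<union> {} \<union> e ` N))" using m by (auto simp: N_def K_def)
  qed (use K in auto)
  moreover have "card K + 1 \<le> dim (f ` slot_union A K)" using dil K unfolding dilworth_def by meson
  moreover have "card K + card N = j"
    using K(1) card_mono[of "{..<j}" K] finite_subset[OF K(1)] by (simp add: N_def card_Diff_subset)
  moreover have "dim (f ` (slot_union A K \<union> {} \<union> e ` N)) \<le> dim G" using finite_G sub by (rule dim_mono_finite)
  moreover have "dim G \<le> j"
  proof -
    have "dim G \<le> card G" using finite_G by (rule dim_card_le)
    also have "\<dots> \<le> card {..<j}" unfolding G_def image_image by (rule card_image_le) simp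
    finally show ?thesis by simp
  qed
  ultimately show False by simp
qed

lemma dim_entries:
  assumes J: "J \<subseteq> {..<j}"
  shows "dim (f ` e ` J) = card J"
proof -
  have "dim (f ` (slot_union A {} \<union> {} \<union> e ` J)) = dim (f ` (slot_union A {} \<union> {})) + card J"
  proof (rule dim_with_entries)
    fix i assume i: "i \<in> J"
    have "span (f ` (slot_union A {} \<union> {} \<union> e ` J)) \<subseteq> span G" using eG[OF J] by (intro span_mono) (simp add: slot_union_def)
    then show "\<not> f ` A i \<subseteq> span (f ` (slot_union A {} \<union> {} \<union> e ` J))" using slot_not_in_span[of i] i J by blast
  qed (use J in auto)
  then show ?thesis by (simp add: slot_union_def)
qed

lemma dim_G: "dim G = j"
  using dim_entries[of "{..<j}"] by (simp add: G_def)

text \<open>The entries of a tight set fall short of its span by exactly one, so any further element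
  of the union completes it. This is why a tight union becomes a single point after
  contraction.\<close>

lemma span_tight_set:
  assumes J: "J \<subseteq> {..<j}" "tight f A J" and x: "x \<in> slot_union A J" "f x \<notin> span (f ` e ` J)"
  shows "span (insert (f x) (f ` e ` J)) = span (f ` slot_union A J)"
proof (rule span_eq_of_dim_ge)
  have fJ: "finite J" using J(1) finite_subset by blast
  show "finite (f ` slot_union A J)" using finite_slot_union[OF finite_A J(1)] by simp
  show "finite (insert (f x) (f ` e ` J))" using fJ by simp
  have "f ` e ` J \<subseteq> f ` slot_union A J" using e J(1) by (auto simp: slot_union_def)
  then show "insert (f x) (f ` e ` J) \<subseteq> span (f ` slot_union A J)"
    using x(1) span_superset[of "f ` slot_union A J"] by auto
  show "dim (f ` slot_union A J) \<le> dim (insert (f x) (f ` e ` J))"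
    using J(2) x(2) dim_insert_finite[of "f ` e ` J" "f x"] dim_entries[OF J(1)] fJ by (simp add: tight_def)
qed

end

text \<open>
  Contracting a typical tuple turns each slot into a single parallel class. These classes are the red points.
\<close>

locale contracted_tuple = typical_tuple +
  fixes \<pi> :: "rvec \<Rightarrow> rvec" and a :: "nat \<Rightarrow> 'a"
  assumes lin: "linear \<pi>" and ker: "\<pi> x = 0 \<longleftrightarrow> x \<in> span G"
    and a: "i < j \<Longrightarrow> a i \<in> A i" "i < j \<Longrightarrow> f (a i) \<notin> span G"
begin

definition \<psi> :: "'a \<Rightarrow> rvec" where "\<psi> x = \<pi> (f x)"

definition R :: "rvec set" where "R = (\<lambda>i. \<psi> (a i)) ` {..<j}"

definition L :: "rvec set \<Rightarrow> nat set" where "L Q = {i\<in>{..<j}. \<psi> (a i) \<in> span Q}"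

lemma image_\<psi>: "\<psi> ` X = \<pi> ` f ` X"
  by (auto simp: \<psi>_def)

lemma \<psi>_in_span_iff: "\<psi> x \<in> span (\<psi> ` X) \<longleftrightarrow> f x \<in> span (f ` X \<union> G)"
  unfolding image_\<psi> unfolding \<psi>_def using lin ker by (rule projection_in_span_iff)

lemma dim_\<psi>: "finite X \<Longrightarrow> dim (\<psi> ` X) + j = dim (f ` X \<union> G)"
  unfolding image_\<psi> using projection_dim[OF lin ker finite_G, of "f ` X"] dim_G by simp

lemma finite_R: "finite R" and zero_notin_R: "0 \<notin> R" and card_R: "card R \<le> j"
  using ker a card_image_le[of "{..<j}" "\<lambda>i. \<psi> (a i)"] by (auto simp: R_def \<psi>_def)

lemma \<psi>_tight_set:
  assumes J: "J \<subseteq> {..<j}" "tight f A J" "i \<in> J" and x: "x \<in> slot_union A J"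
  shows "\<psi> x \<in> span {\<psi> (a i)}"
proof -
  have i: "i < j" using J by auto
  have "f (a i) \<notin> span (f ` e ` J)" using a(2)[OF i] span_mono[OF eG[OF J(1)]] by blast
  moreover have "a i \<in> slot_union A J" using a(1)[OF i] J(3) by (auto simp: slot_union_def)
  ultimately have "span (insert (f (a i)) (f ` e ` J)) = span (f ` slot_union A J)" using span_tight_set J by blast
  moreover have "f x \<in> span (f ` slot_union A J)" using x by (simp add: span_base)
  ultimately have "f x \<in> span (insert (f (a i)) (f ` e ` J))" by simp
  also have "\<dots> \<subseteq> span (f ` {a i} \<union> G)" using eG[OF J(1)] by (intro span_mono) auto
  finally show ?thesis using \<psi>_in_span_iff[of x "{a i}"] by simp
qed

lemma \<psi>_slot:
  assumes "i < j" "x \<in> A i"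
  shows "\<psi> x \<in> span {\<psi> (a i)}"
proof -
  obtain T where T: "T \<subseteq> {..<j}" "i \<in> T" "tight f A T" using tight_set[OF assms(1)] by blast
  have "x \<in> slot_union A T" using T(2) assms(2) by (auto simp: slot_union_def)
  then show ?thesis using \<psi>_tight_set[OF T(1,3,2)] by simp
qed

text \<open>Entries of slots outside \<open>L Q\<close> stay independent over the lifted set, since
  otherwise their red points would lie in \<open>span Q\<close>. Contracting the tuple therefore
  removes at most the \<open>card (L Q)\<close> remaining ranks.\<close>

lemma dim_lift:
  assumes Q: "finite Q" and W: "W \<subseteq> U" "\<And>u. u \<in> W \<Longrightarrow> \<psi> u \<in> span Q"
  shows "dim (f ` (slot_union A (L Q) \<union> W)) \<le> dim Q + card (L Q)"
proof -
  define Y where "Y = slot_union A (L Q) \<union> W"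
  define N where "N = {..<j} - L Q"
  have L: "L Q \<subseteq> {..<j}" "N \<subseteq> {..<j}" by (auto simp: L_def N_def)
  have "finite W" using W(1) finite_U by (rule finite_subset)
  then have fY: "finite Y" using finite_slot_union[OF finite_A L(1)] by (simp add: Y_def)
  have YQ: "\<psi> ` Y \<subseteq> span Q"
  proof
    fix y assume "y \<in> \<psi> ` Y"
    then consider x i where "y = \<psi> x" "i \<in> L Q" "x \<in> A i" | x where "y = \<psi> x" "x \<in> W"
      by (auto simp: Y_def slot_union_def)
    then show "y \<in> span Q"
    proof cases
      case 1
      have "\<psi> x \<in> span {\<psi> (a i)}" using \<psi>_slot 1(2,3) by (simp add: L_def)
      moreover have "\<psi> (a i) \<in> span Q" using 1(2) by (simp add: L_def)
      ultimately show ?thesis using span_trans_subset[of "\<psi> x" "{\<psi> (a i)}" Q] 1(1) by simp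
    next
      case 2 then show ?thesis using W(2) by simp
    qed
  qed
  have sub: "f ` (Y \<union> e ` N) \<subseteq> span (f ` Y \<union> G)"
    using eG[OF L(2)] span_superset[of "f ` Y \<union> G"] by (auto simp: image_Un)
  have "dim (f ` (Y \<union> e ` N)) = dim (f ` Y) + card N" unfolding Y_def
  proof (rule dim_with_entries[OF L(1) W(1) L(2)])
    fix i assume i: "i \<in> N"
    show "\<not> f ` A i \<subseteq> span (f ` (slot_union A (L Q) \<union> W \<union> e ` N))"
    proof
      assume h: "f ` A i \<subseteq> span (f ` (slot_union A (L Q) \<union> W \<union> e ` N))"
      have "f (a i) \<in> span (f ` (Y \<union> e ` N))" using h a(1)[of i] i by (auto simp: N_def Y_def)
      then have "f (a i) \<in> span (f ` Y \<union> G)" using sub by (rule span_trans_subset)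
      then have "\<psi> (a i) \<in> span (\<psi> ` Y)" using \<psi>_in_span_iff by blast
      then have "\<psi> (a i) \<in> span Q" using YQ by (rule span_trans_subset)
      then show False using i by (auto simp: N_def L_def)
    qed
  qed
  moreover have "dim (f ` (Y \<union> e ` N)) \<le> dim (f ` Y \<union> G)" using fY finite_G sub by (intro dim_mono_finite) auto
  moreover have "dim (\<psi> ` Y) + j = dim (f ` Y \<union> G)" using dim_\<psi>[OF fY] .
  moreover have "dim (\<psi> ` Y) \<le> dim Q" using Q YQ by (rule dim_mono_finite)
  moreover have "card N + card (L Q) = j" using L card_Diff_subset[of "L Q" "{..<j}"] card_mono[of "{..<j}" "L Q"] finite_subset[OF L(1)]
    by (simp add: N_def)
  ultimately show ?thesis by (simp add: Y_def)
qed

lemma L_empty: "\<not> (\<exists>r\<in>R. r \<in> span Q) \<Longrightarrow> L Q = {}"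
  by (auto simp: L_def R_def)

lemma \<psi>_nonzero:
  assumes u: "u \<in> U"
  shows "\<psi> u \<noteq> 0"
proof
  assume "\<psi> u = 0"
  then have "dim (f ` (slot_union A (L {}) \<union> {u})) \<le> dim ({}::rvec set) + card (L {})"
    using u by (intro dim_lift) auto
  moreover have "L {} = {}" by (rule L_empty) (use zero_notin_R in auto)
  moreover have "dim {f u} = 1" using dim_insert_finite[of "{}" "f u"] nz u U_sub by auto
  ultimately show False by (simp add: slot_union_def)
qed

text \<open>Lifting a red-free point costs no slots, so two elements over it would span rank at most
  one, contrary to simplicity.\<close>

lemma \<psi>_parallel:
  assumes uv: "u \<in> U" "v \<in> U" "u \<noteq> v" "\<psi> v \<in> span {\<psi> u}"
  shows "\<exists>r\<in>R. r \<in> span {\<psi> u}"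
proof (rule ccontr)
  assume "\<not> ?thesis"
  then have L: "L {\<psi> u} = {}" by (rule L_empty)
  have "dim (f ` (slot_union A (L {\<psi> u}) \<union> {u, v})) \<le> dim {\<psi> u} + card (L {\<psi> u})"
    using uv by (intro dim_lift) (auto simp: span_base)
  moreover have "dim {\<psi> u} \<le> 1" using dim_card_le[of "{\<psi> u}"] by simp
  moreover have "dim (insert (f v) {f u}) = 2"
    using uv U_sub simple[of u v] nz[of u] dim_insert_finite[of "{f u}" "f v"] dim_insert_finite[of "{}" "f u"] by auto
  ultimately show False using L by (simp add: slot_union_def insert_commute)
qed

text \<open>A member with red points grows by \<open>card (L Q)\<close>, at least one, and one
  without red points keeps its rank, which is how \<open>cover_cost\<close> was priced. The red
  points of a tight set are parallel, so its slots all belong to the same member. Uniqueness makes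
  the sets \<open>L Q\<close> disjoint and their total at most \<open>j\<close>.\<close>

lemma flat_cover_of_red_cover:
  assumes cov: "red_cover \<psi> U' R c \<Q>" and U': "U' \<subseteq> U" and unique: "\<forall>r\<in>R. \<exists>!Q. Q \<in> \<Q> \<and> r \<in> span Q"
  shows "flat_cover f E (c + j) (tight_part f E A j \<union> U')"
proof -
  note C = red_coverD[OF cov]
  define T where "T = (\<lambda>Q. slot_union A (L Q) \<union> {u\<in>U'. \<psi> u \<in> span Q})"
  have LQ: "L Q \<subseteq> {..<j}" for Q by (auto simp: L_def)
  have redQ: "\<exists>Q\<in>\<Q>. \<psi> (a i) \<in> span Q" if "i < j" for i
  proof -
    have "\<psi> (a i) \<in> R" using that by (auto simp: R_def)
    then show ?thesis using unique by blast
  qed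
  have cost: "max (dim (f ` T Q) - 1) 1 \<le> cover_cost R Q + card (L Q)" if QQ: "Q \<in> \<Q>" for Q
  proof -
    have d: "dim (f ` T Q) \<le> dim Q + card (L Q)" unfolding T_def using C(2)[OF QQ] U' by (intro dim_lift) auto
    show ?thesis
    proof (cases "\<exists>r\<in>R. r \<in> span Q")
      case True
      then obtain r where r: "r \<in> R" "r \<in> span Q" by blast
      then have "L Q \<noteq> {}" by (auto simp: L_def R_def)
      then have "1 \<le> card (L Q)" using finite_subset[OF LQ] by (simp add: Suc_le_eq card_gt_0_iff)
      moreover have "1 \<le> dim Q" using dim_pos[OF C(2)[OF QQ] r(2)] r(1) zero_notin_R by metis
      ultimately show ?thesis using d unfolding cover_cost_eq[OF r] by linarith
    next
      case False
      then show ?thesis using d L_empty[of Q] by (simp add: cover_cost_def)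
    qed
  qed
  show ?thesis unfolding flat_cover_def
  proof (intro exI[of _ "T ` \<Q>"] conjI ballI)
    show "finite (T ` \<Q>)" using C(1) by simp
    fix X assume "X \<in> T ` \<Q>"
    moreover have "slot_union A (L Q) \<subseteq> E" for Q unfolding slot_union_def using A by (intro UN_least) (auto simp: L_def)
    ultimately show "X \<subseteq> E" using U' U_sub by (auto simp: T_def)
  next
    fix x assume "x \<in> tight_part f E A j \<union> U'"
    then show "\<exists>X\<in>T ` \<Q>. f x \<in> span (f ` X)"
    proof
      assume x: "x \<in> U'"
      then obtain Q where Q: "Q \<in> \<Q>" "\<psi> x \<in> span Q" using C(3) by blast
      then have "x \<in> T Q" using x by (simp add: T_def)
      then show ?thesis using Q(1) span_base by blast
    next
      assume "x \<in> tight_part f E A j"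
      then obtain J where J: "J \<subseteq> {..<j}" "tight f A J" "f x \<in> span (f ` slot_union A J)"
        by (auto simp: tight_part_def)
      obtain i where i: "i \<in> J" using J(2) by (auto simp: tight_def)
      obtain Q where Q: "Q \<in> \<Q>" "\<psi> (a i) \<in> span Q" using redQ i J(1) by blast
      have "J \<subseteq> L Q"
      proof
        fix m assume m: "m \<in> J"
        have "a m \<in> slot_union A J" using m a(1) J(1) by (auto simp: slot_union_def)
        then have "\<psi> (a m) \<in> span {\<psi> (a i)}" using \<psi>_tight_set[OF J(1,2) i] by simp
        then have "\<psi> (a m) \<in> span Q" using Q(2) span_trans_subset[of "\<psi> (a m)" "{\<psi> (a i)}" Q] by simp
        then show "m \<in> L Q" using m J(1) by (auto simp: L_def)
      qed
      then have "slot_union A J \<subseteq> T Q" using slot_union_mono[of J "L Q" A] by (auto simp: T_def)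
      then have "span (f ` slot_union A J) \<subseteq> span (f ` T Q)" by (intro span_mono image_mono)
      then show ?thesis using J(3) Q(1) by blast
    qed
  next
    have "(\<Sum>X\<in>T ` \<Q>. max (dim (f ` X) - 1) 1) \<le> (\<Sum>Q\<in>\<Q>. max (dim (f ` T Q) - 1) 1)"
      using sum_image_le[OF C(1), of "\<lambda>X. max (dim (f ` X) - 1) 1" T] by (simp add: o_def)
    also have "\<dots> \<le> (\<Sum>Q\<in>\<Q>. cover_cost R Q + card (L Q))" using cost by (rule sum_mono)
    also have "\<dots> = (\<Sum>Q\<in>\<Q>. cover_cost R Q) + (\<Sum>Q\<in>\<Q>. card (L Q))" by (rule sum.distrib)
    also have "(\<Sum>Q\<in>\<Q>. card (L Q)) = card (\<Union>Q\<in>\<Q>. L Q)"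
    proof (rule card_UN_disjoint[symmetric])
      show "finite \<Q>" by (rule C(1))
      show "\<forall>Q\<in>\<Q>. finite (L Q)" using finite_subset[OF LQ] by blast
      show "\<forall>P\<in>\<Q>. \<forall>Q\<in>\<Q>. P \<noteq> Q \<longrightarrow> L P \<inter> L Q = {}"
      proof (intro ballI impI)
        fix P Q assume PQ: "P \<in> \<Q>" "Q \<in> \<Q>" "P \<noteq> Q"
        show "L P \<inter> L Q = {}"
        proof (rule ccontr)
          assume "L P \<inter> L Q \<noteq> {}"
          then obtain i where i: "i < j" "\<psi> (a i) \<in> span P" "\<psi> (a i) \<in> span Q" by (auto simp: L_def)
          have "\<psi> (a i) \<in> R" using i(1) by (auto simp: R_def)
          then have "\<exists>!Q. Q \<in> \<Q> \<and> \<psi> (a i) \<in> span Q" using unique by (rule bspec[rotated])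
          then show False using i PQ by (metis (no_types, lifting))
        qed
      qed
    qed
    also have "card (\<Union>Q\<in>\<Q>. L Q) \<le> card {..<j}" using LQ by (intro card_mono) auto
    finally show "(\<Sum>X\<in>T ` \<Q>. max (dim (f ` X) - 1) 1) \<le> c + j" using C(4) by simp
  qed
qed

text \<open>If all candidates were blocked, \<open>blocked_cover\<close> at rank parameter
  \<open>k - j\<close> would cost \<open>k - j - 1\<close>. Returning from the contraction adds
  \<open>j\<close>, so a cover of cost \<open>k - 1\<close> would miss at most
  \<open>max_blue k (k - 2)\<close> elements.\<close>

lemma exists_unblocked:
  assumes k: "1 \<le> k" and few: "\<And>Y. Y \<subseteq> E \<Longrightarrow> flat_cover f E (k - 1) Y \<Longrightarrow> max_blue k (k - 2) < card (E - Y)"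
  shows "\<exists>S\<subseteq>U. dim (\<psi> ` S) = k - j \<and> (\<forall>r\<in>R. r \<notin> span (\<psi> ` S))"
proof (cases "j = k")
  case True
  then show ?thesis using zero_notin_R by (intro exI[of _ "{}"]) auto
next
  case False
  then obtain m where m: "k - j = Suc m" using jk by (metis diff_is_0_eq le_antisym not0_implies_Suc)
  show ?thesis
  proof (rule ccontr)
    assume neg: "\<not> ?thesis"
    have "\<exists>U'\<subseteq>U. card (U - U') \<le> max_blue k (k - 2) \<and> (\<exists>\<Q>. red_cover \<psi> U' R m \<Q>)"
    proof (rule blocked_cover[OF finite_U finite_R zero_notin_R])
      show "\<psi> u \<noteq> 0" if "u \<in> U" for u using \<psi>_nonzero[OF that] .
      show "\<exists>r\<in>R. r \<in> span {\<psi> u}" if "u \<in> U" "v \<in> U" "u \<noteq> v" "\<psi> v \<in> span {\<psi> u}" for u v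
        using \<psi>_parallel[OF that] .
      show "dim (\<psi> ` U \<union> R) \<le> Suc m + 1"
      proof -
        define X where "X = U \<union> a ` {..<j}"
        have X: "X \<subseteq> E" "finite X" using U_sub a(1) A finite_U by (auto simp: X_def)
        have "\<psi> ` U \<union> R = \<psi> ` X" by (auto simp: X_def R_def)
        moreover have "dim (\<psi> ` X) + j = dim (f ` X \<union> G)" using dim_\<psi>[OF X(2)] .
        moreover have "dim (f ` X \<union> G) \<le> dim (f ` E)"
        proof (rule dim_mono_finite)
          have "e i \<in> E" if "i < j" for i using e[OF that] A[OF that] by blast
          then have "f ` X \<union> G \<subseteq> f ` E" using X(1) by (auto simp: G_def)
          then show "f ` X \<union> G \<subseteq> span (f ` E)" using span_superset by (rule subset_trans)
        qed (use E in simp)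
        ultimately show ?thesis using dimE m by simp
      qed
      show "card R + Suc m \<le> k" using card_R m jk by simp
      show "\<exists>r\<in>R. r \<in> span (\<psi> ` S)" if "S \<subseteq> U" "dim (\<psi> ` S) = Suc m" for S using neg that m by metis
    qed
    then obtain U' \<Q> where U': "U' \<subseteq> U" "card (U - U') \<le> max_blue k (k - 2)" "red_cover \<psi> U' R m \<Q>"
      by (elim exE conjE) (rule that)
    obtain \<Q>' where Q': "red_cover \<psi> U' R m \<Q>'" "\<forall>r\<in>R. \<exists>!Q. Q \<in> \<Q>' \<and> r \<in> span Q"
      using normal_red_cover[OF zero_notin_R finite_R U'(3)] by (elim exE conjE) (rule that)
    have "flat_cover f E (m + j) (tight_part f E A j \<union> U')" using flat_cover_of_red_cover[OF Q'(1) U'(1) Q'(2)] .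
    moreover have "m + j = k - 1" using m by simp
    moreover have "tight_part f E A j \<union> U' \<subseteq> E" using U'(1) U_sub by (auto simp: tight_part_def)
    ultimately have "max_blue k (k - 2) < card (E - (tight_part f E A j \<union> U'))" using few by metis
    moreover have "E - (tight_part f E A j \<union> U') = U - U'" by (auto simp: U_def)
    ultimately show False using U'(2) by simp
  qed
qed

end

context typical_tuple
begin

text \<open>The last clause bounds the fibres in the final count. A slot element in the flat but
  outside the span of the entries of \<open>T\<close> would bring the whole tight union into the
  flat by \<open>span_tight_set\<close>, and with it a red point.\<close>

lemma exists_flat_through_tuple:
  assumes k: "1 \<le> k" and few: "\<And>Y. Y \<subseteq> E \<Longrightarrow> flat_cover f E (k - 1) Y \<Longrightarrow> max_blue k (k - 2) < card (E - Y)"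
  shows "\<exists>S\<subseteq>E. dim (f ` (S \<union> e ` {..<j})) = k \<and> (\<forall>T\<subseteq>{..<j}. tight f A T \<longrightarrow>
    (\<forall>i\<in>T. \<forall>z\<in>A i. f z \<in> span (f ` (S \<union> e ` {..<j})) \<longrightarrow> f z \<in> span (f ` e ` T)))"
proof -
  obtain \<pi> :: "rvec \<Rightarrow> rvec" where \<pi>: "linear \<pi>" "\<forall>x. \<pi> x = 0 \<longleftrightarrow> x \<in> span G"
    using exists_projection[of G] by (elim exE conjE) (rule that)
  have "\<forall>i\<in>{..<j}. \<exists>x. x \<in> A i \<and> f x \<notin> span G" using slot_not_in_span by blast
  then obtain a where a: "\<forall>i\<in>{..<j}. a i \<in> A i \<and> f (a i) \<notin> span G" by (rule bchoice[THEN exE])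
  interpret contracted_tuple k j f E A e \<pi> a
  proof (intro contracted_tuple.intro contracted_tuple_axioms.intro)
    show "typical_tuple k j f E A e" by (rule typical_tuple_axioms)
    show "linear \<pi>" by (rule \<pi>(1))
    show "\<pi> x = 0 \<longleftrightarrow> x \<in> span G" for x using \<pi>(2) by (rule spec)
    show "a i \<in> A i" "f (a i) \<notin> span G" if "i < j" for i using a that by simp_all
  qed
  have "\<exists>S\<subseteq>U. dim (\<psi> ` S) = k - j \<and> (\<forall>r\<in>R. r \<notin> span (\<psi> ` S))"
    using k few by (rule exists_unblocked)
  then obtain S where S: "S \<subseteq> U" "dim (\<psi> ` S) = k - j" "\<forall>r\<in>R. r \<notin> span (\<psi> ` S)"
    by (elim exE conjE) (rule that)
  have fS: "finite S" using S(1) finite_U finite_subset by blast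
  have H: "f ` (S \<union> e ` {..<j}) = f ` S \<union> G" by (auto simp: G_def)
  have "dim (f ` (S \<union> e ` {..<j})) = k" using dim_\<psi>[OF fS] S(2) jk H by simp
  moreover have "f z \<in> span (f ` e ` T)"
    if T: "T \<subseteq> {..<j}" "tight f A T" "i \<in> T" and z: "z \<in> A i" "f z \<in> span (f ` (S \<union> e ` {..<j}))" for T i z
  proof (rule ccontr)
    assume n: "f z \<notin> span (f ` e ` T)"
    have i: "i < j" using T by auto
    have "z \<in> slot_union A T" "a i \<in> slot_union A T" using z(1) T(3) a i by (auto simp: slot_union_def)
    then have "span (insert (f z) (f ` e ` T)) = span (f ` slot_union A T)" "f (a i) \<in> span (f ` slot_union A T)"
      using span_tight_set[OF T(1,2) _ n] by (auto intro: span_base)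
    then have "f (a i) \<in> span (insert (f z) (f ` e ` T))" by simp
    moreover have "insert (f z) (f ` e ` T) \<subseteq> span (f ` S \<union> G)"
    proof (rule insert_subsetI)
      show "f z \<in> span (f ` S \<union> G)" using z(2) H by simp
      have "G \<subseteq> span (f ` S \<union> G)" using span_superset[of "f ` S \<union> G"] by simp
      then show "f ` e ` T \<subseteq> span (f ` S \<union> G)" by (rule subset_trans[OF eG[OF T(1)]])
    qed
    ultimately have "f (a i) \<in> span (f ` S \<union> G)" by (rule span_trans_subset)
    then have "\<psi> (a i) \<in> span (\<psi> ` S)" using \<psi>_in_span_iff by blast
    moreover have "\<psi> (a i) \<in> R" using i by (auto simp: R_def)
    ultimately show False using S(3) by blast
  qed
  ultimately show ?thesis using S(1) U_sub by (intro exI[of _ S] conjI allI impI ballI) auto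
qed

end

subsection \<open>Counting flats\<close>

definition span_flats :: "('a \<Rightarrow> 'v::real_vector) \<Rightarrow> 'a set \<Rightarrow> nat \<Rightarrow> 'a set set" where
  "span_flats f E k = {F. \<exists>X\<subseteq>E. dim (f ` X) = k \<and> F = {x\<in>E. f x \<in> span (f ` X)}}"

lemma finite_span_flats: "finite E \<Longrightarrow> finite (span_flats f E k)"
  by (rule finite_subset[of _ "Pow E"]) (auto simp: span_flats_def)

lemma card_le_fibres:
  assumes "finite B" "\<And>x. x \<in> A \<Longrightarrow> g x \<in> B" "\<And>x. x \<in> A \<Longrightarrow> card {y\<in>A. g y = g x} \<le> c"
  shows "card A \<le> card B * c"
proof -
  have "card A \<le> card (\<Union>b\<in>B. {y\<in>A. g y = b})"
  proof (cases "finite A")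
    case True
    then show ?thesis using assms(1,2) by (intro card_mono) auto
  qed simp
  also have "\<dots> \<le> (\<Sum>b\<in>B. card {y\<in>A. g y = b})" using assms(1) by (rule card_UN_le)
  also have "\<dots> \<le> (\<Sum>b\<in>B. c)"
  proof (rule sum_mono)
    fix b
    show "card {y\<in>A. g y = b} \<le> c"
    proof (cases "{y\<in>A. g y = b} = {}")
      case True
      show ?thesis unfolding True by simp
    next
      case False
      then obtain x where "x \<in> A" "b = g x" by blast
      then show ?thesis using assms(3) by simp
    qed
  qed
  finally show ?thesis by simp
qed

text \<open>Atypical tuples and tuples with a crowded span take at most a quarter of the product
  each, so half remains.\<close>

lemma many_typical_tuples:
  fixes f :: "'a \<Rightarrow> 'v::real_vector"
  assumes fA: "\<And>i. i < j \<Longrightarrow> finite (A i)" and spr: "\<And>i. i < j \<Longrightarrow> spreading f \<eta> (A i)" and U: "finite U"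
    and \<eta>: "0 \<le> \<eta>" "real j * 4 ^ j * 2 ^ card U * \<eta> \<le> 1 / 4"
    and bad: "\<And>i. i < j \<Longrightarrow> real (card {e\<in>PiE {..<j} A. bad i e}) \<le> \<delta> * (\<Prod>i<j. real (card (A i)))"
    and \<delta>: "real j * \<delta> \<le> 1 / 4"
  shows "(\<Prod>i<j. real (card (A i))) \<le> 2 * real (card {e\<in>PiE {..<j} A. typical f j A U e \<and> (\<forall>i<j. \<not> bad i e)})"
proof -
  let ?P = "PiE {..<j} A"
  define N where "N = (\<Prod>i<j. real (card (A i)))"
  define good where "good = {e\<in>?P. typical f j A U e \<and> (\<forall>i<j. \<not> bad i e)}"
  define B1 where "B1 = {e\<in>?P. \<not> typical f j A U e}"
  define B2 where "B2 = (\<Union>i<j. {e\<in>?P. bad i e})"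
  have N0: "0 \<le> N" by (simp add: N_def prod_nonneg)
  have fP: "finite ?P" using fA by (intro finite_PiE) auto
  have "?P \<subseteq> good \<union> (B1 \<union> B2)" by (auto simp: good_def B1_def B2_def)
  then have "card ?P \<le> card (good \<union> (B1 \<union> B2))" using fP by (intro card_mono) (auto simp: good_def B1_def B2_def)
  also have "\<dots> \<le> card good + (card B1 + card B2)"
    using card_Un_le[of good "B1 \<union> B2"] card_Un_le[of B1 B2] by linarith
  finally have "real (card ?P) \<le> real (card good) + real (card B1) + real (card B2)" by linarith
  moreover have "real (card ?P) = N" by (simp add: N_def card_PiE)
  moreover have "real (card B1) \<le> 1 / 4 * N"
  proof -
    have "real (card B1) \<le> real j * 4 ^ j * 2 ^ card U * \<eta> * N"
      unfolding B1_def N_def using fA spr U \<eta>(1) by (rule card_atypical)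
    also have "\<dots> \<le> 1 / 4 * N" using \<eta>(2) N0 by (rule mult_right_mono)
    finally show ?thesis .
  qed
  moreover have "real (card B2) \<le> 1 / 4 * N"
  proof -
    have "card B2 \<le> (\<Sum>i<j. card {e\<in>?P. bad i e})" unfolding B2_def by (rule card_UN_le) simp
    then have "real (card B2) \<le> real (\<Sum>i<j. card {e\<in>?P. bad i e})" by (simp only: of_nat_le_iff)
    also have "\<dots> = (\<Sum>i<j. real (card {e\<in>?P. bad i e}))" by (rule of_nat_sum)
    also have "\<dots> \<le> (\<Sum>i<j. \<delta> * N)" using bad by (intro sum_mono) (simp add: N_def)
    also have "\<dots> = (real j * \<delta>) * N" by simp
    also have "\<dots> \<le> 1 / 4 * N" using \<delta> N0 by (rule mult_right_mono)
    finally show ?thesis .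
  qed
  ultimately show ?thesis unfolding good_def[symmetric] N_def[symmetric] by linarith
qed

lemma dilworth_mono:
  assumes "dilworth f j A" "i \<le> j"
  shows "dilworth f i A"
  unfolding dilworth_def
proof (intro allI impI)
  fix J assume J: "J \<subseteq> {..<i}" "J \<noteq> {}"
  have "J \<subseteq> {..<j}" using J(1) assms(2) by auto
  then show "card J + 1 \<le> dim (f ` slot_union A J)" using assms(1) J(2) unfolding dilworth_def by blast
qed

text \<open>The numbers \<open>s i\<close> stand for the factors of the product to be bounded; only
  their relation to covers of cost \<open>i\<close> matters here. The tight part of the first
  \<open>i\<close> slots has such a cover, which compares \<open>s i\<close> with the size of slot
  \<open>i\<close>.\<close>

lemma many_span_flats:
  assumes k: "1 \<le> k"
  shows "\<exists>\<rho>>0. \<forall>(f :: 'a \<Rightarrow> rvec) E (s :: nat \<Rightarrow> nat). finite E \<longrightarrow> dim (f ` E) \<le> k + 1 \<longrightarrow>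
    (\<forall>x\<in>E. f x \<noteq> 0) \<longrightarrow> (\<forall>x\<in>E. \<forall>y\<in>E. x \<noteq> y \<longrightarrow> f y \<notin> span {f x}) \<longrightarrow>
    (\<forall>i<k. \<forall>Y\<subseteq>E. flat_cover f E i Y \<longrightarrow> s i \<le> k * card (E - Y)) \<longrightarrow>
    (\<forall>Y\<subseteq>E. flat_cover f E (k - 1) Y \<longrightarrow> max_blue k (k - 2) < card (E - Y)) \<longrightarrow>
    \<rho> * (\<Prod>i<k. real (s i)) \<le> real (card (span_flats f E k))"
proof -
  \<comment> \<open>At most \<open>k\<close> slots can be crowded, each with probability
    \<open>\<delta>\<close>: a quarter in total.\<close>
  define \<delta> where "\<delta> = 1 / (4 * real k)"
  have \<delta>: "0 < \<delta>" using k by (simp add: \<delta>_def)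
  obtain \<eta>0 where \<eta>0: "0 < \<eta>0" and bound: "\<forall>K>0. \<exists>C. \<forall>(f :: 'a \<Rightarrow> rvec) I. finite I \<longrightarrow> card I < Suc k \<longrightarrow> slot_flat_bound f \<eta>0 K C \<delta> I"
    using exists_slot_flat_bound[OF \<delta>, where n = "Suc k"] by (elim exE conjE) (rule that)
  \<comment> \<open>Divided by \<open>2 ^ \<Lambda> j\<close>, this is the spread that survives the
    union bound over subsets of the leftover set; it must also meet the requirement
    \<open>\<eta>0\<close> of the random-flat bound.\<close>
  define c where "c = min \<eta>0 (1 / (4 * real k * 4 ^ k))"
  have c: "0 < c" "c \<le> \<eta>0" "real k * 4 ^ k * c \<le> 1 / 4"
  proof -
    show "0 < c" "c \<le> \<eta>0" using \<eta>0 k by (auto simp: c_def)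
    have "real k * 4 ^ k * c \<le> real k * 4 ^ k * (1 / (4 * real k * 4 ^ k))" by (rule mult_left_mono) (auto simp: c_def)
    then show "real k * 4 ^ k * c \<le> 1 / 4" using k by simp
  qed
  have ck: "c * 2 ^ k \<le> 1 / 2"
  proof -
    have "1 * 2 ^ k \<le> real k * (4::real) ^ k" using k by (intro mult_mono power_mono) auto
    then have "c * (1 * 2 ^ k) \<le> c * (real k * 4 ^ k)" using c(1) by (intro mult_left_mono) auto
    then show ?thesis using c(3) by (simp add: mult_ac)
  qed
  obtain \<eta> \<Lambda> K where sc: "slot_constants k \<eta> \<Lambda> K" and Kpos: "0 < K" and \<eta>c: "\<forall>i<k. \<eta> i * 2 ^ \<Lambda> (Suc i) \<le> c"
    using exists_slot_constants[OF c(1) ck] by (elim exE conjE) (rule that)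
  interpret slot_constants k \<eta> \<Lambda> K by (rule sc)
  obtain C where C: "\<forall>(f :: 'a \<Rightarrow> rvec) I. finite I \<longrightarrow> card I < Suc k \<longrightarrow> slot_flat_bound f \<eta>0 K C \<delta> I"
    using bound[THEN spec, THEN mp, OF Kpos] by (elim exE) (rule that)
  define C' where "C' = max 1 C"
  \<comment> \<open>Covers both kinds of factors: those with a slot, via \<open>k * K\<close>, and
    those beyond the last slot, where the remainder is below \<open>\<Lambda> 0\<close>.\<close>
  define D where "D = max 1 (max (real k * K) (real k * real (\<Lambda> 0)))"
  define \<rho> where "\<rho> = 1 / (2 * real C' ^ k * D ^ k)"
  have D: "1 \<le> D" "real k * K \<le> D" "real k * real (\<Lambda> 0) \<le> D" by (auto simp: D_def)
  have C': "1 \<le> C'" by (simp add: C'_def)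
  have \<rho>: "0 < \<rho>" using C' D by (simp add: \<rho>_def)
  show ?thesis
  proof (intro exI[of _ \<rho>] conjI \<rho> allI impI)
    fix f :: "'a \<Rightarrow> rvec" and E and s :: "nat \<Rightarrow> nat"
    assume E: "finite E" and dimE: "dim (f ` E) \<le> k + 1" and nz: "\<forall>x\<in>E. f x \<noteq> 0"
      and simple: "\<forall>x\<in>E. \<forall>y\<in>E. x \<noteq> y \<longrightarrow> f y \<notin> span {f x}"
      and s: "\<forall>i<k. \<forall>Y\<subseteq>E. flat_cover f E i Y \<longrightarrow> s i \<le> k * card (E - Y)"
      and few: "\<forall>Y\<subseteq>E. flat_cover f E (k - 1) Y \<longrightarrow> max_blue k (k - 2) < card (E - Y)"
    have two: "dim {f x, f y} = 2" if xy: "x \<in> E" "y \<in> E" "x \<noteq> y" for x y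
    proof -
      have "f x \<notin> span {f y}" using simple[rule_format, OF xy(2,1)] xy(3) by blast
      moreover have "f y \<noteq> 0" using nz xy(2) by blast
      ultimately show ?thesis using dim_insert_finite[of "{f y}" "f x"] dim_insert_finite[of "{}" "f y"] by simp
    qed
    have "\<exists>j\<le>k. \<exists>A. slot_state k \<eta> \<Lambda> K f E j A \<and> card (E - tight_part f E A j) < \<Lambda> j \<and>
      (\<forall>i<j. \<exists>T\<subseteq>{..<j}. i \<in> T \<and> tight f A T \<and> (\<forall>m\<in>T. real (card (A i)) \<le> K * real (card (A m))))"
      by (rule exists_slots[OF E two dimE]) (use k in auto)
    then obtain j A where j: "j \<le> k" and st: "slot_state k \<eta> \<Lambda> K f E j A" and U: "card (E - tight_part f E A j) < \<Lambda> j"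
      and T: "\<forall>i<j. \<exists>T\<subseteq>{..<j}. i \<in> T \<and> tight f A T \<and> (\<forall>m\<in>T. real (card (A i)) \<le> K * real (card (A m)))"
      by (elim exE conjE) (rule that)
    note S = slot_stateD[OF st]
    have "\<forall>i\<in>{..<j}. \<exists>T. T \<subseteq> {..<j} \<and> i \<in> T \<and> tight f A T \<and> (\<forall>m\<in>T. real (card (A i)) \<le> K * real (card (A m)))"
      using T by simp
    then obtain T where T': "\<forall>i\<in>{..<j}. T i \<subseteq> {..<j} \<and> i \<in> T i \<and> tight f A (T i) \<and> (\<forall>m\<in>T i. real (card (A i)) \<le> K * real (card (A m)))"
      by (rule bchoice[THEN exE])
    have T: "T i \<subseteq> {..<j}" "i \<in> T i" "tight f A (T i)" "\<forall>m\<in>T i. real (card (A i)) \<le> K * real (card (A m))" if "i < j" for i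
      using T'[rule_format, of i] that by simp_all
    have fA: "finite (A i)" if "i < j" for i using S(1)[OF that] E by (rule finite_subset)
    have neA: "A i \<noteq> {}" if "i < j" for i using S(3)[OF that] by auto
    define N where "N = (\<Prod>i<j. real (card (A i)))"
    define U where "U = E - tight_part f E A j"
    have fU: "finite U" using E by (simp add: U_def)
    \<comment> \<open>All slots present at the stop were cut with thresholds
      \<open>\<Lambda> (i + 1)\<close> no smaller than \<open>\<Lambda> j\<close>, so they are
      spread enough for a leftover set of fewer than \<open>\<Lambda> j\<close> elements.\<close>
    have spr: "spreading f (c / 2 ^ \<Lambda> j) (A i)" if i: "i < j" for i
    proof -
      have ik: "i < k" using i j by simp
      have "2 ^ \<Lambda> j \<le> (2::real) ^ \<Lambda> (Suc i)" using \<Lambda>_antimono[of "Suc i" j] i j by (intro power_increasing) auto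
      then have "\<eta> i * 2 ^ \<Lambda> j \<le> \<eta> i * 2 ^ \<Lambda> (Suc i)" using \<eta>(1)[OF ik] by (intro mult_left_mono) auto
      then have "\<eta> i \<le> c / 2 ^ \<Lambda> j" using \<eta>c[rule_format, OF ik] by (simp add: pos_le_divide_eq)
      then show ?thesis using S(2)[OF i] spreading_mono by blast
    qed
    have c\<Lambda>: "c / 2 ^ \<Lambda> j \<le> c" using c(1) by (simp add: divide_le_eq)
    define bad where "bad = (\<lambda>i e. C < card {z\<in>A i. f z \<in> span (f ` e ` T i)})"
    have bad: "real (card {e\<in>PiE {..<j} A. bad i e}) \<le> \<delta> * N" if i: "i < j" for i
    proof -
      have fT: "finite (T i)" using T(1)[OF i] by (rule finite_subset) simp
      have "card (T i) \<le> j" using card_mono[OF _ T(1)[OF i]] by simp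
      then have b: "slot_flat_bound f \<eta>0 K C \<delta> (T i)" using C[rule_format, OF fT] j by simp
      have "real (card {e\<in>PiE (T i) A. C < card {z\<in>A i. f z \<in> span (f ` e ` T i)}}) \<le> \<delta> * (\<Prod>m\<in>T i. real (card (A m)))"
      proof (rule slot_flat_boundD[OF b E nz simple _ _ S(1)[OF i]])
        show "\<forall>m\<in>T i. A m \<subseteq> E \<and> A m \<noteq> {} \<and> spreading f \<eta>0 (A m)"
        proof
          fix m assume "m \<in> T i"
          then have m: "m < j" using T(1)[OF i] by auto
          have "c / 2 ^ \<Lambda> j \<le> \<eta>0" using c\<Lambda> c(2) by linarith
          then show "A m \<subseteq> E \<and> A m \<noteq> {} \<and> spreading f \<eta>0 (A m)"
            using S(1)[OF m] neA[OF m] spreading_mono[OF spr[OF m]] by blast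
        qed
        show "\<forall>J\<subseteq>T i. J \<noteq> {} \<longrightarrow> card J + 1 \<le> dim (f ` slot_union A J)"
          using S(5) T(1)[OF i] unfolding dilworth_def by (meson subset_trans)
        show "\<forall>m\<in>T i. real (card (A i)) \<le> K * real (card (A m))" by (rule T(4)[OF i])
      qed
      then have "real (card {e\<in>PiE {..<j} A. C < card {z\<in>A i. f z \<in> span (f ` FuncSet.restrict e (T i) ` T i)}}) \<le> \<delta> * N"
        unfolding N_def using fA by (intro card_PiE_restrict[OF _ T(1)[OF i]]) auto
      moreover have "FuncSet.restrict e (T i) ` T i = e ` T i" for e :: "nat \<Rightarrow> 'a" by (rule image_restrict_eq)
      ultimately show ?thesis by (simp add: bad_def)
    qed
    define good where "good = {e\<in>PiE {..<j} A. typical f j A U e \<and> (\<forall>i<j. \<not> bad i e)}"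
    have N: "N \<le> 2 * real (card good)" unfolding N_def good_def
    proof (rule many_typical_tuples[OF fA spr fU _ _ bad[unfolded N_def]])
      show "0 \<le> c / 2 ^ \<Lambda> j" using c(1) by simp
      show "real j * 4 ^ j * 2 ^ card U * (c / 2 ^ \<Lambda> j) \<le> 1 / 4"
      proof -
        have "2 ^ card U \<le> (2::real) ^ \<Lambda> j" using U by (intro power_increasing) (auto simp: U_def)
        then have "2 ^ card U * (c / 2 ^ \<Lambda> j) \<le> 2 ^ \<Lambda> j * (c / 2 ^ \<Lambda> j)" using c(1) by (intro mult_right_mono) auto
        then have cU: "2 ^ card U * (c / 2 ^ \<Lambda> j) \<le> c" by simp
        have "real j * 4 ^ j \<le> real k * 4 ^ k" using j by (intro mult_mono power_increasing) auto
        then have "(real j * 4 ^ j) * (2 ^ card U * (c / 2 ^ \<Lambda> j)) \<le> (real k * 4 ^ k) * c"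
          using cU by (rule mult_mono) (use c(1) in auto)
        then have "(real j * 4 ^ j) * (2 ^ card U * (c / 2 ^ \<Lambda> j)) \<le> 1 / 4" using c(3) by (rule order_trans)
        then show ?thesis by (simp only: mult.assoc)
      qed
      have "real j * \<delta> \<le> real k * \<delta>" using j \<delta> by (intro mult_right_mono) auto
      then show "real j * \<delta> \<le> 1 / 4" using k by (simp add: \<delta>_def)
    qed
    have ex: "\<exists>F. F \<in> span_flats f E k \<and> e \<in> PiE {..<j} (\<lambda>i. A i \<inter> F) \<and> (\<forall>i<j. card (A i \<inter> F) \<le> C')" if e: "e \<in> good" for e
    proof -
      have eP: "e \<in> PiE {..<j} A" and ty: "typical f j A U e" and nb: "\<And>i. i < j \<Longrightarrow> \<not> bad i e"
        using e by (simp_all add: good_def)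
      have eA: "e i \<in> A i" if "i < j" for i using eP that by (auto simp: PiE_def Pi_def)
      have "typical_tuple k j f E A e"
      proof
        show "finite E" "j \<le> k" "dim (f ` E) \<le> k + 1" by (fact E j dimE)+
        show "f x \<noteq> 0" if "x \<in> E" for x using nz that by blast
        show "f y \<notin> span {f x}" if "x \<in> E" "y \<in> E" "x \<noteq> y" for x y using simple[rule_format, OF that] .
        show "A i \<subseteq> E" if "i < j" for i using S(1)[OF that] .
        show "dilworth f j A" by (rule S(5))
        show "\<exists>T\<subseteq>{..<j}. i \<in> T \<and> tight f A T" if "i < j" for i using T[OF that] by blast
        show "e i \<in> A i" if "i < j" for i using eA[OF that] .
        show "typical f j A (E - tight_part f E A j) e" using ty by (simp add: U_def)
      qed
      then have "\<exists>X\<subseteq>E. dim (f ` (X \<union> e ` {..<j})) = k \<and> (\<forall>T\<subseteq>{..<j}. tight f A T \<longrightarrow>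
        (\<forall>i\<in>T. \<forall>z\<in>A i. f z \<in> span (f ` (X \<union> e ` {..<j})) \<longrightarrow> f z \<in> span (f ` e ` T)))"
        using k by (rule typical_tuple.exists_flat_through_tuple) (use few in blast)
      then obtain X where X: "X \<subseteq> E" "dim (f ` (X \<union> e ` {..<j})) = k" and
        XT: "\<forall>T\<subseteq>{..<j}. tight f A T \<longrightarrow>
        (\<forall>i\<in>T. \<forall>z\<in>A i. f z \<in> span (f ` (X \<union> e ` {..<j})) \<longrightarrow> f z \<in> span (f ` e ` T))"
        by (elim exE conjE) (rule that)
      define F where "F = {x\<in>E. f x \<in> span (f ` (X \<union> e ` {..<j}))}"
      have eE: "e i \<in> E" if "i < j" for i using eA[OF that] S(1)[OF that] by blast
      have "X \<union> e ` {..<j} \<subseteq> E" using X(1) eE by auto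
      then have "F \<in> span_flats f E k" using X(2) unfolding span_flats_def F_def by blast
      moreover have "e i \<in> F" if "i < j" for i using eE[OF that] that by (auto simp: F_def intro!: span_base)
      then have "e \<in> PiE {..<j} (\<lambda>i. A i \<inter> F)" using eP by (auto simp: PiE_def Pi_def)
      moreover have "card (A i \<inter> F) \<le> C'" if i: "i < j" for i
      proof -
        have "A i \<inter> F \<subseteq> {z\<in>A i. f z \<in> span (f ` e ` T i)}"
        proof
          fix z assume z: "z \<in> A i \<inter> F"
          then have "f z \<in> span (f ` (X \<union> e ` {..<j}))" by (simp add: F_def)
          then have "f z \<in> span (f ` e ` T i)" using XT[rule_format, OF T(1)[OF i] T(3)[OF i] T(2)[OF i]] z by simp
          then show "z \<in> {z\<in>A i. f z \<in> span (f ` e ` T i)}" using z by simp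
        qed
        then have "card (A i \<inter> F) \<le> card {z\<in>A i. f z \<in> span (f ` e ` T i)}" using fA[OF i] by (intro card_mono) auto
        moreover have "card {z\<in>A i. f z \<in> span (f ` e ` T i)} \<le> C" using nb[OF i] by (simp add: bad_def)
        ultimately show ?thesis unfolding C'_def by linarith
      qed
      ultimately show ?thesis by blast
    qed
    then have "\<forall>e\<in>good. \<exists>F. F \<in> span_flats f E k \<and> e \<in> PiE {..<j} (\<lambda>i. A i \<inter> F) \<and> (\<forall>i<j. card (A i \<inter> F) \<le> C')" by blast
    then obtain F where F: "\<forall>e\<in>good. F e \<in> span_flats f E k \<and> e \<in> PiE {..<j} (\<lambda>i. A i \<inter> F e) \<and> (\<forall>i<j. card (A i \<inter> F e) \<le> C')"
      by (rule bchoice[THEN exE])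
    \<comment> \<open>Tuples assigned to the same flat lie in the product of its intersections with
      the slots, each of size at most \<open>C'\<close>.\<close>
    have "card good \<le> card (span_flats f E k) * C' ^ k"
    proof (rule card_le_fibres[OF finite_span_flats[OF E], of good F])
      show "F e \<in> span_flats f E k" if "e \<in> good" for e using F that by blast
      fix e assume e: "e \<in> good"
      have "{e'\<in>good. F e' = F e} \<subseteq> PiE {..<j} (\<lambda>i. A i \<inter> F e)"
      proof
        fix e' assume "e' \<in> {e'\<in>good. F e' = F e}"
        then show "e' \<in> PiE {..<j} (\<lambda>i. A i \<inter> F e)" using F[rule_format, of e'] by simp
      qed
      then have "card {e'\<in>good. F e' = F e} \<le> card (PiE {..<j} (\<lambda>i. A i \<inter> F e))"
        using fA by (intro card_mono finite_PiE) auto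
      also have "\<dots> = (\<Prod>i<j. card (A i \<inter> F e))" by (simp add: card_PiE)
      also have "\<dots> \<le> (\<Prod>i<j. C')" using F[rule_format, OF e] by (intro prod_mono) auto
      also have "\<dots> \<le> C' ^ k" using C' j by (simp add: power_increasing)
      finally show "card {e'\<in>good. F e' = F e} \<le> C' ^ k" .
    qed
    then have "real (card good) \<le> real (card (span_flats f E k) * C' ^ k)" by (simp only: of_nat_le_iff)
    then have count: "N \<le> 2 * real C' ^ k * real (card (span_flats f E k))" using N by (simp add: mult_ac)
    have "(\<Prod>i<k. real (s i)) \<le> (\<Prod>i<k. D * (if i < j then real (card (A i)) else 1))"
    proof (rule prod_mono, safe)
      fix i assume i: "i < k"
      show "real (s i) \<le> D * (if i < j then real (card (A i)) else 1)"
      proof (cases "i < j")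
        case True
        have "flat_cover f E i (tight_part f E A i)"
          using dilworth_mono[OF S(5), of i] True S(1) by (intro tight_part_cover E) auto
        moreover have "tight_part f E A i \<subseteq> E" by (auto simp: tight_part_def)
        ultimately have "s i \<le> k * card (E - tight_part f E A i)" using s i by blast
        then have "real (s i) \<le> real (k * card (E - tight_part f E A i))" by (simp only: of_nat_le_iff)
        also have "\<dots> = real k * real (card (E - tight_part f E A i))" by simp
        also have "\<dots> \<le> real k * (K * real (card (A i)))" using S(4)[OF True] by (rule mult_left_mono) simp
        also have "\<dots> = (real k * K) * real (card (A i))" by simp
        also have "\<dots> \<le> D * real (card (A i))" using D(2) by (rule mult_right_mono) simp
        finally show ?thesis using True by simp
      next
        case False
        have "flat_cover f E j (tight_part f E A j)" using S(5) E S(1) by (rule tight_part_cover)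
        then have "flat_cover f E i (tight_part f E A j)" using False by (elim flat_cover_mono) auto
        moreover have "tight_part f E A j \<subseteq> E" by (auto simp: tight_part_def)
        ultimately have "s i \<le> k * card (E - tight_part f E A j)" using s i by blast
        also have "\<dots> \<le> k * \<Lambda> 0" using U \<Lambda>_antimono[of 0 j] j by (intro mult_le_mono) auto
        finally have "real (s i) \<le> real (k * \<Lambda> 0)" by (simp only: of_nat_le_iff)
        then show ?thesis using D(3) False by simp
      qed
    qed simp
    also have "\<dots> = D ^ k * (\<Prod>i<k. if i < j then real (card (A i)) else 1)" by (simp add: prod.distrib)
    also have "(\<Prod>i<k. if i < j then real (card (A i)) else 1) = N"
    proof -
      have "(\<Prod>i<k. if i < j then real (card (A i)) else 1) = (\<Prod>i\<in>{i\<in>{..<k}. i < j}. real (card (A i)))"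
        by (rule prod.inter_filter[symmetric]) simp
      also have "{i\<in>{..<k}. i < j} = {..<j}" using j by auto
      finally show ?thesis by (simp add: N_def)
    qed
    finally have "(\<Prod>i<k. real (s i)) \<le> D ^ k * N" .
    also have "\<dots> \<le> D ^ k * (2 * real C' ^ k * real (card (span_flats f E k)))" using count D(1) by (intro mult_left_mono) auto
    finally have "\<rho> * (\<Prod>i<k. real (s i)) \<le> \<rho> * (D ^ k * (2 * real C' ^ k * real (card (span_flats f E k))))"
      using \<rho> by (intro mult_left_mono) auto
    also have "\<dots> = real (card (span_flats f E k))" using C' D(1) by (simp add: \<rho>_def)
    finally show "\<rho> * (\<Prod>i<k. real (s i)) \<le> real (card (span_flats f E k))" .
  qed
qed

subsection \<open>Stratifications\<close>

lemma subset_between_of_dim: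
  fixes f :: "'a \<Rightarrow> 'v::real_vector"
  assumes "finite X" "P \<subseteq> X" "dim (f ` P) \<le> m" "m \<le> dim (f ` X)"
  shows "\<exists>Q. P \<subseteq> Q \<and> Q \<subseteq> X \<and> dim (f ` Q) = m"
proof -
  have "\<exists>Q. P \<subseteq> Q \<and> Q \<subseteq> X \<and> dim (f ` Q) = m" if "m = dim (f ` P) + d" for d
    using that assms(4)
  proof (induction d arbitrary: m)
    case 0 then show ?case using assms(2) by auto
  next
    case (Suc d)
    then obtain Q where Q: "P \<subseteq> Q" "Q \<subseteq> X" "dim (f ` Q) = dim (f ` P) + d" by auto
    have fQ: "finite Q" using Q(2) assms(1) by (rule finite_subset)
    have "\<not> f ` X \<subseteq> span (f ` Q)"
    proof
      assume "f ` X \<subseteq> span (f ` Q)"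
      then have "dim (f ` X) \<le> dim (f ` Q)" using fQ by (intro dim_mono_finite) auto
      then show False using Q(3) Suc.prems by simp
    qed
    then obtain x where x: "x \<in> X" "f x \<notin> span (f ` Q)" by blast
    have "dim (f ` insert x Q) = m" using x(2) fQ Q(3) Suc.prems(1) dim_insert_finite[of "f ` Q" "f x"] by simp
    then show ?case using Q x(1) by (intro exI[of _ "insert x Q"]) auto
  qed
  from this[of "m - dim (f ` P)"] show ?thesis using assms(3) by simp
qed

locale truncated_representation =
  fixes M :: "'a matroid" and f0 f :: "'a \<Rightarrow> rvec" and k :: nat
  assumes finite_ground: "finite (ground M)" and rep: "represents M f0"
    and trunc: "X \<subseteq> ground M \<Longrightarrow> dim (f ` X) = min (dim (f0 ` X)) (k + 1)"
begin

text \<open>Truncation keeps all ranks up to \<open>k + 1\<close>, so membership in spans of rank at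
  most \<open>k\<close> is the same before and after it.\<close>

lemma span_iff:
  assumes "T \<subseteq> ground M" "dim (f ` T) \<le> k" "x \<in> ground M"
  shows "f x \<in> span (f ` T) \<longleftrightarrow> f0 x \<in> span (f0 ` T)"
proof -
  have fT: "finite T" using assms(1) finite_ground by (rule finite_subset)
  have in_span: "g x \<in> span (g ` T) \<longleftrightarrow> dim (insert (g x) (g ` T)) = dim (g ` T)" for g :: "'a \<Rightarrow> rvec"
    using fT by (simp add: dim_insert_finite)
  have "dim (f0 ` T) = dim (f ` T)" using trunc[OF assms(1)] assms(2) by simp
  moreover have "dim (insert (f x) (f ` T)) = min (dim (insert (f0 x) (f0 ` T))) (k + 1)"
    using trunc[of "insert x T"] assms by simp
  ultimately show ?thesis unfolding in_span[of f] in_span[of f0] using assms(2) by linarith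
qed

text \<open>The trace of each member on \<open>X\<close> is enlarged inside \<open>X\<close> to rank
  at least two and then closed to a flat of the restriction. This does not exceed the charge of the
  member, because that is never below 1.\<close>

lemma degenerate_of_flat_cover:
  assumes i: "2 \<le> i" "i \<le> k" and X: "X \<subseteq> ground M" and cov: "flat_cover f (ground M) (i - 1) X"
  shows "degenerate_in i M X"
proof -
  let ?N = "restrict M X"
  have gN: "ground ?N = X" using X by (auto simp: restrict_def)
  have fX: "finite X" using X finite_ground by (rule finite_subset)
  have rk: "matroid_rank ?N F = dim (f0 ` F)" if "F \<subseteq> X" for F
    using matroid_rank_restrict[OF that] matroid_rank_eq_dim[OF finite_ground rep] that X by simp
  have fl: "flat ?N F \<longleftrightarrow> F \<subseteq> X \<and> (\<forall>x\<in>X - F. f0 x \<notin> span (f0 ` F))" for F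
    using flat_iff_span[OF finite_ground_restrict[OF finite_ground] represents_restrict[OF rep], of X F] gN by simp
  have "matroid_rank ?N X \<le> 1 \<or> (\<exists>Fs. (\<forall>F\<in>set Fs. flat ?N F \<and> matroid_rank ?N F \<ge> 2) \<and> X \<subseteq> \<Union>(set Fs) \<and>
              (\<Sum>F\<leftarrow>Fs. matroid_rank ?N F - 1) \<le> i - 1)"
  proof (cases "dim (f0 ` X) \<le> 1")
    case True then show ?thesis using rk[of X] by simp
  next
    case False
    obtain \<T> where T: "finite \<T>" "\<forall>T\<in>\<T>. T \<subseteq> ground M" "\<forall>x\<in>X. \<exists>T\<in>\<T>. f x \<in> span (f ` T)"
      "(\<Sum>T\<in>\<T>. max (dim (f ` T) - 1) 1) \<le> i - 1"
      using cov unfolding flat_cover_def by (elim exE conjE) (rule that)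
    have "\<forall>T\<in>\<T>. \<exists>F. flat ?N F \<and> 2 \<le> dim (f0 ` F) \<and> {x\<in>X. f x \<in> span (f ` T)} \<subseteq> F \<and> dim (f0 ` F) - 1 \<le> max (dim (f ` T) - 1) 1"
    proof
      fix T assume TT: "T \<in> \<T>"
      have Tg: "T \<subseteq> ground M" using T(2) TT by blast
      have fT: "finite T" using Tg finite_ground by (rule finite_subset)
      have "max (dim (f ` T) - 1) 1 \<le> i - 1"
        using member_le_sum[OF TT, of "\<lambda>T. max (dim (f ` T) - 1) 1"] T(1,4) by simp
      then have dT: "dim (f ` T) \<le> k" using i by linarith
      define P where "P = {x\<in>X. f x \<in> span (f ` T)}"
      have PX: "P \<subseteq> X" by (auto simp: P_def)
      have "f0 ` P \<subseteq> span (f0 ` T)" using span_iff[OF Tg dT] X by (auto simp: P_def)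
      then have dP: "dim (f0 ` P) \<le> dim (f ` T)"
        using dim_mono_finite[of "f0 ` T" "f0 ` P"] fT trunc[OF Tg] dT by simp
      have "dim (f0 ` P) \<le> dim (f0 ` X)" using fX PX by (rule dim_image_mono)
      \<comment> \<open>A trace of rank 0 or 1 is raised to rank exactly 2; the excluded case of
        rank at most one of \<open>X\<close> is where this would be impossible.\<close>
      then obtain Q where Q: "P \<subseteq> Q" "Q \<subseteq> X" "dim (f0 ` Q) = max (dim (f0 ` P)) 2"
        using subset_between_of_dim[OF fX PX, of f0 "max (dim (f0 ` P)) 2"] False by auto
      define F where "F = {x\<in>X. f0 x \<in> span (f0 ` Q)}"
      have "Q \<subseteq> F" using Q(2) by (auto simp: F_def intro: span_base)
      then have sF: "span (f0 ` Q) = span (f0 ` F)" by (intro span_eq_of_subsets) (auto simp: F_def)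
      have "flat ?N F" unfolding fl sF[symmetric] by (auto simp: F_def)
      moreover have "dim (f0 ` F) = max (dim (f0 ` P)) 2" using span_eq_dim[OF sF] Q(3) by simp
      ultimately show "\<exists>F. flat ?N F \<and> 2 \<le> dim (f0 ` F) \<and> {x\<in>X. f x \<in> span (f ` T)} \<subseteq> F \<and> dim (f0 ` F) - 1 \<le> max (dim (f ` T) - 1) 1"
        using dP Q(1) \<open>Q \<subseteq> F\<close> by (intro exI[of _ F]) (auto simp: P_def)
    qed
    then obtain F where F': "\<forall>T\<in>\<T>. flat ?N (F T) \<and> 2 \<le> dim (f0 ` F T) \<and> {x\<in>X. f x \<in> span (f ` T)} \<subseteq> F T \<and>
      dim (f0 ` F T) - 1 \<le> max (dim (f ` T) - 1) 1" by (rule bchoice[THEN exE])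
    have F: "flat ?N (F T)" "2 \<le> dim (f0 ` F T)" "{x\<in>X. f x \<in> span (f ` T)} \<subseteq> F T"
      "dim (f0 ` F T) - 1 \<le> max (dim (f ` T) - 1) 1" if "T \<in> \<T>" for T
      using bspec[OF F' that] by blast+
    have rF: "matroid_rank ?N (F T) = dim (f0 ` F T)" if "T \<in> \<T>" for T
      using F(1)[OF that] unfolding fl by (intro rk) (rule conjunct1)
    obtain Ts where Ts: "set Ts = \<T>" "distinct Ts" using finite_distinct_list[OF T(1)] by blast
    have "(\<Sum>G\<leftarrow>map F Ts. matroid_rank ?N G - 1) = (\<Sum>T\<in>\<T>. matroid_rank ?N (F T) - 1)"
      using Ts by (simp add: o_def sum_list_distinct_conv_sum_set)
    also have "\<dots> \<le> (\<Sum>T\<in>\<T>. max (dim (f ` T) - 1) 1)" using F(4) rF by (intro sum_mono) simp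
    finally have "(\<Sum>G\<leftarrow>map F Ts. matroid_rank ?N G - 1) \<le> i - 1" using T(4) by linarith
    moreover have "\<forall>G\<in>set (map F Ts). flat ?N G \<and> matroid_rank ?N G \<ge> 2" using F(1,2) rF Ts by simp
    moreover have "X \<subseteq> \<Union>(set (map F Ts))"
    proof
      fix x assume x: "x \<in> X"
      then obtain T where "T \<in> \<T>" "f x \<in> span (f ` T)" using T(3) by blast
      then have "x \<in> F T" using F(3)[of T] x by blast
      then show "x \<in> \<Union>(set (map F Ts))" using Ts \<open>T \<in> \<T>\<close> by auto
    qed
    ultimately show ?thesis by blast
  qed
  then show ?thesis using i X gN by (simp add: degenerate_in_def degenerate_def)
qed

text \<open>An \<open>i\<close>-degenerate cover stays admissible at every level
  \<open>l \<ge> i\<close>. The part of the next stratum inside \<open>Y\<close> competes with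
  \<open>X l\<close>, so consecutive strata differ by at most the number of elements outside
  \<open>Y\<close>. Summing over the \<open>k + 1 - l\<close> steps up to the ground set gives the
  bound.\<close>

lemma stratification_deficiency:
  assumes opt: "optimal_stratification k M X" and i: "2 \<le> i" "i \<le> k"
    and Y: "Y \<subseteq> ground M" and cov: "flat_cover f (ground M) (i - 1) Y"
    and l: "i \<le> l" "l \<le> k"
  shows "card (ground M) \<le> card (X l) + (k + 1 - l) * card (ground M - Y)"
proof -
  have opt': "card Z \<le> card (X l)" if "2 \<le> l" "l \<le> k" "Z \<subseteq> strat_ext k M X (l + 1)" "degenerate_in l M Z" for Z l
    using opt that unfolding optimal_stratification_def by (meson atLeastAtMost_iff)
  have ext: "strat_ext k M X l \<subseteq> ground M" for l
    using opt unfolding optimal_stratification_def stratification_def strat_ext_def by auto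
  have layer: "card (strat_ext k M X (l + 1)) \<le> card (X l) + card (ground M - Y)" if l: "i \<le> l" "l \<le> k" for l
  proof -
    let ?S = "strat_ext k M X (l + 1)"
    have fS: "finite ?S" using ext finite_ground by (rule finite_subset)
    have "flat_cover f (ground M) (l - 1) (?S \<inter> Y)" using cov l by (elim flat_cover_mono) auto
    then have "degenerate_in l M (?S \<inter> Y)" using i l Y by (intro degenerate_of_flat_cover) auto
    then have "card (?S \<inter> Y) \<le> card (X l)" using i l by (intro opt') auto
    moreover have "card (?S - Y) \<le> card (ground M - Y)" using ext[of "l + 1"] finite_ground by (intro card_mono) auto
    moreover have "card ?S = card (?S \<inter> Y) + card (?S - Y)"
      using card_Un_disjoint[of "?S \<inter> Y" "?S - Y"] fS by (simp add: Int_Diff_Un Int_Diff_disjoint)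
    ultimately show ?thesis by linarith
  qed
  show ?thesis using l(2,1)
  proof (induction l rule: inc_induct)
    case base
    then show ?case using layer[of k] i by (simp add: strat_ext_def)
  next
    case (step l)
    have "strat_ext k M X (l + 1) = X (Suc l)" using step.hyps step.prems i by (simp add: strat_ext_def)
    then have "card (X (Suc l)) \<le> card (X l) + card (ground M - Y)" using \<open>i \<le> l\<close> step.hyps layer[of l] by simp
    moreover have "card (ground M) \<le> card (X (Suc l)) + (k + 1 - Suc l) * card (ground M - Y)"
      using step.IH step.prems by simp
    moreover have "k + 1 - l = Suc (k + 1 - Suc l)" using step.hyps by simp
    ultimately show ?case by simp
  qed
qed

lemma card_span_flats_le: "card (span_flats f (ground M) k) \<le> card {F. flat M F \<and> matroid_rank M F = k}"
proof (rule card_mono)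
  show "finite {F. flat M F \<and> matroid_rank M F = k}"
    by (rule finite_subset[of _ "Pow (ground M)"]) (auto simp: flat_def finite_ground)
  show "span_flats f (ground M) k \<subseteq> {F. flat M F \<and> matroid_rank M F = k}"
  proof
    fix F assume "F \<in> span_flats f (ground M) k"
    then obtain X where X: "X \<subseteq> ground M" "dim (f ` X) = k" "F = {x\<in>ground M. f x \<in> span (f ` X)}"
      by (auto simp: span_flats_def)
    have F: "F = {x\<in>ground M. f0 x \<in> span (f0 ` X)}" using X span_iff[OF X(1)] by auto
    have "X \<subseteq> F" using X(1) by (auto simp: F intro: span_base)
    then have sF: "span (f0 ` X) = span (f0 ` F)" by (intro span_eq_of_subsets) (auto simp: F)
    have "flat M F" unfolding flat_iff_span[OF finite_ground rep] sF[symmetric] by (auto simp: F)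
    moreover have "dim (f0 ` X) = k" using trunc[OF X(1)] X(2) by simp
    then have "matroid_rank M F = k"
      using matroid_rank_eq_dim[OF finite_ground rep, of F] span_eq_dim[OF sF] by (simp add: F)
    ultimately show "F \<in> {F. flat M F \<and> matroid_rank M F = k}" by simp
  qed
qed

end

theorem theorem1p5:
  fixes k :: nat
  assumes "k \<ge> 2"
  shows "\<exists>\<rho>::real. \<rho> > 0 \<and>
    (\<forall>(M :: 'a matroid) (n :: nat) X.
       matroid M \<longrightarrow> simple_matroid M \<longrightarrow> real_representable M \<longrightarrow> card (ground M) = n \<longrightarrow>
       optimal_stratification k M X \<longrightarrow> n - card (X k) > max_blue k (k - 2) \<longrightarrow>
       real (card {F. flat M F \<and> matroid_rank M F = k})
         \<ge> \<rho> * real n * (\<Prod>i=2..k. real n - real (card (X i))))"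
proof -
  have "1 \<le> k" using assms by simp
  from many_span_flats[OF this] obtain \<rho> where \<rho>: "0 < \<rho>" and main: "\<forall>(f :: 'a \<Rightarrow> rvec) E (s :: nat \<Rightarrow> nat). finite E \<longrightarrow> dim (f ` E) \<le> k + 1 \<longrightarrow>
    (\<forall>x\<in>E. f x \<noteq> 0) \<longrightarrow> (\<forall>x\<in>E. \<forall>y\<in>E. x \<noteq> y \<longrightarrow> f y \<notin> span {f x}) \<longrightarrow>
    (\<forall>i<k. \<forall>Y\<subseteq>E. flat_cover f E i Y \<longrightarrow> s i \<le> k * card (E - Y)) \<longrightarrow>
    (\<forall>Y\<subseteq>E. flat_cover f E (k - 1) Y \<longrightarrow> max_blue k (k - 2) < card (E - Y)) \<longrightarrow>
    \<rho> * (\<Prod>i<k. real (s i)) \<le> real (card (span_flats f E k))"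
    by (elim exE conjE) (rule that)
  show ?thesis
  proof (intro exI[of _ \<rho>] conjI \<rho> allI impI)
    fix M :: "'a matroid" and n :: nat and X
    assume M: "matroid M" "simple_matroid M" "real_representable M" and n: "card (ground M) = n"
      and opt: "optimal_stratification k M X" and large: "n - card (X k) > max_blue k (k - 2)"
    let ?E = "ground M"
    have fE: "finite ?E" using M(1) by (rule matroid.finite_ground)
    obtain f0 :: "'a \<Rightarrow> rvec" where rep: "represents M f0" using M(3) real_representable_iff by blast
    obtain f :: "'a \<Rightarrow> rvec" where tr: "\<forall>Y\<subseteq>?E. dim (f ` Y) = min (dim (f0 ` Y)) (k + 1)"
      using truncate_configuration[OF fE, of f0 "k + 1"] by (elim exE) (rule that)
    interpret truncated_representation M f0 f k
      by (rule truncated_representation.intro[OF fE rep]) (use tr in blast)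
    have pair: "dim {f x, f y} = card {x, y}" if xy: "x \<in> ?E" "y \<in> ?E" for x y
    proof -
      have "indep M {x, y}" using M(2) xy by (simp add: simple_matroid_def)
      then have "inj_on f0 {x, y}" "independent (f0 ` {x, y})" using rep xy by (auto simp: represents_def)
      then have "dim (f0 ` {x, y}) = card {x, y}" using dim_eq_card_independent card_image by metis
      moreover have "card {x, y} \<le> k + 1" using card_insert_le_m1[of 2 "{y}" x] assms by simp
      ultimately show ?thesis using tr[rule_format, of "{x, y}"] xy by simp
    qed
    \<comment> \<open>The shift by one matches cost \<open>i\<close> with degeneracy
      \<open>i + 1\<close>. Cost 0 covers only the empty set, and this produces the separate factor
      \<open>n\<close>.\<close>
    define s where "s = (\<lambda>i. if i = 0 then n else n - card (X (i + 1)))"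
    have "\<rho> * (\<Prod>i<k. real (s i)) \<le> real (card (span_flats f ?E k))"
    proof (rule main[rule_format, OF fE])
      show "dim (f ` ?E) \<le> k + 1" using tr by simp
      show nz: "f x \<noteq> 0" if "x \<in> ?E" for x using pair[OF that that] dim_insert_finite[of "{}" "f x"] by auto
      show "f y \<notin> span {f x}" if "x \<in> ?E" "y \<in> ?E" "x \<noteq> y" for x y
        using pair[OF that(2,1)] that(3) nz[OF that(1)] dim_insert_finite[of "{f x}" "f y"] dim_insert_finite[of "{}" "f x"]
        by (auto split: if_splits)
    next
      fix i Y assume i: "i < k" and Y: "Y \<subseteq> ?E" "flat_cover f ?E i Y"
      show "s i \<le> k * card (?E - Y)"
      proof (cases "i = 0")
        case True
        then have "Y = {}" using Y(2) flat_cover_zero by blast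
        then show ?thesis using True n \<open>1 \<le> k\<close> by (simp add: s_def)
      next
        case False
        have "card ?E \<le> card (X (i + 1)) + (k + 1 - (i + 1)) * card (?E - Y)"
          by (rule stratification_deficiency[OF opt, of "i + 1"]) (use False i Y in simp_all)
        moreover have "(k + 1 - (i + 1)) * card (?E - Y) \<le> k * card (?E - Y)" by (rule mult_le_mono1) simp
        moreover have "s i = n - card (X (i + 1))" using False by (simp add: s_def)
        ultimately show ?thesis using n by linarith
      qed
    next
      fix Y assume Y: "Y \<subseteq> ?E" "flat_cover f ?E (k - 1) Y"
      have "card ?E \<le> card (X k) + (k + 1 - k) * card (?E - Y)"
        by (rule stratification_deficiency[OF opt, of k]) (use assms Y in simp_all)
      then show "max_blue k (k - 2) < card (?E - Y)" using large n by simp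
    qed
    moreover have "(\<Prod>i<k. real (s i)) = real n * (\<Prod>i=2..k. real n - real (card (X i)))"
    proof -
      have "{..<k} = insert 0 {1..<k}" using assms by auto
      then have "(\<Prod>i<k. real (s i)) = real (s 0) * (\<Prod>i=1..<k. real (s i))" by simp
      also have "(\<Prod>i=1..<k. real (s i)) = (\<Prod>i=2..k. real n - real (card (X i)))"
      proof (rule prod.reindex_bij_witness[of _ "\<lambda>i. i - 1" "\<lambda>i. i + 1"])
        fix i assume i: "i \<in> {1..<k}"
        have "X (i + 1) \<subseteq> ?E" using opt i unfolding optimal_stratification_def stratification_def by auto
        then have "card (X (i + 1)) \<le> n" using card_mono[OF fE] n by blast
        then show "real n - real (card (X (i + 1))) = real (s i)" using i by (simp add: s_def of_nat_diff)
      qed auto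
      finally show ?thesis by (simp add: s_def)
    qed
    moreover have "real (card (span_flats f ?E k)) \<le> real (card {F. flat M F \<and> matroid_rank M F = k})"
      using card_span_flats_le by (simp only: of_nat_le_iff)
    ultimately show "real (card {F. flat M F \<and> matroid_rank M F = k})
         \<ge> \<rho> * real n * (\<Prod>i=2..k. real n - real (card (X i)))" by (simp add: mult.assoc)
  qed
qed

end
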